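(* Let $g$ satisfy (A1) and (A3) (with function $\xi$ and exponent $1\le q<2$), let $p$ satisfy the exponent conditions (P), let $\mu>0$ satisfy $p_2+\mu<\frac{2n}{n-2}$, and let $(u_0,u_1)\in H_0^1(\Omega)\times L^2(\Omega)$. Then for all sufficiently small $\alpha>0$ (i.e. there is $\alpha_0>0$, depending on $n,\Omega,p,g,\mu,u_0,u_1$, such that for every $\alpha\in(0,\alpha_0)$) the following holds. If $u$ is the solution of problem (W) and the initial data satisfy $$E(0)<E_1,\qquad \lambda(0)<\lambda_1,$$ then there exist constants $K>0$ and $K'>0$ such that, for all $t\ge0$, $$E(t)\le\begin{cases}E(0)\exp\Big(1-K\displaystyle\int_0^t\xi(s)\,\mathrm ds\Big), & q=1,\\[2mm] E(0)\left(\dfrac{q}{1+K'(q-1)\int_0^t\xi(s)\,\mathrm ds}\right)^{\frac1{q-1}}, & 1<q<2.\end{cases}$$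
   Context: Setting. $\Omega\subset\mathbb R^n$, $n\ge3$, is a bounded domain with smooth boundary; $\|\cdot\|_k$ is the norm of $L^k(\Omega)$; $2_*:=\frac{2n}{n-2}$. Problem (W), with constant $\alpha>0$: $$u_{tt}-\Delta u+\int_0^t g(t-s)\Delta u(s)\,\mathrm ds+u_t=\alpha|u|^{p(x)-2}u\log|u|\ \text{ in }\Omega\times(0,\infty),$$ $$u(x,0)=u_0(x),\quad u_t(x,0)=u_1(x)\ \text{ in }\Omega,\qquad u=0\ \text{ on }\partial\Omega\times(0,\infty).$$ Solutions are understood in the usual weak sense: $u\in C([0,T);H_0^1(\Omega))\cap C^1([0,T);L^2(\Omega))$, attaining the initial data and satisfying the equation in the weak sense (tested against $H_0^1(\Omega)$ functions). Convention: $|u|^{p}\log|u|=0$ where $u=0$. Under the hypotheses on $E(0)$ and $\lambda(0)$ below the solution is global ($T_{\max}=\infty$). (P) $p:\Omega\to\mathbb R$ is measurable and bounded, $p_1:=\operatorname{ess\,inf}_\Omega p>2$, $p_2:=\operatorname{ess\,sup}_\Omega p<\frac{2(n-1)}{n-2}$, and $p$ is log-Hölder continuous: there is $A>0$ with $|p(x)-p(y)|\le-\frac{A}{\log|x-y|}$ for a.e. $x,y\in\Omega$ with $|x-y|<1$. (A1) $g\in C^1([0,\infty);(0,\infty))$ is non-increasing, $g(0)>0$, and $\ell:=1-\int_0^\infty g(s)\,\mathrm ds>0$. (A3) $\xi\in C^1([0,\infty);(0,\infty))$ is non-increasing with $\int_0^\infty\xi(s)\,\mathrm ds=\infty$, $1\le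 q<2$, and $g'(t)\le-\xi(t)\,g(t)^q$ for all $t>0$. Notation. $(g\circ\nabla u)(t):=\int_0^t g(t-s)\|\nabla u(t)-\nabla u(s)\|_2^2\,\mathrm ds$. Energy: $$E(t):=\tfrac12\|u_t(t)\|_2^2+\tfrac12\Big(1-\int_0^t g(s)\,\mathrm ds\Big)\|\nabla u(t)\|_2^2+\tfrac12(g\circ\nabla u)(t)-\alpha\int_\Omega\frac{|u(t)|^{p(x)}\log|u(t)|}{p(x)}\,\mathrm dx+\alpha\int_\Omega\frac{|u(t)|^{p(x)}}{p(x)^2}\,\mathrm dx.$$ $\lambda(t):=\{\ell\|\nabla u(t)\|_2^2+(g\circ\nabla u)(t)\}^{1/2}$, so $\lambda(0)=\ell^{1/2}\|\nabla u_0\|_2$. For $2\le k\le2_*$, $B_k$ is the optimal constant in $\|v\|_k^k\le B_k\|\nabla v\|_2^k$ for all $v\in H_0^1(\Omega)$. With $\mathrm e$ Euler's number, $$B:=B_{p_2+\mu}\,\ell^{-\frac{p_2+\mu}{2}},\qquad \lambda_1:=\Big(\frac{\mathrm e\mu p_1}{\alpha(p_2+\mu)B}\Big)^{\frac1{p_2+\mu-2}},\qquad E_1:=\Big(\frac12-\frac1{p_2+\mu}\Big)\lambda_1^2 .$$ *)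

theory Defs
  imports "HOL-Analysis.Analysis" "HOL-Probability.Essential_Supremum"
begin

text \<open>
  Functions on a domain \<open>\<Omega>\<close> are total functions whose values outside \<open>\<Omega>\<close> are irrelevant. Elements
  of the Lebesgue and Sobolev spaces are represented by functions rather than by equivalence
  classes; two representatives that agree almost everywhere on \<open>\<Omega>\<close> are interchangeable.
\<close>

section \<open>Smoothness and domains\<close>

primrec Ck :: "nat \<Rightarrow> ('a::real_normed_vector \<Rightarrow> real) \<Rightarrow> bool" where
  "Ck 0 f \<longleftrightarrow> continuous_on UNIV f"
| "Ck (Suc k) f \<longleftrightarrow>
     (\<forall>x. f differentiable (at x)) \<and> (\<forall>v. Ck k (\<lambda>x. frechet_derivative f (at x) v))"

definition smooth :: "('a::real_normed_vector \<Rightarrow> real) \<Rightarrow> bool" where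
  "smooth f \<longleftrightarrow> (\<forall>k. Ck k f)"

text \<open>
  Near each boundary point the domain is, in suitable orthonormal coordinates with last axis \<open>e\<close>, the
  region above the graph of a smooth function of the remaining coordinates; \<open>\<gamma>\<close> is that function,
  extended to the whole space constantly in direction \<open>e\<close>.
\<close>

definition smooth_boundary :: "'a::euclidean_space set \<Rightarrow> bool" where
  "smooth_boundary \<Omega> \<longleftrightarrow>
     (\<forall>z\<in>frontier \<Omega>. \<exists>r>0. \<exists>e \<gamma>.
        norm e = 1 \<and> smooth \<gamma> \<and> (\<forall>x s. \<gamma> (x + s *\<^sub>R e) = \<gamma> x) \<and>
        \<Omega> \<inter> ball z r = {x \<in> ball z r. \<gamma> x < x \<bullet> e})"

definition smooth_bounded_domain :: "'a::euclidean_space set \<Rightarrow> bool" where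
  "smooth_bounded_domain \<Omega> \<longleftrightarrow>
     open \<Omega> \<and> connected \<Omega> \<and> \<Omega> \<noteq> {} \<and> bounded \<Omega> \<and> smooth_boundary \<Omega>"


section \<open>Lebesgue and Sobolev spaces\<close>

definition Lspace :: "real \<Rightarrow> 'a::euclidean_space set \<Rightarrow> ('a \<Rightarrow> 'b::euclidean_space) set" where
  "Lspace k \<Omega> =
     {f. f \<in> borel_measurable (lebesgue_on \<Omega>) \<and> integrable (lebesgue_on \<Omega>) (\<lambda>x. norm (f x) powr k)}"

definition Lnorm :: "real \<Rightarrow> 'a::euclidean_space set \<Rightarrow> ('a \<Rightarrow> 'b::euclidean_space) \<Rightarrow> real" where
  "Lnorm k \<Omega> f = (LINT x|lebesgue_on \<Omega>. norm (f x) powr k) powr (1 / k)"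

definition L2inner ::
  "'a::euclidean_space set \<Rightarrow> ('a \<Rightarrow> 'b::euclidean_space) \<Rightarrow> ('a \<Rightarrow> 'b) \<Rightarrow> real" where
  "L2inner \<Omega> f h = (LINT x|lebesgue_on \<Omega>. f x \<bullet> h x)"

definition test_fun :: "'a::euclidean_space set \<Rightarrow> ('a \<Rightarrow> real) set" where
  "test_fun \<Omega> = {\<phi>. smooth \<phi> \<and> compact (closure {x. \<phi> x \<noteq> 0}) \<and> closure {x. \<phi> x \<noteq> 0} \<subseteq> \<Omega>}"

definition is_weak_grad ::
  "'a::euclidean_space set \<Rightarrow> ('a \<Rightarrow> real) \<Rightarrow> ('a \<Rightarrow> 'a) \<Rightarrow> bool" where
  "is_weak_grad \<Omega> f G \<longleftrightarrow>
     (\<forall>\<phi>\<in>test_fun \<Omega>. \<forall>b\<in>Basis.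
        (LINT x|lebesgue_on \<Omega>. f x * frechet_derivative \<phi> (at x) b) =
        - (LINT x|lebesgue_on \<Omega>. (G x \<bullet> b) * \<phi> x))"

definition H1 :: "'a::euclidean_space set \<Rightarrow> ('a \<Rightarrow> real) set" where
  "H1 \<Omega> = {f \<in> Lspace 2 \<Omega>. \<exists>G\<in>Lspace 2 \<Omega>. is_weak_grad \<Omega> f G}"

text \<open>For \<^term>\<open>f \<in> H1 \<Omega>\<close> the weak gradient is unique up to a null set, so the choice is harmless.\<close>

definition wgrad :: "'a::euclidean_space set \<Rightarrow> ('a \<Rightarrow> real) \<Rightarrow> 'a \<Rightarrow> 'a" where
  "wgrad \<Omega> f = (SOME G. G \<in> Lspace 2 \<Omega> \<and> is_weak_grad \<Omega> f G)"

definition H1norm :: "'a::euclidean_space set \<Rightarrow> ('a \<Rightarrow> real) \<Rightarrow> real" where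
  "H1norm \<Omega> f = sqrt ((Lnorm 2 \<Omega> f)\<^sup>2 + (Lnorm 2 \<Omega> (wgrad \<Omega> f))\<^sup>2)"

definition H10 :: "'a::euclidean_space set \<Rightarrow> ('a \<Rightarrow> real) set" where
  "H10 \<Omega> = {f \<in> H1 \<Omega>. \<forall>\<epsilon>>0. \<exists>\<phi>\<in>test_fun \<Omega>. H1norm \<Omega> (\<lambda>x. f x - \<phi> x) < \<epsilon>}"


section \<open>Hypotheses on the exponent and on the relaxation function\<close>

definition ess_lower :: "'a::euclidean_space set \<Rightarrow> ('a \<Rightarrow> real) \<Rightarrow> real" where
  "ess_lower \<Omega> p = real_of_ereal (- esssup (lebesgue_on \<Omega>) (\<lambda>x. - ereal (p x)))"

definition ess_upper :: "'a::euclidean_space set \<Rightarrow> ('a \<Rightarrow> real) \<Rightarrow> real" where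
  "ess_upper \<Omega> p = real_of_ereal (esssup (lebesgue_on \<Omega>) (\<lambda>x. ereal (p x)))"

definition log_Hoelder :: "'a::euclidean_space set \<Rightarrow> ('a \<Rightarrow> real) \<Rightarrow> bool" where
  "log_Hoelder \<Omega> p \<longleftrightarrow>
     (\<exists>A>0. AE x in lebesgue_on \<Omega>. AE y in lebesgue_on \<Omega>.
        dist x y < 1 \<longrightarrow> \<bar>p x - p y\<bar> \<le> - A / ln (dist x y))"

definition exponent_condition :: "'a::euclidean_space set \<Rightarrow> ('a \<Rightarrow> real) \<Rightarrow> bool" where
  "exponent_condition \<Omega> p \<longleftrightarrow>
     p \<in> borel_measurable (lebesgue_on \<Omega>) \<and> bounded (p ` \<Omega>) \<and>
     ess_lower \<Omega> p > 2 \<and>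
     ess_upper \<Omega> p < 2 * (real DIM('a) - 1) / (real DIM('a) - 2) \<and>
     log_Hoelder \<Omega> p"

definition C1_pos_halfline :: "(real \<Rightarrow> real) \<Rightarrow> bool" where
  "C1_pos_halfline f \<longleftrightarrow>
     (\<forall>t\<ge>0. f t > 0) \<and>
     (\<exists>f'. (\<forall>t\<ge>0. (f has_real_derivative f' t) (at t within {0..})) \<and> continuous_on {0..} f')"

definition ell :: "(real \<Rightarrow> real) \<Rightarrow> real" where
  "ell g = 1 - integral {0..} g"

definition cond_A1 :: "(real \<Rightarrow> real) \<Rightarrow> bool" where
  "cond_A1 g \<longleftrightarrow>
     C1_pos_halfline g \<and> antimono_on {0..} g \<and> g 0 > 0 \<and> g integrable_on {0..} \<and> ell g > 0"

definition cond_A3 :: "(real \<Rightarrow> real) \<Rightarrow> (real \<Rightarrow> real) \<Rightarrow> real \<Rightarrow> bool" where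
  "cond_A3 g \<xi> q \<longleftrightarrow>
     C1_pos_halfline \<xi> \<and> antimono_on {0..} \<xi> \<and>
     filterlim (\<lambda>t. integral {0..t} \<xi>) at_top at_top \<and>
     1 \<le> q \<and> q < 2 \<and>
     (\<forall>t>0. deriv g t \<le> - \<xi> t * g t powr q)"


section \<open>Weak solutions\<close>

text \<open>
  \<open>u\<close> is a global weak solution and \<open>v\<close> its time derivative \<open>u\<^sub>t\<close>, understood in the \<open>L\<^sup>2\<close> norm (so \<open>v\<close> is
  determined by \<open>u\<close> up to null sets). The convention that the source vanishes where \<open>u = 0\<close> is
  automatic. The last clause is the equation tested with \<open>w\<close>, the second time derivative being
  that of the scalar function \<open>t \<mapsto> (u\<^sub>t(t), w)\<close>.
\<close>

definition weak_solution ::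
  "'a::euclidean_space set \<Rightarrow> (real \<Rightarrow> real) \<Rightarrow> ('a \<Rightarrow> real) \<Rightarrow> real \<Rightarrow> ('a \<Rightarrow> real) \<Rightarrow> ('a \<Rightarrow> real) \<Rightarrow>
   (real \<Rightarrow> 'a \<Rightarrow> real) \<Rightarrow> (real \<Rightarrow> 'a \<Rightarrow> real) \<Rightarrow> bool" where
  "weak_solution \<Omega> g p \<alpha> u0 u1 u v \<longleftrightarrow>
     (\<forall>t\<ge>0. u t \<in> H10 \<Omega>) \<and>
     (\<forall>t\<ge>0. ((\<lambda>s. H1norm \<Omega> (\<lambda>x. u s x - u t x)) \<longlongrightarrow> 0) (at t within {0..})) \<and>
     (\<forall>t\<ge>0. v t \<in> Lspace 2 \<Omega>) \<and>
     (\<forall>t\<ge>0. ((\<lambda>s. Lnorm 2 \<Omega> (\<lambda>x. (u s x - u t x) / (s - t) - v t x)) \<longlongrightarrow> 0) (at t within {0..})) \<and>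
     (\<forall>t\<ge>0. ((\<lambda>s. Lnorm 2 \<Omega> (\<lambda>x. v s x - v t x)) \<longlongrightarrow> 0) (at t within {0..})) \<and>
     (AE x in lebesgue_on \<Omega>. u 0 x = u0 x) \<and>
     (AE x in lebesgue_on \<Omega>. v 0 x = u1 x) \<and>
     (\<forall>w\<in>H10 \<Omega>. \<forall>t>0. \<exists>D.
        ((\<lambda>\<tau>. L2inner \<Omega> (v \<tau>) w) has_real_derivative D) (at t) \<and>
        D + L2inner \<Omega> (wgrad \<Omega> (u t)) (wgrad \<Omega> w)
          - integral {0..t} (\<lambda>s. g (t - s) * L2inner \<Omega> (wgrad \<Omega> (u s)) (wgrad \<Omega> w))
          + L2inner \<Omega> (v t) w
        = \<alpha> * (LINT x|lebesgue_on \<Omega>. \<bar>u t x\<bar> powr (p x - 2) * u t x * ln \<bar>u t x\<bar> * w x))"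


section \<open>Energy and the potential-well constants\<close>

definition memory ::
  "'a::euclidean_space set \<Rightarrow> (real \<Rightarrow> real) \<Rightarrow> (real \<Rightarrow> 'a \<Rightarrow> real) \<Rightarrow> real \<Rightarrow> real" where
  "memory \<Omega> g u t =
     integral {0..t} (\<lambda>s. g (t - s) * (Lnorm 2 \<Omega> (\<lambda>x. wgrad \<Omega> (u t) x - wgrad \<Omega> (u s) x))\<^sup>2)"

definition energy ::
  "'a::euclidean_space set \<Rightarrow> (real \<Rightarrow> real) \<Rightarrow> ('a \<Rightarrow> real) \<Rightarrow> real \<Rightarrow>
   (real \<Rightarrow> 'a \<Rightarrow> real) \<Rightarrow> (real \<Rightarrow> 'a \<Rightarrow> real) \<Rightarrow> real \<Rightarrow> real" where
  "energy \<Omega> g p \<alpha> u v t =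
     1/2 * (Lnorm 2 \<Omega> (v t))\<^sup>2
     + 1/2 * (1 - integral {0..t} g) * (Lnorm 2 \<Omega> (wgrad \<Omega> (u t)))\<^sup>2
     + 1/2 * memory \<Omega> g u t
     - \<alpha> * (LINT x|lebesgue_on \<Omega>. \<bar>u t x\<bar> powr p x * ln \<bar>u t x\<bar> / p x)
     + \<alpha> * (LINT x|lebesgue_on \<Omega>. \<bar>u t x\<bar> powr p x / (p x)\<^sup>2)"

definition lam ::
  "'a::euclidean_space set \<Rightarrow> (real \<Rightarrow> real) \<Rightarrow> (real \<Rightarrow> 'a \<Rightarrow> real) \<Rightarrow> real \<Rightarrow> real" where
  "lam \<Omega> g u t = sqrt (ell g * (Lnorm 2 \<Omega> (wgrad \<Omega> (u t)))\<^sup>2 + memory \<Omega> g u t)"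

definition Sobolev_const :: "'a::euclidean_space set \<Rightarrow> real \<Rightarrow> real" where
  "Sobolev_const \<Omega> k =
     Inf {C. \<forall>f\<in>H10 \<Omega>. f \<in> Lspace k \<Omega> \<and>
              (Lnorm k \<Omega> f) powr k \<le> C * (Lnorm 2 \<Omega> (wgrad \<Omega> f)) powr k}"

definition B_const ::
  "'a::euclidean_space set \<Rightarrow> (real \<Rightarrow> real) \<Rightarrow> ('a \<Rightarrow> real) \<Rightarrow> real \<Rightarrow> real" where
  "B_const \<Omega> g p \<mu> =
     Sobolev_const \<Omega> (ess_upper \<Omega> p + \<mu>) * ell g powr (- (ess_upper \<Omega> p + \<mu>) / 2)"

definition lambda1 ::
  "'a::euclidean_space set \<Rightarrow> (real \<Rightarrow> real) \<Rightarrow> ('a \<Rightarrow> real) \<Rightarrow> real \<Rightarrow> real \<Rightarrow> real" where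
  "lambda1 \<Omega> g p \<mu> \<alpha> =
     (exp 1 * \<mu> * ess_lower \<Omega> p / (\<alpha> * (ess_upper \<Omega> p + \<mu>) * B_const \<Omega> g p \<mu>))
       powr (1 / (ess_upper \<Omega> p + \<mu> - 2))"

definition E1 ::
  "'a::euclidean_space set \<Rightarrow> (real \<Rightarrow> real) \<Rightarrow> ('a \<Rightarrow> real) \<Rightarrow> real \<Rightarrow> real \<Rightarrow> real" where
  "E1 \<Omega> g p \<mu> \<alpha> = (1/2 - 1 / (ess_upper \<Omega> p + \<mu>)) * (lambda1 \<Omega> g p \<mu> \<alpha>)\<^sup>2"

end

theory Submission
  imports Defs
begin

text \<open>
  For small \<open>\<alpha>\<close> the source is a small perturbation: the subcritical Sobolev inequality bounds it by
  \<open>\<alpha> C \<parallel>\<nabla>u\<parallel>\<^sup>2\<close> as long as \<open>\<parallel>\<nabla>u\<parallel>\<close> stays below a bound fixed by the data, and a continuity argument shows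
  that it does. The energy identity holds for weak solutions, and with \<open>\<psi> = (u, u\<^sub>t) + \<parallel>u\<parallel>\<^sup>2 / 2\<close> the functional
  \<open>L = K E + \<psi>\<close> is equivalent to \<open>E\<close> and satisfies \<open>L' \<le> - c E + C (g \<circ> \<nabla>u)\<close> with \<open>C\<close> so small that \<open>E\<close> is
  integrable in time. Integrability gives \<open>E\<^sup>q\<^sup>-\<^sup>1 (g \<circ> \<nabla>u) \<le> \<epsilon> E\<^sup>q + C (g\<^sup>q \<circ> \<nabla>u)\<close>, while
  \<open>\<xi> (g\<^sup>q \<circ> \<nabla>u) \<le> - 2 E'\<close>. Hence \<open>F = \<xi> E\<^sup>q\<^sup>-\<^sup>1 L + c E\<close> is equivalent to \<open>E\<close> and \<open>F' \<le> - c \<xi> F\<^sup>q\<close>. The stated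
  constants \<open>1\<close> and \<open>q\<close> are reached by shrinking \<open>K\<close> and \<open>K'\<close>.
\<close>

section \<open>L2 inner products and norms\<close>

text \<open>All analysis in time is done on scalar functions of two times, such as the L2 products
  of \<nabla>u(s) with \<nabla>u(t) or of u_t(s) with u(t), jointly continuous on the closed
  quadrant; the equation enters only tested with u(\<sigma>). An exponent \<open>m\<close> slightly
  above \<open>p2\<close> pays for the logarithm. Because p_2 < 2(n-1)/(n-2), \<open>m\<close> can
  be taken with \<open>2 * (m - 1)\<close> below the critical exponent 2n/(n-2), which makes the
  source locally Lipschitz from H10 to L2. As u is differentiable in time only in L2, the chain rule
  for the potential rests on a quadratic remainder bounded by one gradient norm times one L2 norm.
  The threshold for \<alpha> comes from a radius given by the initial data and the source constant
  on that ball, before \<xi> and \<open>q\<close> are given. For q > 1 the dissipation controls only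
  the memory with kernel g^q, so the energy is shown integrable before any rate is invoked: the
  memory is at most a multiple of the squared gradient norm plus its convolution with g, and
  convolution with a kernel of integral at most 1 preserves integrability.\<close>

lemma Lspace_2_iff:
  fixes f :: "'a::euclidean_space \<Rightarrow> 'b::euclidean_space"
  shows "f \<in> Lspace 2 \<Omega> \<longleftrightarrow>
     f \<in> borel_measurable (lebesgue_on \<Omega>) \<and> integrable (lebesgue_on \<Omega>) (\<lambda>x. (norm (f x))\<^sup>2)"
  by (simp add: Lspace_def)

lemma Lspace_2_measurable: "f \<in> Lspace 2 \<Omega> \<Longrightarrow> f \<in> borel_measurable (lebesgue_on \<Omega>)"
  by (simp add: Lspace_def)

lemma Lnorm_2_sq: "(Lnorm 2 \<Omega> f)\<^sup>2 = L2inner \<Omega> f f"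
proof -
  have "0 \<le> (LINT x|lebesgue_on \<Omega>. (norm (f x))\<^sup>2)" by (intro integral_nonneg_AE) auto
  then show ?thesis
    by (simp add: Lnorm_def L2inner_def power2_norm_eq_inner powr_half_sqrt)
qed

lemma Lnorm_nonneg: "0 \<le> Lnorm k \<Omega> f" by (simp add: Lnorm_def)

lemma Lnorm_2_eq_sqrt: "Lnorm 2 \<Omega> f = sqrt (L2inner \<Omega> f f)"
  by (metis Lnorm_2_sq Lnorm_nonneg real_sqrt_unique)

lemma L2_integrable_inner:
  assumes "f \<in> Lspace 2 \<Omega>" "h \<in> Lspace 2 \<Omega>"
  shows "integrable (lebesgue_on \<Omega>) (\<lambda>x. f x \<bullet> h x)"
proof (rule Bochner_Integration.integrable_bound[where f = "\<lambda>x. (norm (f x))\<^sup>2 + (norm (h x))\<^sup>2"])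
  show "integrable (lebesgue_on \<Omega>) (\<lambda>x. (norm (f x))\<^sup>2 + (norm (h x))\<^sup>2)"
    using assms by (simp add: Lspace_2_iff)
  have [measurable]: "f \<in> borel_measurable (lebesgue_on \<Omega>)" "h \<in> borel_measurable (lebesgue_on \<Omega>)"
    using assms by (simp_all add: Lspace_2_iff)
  show "(\<lambda>x. f x \<bullet> h x) \<in> borel_measurable (lebesgue_on \<Omega>)" by measurable
  have "norm (f x \<bullet> h x) \<le> norm ((norm (f x))\<^sup>2 + (norm (h x))\<^sup>2)" for x
  proof -
    have "\<bar>f x \<bullet> h x\<bar> \<le> norm (f x) * norm (h x)" by (rule Cauchy_Schwarz_ineq2)
    also have "\<dots> \<le> (norm (f x))\<^sup>2 + (norm (h x))\<^sup>2"
      using sum_squares_bound[of "norm (f x)" "norm (h x)"]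
        mult_nonneg_nonneg[OF norm_ge_zero[of "f x"] norm_ge_zero[of "h x"]] by linarith
    finally show ?thesis by simp
  qed
  then show "AE x in lebesgue_on \<Omega>. norm (f x \<bullet> h x) \<le> norm ((norm (f x))\<^sup>2 + (norm (h x))\<^sup>2)" by simp
qed

lemma L2_add:
  assumes "f \<in> Lspace 2 \<Omega>" "h \<in> Lspace 2 \<Omega>"
  shows "(\<lambda>x. f x + h x) \<in> Lspace 2 \<Omega>"
proof -
  have [measurable]: "f \<in> borel_measurable (lebesgue_on \<Omega>)" "h \<in> borel_measurable (lebesgue_on \<Omega>)"
    using assms by (simp_all add: Lspace_2_iff)
  have "(\<lambda>x. (norm (f x + h x))\<^sup>2) = (\<lambda>x. (norm (f x))\<^sup>2 + (norm (h x))\<^sup>2 + 2 * (f x \<bullet> h x))"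
    by (auto simp: power2_norm_eq_inner inner_simps inner_commute)
  then show ?thesis
    using assms L2_integrable_inner[OF assms] by (simp add: Lspace_2_iff)
qed

lemma L2_scale:
  assumes "f \<in> Lspace 2 \<Omega>"
  shows "(\<lambda>x. c *\<^sub>R f x) \<in> Lspace 2 \<Omega>"
  using assms by (auto simp add: Lspace_2_iff power_mult_distrib)

lemma L2_diff:
  assumes "f \<in> Lspace 2 \<Omega>" "h \<in> Lspace 2 \<Omega>"
  shows "(\<lambda>x. f x - h x) \<in> Lspace 2 \<Omega>"
  using L2_add[OF assms(1) L2_scale[OF assms(2), of "-1"]] by simp

lemma L2inner_commute: "L2inner \<Omega> f h = L2inner \<Omega> h f"
  by (simp add: L2inner_def inner_commute)

lemma L2inner_nonneg: "0 \<le> L2inner \<Omega> f f"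
  unfolding L2inner_def by (intro integral_nonneg_AE) auto

lemma L2inner_diff_left:
  assumes "f \<in> Lspace 2 \<Omega>" "h \<in> Lspace 2 \<Omega>" "w \<in> Lspace 2 \<Omega>"
  shows "L2inner \<Omega> (\<lambda>x. f x - h x) w = L2inner \<Omega> f w - L2inner \<Omega> h w"
  using assms by (simp add: L2inner_def inner_diff_left L2_integrable_inner)

lemma L2inner_scale_left: "L2inner \<Omega> (\<lambda>x. c *\<^sub>R f x) w = c * L2inner \<Omega> f w"
  by (simp add: L2inner_def)

lemma L2inner_diff_right:
  assumes "f \<in> Lspace 2 \<Omega>" "h \<in> Lspace 2 \<Omega>" "w \<in> Lspace 2 \<Omega>"
  shows "L2inner \<Omega> w (\<lambda>x. f x - h x) = L2inner \<Omega> w f - L2inner \<Omega> w h"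
  using L2inner_diff_left[OF assms] by (simp add: L2inner_commute)

lemma L2inner_diff_self:
  assumes f: "f \<in> Lspace 2 \<Omega>" and h: "h \<in> Lspace 2 \<Omega>"
  shows "L2inner \<Omega> (\<lambda>x. f x - h x) (\<lambda>x. f x - h x) = L2inner \<Omega> f f + L2inner \<Omega> h h - 2 * L2inner \<Omega> f h"
  unfolding L2inner_diff_left[OF f h L2_diff[OF f h]] L2inner_diff_right[OF f h f] L2inner_diff_right[OF f h h]
  using L2inner_commute[of \<Omega> h f] by simp

lemma L2_Cauchy_Schwarz:
  assumes f: "f \<in> Lspace 2 \<Omega>" and h: "h \<in> Lspace 2 \<Omega>"
  shows "\<bar>L2inner \<Omega> f h\<bar> \<le> Lnorm 2 \<Omega> f * Lnorm 2 \<Omega> h"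
proof -
  define a b c where "a = L2inner \<Omega> f f" and "b = L2inner \<Omega> f h" and "c = L2inner \<Omega> h h"
  have q: "0 \<le> a + s\<^sup>2 * c - 2 * s * b" for s
  proof -
    have "L2inner \<Omega> (\<lambda>x. s *\<^sub>R h x) (\<lambda>x. s *\<^sub>R h x) = s\<^sup>2 * c"
      by (simp add: c_def L2inner_def power2_eq_square mult.assoc)
    moreover have "L2inner \<Omega> f (\<lambda>x. s *\<^sub>R h x) = s * b"
      by (simp add: b_def L2inner_def)
    ultimately show ?thesis
      using L2inner_nonneg[of \<Omega> "\<lambda>x. f x - s *\<^sub>R h x"]
      unfolding L2inner_diff_self[OF f L2_scale[OF h]] by (simp add: a_def)
  qed
  have a: "0 \<le> a" and c: "0 \<le> c" by (simp_all add: a_def c_def L2inner_nonneg)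
  have "b\<^sup>2 \<le> a * c"
  proof (cases "c = 0")
    case True
    have "b = 0"
    proof (rule ccontr)
      assume "b \<noteq> 0"
      \<comment> \<open>For \<open>c = 0\<close> the quadratic is linear in \<open>s\<close>; at
        this value it equals -1.\<close>
      with q[of "(a + 1) / (2 * b)"] True show False by (simp add: field_simps)
    qed
    then show ?thesis using a c by simp
  next
    case False
    with c have "c > 0" by simp
    then show ?thesis using q[of "b / c"] by (simp add: field_simps power2_eq_square)
  qed
  then have "\<bar>b\<bar> \<le> sqrt (a * c)" by (metis real_sqrt_le_mono real_sqrt_abs)
  then show ?thesis by (simp add: Lnorm_2_eq_sqrt a_def b_def c_def real_sqrt_mult)
qed

lemma Lnorm_2_triangle:
  assumes f: "f \<in> Lspace 2 \<Omega>" and h: "h \<in> Lspace 2 \<Omega>"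
  shows "Lnorm 2 \<Omega> (\<lambda>x. f x - h x) \<le> Lnorm 2 \<Omega> f + Lnorm 2 \<Omega> h"
proof (rule power2_le_imp_le)
  show "(Lnorm 2 \<Omega> (\<lambda>x. f x - h x))\<^sup>2 \<le> (Lnorm 2 \<Omega> f + Lnorm 2 \<Omega> h)\<^sup>2"
    using L2_Cauchy_Schwarz[OF f h]
    by (simp add: Lnorm_2_sq L2inner_diff_self[OF f h] power2_sum)
qed (simp add: Lnorm_nonneg)

lemma L2inner_cong_AE:
  fixes f f' h h' :: "'a::euclidean_space \<Rightarrow> 'b::euclidean_space"
  assumes "AE x in lebesgue_on \<Omega>. f x = f' x" "AE x in lebesgue_on \<Omega>. h x = h' x"
    and "f \<in> borel_measurable (lebesgue_on \<Omega>)" "f' \<in> borel_measurable (lebesgue_on \<Omega>)"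
    "h \<in> borel_measurable (lebesgue_on \<Omega>)" "h' \<in> borel_measurable (lebesgue_on \<Omega>)"
  shows "L2inner \<Omega> f h = L2inner \<Omega> f' h'"
  unfolding L2inner_def
proof (rule integral_cong_AE)
  show "AE x in lebesgue_on \<Omega>. f x \<bullet> h x = f' x \<bullet> h' x"
    using assms(1,2) by eventually_elim simp
  note assms(3-)[measurable]
  show "(\<lambda>x. f x \<bullet> h x) \<in> borel_measurable (lebesgue_on \<Omega>)"
    "(\<lambda>x. f' x \<bullet> h' x) \<in> borel_measurable (lebesgue_on \<Omega>)" by measurable
qed

lemma Lnorm_cong_AE:
  fixes f f' :: "'a::euclidean_space \<Rightarrow> 'b::euclidean_space"
  assumes "AE x in lebesgue_on \<Omega>. f x = f' x"
    and "f \<in> borel_measurable (lebesgue_on \<Omega>)" "f' \<in> borel_measurable (lebesgue_on \<Omega>)"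
  shows "Lnorm 2 \<Omega> f = Lnorm 2 \<Omega> f'"
  using L2inner_cong_AE[OF assms(1,1,2,3,2,3)] by (simp add: Lnorm_2_eq_sqrt)

section \<open>Curves in L2: continuity and weak differentiation\<close>

definition L2cont :: "'a::euclidean_space set \<Rightarrow> (real \<Rightarrow> 'a \<Rightarrow> 'b::euclidean_space) \<Rightarrow> bool" where
  "L2cont \<Omega> a \<longleftrightarrow> (\<forall>t\<ge>0. a t \<in> Lspace 2 \<Omega>) \<and>
     (\<forall>t\<ge>0. ((\<lambda>s. Lnorm 2 \<Omega> (\<lambda>x. a s x - a t x)) \<longlongrightarrow> 0) (at t within {0..}))"

lemma L2cont_seq:
  assumes a: "L2cont \<Omega> a" and "s \<ge> 0" "\<And>n. \<sigma> n \<ge> 0" "\<sigma> \<longlonglongrightarrow> s"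
  shows "(\<lambda>n. Lnorm 2 \<Omega> (\<lambda>x. a (\<sigma> n) x - a s x)) \<longlonglongrightarrow> 0"
proof -
  \<comment> \<open>The filter in \<open>L2cont\<close> omits the point \<open>s\<close>. Since the
    value there is 0, the limit is continuity at \<open>s\<close>, and the sequence may hit
    \<open>s\<close>.\<close>
  have "Lnorm 2 \<Omega> (\<lambda>x. a s x - a s x) = 0" by (simp add: Lnorm_def)
  then have c: "continuous (at s within {0..}) (\<lambda>r. Lnorm 2 \<Omega> (\<lambda>x. a r x - a s x))"
    using a \<open>s \<ge> 0\<close> unfolding L2cont_def continuous_within by metis
  have "(\<lambda>n. Lnorm 2 \<Omega> (\<lambda>x. a (\<sigma> n) x - a s x)) \<longlonglongrightarrow> Lnorm 2 \<Omega> (\<lambda>x. a s x - a s x)"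
    using assms by (intro continuous_within_tendsto_compose'[OF c]) auto
  then show ?thesis by (simp add: Lnorm_def)
qed

text \<open>Joint continuity is needed because these products are later evaluated on the diagonal
  and at shifted pairs of times. Expanding both factors around the limit point leaves only norms of
  differences and two fixed norms, so no bound along the sequence is required.\<close>

lemma L2cont_inner:
  fixes a b :: "real \<Rightarrow> 'a::euclidean_space \<Rightarrow> 'b::euclidean_space"
  assumes a: "L2cont \<Omega> a" and b: "L2cont \<Omega> b"
  shows "continuous_on ({0..} \<times> {0..}) (\<lambda>(s, t). L2inner \<Omega> (a s) (b t))"
  unfolding continuous_on_sequentially
proof (intro allI impI ballI, elim conjE)
  fix z :: "nat \<Rightarrow> real \<times> real" and z0 :: "real \<times> real"
  assume z0: "z0 \<in> {0..} \<times> {0..}" and z: "\<forall>n. z n \<in> {0..} \<times> {0..}" and lim: "z \<longlonglongrightarrow> z0"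
  obtain s t where st: "z0 = (s, t)" "s \<ge> 0" "t \<ge> 0" using z0 by (cases z0) auto
  define \<sigma> \<tau> where "\<sigma> n = fst (z n)" and "\<tau> n = snd (z n)" for n
  have pos: "\<sigma> n \<ge> 0" "\<tau> n \<ge> 0" for n using z[rule_format, of n] by (auto simp: \<sigma>_def \<tau>_def)
  have lims: "\<sigma> \<longlonglongrightarrow> s" "\<tau> \<longlonglongrightarrow> t"
    using tendsto_fst[OF lim] tendsto_snd[OF lim] by (simp_all add: st \<sigma>_def[abs_def] \<tau>_def[abs_def])
  have A: "(\<lambda>n. Lnorm 2 \<Omega> (\<lambda>x. a (\<sigma> n) x - a s x)) \<longlonglongrightarrow> 0"
    by (rule L2cont_seq[OF a st(2) pos(1) lims(1)])
  have B: "(\<lambda>n. Lnorm 2 \<Omega> (\<lambda>x. b (\<tau> n) x - b t x)) \<longlonglongrightarrow> 0"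
    by (rule L2cont_seq[OF b st(3) pos(2) lims(2)])
  have bd: "norm (L2inner \<Omega> (a (\<sigma> n)) (b (\<tau> n)) - L2inner \<Omega> (a s) (b t))
      \<le> Lnorm 2 \<Omega> (\<lambda>x. a (\<sigma> n) x - a s x) * Lnorm 2 \<Omega> (\<lambda>x. b (\<tau> n) x - b t x)
        + Lnorm 2 \<Omega> (\<lambda>x. a (\<sigma> n) x - a s x) * Lnorm 2 \<Omega> (b t)
        + Lnorm 2 \<Omega> (a s) * Lnorm 2 \<Omega> (\<lambda>x. b (\<tau> n) x - b t x)" for n
  proof -
    have m: "a (\<sigma> n) \<in> Lspace 2 \<Omega>" "b (\<tau> n) \<in> Lspace 2 \<Omega>" "a s \<in> Lspace 2 \<Omega>" "b t \<in> Lspace 2 \<Omega>"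
      using a b st pos by (auto simp: L2cont_def)
    have "L2inner \<Omega> (a (\<sigma> n)) (b (\<tau> n)) - L2inner \<Omega> (a s) (b t)
      = L2inner \<Omega> (\<lambda>x. a (\<sigma> n) x - a s x) (\<lambda>x. b (\<tau> n) x - b t x)
       + L2inner \<Omega> (\<lambda>x. a (\<sigma> n) x - a s x) (b t) + L2inner \<Omega> (a s) (\<lambda>x. b (\<tau> n) x - b t x)"
      unfolding L2inner_diff_left[OF m(1,3) L2_diff[OF m(2,4)]] L2inner_diff_left[OF m(1,3,4)]
        L2inner_diff_right[OF m(2,4,1)] L2inner_diff_right[OF m(2,4,3)] by simp
    then show ?thesis
      using L2_Cauchy_Schwarz[OF L2_diff[OF m(1,3)] L2_diff[OF m(2,4)]]
        L2_Cauchy_Schwarz[OF L2_diff[OF m(1,3)] m(4)] L2_Cauchy_Schwarz[OF m(3) L2_diff[OF m(2,4)]]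
      unfolding real_norm_def by linarith
  qed
  have r: "(\<lambda>n. Lnorm 2 \<Omega> (\<lambda>x. a (\<sigma> n) x - a s x) * Lnorm 2 \<Omega> (\<lambda>x. b (\<tau> n) x - b t x)
        + Lnorm 2 \<Omega> (\<lambda>x. a (\<sigma> n) x - a s x) * Lnorm 2 \<Omega> (b t)
        + Lnorm 2 \<Omega> (a s) * Lnorm 2 \<Omega> (\<lambda>x. b (\<tau> n) x - b t x)) \<longlonglongrightarrow> 0 * 0 + 0 * Lnorm 2 \<Omega> (b t) + Lnorm 2 \<Omega> (a s) * 0"
    by (intro tendsto_add tendsto_mult tendsto_const A B)
  have "(\<lambda>n. L2inner \<Omega> (a (\<sigma> n)) (b (\<tau> n)) - L2inner \<Omega> (a s) (b t)) \<longlonglongrightarrow> 0"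
    by (rule Lim_null_comparison[OF always_eventually[OF allI[OF bd]]]) (use r in simp)
  then have "(\<lambda>n. L2inner \<Omega> (a (\<sigma> n)) (b (\<tau> n))) \<longlonglongrightarrow> L2inner \<Omega> (a s) (b t)"
    by (simp add: LIM_zero_iff)
  then show "((\<lambda>(s, t). L2inner \<Omega> (a s) (b t)) \<circ> z) \<longlonglongrightarrow> (case z0 of (s, t) \<Rightarrow> L2inner \<Omega> (a s) (b t))"
    by (simp add: case_prod_unfold \<sigma>_def \<tau>_def o_def st)
qed

text \<open>By the Cauchy-Schwarz inequality, convergence of the difference quotients in L2 norm
  passes to products with a fixed \<open>w\<close>. In this form the time derivative becomes an
  ordinary derivative of a real function.\<close>

lemma L2_weak_derivative:
  fixes u v :: "real \<Rightarrow> 'a::euclidean_space \<Rightarrow> real"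
  assumes u: "\<And>s. s \<ge> 0 \<Longrightarrow> u s \<in> Lspace 2 \<Omega>" and v: "v t \<in> Lspace 2 \<Omega>" and t: "t \<ge> 0"
    and lim: "((\<lambda>s. Lnorm 2 \<Omega> (\<lambda>x. (u s x - u t x) / (s - t) - v t x)) \<longlongrightarrow> 0) (at t within {0..})"
    and w: "w \<in> Lspace 2 \<Omega>"
  shows "((\<lambda>s. L2inner \<Omega> w (u s)) has_real_derivative L2inner \<Omega> w (v t)) (at t within {0..})"
proof -
  have bd: "\<forall>\<^sub>F s in at t within {0..}. norm ((L2inner \<Omega> w (u s) - L2inner \<Omega> w (u t)) / (s - t) - L2inner \<Omega> w (v t))
     \<le> Lnorm 2 \<Omega> w * Lnorm 2 \<Omega> (\<lambda>x. (u s x - u t x) / (s - t) - v t x)"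
    unfolding eventually_at_filter
  proof (intro always_eventually allI impI)
    fix s :: real assume "s \<in> {0..}"
    then have us: "u s \<in> Lspace 2 \<Omega>" by (simp add: u)
    have ut: "u t \<in> Lspace 2 \<Omega>" by (simp add: u t)
    have q: "(\<lambda>x. inverse (s - t) *\<^sub>R (u s x - u t x)) \<in> Lspace 2 \<Omega>"
      by (intro L2_scale L2_diff us ut)
    have e: "(\<lambda>x. (u s x - u t x) / (s - t)) = (\<lambda>x. inverse (s - t) *\<^sub>R (u s x - u t x))"
      by (simp add: divide_inverse mult.commute)
    have "(L2inner \<Omega> w (u s) - L2inner \<Omega> w (u t)) / (s - t) - L2inner \<Omega> w (v t)
      = L2inner \<Omega> w (\<lambda>x. (u s x - u t x) / (s - t) - v t x)"
      unfolding L2inner_diff_right[OF q[folded e] v w] unfolding e L2inner_commute[of _ w]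
        L2inner_scale_left L2inner_diff_left[OF us ut w] by (simp add: divide_inverse mult.commute)
    then show "norm ((L2inner \<Omega> w (u s) - L2inner \<Omega> w (u t)) / (s - t) - L2inner \<Omega> w (v t))
     \<le> Lnorm 2 \<Omega> w * Lnorm 2 \<Omega> (\<lambda>x. (u s x - u t x) / (s - t) - v t x)"
      using L2_Cauchy_Schwarz[OF w L2_diff[OF q[folded e] v]] by simp
  qed
  have "((\<lambda>s. (L2inner \<Omega> w (u s) - L2inner \<Omega> w (u t)) / (s - t) - L2inner \<Omega> w (v t)) \<longlongrightarrow> 0) (at t within {0..})"
    by (rule Lim_null_comparison[OF bd]) (auto intro!: tendsto_eq_intros lim)
  then show ?thesis
    by (simp add: has_field_derivative_iff LIM_zero_iff)
qed

section \<open>Smooth functions and bump functions\<close>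

text \<open>Differentiability gives continuity at each order, so an induction on \<open>k\<close>
  needs only a family closed under directional derivatives. No formula for higher derivatives has to
  be found.\<close>

lemma smooth_coinduct:
  assumes P: "P f"
    and step: "\<And>f. P f \<Longrightarrow> (\<forall>x. f differentiable (at x)) \<and> (\<forall>v. P (\<lambda>x. frechet_derivative f (at x) v))"
  shows "smooth f"
proof -
  have "P f \<Longrightarrow> Ck k f" for k f
  proof (induction k arbitrary: f)
    case 0
    then have "\<forall>x. f differentiable (at x)" using step by blast
    then show ?case by (auto simp: continuous_on_eq_continuous_within intro: differentiable_imp_continuous_within)
  next
    case (Suc k)
    then show ?case using step by auto
  qed
  then show ?thesis using P by (simp add: smooth_def)
qed

lemma smooth_differentiable: "smooth f \<Longrightarrow> f differentiable (at x)"
  unfolding smooth_def using Ck.simps(2)[of 0 f] by blast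

lemma smooth_frechet: "smooth f \<Longrightarrow> smooth (\<lambda>x. frechet_derivative f (at x) v)"
  unfolding smooth_def using Ck.simps(2) by blast

lemma smooth_continuous: "smooth f \<Longrightarrow> continuous_on UNIV f"
  unfolding smooth_def using Ck.simps(1) by blast

lemma smooth_has_derivative: "smooth f \<Longrightarrow> (f has_derivative frechet_derivative f (at x)) (at x)"
  using smooth_differentiable frechet_derivative_works by blast

lemma smooth_diff:
  assumes "smooth f" "smooth g" shows "smooth (\<lambda>x. f x - g x)"
proof (rule smooth_coinduct[where P = "\<lambda>h. \<exists>f g. smooth f \<and> smooth g \<and> h = (\<lambda>x. f x - g x)"])
  show "\<exists>f' g'. smooth f' \<and> smooth g' \<and> (\<lambda>x. f x - g x) = (\<lambda>x. f' x - g' x)" using assms by blast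
next
  fix h :: "'a \<Rightarrow> real" assume "\<exists>f g. smooth f \<and> smooth g \<and> h = (\<lambda>x. f x - g x)"
  then obtain f g where fg: "smooth f" "smooth g" "h = (\<lambda>x. f x - g x)" by blast
  have d: "(h has_derivative (\<lambda>v. frechet_derivative f (at x) v - frechet_derivative g (at x) v)) (at x)" for x
    unfolding fg(3) by (intro has_derivative_diff smooth_has_derivative fg)
  have e: "frechet_derivative h (at x) v = frechet_derivative f (at x) v - frechet_derivative g (at x) v" for x v
    using frechet_derivative_at[OF d, of x] by metis
  show "(\<forall>x. h differentiable at x) \<and>
         (\<forall>v. \<exists>f g. smooth f \<and> smooth g \<and> (\<lambda>x. frechet_derivative h (at x) v) = (\<lambda>x. f x - g x))"
  proof (intro conjI allI)
    show "h differentiable at x" for x using d differentiable_def by blast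
    show "\<exists>f g. smooth f \<and> smooth g \<and> (\<lambda>x. frechet_derivative h (at x) v) = (\<lambda>x. f x - g x)" for v
      unfolding e using fg smooth_frechet by blast
  qed
qed

text \<open>The classical flat function exp(-c/t), extended by 0. The powers of 1/t are carried
  along because differentiation raises them, the parameter \<open>c\<close> because \<open>c\<close>
  tending to 0 turns \<open>flat c 0\<close> into the indicator of the positive half-line.\<close>

definition flat :: "real \<Rightarrow> nat \<Rightarrow> real \<Rightarrow> real" where
  "flat c j t = (if t > 0 then inverse t ^ j * exp (- (c * inverse t)) else 0)"

lemma flat_at_right_0:
  assumes "c > 0" shows "(flat c j \<longlongrightarrow> 0) (at_right 0)"
proof -
  have "((\<lambda>y::real. y ^ j / exp y) \<longlongrightarrow> 0) at_top" by (rule tendsto_power_div_exp_0)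
  moreover have "filterlim (\<lambda>t::real. c * inverse t) at_top (at_right 0)"
    by (rule filterlim_tendsto_pos_mult_at_top[OF tendsto_const assms filterlim_inverse_at_top_right])
  ultimately have "((\<lambda>t. (c * inverse t) ^ j / exp (c * inverse t)) \<longlongrightarrow> 0) (at_right 0)"
    by (rule filterlim_compose)
  then have "((\<lambda>t. inverse (c ^ j) * ((c * inverse t) ^ j / exp (c * inverse t))) \<longlongrightarrow> 0) (at_right 0)"
    by (rule tendsto_mult_right_zero)
  moreover have "\<forall>\<^sub>F t in at_right 0. inverse (c ^ j) * ((c * inverse t) ^ j / exp (c * inverse t)) = flat c j t"
    using eventually_at_right_less[of "0::real"]
    by eventually_elim (use assms in \<open>simp add: flat_def power_mult_distrib exp_minus field_simps\<close>)
  ultimately show ?thesis by (rule Lim_transform_eventually)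
qed

lemma flat_deriv:
  assumes c: "c > 0"
  shows "(flat c j has_real_derivative (c * flat c (j + 2) t - j * flat c (j + 1) t)) (at t)"
proof -
  consider "t > 0" | "t < 0" | "t = 0" by linarith
  then show ?thesis
  proof cases
    case 1
    have "((\<lambda>t. inverse t ^ j * exp (- (c * inverse t))) has_real_derivative
       (c * flat c (j + 2) t - j * flat c (j + 1) t)) (at t)"
    proof -
      \<comment> \<open>The truncated exponent \<open>j - Suc 0\<close> does no harm at
        \<open>j = 0\<close>, where the factor \<open>real j\<close> vanishes.\<close>
      have pw: "real j * (- (y ^ Suc (Suc 0)) * y ^ (j - Suc 0)) = - (real j * y ^ (j + 1))" for y :: real
        by (cases j) auto
      have d: "((\<lambda>t. inverse t ^ j) has_real_derivative - (real j * inverse t ^ (j + 1))) (at t)"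
        by (rule DERIV_cong[OF DERIV_power[OF DERIV_inverse]])
          (use 1 in \<open>simp_all only: pw less_imp_neq[symmetric] not_False_eq_True\<close>)
      have e: "((\<lambda>t. exp (- (c * inverse t))) has_real_derivative c * inverse t ^ 2 * exp (- (c * inverse t))) (at t)"
        using 1 by (auto intro!: derivative_eq_intros simp: power2_eq_square)
      have "((\<lambda>t. inverse t ^ j * exp (- (c * inverse t))) has_real_derivative
         - (real j * inverse t ^ (j + 1)) * exp (- (c * inverse t)) + c * inverse t ^ 2 * exp (- (c * inverse t)) * inverse t ^ j) (at t)"
        by (rule DERIV_mult[OF d e])
      then show ?thesis
        by (rule DERIV_cong) (use 1 in \<open>simp add: flat_def power_add power2_eq_square algebra_simps\<close>)
    qed
    then show ?thesis
    proof (rule DERIV_cong_ev[THEN iffD1, rotated -1])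
      show "\<forall>\<^sub>F x in nhds t. inverse x ^ j * exp (- (c * inverse x)) = flat c j x"
        using eventually_nhds_in_open[of "{0<..}" t] 1 by (auto simp: flat_def elim!: eventually_mono)
    qed simp_all
  next
    case 2
    have "((\<lambda>t. 0) has_real_derivative (c * flat c (j + 2) t - j * flat c (j + 1) t)) (at t)"
      using 2 by (auto simp: flat_def)
    then show ?thesis
    proof (rule DERIV_cong_ev[THEN iffD1, rotated -1])
      show "\<forall>\<^sub>F x in nhds t. 0 = flat c j x"
        using eventually_nhds_in_open[of "{..<0}" t] 2 by (auto simp: flat_def elim!: eventually_mono)
    qed simp_all
  next
    case 3
    \<comment> \<open>On the right of 0 the difference quotient is \<open>flat c (Suc j)\<close>,
      another member of the family, and it tends to 0.\<close>
    have r: "((\<lambda>t. flat c j t / t) \<longlongrightarrow> 0) (at_right 0)"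
    proof (rule Lim_transform_eventually[OF flat_at_right_0[OF c, of "Suc j"]])
      show "\<forall>\<^sub>F x in at_right 0. flat c (Suc j) x = flat c j x / x"
        using eventually_at_right_less[of "0::real"] by eventually_elim (simp add: flat_def field_simps)
    qed
    have l: "((\<lambda>t. flat c j t / t) \<longlongrightarrow> 0) (at_left 0)"
    proof (rule Lim_transform_eventually[OF tendsto_const[of 0]])
      show "\<forall>\<^sub>F x in at_left 0. 0 = flat c j x / x"
        by (auto simp: eventually_at_filter flat_def)
    qed
    have "((\<lambda>t. flat c j t / t) \<longlongrightarrow> 0) (at 0)"
      using l r filterlim_at_split by blast
    then show ?thesis using 3 by (simp add: has_field_derivative_iff flat_def)
  qed
qed

text \<open>An algebra containing the factors of a box bump and, by \<open>flat_deriv\<close>,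
  closed under directional derivatives: the invariant family that \<open>smooth_coinduct\<close>
  asks for.\<close>

inductive flat_alg :: "real \<Rightarrow> ('a::euclidean_space \<Rightarrow> real) \<Rightarrow> bool" for c where
  const: "flat_alg c (\<lambda>x. k)"
| flat: "flat_alg c (\<lambda>x. flat c j (x \<bullet> b + r))"
| add: "flat_alg c f \<Longrightarrow> flat_alg c g \<Longrightarrow> flat_alg c (\<lambda>x. f x + g x)"
| mult: "flat_alg c f \<Longrightarrow> flat_alg c g \<Longrightarrow> flat_alg c (\<lambda>x. f x * g x)"

lemma flat_alg_step:
  assumes c: "c > 0" and "flat_alg c f"
  shows "\<exists>D. (\<forall>x. (f has_derivative D x) (at x)) \<and> (\<forall>v. flat_alg c (\<lambda>x. D x v))"
  using assms(2)
proof induction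
  case (const k)
  show ?case by (rule exI[of _ "\<lambda>x v. 0"]) (auto intro: flat_alg.const)
next
  case (flat j b r)
  define D where "D x v = (c * flat c (j + 2) (x \<bullet> b + r) + (- real j) * flat c (j + 1) (x \<bullet> b + r)) * (v \<bullet> b)" for x v :: 'a
  have "((\<lambda>x. flat c j (x \<bullet> b + r)) has_derivative D x) (at x)" for x
  proof -
    have 1: "((\<lambda>x. x \<bullet> b + r) has_derivative (\<lambda>v. v \<bullet> b)) (at x)"
      by (auto intro!: derivative_eq_intros)
    show ?thesis
      by (rule has_derivative_eq_rhs[OF has_derivative_compose[OF 1
          flat_deriv[OF c, unfolded has_field_derivative_def]]])
        (auto simp: D_def algebra_simps)
  qed
  moreover have "flat_alg c (\<lambda>x. D x v)" for v
    unfolding D_def by (intro flat_alg.intros)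
  ultimately show ?case by blast
next
  case (add f g)
  then obtain D E where DE: "\<forall>x. (f has_derivative D x) (at x)" "\<forall>v. flat_alg c (\<lambda>x. D x v)"
     "\<forall>x. (g has_derivative E x) (at x)" "\<forall>v. flat_alg c (\<lambda>x. E x v)" by blast
  show ?case
    by (rule exI[of _ "\<lambda>x v. D x v + E x v"]) (use DE in \<open>auto intro: has_derivative_add flat_alg.add\<close>)
next
  case (mult f g)
  then obtain D E where DE: "\<forall>x. (f has_derivative D x) (at x)" "\<forall>v. flat_alg c (\<lambda>x. D x v)"
     "\<forall>x. (g has_derivative E x) (at x)" "\<forall>v. flat_alg c (\<lambda>x. E x v)" by blast
  show ?case
    by (rule exI[of _ "\<lambda>x v. f x * E x v + D x v * g x"])
      (use DE mult.hyps in \<open>auto intro!: has_derivative_mult flat_alg.add flat_alg.mult\<close>)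
qed

lemma flat_alg_smooth:
  assumes c: "c > 0" and "flat_alg c f" shows "smooth f"
proof (rule smooth_coinduct[where P = "flat_alg c"])
  fix f :: "'a \<Rightarrow> real" assume "flat_alg c f"
  then obtain D where D: "\<And>x. (f has_derivative D x) (at x)" "\<And>v. flat_alg c (\<lambda>x. D x v)"
    using flat_alg_step[OF c] by blast
  have "frechet_derivative f (at x) = D x" for x
    using frechet_derivative_at[OF D(1), of x] by simp
  then show "(\<forall>x. f differentiable at x) \<and> (\<forall>v. flat_alg c (\<lambda>x. frechet_derivative f (at x) v))"
    using D by (auto simp: differentiable_def)
qed (rule assms)

text \<open>A smooth function, positive exactly on \<open>box a b\<close> and bounded by 1, that
  increases to the indicator of the box as \<open>c\<close> decreases to 0. Testing with it turns
  statements about test functions into statements about integrals over boxes.\<close>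

definition bump :: "real \<Rightarrow> 'a::euclidean_space \<Rightarrow> 'a \<Rightarrow> 'a \<Rightarrow> real" where
  "bump c a b x = (\<Prod>i\<in>Basis. flat c 0 (x \<bullet> i - a \<bullet> i) * flat c 0 (b \<bullet> i - x \<bullet> i))"

lemma bump_smooth:
  assumes "c > 0" shows "smooth (bump c a b)"
proof -
  have "flat_alg c (\<lambda>x::'a. \<Prod>i\<in>I. flat c 0 (x \<bullet> i - a \<bullet> i) * flat c 0 (b \<bullet> i - x \<bullet> i))" if "finite I" for I
    using that
  proof induction
    case empty
    then show ?case using flat_alg.const[of c 1] by simp
  next
    case (insert i I)
    have 1: "flat_alg c (\<lambda>x::'a. flat c 0 (x \<bullet> i - a \<bullet> i))"
      using flat_alg.flat[of c 0 i "- (a \<bullet> i)"] by simp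
    have 2: "flat_alg c (\<lambda>x::'a. flat c 0 (b \<bullet> i - x \<bullet> i))"
      using flat_alg.flat[of c 0 "-i" "b \<bullet> i"] by simp
    show ?case using insert by (simp add: flat_alg.mult[OF flat_alg.mult[OF 1 2]])
  qed
  from flat_alg_smooth[OF assms this[of Basis]] show ?thesis by (simp add: bump_def[abs_def])
qed

lemma flat_0_bounds: "c > 0 \<Longrightarrow> 0 \<le> flat c 0 t \<and> flat c 0 t \<le> 1"
  by (auto simp: flat_def)

lemma bump_bounds: "c > 0 \<Longrightarrow> 0 \<le> bump c a b x \<and> bump c a b x \<le> 1"
  unfolding bump_def using flat_0_bounds[of c]
  by (auto intro!: prod_nonneg prod_le_1 mult_le_one)

lemma bump_outside: "x \<notin> box a b \<Longrightarrow> bump c a b x = 0"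
proof -
  assume "x \<notin> box a b"
  then obtain i where "i \<in> Basis" "flat c 0 (x \<bullet> i - a \<bullet> i) * flat c 0 (b \<bullet> i - x \<bullet> i) = 0"
    by (auto simp: box_def flat_def not_less)
  then show ?thesis unfolding bump_def by (meson finite_Basis prod_zero)
qed

lemma bump_limit:
  "(\<lambda>n. bump (1 / real (Suc n)) a b x) \<longlonglongrightarrow> indicator (box a b) x"
proof (cases "x \<in> box a b")
  case True
  have f: "(\<lambda>n. flat (1 / real (Suc n)) 0 t) \<longlonglongrightarrow> 1" if "t > 0" for t
  proof -
    have "(\<lambda>n. exp (- (1 / real (Suc n) * inverse t))) \<longlonglongrightarrow> exp (- (0 * inverse t))"
      by (intro tendsto_intros LIMSEQ_Suc[OF lim_1_over_n])
    then show ?thesis using that by (simp add: flat_def)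
  qed
  have "(\<lambda>n. bump (1 / real (Suc n)) a b x) \<longlonglongrightarrow> (\<Prod>i\<in>(Basis::'a set). 1 * 1)"
    unfolding bump_def using True by (intro tendsto_prod tendsto_mult f) (auto simp: box_def)
  then show ?thesis using True by simp
next
  case False
  then show ?thesis by (simp add: bump_outside)
qed

lemma bump_test_fun:
  assumes c: "c > 0" and "cbox a b \<subseteq> \<Omega>" shows "bump c a b \<in> test_fun \<Omega>"
proof -
  have "{x. bump c a b x \<noteq> 0} \<subseteq> cbox a b"
    using bump_outside[of _ a b c] box_subset_cbox by blast
  then have "closure {x. bump c a b x \<noteq> 0} \<subseteq> cbox a b" by (intro closure_minimal) auto
  then show ?thesis
    using assms bump_smooth[OF c] by (auto simp: test_fun_def intro: bounded_subset[OF bounded_cbox \<open>{x. bump c a b x \<noteq> 0} \<subseteq> cbox a b\<close>])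
qed

section \<open>Gradients of test functions\<close>

text \<open>The definitions integrate over the completed measure restricted to \<Omega>, whereas
  translation, scaling and Fubini are used for \<open>lborel\<close> on the whole space. Functions
  vanishing off \<Omega> pass from one to the other.\<close>

lemma lebesgue_on_integral_eq_lborel:
  fixes F :: "'a::euclidean_space \<Rightarrow> real"
  assumes F: "F \<in> borel_measurable borel" and \<Omega>: "open \<Omega>" and z: "\<And>x. x \<notin> \<Omega> \<Longrightarrow> F x = 0"
  shows "(LINT x|lebesgue_on \<Omega>. F x) = (LINT x|lborel. F x)"
proof -
  have "(LINT x|lebesgue_on \<Omega>. F x) = (LINT x|lebesgue. indicator \<Omega> x *\<^sub>R F x)"
    by (rule integral_restrict_space) (use \<Omega> in auto)
  also have "(\<lambda>x. indicator \<Omega> x *\<^sub>R F x) = F" using z by (auto simp: fun_eq_iff indicator_def)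
  also have "integral\<^sup>L lebesgue F = integral\<^sup>L lborel F" by (rule integral_completion) (use F in simp)
  finally show ?thesis .
qed

lemma lborel_integral_translate:
  fixes F :: "'a::euclidean_space \<Rightarrow> real"
  assumes [measurable]: "F \<in> borel_measurable borel"
  shows "(LINT x|lborel. F (c + x)) = (LINT x|lborel. F x)"
proof -
  have "(LINT x|lborel. F x) = integral\<^sup>L (distr lborel borel ((+) c)) F" by (simp add: lborel_distr_plus)
  also have "\<dots> = (LINT x|lborel. F (c + x))" by (rule integral_distr) measurable
  finally show ?thesis by simp
qed

text \<open>Translation invariance makes the integral of every difference quotient in direction
  \<open>b\<close> vanish, and dominated convergence carries this to the derivative. No iterated
  integration along coordinate lines occurs.\<close>

lemma integral_partial_derivative_eq_0:
  fixes f :: "'a::euclidean_space \<Rightarrow> real"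
  assumes D: "\<And>x. (f has_derivative D x) (at x)" and cont: "continuous_on UNIV (\<lambda>x. D x b)"
    and supp: "\<And>x. x \<notin> cball 0 R \<Longrightarrow> f x = 0"
  shows "(LINT x|lborel. D x b) = 0"
proof -
  have [measurable]: "f \<in> borel_measurable borel"
    using D by (intro borel_measurable_continuous_onI has_derivative_continuous_on) (auto intro: has_derivative_at_withinI)
  have [measurable]: "(\<lambda>x. D x b) \<in> borel_measurable borel"
    using cont by (rule borel_measurable_continuous_onI)
  have D0: "D x b = 0" if "x \<notin> cball 0 R" for x
  proof -
    have "((\<lambda>x. 0) has_derivative D x) (at x)"
      by (rule has_derivative_transform_within_open[OF D, of "- cball 0 R"]) (use that supp in auto)
    then show ?thesis using has_derivative_unique[OF _ has_derivative_const[of 0 "at x"]] by metis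
  qed
  have "compact ((\<lambda>x. D x b) ` cball 0 R)"
    by (intro compact_continuous_image continuous_on_subset[OF cont]) auto
  then obtain C0 where C0: "\<And>x. x \<in> cball 0 R \<Longrightarrow> norm (D x b) \<le> C0"
    using compact_imp_bounded[of "(\<lambda>x. D x b) ` cball 0 R"] unfolding bounded_iff by blast
  define C where "C = max C0 0"
  have C: "\<bar>D x b\<bar> \<le> C" for x using C0[of x] D0[of x] by (cases "x \<in> cball 0 R") (auto simp: C_def)
  have C_nn: "C \<ge> 0" by (simp add: C_def)
  have Dl: "((\<lambda>s. f (x + s *\<^sub>R b)) has_real_derivative D (x + s *\<^sub>R b) b) (at s)" for x s
  proof -
    have 1: "((\<lambda>s. x + s *\<^sub>R b) has_derivative (\<lambda>s. s *\<^sub>R b)) (at s)" by (auto intro!: derivative_eq_intros)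
    show ?thesis
      unfolding has_field_derivative_def
      by (rule has_derivative_eq_rhs[OF has_derivative_compose[OF 1 D]])
        (auto simp: fun_eq_iff mult.commute linear_scale[OF has_derivative_linear[OF D]])
  qed
  define h where "h n = 1 / real (Suc n)" for n
  have h: "h n > 0" "h n \<le> 1" for n by (auto simp: h_def)
  have h0: "h \<longlonglongrightarrow> 0" unfolding h_def by (rule LIMSEQ_Suc[OF lim_1_over_n])
  define q where "q n x = (f (h n *\<^sub>R b + x) - f x) / h n" for n x
  have [measurable]: "q n \<in> borel_measurable borel" for n unfolding q_def by measurable
  have lim: "(\<lambda>n. q n x) \<longlonglongrightarrow> D x b" for x
  proof -
    have "((\<lambda>s. (f (x + s *\<^sub>R b) - f x) / s) \<longlongrightarrow> D x b) (at 0)"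
      using Dl[of x 0] by (simp add: has_field_derivative_iff)
    moreover have "filterlim h (at 0) sequentially"
      using h0 h(1) by (auto simp: filterlim_at intro!: always_eventually less_imp_neq[symmetric])
    ultimately have "(\<lambda>n. (f (x + h n *\<^sub>R b) - f x) / h n) \<longlonglongrightarrow> D x b" by (rule filterlim_compose)
    then show ?thesis by (simp add: q_def add.commute)
  qed
  have fi: "integrable lborel f"
  proof -
    have "(\<lambda>x. indicator (cball 0 R) x *\<^sub>R f x) = f" (is "?g = _") using supp by (auto simp: indicator_def fun_eq_iff)
    moreover have "integrable lborel ?g"
      by (rule borel_integrable_compact)
        (use D in \<open>auto intro!: has_derivative_continuous_on intro: has_derivative_at_withinI\<close>)
    ultimately show ?thesis by (simp only:)
  qed
  have fi': "integrable lborel (\<lambda>x. f (c + x))" for c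
  proof -
    have 1: "(+) c \<in> measurable lborel borel" by measurable
    have 2: "integrable (distr lborel borel ((+) c)) f" using fi by (simp add: lborel_distr_plus)
    show ?thesis using integrable_distr[OF 1 2] by simp
  qed
  have "(LINT x|lborel. q n x) = 0" for n
    using fi fi'[of "h n *\<^sub>R b"] lborel_integral_translate[of f "h n *\<^sub>R b"] by (simp add: q_def)
  \<comment> \<open>The mean value theorem bounds the quotients by \<open>C\<close>. As the step
    sizes are at most 1, all quotients vanish outside the ball enlarged by
    \<open>norm b\<close>.\<close>
  moreover have "(\<lambda>n. LINT x|lborel. q n x) \<longlonglongrightarrow> (LINT x|lborel. D x b)"
  proof (rule integral_dominated_convergence[where w = "\<lambda>x. C * indicator (cball 0 (R + norm b)) x"])
    show "integrable lborel (\<lambda>x. C * indicator (cball 0 (R + norm b)) x)"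
      by (intro integrable_mult_right integrable_real_indicator) (use emeasure_bounded_finite[of "cball 0 (R + norm b)"] in \<open>auto simp: infinity_ennreal_def\<close>)
    show "AE x in lborel. (\<lambda>n. q n x) \<longlonglongrightarrow> D x b" using lim by simp
    have "norm (q n x) \<le> C * indicator (cball 0 (R + norm b)) x" for n x
    proof (cases "x \<in> cball 0 (R + norm b)")
      case True
      obtain s where "0 < s" "s < h n" "f (x + h n *\<^sub>R b) - f (x + 0 *\<^sub>R b) = (h n - 0) * D (x + s *\<^sub>R b) b"
        using MVT2[of 0 "h n" "\<lambda>s. f (x + s *\<^sub>R b)" "\<lambda>s. D (x + s *\<^sub>R b) b"] h[of n] Dl[of x] by auto
      then have "q n x = D (x + s *\<^sub>R b) b" using h[of n] by (simp add: q_def add.commute)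
      then show ?thesis using C True by simp
    next
      case False
      have "norm (h n *\<^sub>R b) \<le> norm b" using h[of n] by (simp add: mult_left_le_one_le)
      then have "norm (h n *\<^sub>R b + x) > R" using False norm_triangle_ineq[of "h n *\<^sub>R b + x" "- (h n *\<^sub>R b)"]
        unfolding mem_cball dist_0_norm norm_minus_cancel by simp
      moreover have "norm x > R" using False norm_ge_zero[of b] unfolding mem_cball dist_0_norm by linarith
      ultimately have "q n x = 0" using supp by (simp add: q_def)
      then show ?thesis using C_nn by simp
    qed
    then show "AE x in lborel. norm (q n x) \<le> C * indicator (cball 0 (R + norm b)) x" for n by simp
  qed measurable
  ultimately show ?thesis by (simp add: LIMSEQ_const_iff)
qed

definition tgrad :: "('a::euclidean_space \<Rightarrow> real) \<Rightarrow> 'a \<Rightarrow> 'a" where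
  "tgrad \<phi> x = (\<Sum>b\<in>Basis. frechet_derivative \<phi> (at x) b *\<^sub>R b)"

lemma tgrad_inner:
  assumes "\<phi> differentiable at x"
  shows "tgrad \<phi> x \<bullet> v = frechet_derivative \<phi> (at x) v"
proof -
  have l: "linear (frechet_derivative \<phi> (at x))" using assms by (rule linear_frechet_derivative)
  have "frechet_derivative \<phi> (at x) v = frechet_derivative \<phi> (at x) (\<Sum>b\<in>Basis. (v \<bullet> b) *\<^sub>R b)"
    by (simp add: euclidean_representation)
  also have "\<dots> = (\<Sum>b\<in>Basis. (v \<bullet> b) * frechet_derivative \<phi> (at x) b)"
    by (simp add: linear_sum[OF l] linear_scale[OF l])
  also have "\<dots> = v \<bullet> tgrad \<phi> x" by (simp add: tgrad_def inner_sum_right mult.commute)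
  finally show ?thesis by (simp add: inner_commute)
qed

lemma tgrad_continuous:
  assumes "smooth \<phi>" shows "continuous_on UNIV (tgrad \<phi>)"
  unfolding tgrad_def by (intro continuous_intros smooth_continuous smooth_frechet assms)

lemma test_funD:
  assumes "\<phi> \<in> test_fun \<Omega>"
  shows "smooth \<phi>" "compact (closure {x. \<phi> x \<noteq> 0})" "closure {x. \<phi> x \<noteq> 0} \<subseteq> \<Omega>" "x \<notin> closure {x. \<phi> x \<noteq> 0} \<Longrightarrow> \<phi> x = 0"
    "x \<notin> closure {x. \<phi> x \<noteq> 0} \<Longrightarrow> tgrad \<phi> x = 0" "x \<notin> \<Omega> \<Longrightarrow> \<phi> x = 0" "x \<notin> \<Omega> \<Longrightarrow> tgrad \<phi> x = 0"
    "x \<notin> \<Omega> \<Longrightarrow> frechet_derivative \<phi> (at x) v = 0"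
proof -
  have 1: "smooth \<phi>" and c: "compact (closure {x. \<phi> x \<noteq> 0})" and 2: "closure {x. \<phi> x \<noteq> 0} \<subseteq> \<Omega>"
    using assms unfolding test_fun_def mem_Collect_eq by iprover+
  have 0: "\<phi> y = 0" if "y \<notin> closure {x. \<phi> x \<noteq> 0}" for y
  proof (rule ccontr)
    assume "\<phi> y \<noteq> 0"
    then have "y \<in> {x. \<phi> x \<noteq> 0}" by (rule CollectI)
    from subsetD[OF closure_subset this] that show False by contradiction
  qed
  have D0: "frechet_derivative \<phi> (at y) = (\<lambda>v. 0)" if y: "y \<notin> closure {x. \<phi> x \<noteq> 0}" for y
  proof -
    have "((\<lambda>x. 0) has_derivative frechet_derivative \<phi> (at y)) (at y)"
    proof (rule has_derivative_transform_within_open[OF smooth_has_derivative[OF 1]])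
      show "open (- closure {x. \<phi> x \<noteq> 0})" by (rule open_Compl[OF closed_closure])
      show "y \<in> - closure {x. \<phi> x \<noteq> 0}" using y by (simp only: Compl_iff not_False_eq_True)
      show "\<phi> z = 0" if "z \<in> - closure {x. \<phi> x \<noteq> 0}" for z using 0 that by (meson ComplD)
    qed
    then show ?thesis by (rule has_derivative_unique[OF _ has_derivative_const])
  qed
  have 3: "tgrad \<phi> y = 0" if "y \<notin> closure {x. \<phi> x \<noteq> 0}" for y
    unfolding tgrad_def D0[OF that] by simp
  have 4: "y \<notin> closure {x. \<phi> x \<noteq> 0}" if "y \<notin> \<Omega>" for y by (rule contra_subsetD[OF 2 that])
  show "smooth \<phi>" "compact (closure {x. \<phi> x \<noteq> 0})" "closure {x. \<phi> x \<noteq> 0} \<subseteq> \<Omega>" by fact+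
  show "x \<notin> closure {x. \<phi> x \<noteq> 0} \<Longrightarrow> \<phi> x = 0" by (rule 0)
  show "x \<notin> closure {x. \<phi> x \<noteq> 0} \<Longrightarrow> tgrad \<phi> x = 0" by (rule 3)
  show "x \<notin> \<Omega> \<Longrightarrow> \<phi> x = 0" by (rule 0[OF 4])
  show "x \<notin> \<Omega> \<Longrightarrow> tgrad \<phi> x = 0" by (rule 3[OF 4])
  show "frechet_derivative \<phi> (at x) v = 0" if "x \<notin> \<Omega>" unfolding D0[OF 4[OF that]] ..
qed

lemma test_fun_bounded:
  assumes "\<phi> \<in> test_fun \<Omega>"
  shows "\<exists>C. \<forall>x. \<bar>\<phi> x\<bar> \<le> C \<and> norm (tgrad \<phi> x) \<le> C"
proof -
  note t = test_funD[OF assms]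
  let ?K = "closure {x. \<phi> x \<noteq> 0}"
  have "compact (\<phi> ` ?K)"
    by (rule compact_continuous_image[OF continuous_on_subset[OF smooth_continuous[OF t(1)] subset_UNIV] t(2)])
  then obtain C1 where C1: "\<forall>x\<in>?K. norm (\<phi> x) \<le> C1"
    using compact_imp_bounded[of "\<phi> ` ?K"] unfolding bounded_iff by blast
  have "compact (tgrad \<phi> ` ?K)"
    by (rule compact_continuous_image[OF continuous_on_subset[OF tgrad_continuous[OF t(1)] subset_UNIV] t(2)])
  then obtain C2 where C2: "\<forall>x\<in>?K. norm (tgrad \<phi> x) \<le> C2"
    using compact_imp_bounded[of "tgrad \<phi> ` ?K"] unfolding bounded_iff by blast
  from C1 C2 have "\<bar>\<phi> x\<bar> \<le> max 0 (max C1 C2) \<and> norm (tgrad \<phi> x) \<le> max 0 (max C1 C2)" for x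
    using t(4,5)[of x] by (cases "x \<in> ?K") (auto simp: max.coboundedI1 max.coboundedI2)
  then show ?thesis by blast
qed

text \<open>By the product rule this is the vanishing of the integral of a partial derivative of the
  compactly supported product \<phi> \<psi>.\<close>

lemma test_fun_weak_grad:
  assumes \<Omega>: "open \<Omega>" and \<phi>: "\<phi> \<in> test_fun \<Omega>"
  shows "is_weak_grad \<Omega> \<phi> (tgrad \<phi>)"
  unfolding is_weak_grad_def
proof (intro ballI)
  fix \<psi> :: "'a \<Rightarrow> real" and b :: 'a assume \<psi>: "\<psi> \<in> test_fun \<Omega>" and b: "b \<in> Basis"
  note t = test_funD[OF \<phi>] and s = test_funD[OF \<psi>]
  let ?D = "\<lambda>x v. \<phi> x * frechet_derivative \<psi> (at x) v + frechet_derivative \<phi> (at x) v * \<psi> x"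
  have c: "continuous_on UNIV (\<lambda>x. \<phi> x * frechet_derivative \<psi> (at x) b)"
    "continuous_on UNIV (\<lambda>x. frechet_derivative \<phi> (at x) b * \<psi> x)"
    by (intro continuous_intros smooth_continuous smooth_frechet t s)+
  obtain R where R: "\<And>x. x \<in> closure {x. \<phi> x \<noteq> 0} \<Longrightarrow> norm x \<le> R"
    using compact_imp_bounded[OF t(2)] unfolding bounded_iff by blast
  have z: "(LINT x|lborel. ?D x b) = 0"
  proof (rule integral_partial_derivative_eq_0)
    show "((\<lambda>x. \<phi> x * \<psi> x) has_derivative ?D x) (at x)" for x
      by (intro has_derivative_mult smooth_has_derivative t s)
    show "continuous_on UNIV (\<lambda>x. ?D x b)" by (intro continuous_on_add c)
    show "\<phi> x * \<psi> x = 0" if "x \<notin> cball 0 R" for x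
    proof -
      have "x \<notin> closure {x. \<phi> x \<noteq> 0}" using R[of x] that by (meson mem_cball_0)
      from t(4)[OF this] show ?thesis by simp
    qed
  qed
  have i: "integrable lborel G" if G: "continuous_on UNIV G" "\<And>x. x \<notin> closure {x. \<phi> x \<noteq> 0} \<Longrightarrow> G x = 0" for G :: "'a \<Rightarrow> real"
  proof -
    define K where "K = closure {x. \<phi> x \<noteq> 0}"
    have "(\<lambda>x. indicator K x *\<^sub>R G x) = G" using G(2) unfolding K_def[symmetric]
      by (auto simp: indicator_def fun_eq_iff)
    moreover have "integrable lborel (\<lambda>x. indicator K x *\<^sub>R G x)"
      unfolding K_def by (rule borel_integrable_compact[OF t(2) continuous_on_subset[OF G(1) subset_UNIV]])
    ultimately show ?thesis by (simp only:)
  qed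
  have e: "frechet_derivative \<phi> (at x) b = tgrad \<phi> x \<bullet> b" for x by (rule tgrad_inner[OF smooth_differentiable[OF t(1)], symmetric])
  have i1: "integrable lborel (\<lambda>x. \<phi> x * frechet_derivative \<psi> (at x) b)"
    by (rule i[OF c(1)], drule t(4)) (simp only: mult_zero_left)
  have i2: "integrable lborel (\<lambda>x. frechet_derivative \<phi> (at x) b * \<psi> x)"
    by (rule i[OF c(2)], drule t(5)) (simp only: e inner_zero_left mult_zero_left)
  have "(LINT x|lborel. \<phi> x * frechet_derivative \<psi> (at x) b) + (LINT x|lborel. frechet_derivative \<phi> (at x) b * \<psi> x) = 0"
    using z unfolding Bochner_Integration.integral_add[OF i1 i2] .
  moreover have "(LINT x|lebesgue_on \<Omega>. \<phi> x * frechet_derivative \<psi> (at x) b) = (LINT x|lborel. \<phi> x * frechet_derivative \<psi> (at x) b)"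
    by (rule lebesgue_on_integral_eq_lborel[OF borel_measurable_continuous_onI[OF c(1)] \<Omega>]) (simp add: t(6))
  moreover have "(LINT x|lebesgue_on \<Omega>. frechet_derivative \<phi> (at x) b * \<psi> x) = (LINT x|lborel. frechet_derivative \<phi> (at x) b * \<psi> x)"
    by (rule lebesgue_on_integral_eq_lborel[OF borel_measurable_continuous_onI[OF c(2)] \<Omega>]) (simp add: t(8))
  ultimately show "(LINT x|lebesgue_on \<Omega>. \<phi> x * frechet_derivative \<psi> (at x) b) =
             - (LINT x|lebesgue_on \<Omega>. tgrad \<phi> x \<bullet> b * \<psi> x)"
    by (simp add: e)
qed

lemma L2_bounded:
  fixes f :: "'a::euclidean_space \<Rightarrow> 'b::euclidean_space"
  assumes "open \<Omega>" "bounded \<Omega>" "f \<in> borel_measurable (lebesgue_on \<Omega>)" "\<And>x. norm (f x) \<le> C"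
  shows "f \<in> Lspace 2 \<Omega>"
proof -
  interpret finite_measure "lebesgue_on \<Omega>" by (rule finite_measure_lebesgue_on[OF lmeasurable_open[OF assms(2,1)]])
  have [measurable]: "f \<in> borel_measurable (lebesgue_on \<Omega>)" by fact
  have "integrable (lebesgue_on \<Omega>) (\<lambda>x. (norm (f x))\<^sup>2)"
    by (rule integrable_const_bound[where B = "C\<^sup>2"]) (use assms(4) in \<open>auto intro!: power_mono\<close>)
  then show ?thesis using assms(3) by (simp add: Lspace_2_iff)
qed

lemma continuous_measurable_lebesgue_on:
  fixes f :: "'a::euclidean_space \<Rightarrow> 'b::euclidean_space"
  assumes "continuous_on UNIV f" shows "f \<in> borel_measurable (lebesgue_on \<Omega>)"
proof (rule measurable_restrict_space1)
  have "f \<in> borel_measurable lborel" using borel_measurable_continuous_onI[OF assms] by simp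
  then show "f \<in> borel_measurable lebesgue" by (rule measurable_completion)
qed

lemma test_fun_L2:
  assumes "open \<Omega>" "bounded \<Omega>" "\<phi> \<in> test_fun \<Omega>"
  shows "\<phi> \<in> Lspace 2 \<Omega>" "tgrad \<phi> \<in> Lspace 2 \<Omega>"
proof -
  obtain C where C: "\<And>x. \<bar>\<phi> x\<bar> \<le> C" "\<And>x. norm (tgrad \<phi> x) \<le> C" using test_fun_bounded[OF assms(3)] by auto
  have "continuous_on UNIV \<phi>" "continuous_on UNIV (tgrad \<phi>)"
    using test_funD(1)[OF assms(3)] smooth_continuous tgrad_continuous by auto
  then show "\<phi> \<in> Lspace 2 \<Omega>" "tgrad \<phi> \<in> Lspace 2 \<Omega>"
    using C by (auto intro!: L2_bounded[OF assms(1,2)] continuous_measurable_lebesgue_on)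
qed

section \<open>Uniqueness of weak gradients\<close>

lemma nn_integral_pos_eq_neg:
  fixes f :: "'a \<Rightarrow> real"
  assumes f: "integrable M f" and z: "integral\<^sup>L M f = 0"
  shows "(\<integral>\<^sup>+x. ennreal (f x) \<partial>M) = (\<integral>\<^sup>+x. ennreal (- f x) \<partial>M)"
proof -
  have fin: "(\<integral>\<^sup>+x. ennreal (f x) \<partial>M) \<noteq> \<infinity>" "(\<integral>\<^sup>+x. ennreal (- f x) \<partial>M) \<noteq> \<infinity>"
    using f by (auto simp: real_integrable_def)
  have "enn2real (\<integral>\<^sup>+x. ennreal (f x) \<partial>M) = enn2real (\<integral>\<^sup>+x. ennreal (- f x) \<partial>M)"
    using z unfolding real_lebesgue_integral_def[OF f] by simp
  then show ?thesis using fin by (metis ennreal_enn2real infinity_ennreal_def less_top)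
qed

text \<open>The positive and negative parts of \<open>F\<close>, cut off to the box, are densities
  of two finite measures. Boxes are stable under intersection and generate the Borel sets, so the
  measures coincide once they agree on boxes, and then the two densities agree almost everywhere,
  which forces both to vanish.\<close>

lemma AE_zero_on_box:
  fixes F :: "'a::euclidean_space \<Rightarrow> real"
  assumes F: "integrable lborel F"
    and z: "\<And>c d. box c d \<subseteq> box a b \<Longrightarrow> (LINT x|lborel. indicator (box c d) x * F x) = 0"
  shows "AE x in lborel. x \<in> box a b \<longrightarrow> F x = 0"
proof -
  have [measurable]: "F \<in> borel_measurable borel" using borel_measurable_integrable[OF F] by simp
  define P N where "P = density lborel (\<lambda>x. ennreal (indicator (box a b) x * F x))"
    and "N = density lborel (\<lambda>x. ennreal (- (indicator (box a b) x * F x)))"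
  let ?E = "range (\<lambda>(a, b). box a b :: 'a set)"
  have emP: "emeasure P X = (\<integral>\<^sup>+x. ennreal (indicator (box a b \<inter> X) x * F x) \<partial>lborel)"
    if [measurable]: "X \<in> sets borel" for X
    unfolding P_def by (subst emeasure_density) (auto intro!: nn_integral_cong simp: indicator_def)
  have emN: "emeasure N X = (\<integral>\<^sup>+x. ennreal (- (indicator (box a b \<inter> X) x * F x)) \<partial>lborel)"
    if [measurable]: "X \<in> sets borel" for X
    unfolding N_def by (subst emeasure_density) (auto intro!: nn_integral_cong simp: indicator_def)
  have int: "integrable lborel (\<lambda>x. indicator X x * F x)" if "X \<in> sets borel" for X
    using integrable_mult_indicator[OF _ F, of X] that by simp
  have eq: "emeasure P X = emeasure N X" if "X \<in> ?E" for X
  proof -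
    from that obtain c d where X: "X = box c d" by auto
    obtain c' d' where cd: "box a b \<inter> X = box c' d'" unfolding X box_Int_box by blast
    have "box c' d' \<subseteq> box a b" using cd by blast
    from z[OF this] show ?thesis
      unfolding emP[of X, unfolded X, OF borel_open[OF open_box], folded X] emN[of X, unfolded X, OF borel_open[OF open_box], folded X] cd
      by (intro nn_integral_pos_eq_neg int) auto
  qed
  have "P = N"
  proof (rule measure_eqI_generator_eq[where E = ?E and \<Omega> = UNIV and A = "\<lambda>i::nat. box (- (real i *\<^sub>R One)) (real i *\<^sub>R One)"])
    show "Int_stable ?E" by (auto simp: Int_stable_def box_Int_box)
    show "sets P = sigma_sets UNIV ?E" "sets N = sigma_sets UNIV ?E"
      by (simp_all add: P_def N_def borel_eq_box)
    show "range (\<lambda>i::nat. box (- (real i *\<^sub>R One)) (real i *\<^sub>R One)) \<subseteq> ?E" by auto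
    show "(\<Union>i::nat. box (- (real i *\<^sub>R One)) (real i *\<^sub>R One)) = (UNIV :: 'a set)" by (rule UN_box_eq_UNIV)
    show "emeasure P (box (- (real i *\<^sub>R One)) (real i *\<^sub>R One)) \<noteq> \<infinity>" for i :: nat
      unfolding emP[OF borel_open[OF open_box]]
      using int[of "box a b \<inter> box (- (real i *\<^sub>R One)) (real i *\<^sub>R One)"] by (auto simp: real_integrable_def)
  qed (use eq in auto)
  then have "AE x in lborel. ennreal (indicator (box a b) x * F x) = ennreal (- (indicator (box a b) x * F x))"
    unfolding P_def N_def by (subst (asm) sigma_finite_measure.density_unique_iff[OF sigma_finite_lborel]) simp_all
  then show ?thesis
  proof eventually_elim
    case (elim x)
    show ?case
    proof
      assume "x \<in> box a b"
      with elim have e: "ennreal (F x) = ennreal (- F x)" by simp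
      show "F x = 0"
      proof (cases "F x \<ge> 0")
        case True
        then have "ennreal (- F x) = 0" by (simp add: ennreal_eq_0_iff)
        with e True show ?thesis by (simp add: ennreal_eq_0_iff)
      next
        case False
        then have "ennreal (F x) = 0" by (simp add: ennreal_eq_0_iff)
        with e[symmetric] False show ?thesis by (simp add: ennreal_eq_0_iff)
      qed
    qed
  qed
qed

text \<open>A Borel representative of \<open>F\<close> brings the question to \<open>lborel\<close>;
  an open set is a countable union of closed boxes, and on each of them
  \<open>AE_zero_on_box\<close> applies up to the negligible boundary.\<close>

lemma AE_zero_of_box_integrals:
  fixes F :: "'a::euclidean_space \<Rightarrow> real"
  assumes \<Omega>: "open \<Omega>" and F: "integrable (lebesgue_on \<Omega>) F"
    and z: "\<And>a b. cbox a b \<subseteq> \<Omega> \<Longrightarrow> (LINT x|lebesgue_on \<Omega>. indicator (box a b) x * F x) = 0"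
  shows "AE x in lebesgue_on \<Omega>. F x = 0"
proof -
  have \<Omega>m: "\<Omega> \<inter> space lebesgue \<in> sets lebesgue" using \<Omega> by simp
  define F0 where "F0 x = indicator \<Omega> x *\<^sub>R F x" for x
  have F0: "integrable lebesgue F0" using F unfolding integrable_restrict_space[OF \<Omega>m] F0_def .
  obtain F1 where [measurable]: "F1 \<in> borel_measurable lborel" and F1: "AE x in lborel. F0 x = F1 x"
    using completion_ex_borel_measurable_real[OF borel_measurable_integrable[OF F0]] by blast
  have F1c: "F1 \<in> borel_measurable lebesgue" by (rule measurable_completion) simp
  have F1': "AE x in lebesgue. F0 x = F1 x" by (rule AE_completion[OF F1])
  have "integrable lebesgue F1"
    using integrable_cong_AE[OF borel_measurable_integrable[OF F0] F1c F1'] F0 by simp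
  then have F1i: "integrable lborel F1" by (subst (asm) integrable_completion) simp_all
  have box: "(LINT x|lborel. indicator (box a b) x * F1 x) = 0" if ab: "cbox a b \<subseteq> \<Omega>" for a b
  proof -
    have "(LINT x|lborel. indicator (box a b) x * F1 x) = (LINT x|lebesgue. indicator (box a b) x * F1 x)"
      by (rule integral_completion[symmetric]) simp
    also have "\<dots> = (LINT x|lebesgue. indicator \<Omega> x *\<^sub>R (indicator (box a b) x * F x))"
    proof (rule integral_cong_AE)
      show "AE x in lebesgue. indicator (box a b) x * F1 x = indicator \<Omega> x *\<^sub>R (indicator (box a b) x * F x)"
        using F1' by eventually_elim (auto simp: F0_def indicator_def)
      have [measurable]: "box a b \<in> sets lebesgue" by simp
      show "(\<lambda>x. indicator (box a b) x * F1 x) \<in> borel_measurable lebesgue"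
        using F1c by measurable
      have "(\<lambda>x. indicator (box a b) x * F0 x) \<in> borel_measurable lebesgue"
        using borel_measurable_integrable[OF F0] by measurable
      moreover have "(\<lambda>x. indicator (box a b) x * F0 x) = (\<lambda>x. indicator \<Omega> x *\<^sub>R (indicator (box a b) x * F x))"
        by (auto simp: F0_def fun_eq_iff)
      ultimately show "(\<lambda>x. indicator \<Omega> x *\<^sub>R (indicator (box a b) x * F x)) \<in> borel_measurable lebesgue"
        by (simp only:)
    qed
    also have "\<dots> = 0" using z[OF ab] unfolding integral_restrict_space[OF \<Omega>m] .
    finally show ?thesis .
  qed
  have zero: "AE x in lebesgue. x \<in> cbox a b \<longrightarrow> F1 x = 0" if ab: "cbox a b \<subseteq> \<Omega>" for a b
  proof -
    have "AE x in lborel. x \<in> box a b \<longrightarrow> F1 x = 0"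
    proof (rule AE_zero_on_box[OF F1i])
      fix c d assume cd: "box c d \<subseteq> box a b"
      show "(LINT x|lborel. indicator (box c d) x * F1 x) = 0"
      proof (cases "box c d = {}")
        case False
        \<comment> \<open>The integral hypothesis needs a closed box inside \<Omega>, while only an
          inclusion of open boxes is known. For a nonempty open box the inclusion passes to
          closures.\<close>
        have "cbox c d = closure (box c d)" using closure_box[OF False] by simp
        also have "\<dots> \<subseteq> cbox a b" using cd box_subset_cbox[of a b] by (intro closure_minimal) auto
        finally show ?thesis using ab by (intro box) auto
      qed simp
    qed
    then have 1: "AE x in lebesgue. x \<in> box a b \<longrightarrow> F1 x = 0" by (rule AE_completion)
    have "AE x in lebesgue. x \<notin> cbox a b - box a b"
      using negligible_frontier_interval[of a b] by (intro AE_not_in) (simp add: negligible_iff_null_sets)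
    with 1 show ?thesis by eventually_elim blast
  qed
  obtain \<D> where \<D>: "countable \<D>" "\<And>X. X \<in> \<D> \<Longrightarrow> X \<subseteq> \<Omega>" "\<And>X. X \<in> \<D> \<Longrightarrow> \<exists>a b. X = cbox a b" "\<Union>\<D> = \<Omega>"
    by (rule open_countable_Union_open_cbox[OF \<Omega>]) blast
  have "AE x in lebesgue. \<forall>X\<in>\<D>. x \<in> X \<longrightarrow> F1 x = 0"
    unfolding AE_ball_countable[OF \<D>(1)]
  proof
    fix X assume X: "X \<in> \<D>"
    then obtain a b where "X = cbox a b" using \<D>(3) by blast
    with zero[of a b] \<D>(2)[OF X] show "AE x in lebesgue. x \<in> X \<longrightarrow> F1 x = 0" by simp
  qed
  with F1' have "AE x in lebesgue. x \<in> \<Omega> \<longrightarrow> F x = 0"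
  proof eventually_elim
    case (elim x)
    then show ?case using \<D>(4) unfolding F0_def by (auto simp: indicator_def)
  qed
  then show ?thesis unfolding AE_restrict_space_iff[OF \<Omega>m] .
qed

section \<open>Weak gradients and the space H10 over a bounded open set\<close>

locale bounded_open =
  fixes \<Omega> :: "'a::euclidean_space set"
  assumes open_\<Omega>: "open \<Omega>" and bounded_\<Omega>: "bounded \<Omega>"
begin

abbreviation "M \<equiv> lebesgue_on \<Omega>"

sublocale finite_measure "lebesgue_on \<Omega>"
  by (rule finite_measure_lebesgue_on[OF lmeasurable_open[OF bounded_\<Omega> open_\<Omega>]])

lemma L2_const: "(\<lambda>x. c) \<in> Lspace 2 \<Omega>"
  by (rule L2_bounded[OF open_\<Omega> bounded_\<Omega>, of _ "norm c"]) auto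

lemma L2_test_vec:
  fixes b :: 'a
  assumes \<phi>: "\<phi> \<in> test_fun \<Omega>"
  shows "(\<lambda>x. \<phi> x *\<^sub>R b) \<in> Lspace 2 \<Omega>" "(\<lambda>x. frechet_derivative \<phi> (at x) b) \<in> Lspace 2 \<Omega>"
proof -
  obtain C where C: "\<And>x. \<bar>\<phi> x\<bar> \<le> C" "\<And>x. norm (tgrad \<phi> x) \<le> C" using test_fun_bounded[OF \<phi>] by auto
  note s = test_funD(1)[OF \<phi>]
  show "(\<lambda>x. \<phi> x *\<^sub>R b) \<in> Lspace 2 \<Omega>"
    using C by (intro L2_bounded[OF open_\<Omega> bounded_\<Omega>, where C = "C * norm b"] continuous_measurable_lebesgue_on
       continuous_intros smooth_continuous s) (simp add: mult_right_mono)
  have "\<bar>frechet_derivative \<phi> (at x) b\<bar> \<le> C * norm b" for x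
  proof -
    have "\<bar>tgrad \<phi> x \<bullet> b\<bar> \<le> norm (tgrad \<phi> x) * norm b" by (rule Cauchy_Schwarz_ineq2)
    also have "\<dots> \<le> C * norm b" using C(2)[of x] by (simp add: mult_right_mono)
    finally show ?thesis unfolding tgrad_inner[OF smooth_differentiable[OF s]] .
  qed
  then show "(\<lambda>x. frechet_derivative \<phi> (at x) b) \<in> Lspace 2 \<Omega>"
    by (intro L2_bounded[OF open_\<Omega> bounded_\<Omega>, where C = "C * norm b"] continuous_measurable_lebesgue_on
       smooth_continuous smooth_frechet s) simp
qed

lemma weak_grad_integrable:
  assumes "f \<in> Lspace 2 \<Omega>" "G \<in> Lspace 2 \<Omega>" and \<phi>: "\<phi> \<in> test_fun \<Omega>"
  shows "integrable M (\<lambda>x. f x * frechet_derivative \<phi> (at x) b)" "integrable M (\<lambda>x. (G x \<bullet> b) * \<phi> x)"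
  using L2_integrable_inner[OF assms(1) L2_test_vec(2)[OF \<phi>, of b]]
    L2_integrable_inner[OF assms(2) L2_test_vec(1)[OF \<phi>, of b]] by (simp_all add: mult.commute)

text \<open>Each component of the difference is orthogonal to all test functions, in particular to
  bumps; letting these increase to the indicator of a box shows that all its integrals over boxes
  vanish.\<close>

lemma weak_grad_unique:
  assumes f: "f \<in> Lspace 2 \<Omega>" and G: "G \<in> Lspace 2 \<Omega>" "is_weak_grad \<Omega> f G"
    and H: "H \<in> Lspace 2 \<Omega>" "is_weak_grad \<Omega> f H"
  shows "AE x in M. G x = H x"
proof -
  have "AE x in M. (G x - H x) \<bullet> b = 0" if b: "b \<in> Basis" for b
  proof (rule AE_zero_of_box_integrals[OF open_\<Omega>])
    show i: "integrable M (\<lambda>x. (G x - H x) \<bullet> b)" by (rule L2_integrable_inner[OF L2_diff[OF G(1) H(1)] L2_const])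
    have test: "(LINT x|M. \<phi> x * ((G x - H x) \<bullet> b)) = 0" if \<phi>: "\<phi> \<in> test_fun \<Omega>" for \<phi>
    proof -
      have "- (LINT x|M. (G x \<bullet> b) * \<phi> x) = - (LINT x|M. (H x \<bullet> b) * \<phi> x)"
        using G(2)[unfolded is_weak_grad_def, rule_format, OF \<phi> b]
          H(2)[unfolded is_weak_grad_def, rule_format, OF \<phi> b] by (rule trans[OF sym])
      then have "(LINT x|M. (G x \<bullet> b) * \<phi> x - (H x \<bullet> b) * \<phi> x) = 0"
        using weak_grad_integrable(2)[OF f G(1) \<phi>, of b] weak_grad_integrable(2)[OF f H(1) \<phi>, of b] by simp
      then show ?thesis by (simp add: inner_diff_left algebra_simps)
    qed
    fix a c :: 'a assume ac: "cbox a c \<subseteq> \<Omega>"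
    have [measurable]: "(\<lambda>x. (G x - H x) \<bullet> b) \<in> borel_measurable M" using i by (rule borel_measurable_integrable)
    have "(\<lambda>n. LINT x|M. bump (1 / real (Suc n)) a c x * ((G x - H x) \<bullet> b)) \<longlonglongrightarrow> (LINT x|M. indicator (box a c) x * ((G x - H x) \<bullet> b))"
    proof (rule integral_dominated_convergence[where w = "\<lambda>x. \<bar>(G x - H x) \<bullet> b\<bar>"])
      have m: "bump (1 / real (Suc n)) a c \<in> borel_measurable M" for n
        by (intro continuous_measurable_lebesgue_on smooth_continuous bump_smooth) simp
      show "(\<lambda>x. bump (1 / real (Suc n)) a c x * ((G x - H x) \<bullet> b)) \<in> borel_measurable M" for n
        using m[of n] by measurable
      have "(indicator (box a c) :: 'a \<Rightarrow> real) \<in> borel_measurable lborel" by measurable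
      then have [measurable]: "(indicator (box a c) :: 'a \<Rightarrow> real) \<in> borel_measurable M"
        by (intro measurable_restrict_space1 measurable_completion)
      show "(\<lambda>x. indicator (box a c) x * ((G x - H x) \<bullet> b)) \<in> borel_measurable M" by measurable
      show "integrable M (\<lambda>x. \<bar>(G x - H x) \<bullet> b\<bar>)" using i by simp
      show "AE x in M. (\<lambda>n. bump (1 / real (Suc n)) a c x * ((G x - H x) \<bullet> b)) \<longlonglongrightarrow> indicator (box a c) x * ((G x - H x) \<bullet> b)"
        by (intro AE_I2 tendsto_mult bump_limit tendsto_const)
      have "\<bar>bump (1 / real (Suc n)) a c x\<bar> \<le> 1" for n x
        using bump_bounds[of "1 / real (Suc n)" a c x] by simp
      then show "AE x in M. norm (bump (1 / real (Suc n)) a c x * ((G x - H x) \<bullet> b)) \<le> \<bar>(G x - H x) \<bullet> b\<bar>" for n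
        by (intro AE_I2) (simp add: abs_mult mult_left_le_one_le)
    qed
    moreover have "(LINT x|M. bump (1 / real (Suc n)) a c x * ((G x - H x) \<bullet> b)) = 0" for n
      by (rule test[OF bump_test_fun[OF _ ac]]) simp
    ultimately show "(LINT x|M. indicator (box a c) x * ((G x - H x) \<bullet> b)) = 0"
      by (simp only: LIMSEQ_const_iff)
  qed
  then have "AE x in M. \<forall>b\<in>Basis. (G x - H x) \<bullet> b = 0" by (simp add: AE_ball_countable countable_finite)
  then show ?thesis
    by eventually_elim (auto simp: inner_diff_left intro: euclidean_eqI)
qed

lemma wgrad:
  assumes "f \<in> H1 \<Omega>"
  shows "wgrad \<Omega> f \<in> Lspace 2 \<Omega>" "is_weak_grad \<Omega> f (wgrad \<Omega> f)"
proof -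
  have "\<exists>G. G \<in> Lspace 2 \<Omega> \<and> is_weak_grad \<Omega> f G" using assms by (auto simp: H1_def)
  from someI_ex[OF this] show "wgrad \<Omega> f \<in> Lspace 2 \<Omega>" "is_weak_grad \<Omega> f (wgrad \<Omega> f)"
    by (simp_all add: wgrad_def)
qed

lemma H1_L2: "f \<in> H1 \<Omega> \<Longrightarrow> f \<in> Lspace 2 \<Omega>" by (simp add: H1_def)

lemma H10_H1: "f \<in> H10 \<Omega> \<Longrightarrow> f \<in> H1 \<Omega>" by (simp add: H10_def)

lemma H10_L2: "f \<in> H10 \<Omega> \<Longrightarrow> f \<in> Lspace 2 \<Omega>" by (simp add: H10_def H1_def)

lemma weak_grad_diff:
  assumes f: "f \<in> Lspace 2 \<Omega>" "G \<in> Lspace 2 \<Omega>" "is_weak_grad \<Omega> f G"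
    and h: "h \<in> Lspace 2 \<Omega>" "H \<in> Lspace 2 \<Omega>" "is_weak_grad \<Omega> h H"
  shows "is_weak_grad \<Omega> (\<lambda>x. f x - h x) (\<lambda>x. G x - H x)"
  unfolding is_weak_grad_def
proof (intro ballI)
  fix \<phi> b assume \<phi>: "\<phi> \<in> test_fun \<Omega>" and b: "b \<in> (Basis :: 'a set)"
  have "(LINT x|M. f x * frechet_derivative \<phi> (at x) b) - (LINT x|M. h x * frechet_derivative \<phi> (at x) b)
     = - ((LINT x|M. (G x \<bullet> b) * \<phi> x) - (LINT x|M. (H x \<bullet> b) * \<phi> x))"
    using f(3) h(3) \<phi> b unfolding is_weak_grad_def by simp
  then show "(LINT x|M. (f x - h x) * frechet_derivative \<phi> (at x) b) = - (LINT x|M. (G x - H x) \<bullet> b * \<phi> x)"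
    using weak_grad_integrable[OF f(1,2) \<phi>, of b] weak_grad_integrable[OF h(1,2) \<phi>, of b]
    by (simp add: left_diff_distrib inner_diff_left)
qed

lemma H1_diff:
  assumes f: "f \<in> H1 \<Omega>" and h: "h \<in> H1 \<Omega>"
  shows "(\<lambda>x. f x - h x) \<in> H1 \<Omega>"
proof -
  have "is_weak_grad \<Omega> (\<lambda>x. f x - h x) (\<lambda>x. wgrad \<Omega> f x - wgrad \<Omega> h x)"
    by (intro weak_grad_diff H1_L2 wgrad f h)
  moreover have "(\<lambda>x. wgrad \<Omega> f x - wgrad \<Omega> h x) \<in> Lspace 2 \<Omega>" "(\<lambda>x. f x - h x) \<in> Lspace 2 \<Omega>"
    by (intro L2_diff wgrad H1_L2 f h)+
  ultimately show ?thesis unfolding H1_def by blast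
qed

lemma wgrad_eqI:
  assumes "f \<in> Lspace 2 \<Omega>" "G \<in> Lspace 2 \<Omega>" "is_weak_grad \<Omega> f G"
  shows "AE x in M. wgrad \<Omega> f x = G x"
proof -
  have "f \<in> H1 \<Omega>" using assms by (auto simp: H1_def)
  from wgrad[OF this] show ?thesis by (intro weak_grad_unique[OF assms(1)] assms)
qed

lemma wgrad_diff:
  assumes f: "f \<in> H1 \<Omega>" and h: "h \<in> H1 \<Omega>"
  shows "AE x in M. wgrad \<Omega> (\<lambda>x. f x - h x) x = wgrad \<Omega> f x - wgrad \<Omega> h x"
  by (intro wgrad_eqI weak_grad_diff L2_diff wgrad H1_L2 f h)

lemma Lnorm_wgrad_diff:
  assumes f: "f \<in> H1 \<Omega>" and h: "h \<in> H1 \<Omega>"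
  shows "Lnorm 2 \<Omega> (wgrad \<Omega> (\<lambda>x. f x - h x)) = Lnorm 2 \<Omega> (\<lambda>x. wgrad \<Omega> f x - wgrad \<Omega> h x)"
  by (intro Lnorm_cong_AE wgrad_diff f h Lspace_2_measurable L2_diff wgrad H1_diff)

text \<open>An equality of functions, not merely almost everywhere: \<open>is_weak_grad\<close> sees
  \<open>f\<close> only through integrals, so both sides are the same choice from the same
  predicate. It identifies the gradient of \<open>u 0\<close> with that of
  \<open>u0\<close>.\<close>

lemma wgrad_cong_AE:
  assumes "AE x in M. f x = h x" and f: "f \<in> Lspace 2 \<Omega>" and h: "h \<in> Lspace 2 \<Omega>"
  shows "wgrad \<Omega> f = wgrad \<Omega> h"
proof -
  have "(LINT x|M. f x * frechet_derivative \<phi> (at x) b) = (LINT x|M. h x * frechet_derivative \<phi> (at x) b)"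
    if \<phi>: "\<phi> \<in> test_fun \<Omega>" for \<phi> b
  proof (rule integral_cong_AE)
    have [measurable]: "f \<in> borel_measurable M" "h \<in> borel_measurable M" "(\<lambda>x. frechet_derivative \<phi> (at x) b) \<in> borel_measurable M"
      by (intro Lspace_2_measurable f h L2_test_vec(2) \<phi>)+
    show "(\<lambda>x. f x * frechet_derivative \<phi> (at x) b) \<in> borel_measurable M"
      "(\<lambda>x. h x * frechet_derivative \<phi> (at x) b) \<in> borel_measurable M" by measurable
    show "AE x in M. f x * frechet_derivative \<phi> (at x) b = h x * frechet_derivative \<phi> (at x) b"
      using assms(1) by eventually_elim simp
  qed
  then have "is_weak_grad \<Omega> f = is_weak_grad \<Omega> h" unfolding is_weak_grad_def fun_eq_iff by simp
  then show ?thesis by (simp add: wgrad_def)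
qed

lemma test_fun_H1:
  assumes \<phi>: "\<phi> \<in> test_fun \<Omega>"
  shows "\<phi> \<in> H1 \<Omega>" "AE x in M. wgrad \<Omega> \<phi> x = tgrad \<phi> x"
proof -
  note t = test_fun_L2[OF open_\<Omega> bounded_\<Omega> \<phi>] test_fun_weak_grad[OF open_\<Omega> \<phi>]
  show "\<phi> \<in> H1 \<Omega>" using t by (auto simp: H1_def)
  show "AE x in M. wgrad \<Omega> \<phi> x = tgrad \<phi> x" by (rule wgrad_eqI[OF t])
qed

lemma H1norm_bounds: "Lnorm 2 \<Omega> f \<le> H1norm \<Omega> f" "Lnorm 2 \<Omega> (wgrad \<Omega> f) \<le> H1norm \<Omega> f"
  "H1norm \<Omega> f \<le> Lnorm 2 \<Omega> f + Lnorm 2 \<Omega> (wgrad \<Omega> f)"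
  unfolding H1norm_def by (simp_all add: real_le_rsqrt sqrt_sum_squares_le_sum Lnorm_nonneg)

lemma test_fun_diff:
  assumes \<phi>: "\<phi> \<in> test_fun \<Omega>" and \<psi>: "\<psi> \<in> test_fun \<Omega>"
  shows "(\<lambda>x. \<phi> x - \<psi> x) \<in> test_fun \<Omega>"
proof -
  note t = test_funD(1-3)[OF \<phi>] and s = test_funD(1-3)[OF \<psi>]
  have sub: "closure {x. \<phi> x - \<psi> x \<noteq> 0} \<subseteq> closure {x. \<phi> x \<noteq> 0} \<union> closure {x. \<psi> x \<noteq> 0}"
    unfolding closure_Un[symmetric] by (rule closure_mono) auto
  have "compact (closure {x. \<phi> x - \<psi> x \<noteq> 0})"
    using compact_Int_closed[OF compact_Un[OF t(2) s(2)] closed_closure[of "{x. \<phi> x - \<psi> x \<noteq> 0}"]]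
    unfolding Int_absorb1[OF sub] .
  then show ?thesis using sub t(1,3) s(1,3) unfolding test_fun_def by (auto intro: smooth_diff)
qed

lemma H10_diff:
  assumes f: "f \<in> H10 \<Omega>" and h: "h \<in> H10 \<Omega>"
  shows "(\<lambda>x. f x - h x) \<in> H10 \<Omega>"
proof -
  note f1 = H10_H1[OF f] and h1 = H10_H1[OF h]
  have "\<exists>\<phi>\<in>test_fun \<Omega>. H1norm \<Omega> (\<lambda>x. f x - h x - \<phi> x) < e" if e: "e > 0" for e
  proof -
    \<comment> \<open>The triangle inequality is applied to the two L2 norms inside
      \<open>H1norm\<close> separately, which counts each of the two errors twice; hence a quarter
      of \<open>e\<close> for each.\<close>
    obtain \<phi> where \<phi>: "\<phi> \<in> test_fun \<Omega>" "H1norm \<Omega> (\<lambda>x. f x - \<phi> x) < e / 4"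
      using f e by (auto simp: H10_def dest: spec[of _ "e / 4"])
    obtain \<psi> where \<psi>: "\<psi> \<in> test_fun \<Omega>" "H1norm \<Omega> (\<lambda>x. h x - \<psi> x) < e / 4"
      using h e by (auto simp: H10_def dest: spec[of _ "e / 4"])
    note \<phi>1 = test_fun_H1(1)[OF \<phi>(1)] and \<psi>1 = test_fun_H1(1)[OF \<psi>(1)]
    note d1 = H1_diff[OF f1 \<phi>1] and d2 = H1_diff[OF h1 \<psi>1]
    have eq: "(\<lambda>x. f x - h x - (\<phi> x - \<psi> x)) = (\<lambda>x. (f x - \<phi> x) - (h x - \<psi> x))" by auto
    have "H1norm \<Omega> (\<lambda>x. (f x - \<phi> x) - (h x - \<psi> x)) \<le>
       (Lnorm 2 \<Omega> (\<lambda>x. f x - \<phi> x) + Lnorm 2 \<Omega> (\<lambda>x. h x - \<psi> x))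
       + (Lnorm 2 \<Omega> (wgrad \<Omega> (\<lambda>x. f x - \<phi> x)) + Lnorm 2 \<Omega> (wgrad \<Omega> (\<lambda>x. h x - \<psi> x)))"
      by (rule order_trans[OF H1norm_bounds(3)], unfold Lnorm_wgrad_diff[OF d1 d2])
        (intro add_mono Lnorm_2_triangle H1_L2 wgrad d1 d2)
    also have "\<dots> \<le> 2 * H1norm \<Omega> (\<lambda>x. f x - \<phi> x) + 2 * H1norm \<Omega> (\<lambda>x. h x - \<psi> x)"
      using H1norm_bounds(1,2)[of "\<lambda>x. f x - \<phi> x"] H1norm_bounds(1,2)[of "\<lambda>x. h x - \<psi> x"] by linarith
    also have "\<dots> < e" using \<phi>(2) \<psi>(2) by linarith
    finally show ?thesis unfolding eq[symmetric] by (rule bexI[OF _ test_fun_diff[OF \<phi>(1) \<psi>(1)]])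
  qed
  then show ?thesis using H1_diff[OF f1 h1] by (simp add: H10_def)
qed

end

section \<open>Riesz potential estimates\<close>

lemma sigma_pair_lborel: "pair_sigma_finite (lborel :: 'a::euclidean_space measure) (lborel :: 'b::euclidean_space measure)"
  by (intro pair_sigma_finite.intro sigma_finite_lborel)

lemma nn_integral_lborel_scale:
  fixes g :: "'a::euclidean_space \<Rightarrow> ennreal"
  assumes [measurable]: "g \<in> borel_measurable borel" and c: "c > 0"
  shows "(\<integral>\<^sup>+w. g w \<partial>lborel) = ennreal (c ^ DIM('a)) * (\<integral>\<^sup>+z. g (c *\<^sub>R z) \<partial>lborel)"
proof -
  have "(\<integral>\<^sup>+w. g w \<partial>lborel) = (\<integral>\<^sup>+w. g w \<partial>density (distr lborel borel (\<lambda>x. 0 + c *\<^sub>R x)) (\<lambda>_. ennreal (\<bar>c\<bar> ^ DIM('a))))"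
    using lborel_affine[of c "0::'a"] c by simp
  also have "\<dots> = (\<integral>\<^sup>+z. ennreal (c ^ DIM('a)) * g (c *\<^sub>R z) \<partial>lborel)"
    using c by (subst nn_integral_density) (auto simp: nn_integral_distr)
  finally show ?thesis by (simp add: nn_integral_cmult)
qed

lemma nn_integral_lborel_translate:
  fixes g :: "'a::euclidean_space \<Rightarrow> ennreal"
  assumes [measurable]: "g \<in> borel_measurable borel"
  shows "(\<integral>\<^sup>+x. g (c + x) \<partial>lborel) = (\<integral>\<^sup>+x. g x \<partial>lborel)"
proof -
  have "(\<integral>\<^sup>+x. g x \<partial>lborel) = integral\<^sup>N (distr lborel borel ((+) c)) g" by (simp add: lborel_distr_plus)
  also have "\<dots> = (\<integral>\<^sup>+x. g (c + x) \<partial>lborel)" by (rule nn_integral_distr) measurable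
  finally show ?thesis by simp
qed

text \<open>Writing |w|^(-s) as the integral of s t^(-s-1) over t \<ge> |w| and exchanging the
  integrals reduces the claim to volumes of balls, so no polar coordinates are needed. The condition
  s < n gives convergence at t = 0, the condition s > 0 at infinity.\<close>

lemma singular_kernel_integrable:
  assumes s: "0 < s" "s < real DIM('a::euclidean_space)" and D: "D > 0"
  shows "(\<integral>\<^sup>+w. ennreal (norm (w::'a) powr (- s)) * indicator (ball 0 D) w \<partial>lborel) < \<infinity>"
proof -
  let ?n = "DIM('a)" and ?V = "unit_ball_vol (real DIM('a))"
  have V: "?V \<ge> 0" by simp
  have [measurable]: "(\<lambda>z. indicator (ball (0::'a) D) (snd z) :: ennreal) \<in> borel_measurable ((lborel :: real measure) \<Otimes>\<^sub>M lborel)"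
    "(\<lambda>z. indicator (ball (0::'a) D) (fst z) :: ennreal) \<in> borel_measurable (lborel \<Otimes>\<^sub>M (lborel :: real measure))"
    by (rule measurable_compose[OF measurable_snd borel_measurable_indicator[of _ lborel]]
        measurable_compose[OF measurable_fst borel_measurable_indicator[of _ lborel]], simp)+
  have "(\<integral>\<^sup>+w. ennreal (norm (w::'a) powr (- s)) * indicator (ball 0 D) w \<partial>lborel)
    \<le> (\<integral>\<^sup>+w. (\<integral>\<^sup>+t. ennreal (s * t powr (- s - 1)) * (indicator {t. norm w \<le> t} t * indicator (ball 0 D) w) \<partial>lborel) \<partial>(lborel :: 'a measure))"
  proof (rule nn_integral_mono)
    fix w :: 'a
    show "ennreal (norm w powr (- s)) * indicator (ball 0 D) w
       \<le> (\<integral>\<^sup>+t. ennreal (s * t powr (- s - 1)) * (indicator {t. norm w \<le> t} t * indicator (ball 0 D) w) \<partial>lborel)"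
    \<comment> \<open>At the singular point the convention \<open>0 powr _ = 0\<close> makes the
      left-hand side vanish.\<close>
    proof (cases "w = 0")
      case False
      then have "((\<lambda>t. s * t powr (- s - 1)) has_integral s * (- (norm w powr ((- s - 1) + 1)) / ((- s - 1) + 1))) {norm w..}"
        using s by (intro has_integral_mult_right has_integral_powr_to_inf) auto
      then have "((\<lambda>t. s * t powr (- s - 1)) has_integral (norm w powr (- s))) {norm w..}"
        using s by simp
      then have "(\<integral>\<^sup>+t. ennreal (s * t powr (- s - 1)) * indicator {norm w..} t \<partial>lborel) = ennreal (norm w powr (- s))"
        using s by (intro nn_integral_has_integral_lebesgue') auto
      then have "ennreal (norm w powr (- s)) * indicator (ball 0 D) w
        = (\<integral>\<^sup>+t. ennreal (s * t powr (- s - 1)) * indicator {norm w..} t * indicator (ball 0 D) w \<partial>lborel)"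
        by (simp add: nn_integral_multc)
      also have "\<dots> = (\<integral>\<^sup>+t. ennreal (s * t powr (- s - 1)) * (indicator {t. norm w \<le> t} t * indicator (ball 0 D) w) \<partial>lborel)"
        by (intro nn_integral_cong) (auto simp: indicator_def)
      finally show ?thesis by simp
    qed simp
  qed
  also have "\<dots> = (\<integral>\<^sup>+t. (\<integral>\<^sup>+w. ennreal (s * t powr (- s - 1)) * (indicator {t. norm w \<le> t} t * indicator (ball 0 D) w) \<partial>(lborel :: 'a measure)) \<partial>lborel)"
    by (rule pair_sigma_finite.Fubini'[OF sigma_pair_lborel]) measurable
  also have "\<dots> \<le> (\<integral>\<^sup>+t. ennreal (s * ?V * t powr (?n - s - 1)) * indicator {0..D} t + ennreal (s * ?V * D ^ ?n * t powr (- s - 1)) * indicator {D..} t \<partial>lborel)"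
  proof (rule nn_integral_mono)
    fix t :: real
    have "(\<integral>\<^sup>+w. ennreal (s * t powr (- s - 1)) * (indicator {t. norm w \<le> t} t * indicator (ball 0 D) w) \<partial>(lborel :: 'a measure))
      = (\<integral>\<^sup>+w. ennreal (s * t powr (- s - 1)) * indicator (cball 0 t \<inter> ball 0 D) w \<partial>(lborel :: 'a measure))"
      by (intro nn_integral_cong) (auto simp: indicator_def)
    also have "\<dots> = ennreal (s * t powr (- s - 1)) * emeasure lborel (cball 0 t \<inter> ball (0::'a) D)"
      by (simp add: nn_integral_cmult_indicator)
    also have "\<dots> \<le> ennreal (s * ?V * t powr (?n - s - 1)) * indicator {0..D} t + ennreal (s * ?V * D ^ ?n * t powr (- s - 1)) * indicator {D..} t"
    proof -
      \<comment> \<open>The volume of the intersection is null, at most of order t^n, or capped at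
        order D^n in the three ranges.\<close>
      consider "t \<le> 0" | "0 < t" "t \<le> D" | "D < t" by linarith
      then show ?thesis
      proof cases
        case 1
        have "cball 0 t \<inter> ball (0::'a) D \<subseteq> {0}"
        proof
          fix x :: 'a assume "x \<in> cball 0 t \<inter> ball 0 D"
          then have "norm x \<le> 0" using 1 unfolding Int_iff mem_cball dist_0_norm by linarith
          then show "x \<in> {0}" by simp
        qed
        then have "emeasure lborel (cball 0 t \<inter> ball (0::'a) D) \<le> emeasure lborel {0::'a}"
          by (intro emeasure_mono) auto
        then have "emeasure lborel (cball 0 t \<inter> ball (0::'a) D) = 0" by simp
        then show ?thesis by simp
      next
        case 2
        have "emeasure lborel (cball 0 t \<inter> ball (0::'a) D) \<le> emeasure lborel (cball (0::'a) t)"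
          by (intro emeasure_mono) auto
        also have "\<dots> = ennreal (?V * t ^ ?n)" using 2 by (simp add: emeasure_cball)
        finally have "ennreal (s * t powr (- s - 1)) * emeasure lborel (cball 0 t \<inter> ball (0::'a) D)
           \<le> ennreal (s * t powr (- s - 1)) * ennreal (?V * t ^ ?n)" by (rule mult_left_mono) simp
        also have "\<dots> = ennreal (s * ?V * t powr (?n - s - 1))"
        proof -
          have "t powr (?n - s - 1) = t powr (- s - 1) * t ^ ?n"
            using 2 by (simp add: powr_realpow[symmetric] powr_add[symmetric] algebra_simps)
          then show ?thesis using s V 2 by (simp add: ennreal_mult[symmetric] mult_ac)
        qed
        finally show ?thesis using 2 by (simp add: order_trans)
      next
        case 3
        have "emeasure lborel (cball 0 t \<inter> ball (0::'a) D) \<le> emeasure lborel (cball (0::'a) D)"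
          by (intro emeasure_mono) auto
        also have "\<dots> = ennreal (?V * D ^ ?n)" using D by (simp add: emeasure_cball)
        finally have "ennreal (s * t powr (- s - 1)) * emeasure lborel (cball 0 t \<inter> ball (0::'a) D)
           \<le> ennreal (s * t powr (- s - 1)) * ennreal (?V * D ^ ?n)" by (rule mult_left_mono) simp
        also have "\<dots> = ennreal (s * ?V * D ^ ?n * t powr (- s - 1))"
          using s V D by (simp add: ennreal_mult[symmetric] mult_ac)
        finally show ?thesis using 3 D by (simp add: indicator_def)
      qed
    qed
    finally show "(\<integral>\<^sup>+w. ennreal (s * t powr (- s - 1)) * (indicator {t. norm w \<le> t} t * indicator (ball 0 D) w) \<partial>(lborel :: 'a measure))
       \<le> ennreal (s * ?V * t powr (?n - s - 1)) * indicator {0..D} t + ennreal (s * ?V * D ^ ?n * t powr (- s - 1)) * indicator {D..} t" .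
  qed
  also have "\<dots> = (\<integral>\<^sup>+t. ennreal (s * ?V * t powr (?n - s - 1)) * indicator {0..D} t \<partial>lborel)
      + (\<integral>\<^sup>+t. ennreal (s * ?V * D ^ ?n * t powr (- s - 1)) * indicator {D..} t \<partial>lborel)"
    by (rule nn_integral_add) measurable
  also have "\<dots> = ennreal (s * ?V * (D powr (?n - s - 1 + 1) / (?n - s - 1 + 1)))
     + ennreal (s * ?V * D ^ ?n * (- (D powr (- s - 1 + 1)) / (- s - 1 + 1)))"
  proof -
    have "((\<lambda>t. s * ?V * t powr (?n - s - 1)) has_integral (s * ?V * (D powr (?n - s - 1 + 1) / (?n - s - 1 + 1)))) {0..D}"
      using s D by (intro has_integral_mult_right has_integral_powr_from_0) auto
    then have 1: "(\<integral>\<^sup>+t. ennreal (s * ?V * t powr (?n - s - 1)) * indicator {0..D} t \<partial>lborel)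
      = ennreal (s * ?V * (D powr (?n - s - 1 + 1) / (?n - s - 1 + 1)))"
      using s V by (intro nn_integral_has_integral_lebesgue') auto
    have "((\<lambda>t. s * ?V * D ^ ?n * t powr (- s - 1)) has_integral (s * ?V * D ^ ?n * (- (D powr (- s - 1 + 1)) / (- s - 1 + 1)))) {D..}"
      using s D by (intro has_integral_mult_right has_integral_powr_to_inf) auto
    then have 2: "(\<integral>\<^sup>+t. ennreal (s * ?V * D ^ ?n * t powr (- s - 1)) * indicator {D..} t \<partial>lborel)
      = ennreal (s * ?V * D ^ ?n * (- (D powr (- s - 1 + 1)) / (- s - 1 + 1)))"
      using s V D by (intro nn_integral_has_integral_lebesgue') auto
    show ?thesis unfolding 1 2 ..
  qed
  also have "\<dots> < \<infinity>" by simp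
  finally show ?thesis .
qed

text \<open>The fundamental theorem of calculus along the ray from \<open>x\<close> in direction
  \<open>z\<close>, which eventually leaves the support.\<close>

lemma test_fun_ray:
  fixes \<phi> :: "'a::euclidean_space \<Rightarrow> real"
  assumes \<phi>: "smooth \<phi>" and supp: "\<And>x. x \<notin> cball 0 R \<Longrightarrow> \<phi> x = 0" and z: "z \<noteq> 0"
  shows "ennreal \<bar>\<phi> x\<bar> \<le> (\<integral>\<^sup>+t. ennreal (norm (tgrad \<phi> (x + t *\<^sub>R z)) * norm z) * indicator {0<..} t \<partial>lborel)"
proof -
  \<comment> \<open>With this length, \<open>T * norm z\<close> exceeds
    \<open>\<bar>R\<bar> + norm x\<close>, so the end point lies outside the ball that carries
    \<phi>.\<close>
  define T where "T = (\<bar>R\<bar> + norm x) / norm z + 1"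
  have nz: "norm z > 0" using z by simp
  have T: "T > 0" unfolding T_def using nz by (simp add: add_nonneg_pos)
  have "\<bar>R\<bar> + norm x < T * norm z" using nz by (simp add: T_def field_simps)
  then have "norm (x + T *\<^sub>R z) > R" using norm_triangle_ineq[of "x + T *\<^sub>R z" "- x"] T by simp
  then have end0: "\<phi> (x + T *\<^sub>R z) = 0" by (intro supp) simp
  let ?d = "\<lambda>t. tgrad \<phi> (x + t *\<^sub>R z) \<bullet> z"
  have c: "continuous_on A ?d" for A
    by (intro continuous_intros continuous_on_compose2[OF tgrad_continuous[OF \<phi>]]) auto
  have d: "((\<lambda>t. \<phi> (x + t *\<^sub>R z)) has_vector_derivative ?d t) (at t within {0..T})" for t
  proof -
    have 1: "((\<lambda>s. x + s *\<^sub>R z) has_derivative (\<lambda>s. s *\<^sub>R z)) (at t within {0..T})" by (auto intro!: derivative_eq_intros)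
    have 2: "(\<phi> has_derivative frechet_derivative \<phi> (at (x + t *\<^sub>R z))) (at (x + t *\<^sub>R z))"
      by (rule smooth_has_derivative[OF \<phi>])
    show ?thesis unfolding has_vector_derivative_def tgrad_inner[OF smooth_differentiable[OF \<phi>]]
      by (rule has_derivative_eq_rhs[OF has_derivative_compose[OF 1 2]])
        (simp add: linear_scale[OF has_derivative_linear[OF 2]])
  qed
  have "(LINT t|lborel. indicator {0..T} t *\<^sub>R ?d t) = \<phi> (x + T *\<^sub>R z) - \<phi> (x + 0 *\<^sub>R z)"
    by (rule integral_FTC_atLeastAtMost) (use T d c in auto)
  then have e: "\<bar>\<phi> x\<bar> = norm (LINT t|lborel. indicator {0..T} t *\<^sub>R ?d t)" by (simp add: end0)
  have "ennreal (norm (LINT t|lborel. indicator {0..T} t *\<^sub>R ?d t)) \<le> (\<integral>\<^sup>+t. norm (indicator {0..T} t *\<^sub>R ?d t) \<partial>lborel)"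
    by (intro integral_norm_bound_ennreal borel_integrable_compact c) auto
  also have "\<dots> \<le> (\<integral>\<^sup>+t. ennreal (norm (tgrad \<phi> (x + t *\<^sub>R z)) * norm z) * indicator {0<..} t \<partial>lborel)"
  proof (rule nn_integral_mono_AE)
    show "AE t in lborel. ennreal (norm (indicator {0..T} t *\<^sub>R ?d t)) \<le> ennreal (norm (tgrad \<phi> (x + t *\<^sub>R z)) * norm z) * indicator {0<..} t"
      using AE_lborel_singleton[of "0::real"]
    proof eventually_elim
      case (elim t)
      then show ?case using Cauchy_Schwarz_ineq2[of "tgrad \<phi> (x + t *\<^sub>R z)" z]
        by (auto simp: indicator_def ennreal_leI)
    qed
  qed
  finally show ?thesis unfolding e .
qed

text \<open>The ray estimate is integrated over all directions \<open>z\<close> in the unit ball,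
  which avoids surface measure. Substituting w = t z and integrating out t leaves the Riesz kernel
  |w|^(1-n) / n, written with natural powers so that it is 0 at the origin.\<close>

lemma test_fun_riesz:
  fixes \<phi> :: "'a::euclidean_space \<Rightarrow> real"
  assumes \<phi>: "smooth \<phi>" and supp: "\<And>x. x \<notin> cball 0 R \<Longrightarrow> \<phi> x = 0"
  shows "ennreal \<bar>\<phi> x\<bar> * emeasure lborel (ball (0::'a) 1)
    \<le> (\<integral>\<^sup>+w. ennreal (norm (tgrad \<phi> (x + w)) * (norm w * (1 / norm w) ^ DIM('a) / real DIM('a))) \<partial>lborel)"
proof -
  let ?n = "DIM('a)" and ?F = "\<lambda>y. norm (tgrad \<phi> y)"
  have [measurable]: "tgrad \<phi> \<in> borel_measurable borel"
    by (rule borel_measurable_continuous_onI[OF tgrad_continuous[OF \<phi>]])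
  have [measurable]: "(\<lambda>z. indicator (ball (0::'a) 1) (snd z) :: ennreal) \<in> borel_measurable ((lborel :: real measure) \<Otimes>\<^sub>M lborel)"
    by (rule measurable_compose[OF measurable_snd borel_measurable_indicator[of _ lborel]]) simp
  have "ennreal \<bar>\<phi> x\<bar> * emeasure lborel (ball (0::'a) 1) = (\<integral>\<^sup>+z. ennreal \<bar>\<phi> x\<bar> * indicator (ball (0::'a) 1) z \<partial>lborel)"
    by (simp add: nn_integral_cmult_indicator)
  also have "\<dots> \<le> (\<integral>\<^sup>+z. (\<integral>\<^sup>+t. ennreal (?F (x + t *\<^sub>R z) * norm z) * (indicator {0<..} t * indicator (ball 0 1) z) \<partial>lborel) \<partial>lborel)"
  proof (rule nn_integral_mono_AE)
    show "AE z in lborel. ennreal \<bar>\<phi> x\<bar> * indicator (ball (0::'a) 1) z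
       \<le> (\<integral>\<^sup>+t. ennreal (?F (x + t *\<^sub>R z) * norm z) * (indicator {0<..} t * indicator (ball 0 1) z) \<partial>lborel)"
      using AE_lborel_singleton[of "0::'a"]
    proof eventually_elim
      case (elim z)
      have "ennreal \<bar>\<phi> x\<bar> * indicator (ball (0::'a) 1) z
         \<le> (\<integral>\<^sup>+t. ennreal (?F (x + t *\<^sub>R z) * norm z) * indicator {0<..} t \<partial>lborel) * indicator (ball (0::'a) 1) z"
        by (intro mult_right_mono test_fun_ray[OF \<phi> supp elim]) auto
      also have "\<dots> = (\<integral>\<^sup>+t. ennreal (?F (x + t *\<^sub>R z) * norm z) * indicator {0<..} t * indicator (ball (0::'a) 1) z \<partial>lborel)"
        by (rule nn_integral_multc[symmetric]) measurable
      finally show ?case by (simp add: mult.assoc)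
    qed
  qed
  also have "\<dots> = (\<integral>\<^sup>+t. (\<integral>\<^sup>+z. ennreal (?F (x + t *\<^sub>R z) * norm z) * (indicator {0<..} t * indicator (ball 0 1) z) \<partial>lborel) \<partial>lborel)"
    by (rule pair_sigma_finite.Fubini'[OF sigma_pair_lborel]) measurable
  also have "\<dots> = (\<integral>\<^sup>+t. (\<integral>\<^sup>+w. ennreal (?F (x + w) * norm w * (1 / t) ^ (?n + 1)) * indicator {t. norm w < t} t \<partial>lborel) \<partial>lborel)"
  \<comment> \<open>For fixed \<open>t > 0\<close> the substitution w = t z contributes the Jacobian
    \<open>(1 / t) ^ n\<close>; the factor \<open>norm z\<close> contributes one more
    \<open>1 / t\<close>, and the unit ball becomes \<open>norm w < t\<close>.\<close>
  proof (rule nn_integral_cong)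
    fix t :: real
    show "(\<integral>\<^sup>+z. ennreal (?F (x + t *\<^sub>R z) * norm z) * (indicator {0<..} t * indicator (ball 0 1) z) \<partial>lborel)
      = (\<integral>\<^sup>+w. ennreal (?F (x + w) * norm w * (1 / t) ^ (?n + 1)) * indicator {t. norm w < t} t \<partial>lborel)"
    proof (cases "t > 0")
      case True
      have [measurable]: "(indicator (ball (0::'a) 1) :: _ \<Rightarrow> ennreal) \<in> borel_measurable borel"
        by (rule borel_measurable_indicator) simp
      have [measurable]: "(\<lambda>w. indicator (ball (0::'a) 1) ((1 / t) *\<^sub>R w) :: ennreal) \<in> borel_measurable borel"
        by (rule measurable_compose[of "\<lambda>w. (1 / t) *\<^sub>R w" borel borel, OF _ borel_measurable_indicator]) simp_all
      have "(\<integral>\<^sup>+z. ennreal (?F (x + t *\<^sub>R z) * norm z) * (indicator {0<..} t * indicator (ball 0 1) z) \<partial>lborel)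
        = ennreal ((1 / t) ^ ?n) * (\<integral>\<^sup>+w. ennreal (?F (x + t *\<^sub>R ((1 / t) *\<^sub>R w)) * norm ((1 / t) *\<^sub>R w)) * (indicator {0<..} t * indicator (ball 0 1) ((1 / t) *\<^sub>R w)) \<partial>lborel)"
        using True by (intro nn_integral_lborel_scale) (measurable, simp_all)
      also have "\<dots> = (\<integral>\<^sup>+w. ennreal ((1 / t) ^ ?n) * (ennreal (?F (x + t *\<^sub>R ((1 / t) *\<^sub>R w)) * norm ((1 / t) *\<^sub>R w)) * (indicator {0<..} t * indicator (ball 0 1) ((1 / t) *\<^sub>R w))) \<partial>lborel)"
        by (rule nn_integral_cmult[symmetric]) measurable
      also have "\<dots> = (\<integral>\<^sup>+w. ennreal (?F (x + w) * norm w * (1 / t) ^ (?n + 1)) * indicator {t. norm w < t} t \<partial>lborel)"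
      proof (rule nn_integral_cong)
        fix w :: 'a
        have "indicator {0<..} t * indicator (ball 0 1) ((1 / t) *\<^sub>R w) = (indicator {t. norm w < t} t :: ennreal)"
          using True by (auto simp: indicator_def)
        moreover have "ennreal ((1 / t) ^ ?n) * ennreal (?F (x + t *\<^sub>R ((1 / t) *\<^sub>R w)) * norm ((1 / t) *\<^sub>R w))
          = ennreal (?F (x + w) * norm w * (1 / t) ^ (?n + 1))"
          using True by (simp add: ennreal_mult[symmetric] mult_ac)
        ultimately show "ennreal ((1 / t) ^ ?n) * (ennreal (?F (x + t *\<^sub>R ((1 / t) *\<^sub>R w)) * norm ((1 / t) *\<^sub>R w)) * (indicator {0<..} t * indicator (ball 0 1) ((1 / t) *\<^sub>R w)))
          = ennreal (?F (x + w) * norm w * (1 / t) ^ (?n + 1)) * indicator {t. norm w < t} t"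
          by (metis mult.assoc)
      qed
      finally show ?thesis .
    next
      case False
      then have "indicator {t. norm w < t} t = (0 :: ennreal)" for w :: 'a
        using norm_ge_zero[of w] by (auto simp: indicator_def simp del: norm_ge_zero)
      then show ?thesis using False by simp
    qed
  qed
  also have "\<dots> = (\<integral>\<^sup>+w. (\<integral>\<^sup>+t. ennreal (?F (x + w) * norm w * (1 / t) ^ (?n + 1)) * indicator {t. norm w < t} t \<partial>lborel) \<partial>lborel)"
    by (rule pair_sigma_finite.Fubini'[OF sigma_pair_lborel, symmetric]) measurable
  also have "\<dots> \<le> (\<integral>\<^sup>+w. ennreal (?F (x + w) * (norm w * (1 / norm w) ^ ?n / real ?n)) \<partial>lborel)"
  proof (rule nn_integral_mono)
    fix w :: 'a
    show "(\<integral>\<^sup>+t. ennreal (?F (x + w) * norm w * (1 / t) ^ (?n + 1)) * indicator {t. norm w < t} t \<partial>lborel)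
      \<le> ennreal (?F (x + w) * (norm w * (1 / norm w) ^ ?n / real ?n))"
    proof (cases "w = 0")
      case False
      let ?c = "?F (x + w) * norm w"
      have n: "real ?n > 0" by simp
      have "(\<integral>\<^sup>+t. ennreal (?c * (1 / t) ^ (?n + 1)) * indicator {t. norm w < t} t \<partial>lborel)
        \<le> (\<integral>\<^sup>+t. ennreal (?c * (1 / t) ^ (?n + 1)) * indicator {norm w..} t \<partial>lborel)"
        by (intro nn_integral_mono) (auto simp: indicator_def)
      also have "\<dots> = ennreal (0 - ?c * (- ((1 / norm w) ^ ?n) / real ?n))"
      \<comment> \<open>The integral of t^(-n-1) from \<open>norm w\<close> to infinity is |w|^(-n)
        / n; this is the origin of the factor 1/n in the kernel.\<close>
      proof (rule nn_integral_FTC_atLeast[where F = "\<lambda>t. ?c * (- ((1 / t) ^ ?n) / real ?n)" and f = "\<lambda>t. ?c * (1 / t) ^ (?n + 1)"])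
        show "(\<lambda>t. ?c * (1 / t) ^ (?n + 1)) \<in> borel_measurable borel" by measurable
        show "((\<lambda>t. ?c * (- ((1 / t) ^ ?n) / real ?n)) has_real_derivative ?c * (1 / t) ^ (?n + 1)) (at t)" if "norm w \<le> t" for t
        proof -
          have t: "t > 0" using that False by (metis less_le_trans zero_less_norm_iff)
          obtain m where m: "?n = Suc m" using DIM_positive[where 'a = 'a] gr0_implies_Suc by blast
          have "((\<lambda>t. (1 / t) ^ ?n) has_real_derivative real ?n * (- (1 / t\<^sup>2) * (1 / t) ^ (?n - Suc 0))) (at t)"
            using t by (intro DERIV_power) (auto intro!: derivative_eq_intros simp: power2_eq_square)
          also have "real ?n * (- (1 / t\<^sup>2) * (1 / t) ^ (?n - Suc 0)) = real ?n * (- ((1 / t) ^ (?n + 1)))"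
            unfolding m by (simp add: power2_eq_square)
          finally have "((\<lambda>t. ?c * (- ((1 / t) ^ ?n) / real ?n)) has_real_derivative ?c * (- (real ?n * (- ((1 / t) ^ (?n + 1)))) / real ?n)) (at t)"
            by (intro DERIV_cmult DERIV_cdivide DERIV_minus)
          then show ?thesis using n by simp
        qed
        show "0 \<le> ?c * (1 / t) ^ (?n + 1)" if "norm w \<le> t" for t
          using order_trans[OF norm_ge_zero that] by simp
        have "((\<lambda>t::real. inverse t) \<longlongrightarrow> 0) at_top" by (rule tendsto_inverse_0_at_top[OF filterlim_ident])
        then have "((\<lambda>t::real. ?c * (- ((1 / t) ^ ?n) / real ?n)) \<longlongrightarrow> ?c * (- (0 ^ ?n) / real ?n)) at_top"
          by (intro tendsto_intros) (auto simp: inverse_eq_divide)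
        then show "((\<lambda>t. ?c * (- ((1 / t) ^ ?n) / real ?n)) \<longlongrightarrow> 0) at_top" by (simp add: power_0_left)
      qed
      also have "\<dots> = ennreal (?F (x + w) * (norm w * (1 / norm w) ^ ?n / real ?n))" by (simp add: mult.assoc)
      finally show ?thesis .
    qed simp
  qed
  finally show ?thesis .
qed

section \<open>The subcritical Sobolev inequality\<close>

text \<open>
  Interpolating with the weight \<open>lm = 1 + h\<close> replaces Hoelder's inequality in the proof of Young's
  inequality, at the price of a factor 2.
\<close>

lemma convolution_pointwise_bound:
  fixes F kern :: "'a::euclidean_space \<Rightarrow> real"
  assumes [measurable]: "F \<in> borel_measurable borel" "kern \<in> borel_measurable borel"
    and nn: "\<And>y. 0 \<le> F y" "\<And>w. 0 \<le> kern w" and k: "k > 2" and r: "r = 2 * k / (k + 2)"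
    and \<kappa>: "(\<integral>\<^sup>+w. ennreal (kern w powr r) \<partial>lborel) \<le> ennreal \<kappa>" "\<kappa> > 0"
    and A: "(\<integral>\<^sup>+y. ennreal ((F y)\<^sup>2) \<partial>lborel) \<le> 1"
    and a: "a \<ge> 0" "ennreal a \<le> (\<integral>\<^sup>+w. ennreal (F (x + w) * kern w) \<partial>lborel)"
  shows "ennreal (a powr k) \<le> ennreal ((2 * \<kappa>) powr (k / 2)) * (1 + (\<integral>\<^sup>+w. ennreal ((F (x + w))\<^sup>2 * kern w powr r) \<partial>lborel))"
proof -
  define H where "H = (\<integral>\<^sup>+w. ennreal ((F (x + w))\<^sup>2 * kern w powr r) \<partial>lborel)"
  show ?thesis
  proof (cases "H = \<infinity>")
    \<comment> \<open>An infinite \<open>H\<close> makes the right-hand side infinite, because its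
      prefactor is positive.\<close>
    case True
    then show ?thesis using \<kappa>(2) unfolding H_def[symmetric] by (simp add: ennreal_mult_eq_top_iff ennreal_mult_top)
  next
    case False
    define h where "h = enn2real H"
    have h: "h \<ge> 0" "H = ennreal h" using False by (auto simp: h_def less_top)
    define lm where "lm = 1 + h"
    have lm: "lm > 0" "h \<le> lm" using h by (auto simp: lm_def)
    have tr: "(\<integral>\<^sup>+w. ennreal ((F (x + w))\<^sup>2) \<partial>lborel) \<le> 1"
      using A nn_integral_lborel_translate[of "\<lambda>y. ennreal ((F y)\<^sup>2)" x] by simp
    have interp: "y powr (2 / k) \<le> lm powr (2 / k) * (1 + y / lm)" if y: "y \<ge> 0" for y
    proof -
      have "(y / lm) powr (2 / k) \<le> 1 + y / lm"
      proof (cases "y / lm \<le> 1")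
        case True
        have "(y / lm) powr (2 / k) \<le> 1 powr (2 / k)" using True y lm k by (intro powr_mono2) auto
        then show ?thesis using y lm by (simp add: add_increasing2)
      next
        case False
        then have "(y / lm) powr (2 / k) \<le> (y / lm) powr 1" using k by (intro powr_mono) auto
        then show ?thesis using False by simp
      qed
      then have "lm powr (2 / k) * (y / lm) powr (2 / k) \<le> lm powr (2 / k) * (1 + y / lm)"
        by (rule mult_left_mono) simp
      then show ?thesis using y lm by (simp add: powr_divide)
    qed
    \<comment> \<open>The choice of \<open>r\<close> is Young's relation 1/r = 1/2 + 1/k. It makes
      the square of \<open>kern powr (1 - r / 2)\<close> a power 2/k of \<open>kern powr r\<close>,
      the quantity that \<open>interp\<close> estimates.\<close>
    have r2: "2 - r = r * (2 / k)" using k unfolding r by (simp add: field_simps)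
    have f2: "(\<integral>\<^sup>+w. (ennreal (F (x + w) * kern w powr (1 - r / 2)))\<^sup>2 \<partial>lborel) \<le> ennreal (2 * lm powr (2 / k))"
    proof -
      have "(\<integral>\<^sup>+w. (ennreal (F (x + w) * kern w powr (1 - r / 2)))\<^sup>2 \<partial>lborel)
        \<le> (\<integral>\<^sup>+w. ennreal (lm powr (2 / k)) * (ennreal ((F (x + w))\<^sup>2) + ennreal (1 / lm) * ennreal ((F (x + w))\<^sup>2 * kern w powr r)) \<partial>lborel)"
      proof (rule nn_integral_mono)
        fix w
        have "(kern w powr (1 - r / 2))\<^sup>2 = (kern w powr r) powr (2 / k)"
          unfolding power2_eq_square powr_add[symmetric] powr_powr r2[symmetric] by simp
        also have "\<dots> \<le> lm powr (2 / k) * (1 + kern w powr r / lm)" by (rule interp) simp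
        finally have "(F (x + w))\<^sup>2 * (kern w powr (1 - r / 2))\<^sup>2 \<le> (F (x + w))\<^sup>2 * (lm powr (2 / k) * (1 + kern w powr r / lm))"
          by (rule mult_left_mono) simp
        then have "(F (x + w) * kern w powr (1 - r / 2))\<^sup>2
           \<le> lm powr (2 / k) * ((F (x + w))\<^sup>2 + 1 / lm * ((F (x + w))\<^sup>2 * kern w powr r))"
          by (simp add: power_mult_distrib algebra_simps)
        then show "(ennreal (F (x + w) * kern w powr (1 - r / 2)))\<^sup>2
           \<le> ennreal (lm powr (2 / k)) * (ennreal ((F (x + w))\<^sup>2) + ennreal (1 / lm) * ennreal ((F (x + w))\<^sup>2 * kern w powr r))"
          using lm nn by (simp add: ennreal_power ennreal_mult[symmetric] ennreal_plus[symmetric] ennreal_leI del: ennreal_plus)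
      qed
      also have "\<dots> = ennreal (lm powr (2 / k)) * ((\<integral>\<^sup>+w. ennreal ((F (x + w))\<^sup>2) \<partial>lborel) + ennreal (1 / lm) * H)"
        unfolding H_def by (simp add: nn_integral_cmult nn_integral_add)
      also have "\<dots> \<le> ennreal (lm powr (2 / k)) * (1 + ennreal (1 / lm) * ennreal h)"
        using tr unfolding h(2) by (intro mult_left_mono add_right_mono) auto
      also have "\<dots> \<le> ennreal (lm powr (2 / k)) * (1 + 1)"
      proof (intro mult_left_mono add_left_mono)
        have "1 / lm * h \<le> 1" using lm h by (simp add: field_simps)
        then show "ennreal (1 / lm) * ennreal h \<le> 1" using lm h by (simp add: ennreal_mult[symmetric] ennreal_le_1)
      qed simp
      also have "\<dots> = ennreal (2 * lm powr (2 / k))"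
        by (simp add: ennreal_mult mult.commute one_add_one)
      finally show ?thesis .
    qed
    have g2: "(\<integral>\<^sup>+w. (ennreal (kern w powr (r / 2)))\<^sup>2 \<partial>lborel) \<le> ennreal \<kappa>"
    proof -
      have "(kern w powr (r / 2))\<^sup>2 = kern w powr r" for w
        unfolding power2_eq_square powr_add[symmetric] by simp
      then show ?thesis using \<kappa>(1) by (simp add: ennreal_power)
    qed
    have "(ennreal a)\<^sup>2 \<le> (\<integral>\<^sup>+w. ennreal (F (x + w) * kern w powr (1 - r / 2)) * ennreal (kern w powr (r / 2)) \<partial>lborel)\<^sup>2"
    proof (rule power_mono)
      \<comment> \<open>The splitting for the Cauchy-Schwarz inequality: the square of the second
        factor is \<open>kern powr r\<close>, with integral at most \<kappa>, and \<open>f2\<close>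
        covers the square of the first.\<close>
      have "F (x + w) * kern w = (F (x + w) * kern w powr (1 - r / 2)) * kern w powr (r / 2)" for w
        using nn(2)[of w] by (simp add: mult.assoc powr_add[symmetric])
      then have "ennreal (F (x + w) * kern w) = ennreal (F (x + w) * kern w powr (1 - r / 2)) * ennreal (kern w powr (r / 2))" for w
        using nn by (metis ennreal_mult mult_nonneg_nonneg powr_ge_zero)
      then show "ennreal a \<le> (\<integral>\<^sup>+w. ennreal (F (x + w) * kern w powr (1 - r / 2)) * ennreal (kern w powr (r / 2)) \<partial>lborel)"
        using a(2) by simp
    qed simp
    also have "\<dots> \<le> (\<integral>\<^sup>+w. (ennreal (F (x + w) * kern w powr (1 - r / 2)))\<^sup>2 \<partial>lborel) * (\<integral>\<^sup>+w. (ennreal (kern w powr (r / 2)))\<^sup>2 \<partial>lborel)"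
      by (rule Cauchy_Schwarz_nn_integral) measurable
    also have "\<dots> \<le> ennreal (2 * lm powr (2 / k)) * ennreal \<kappa>"
      by (intro mult_mono f2 g2) auto
    finally have "ennreal (a\<^sup>2) \<le> ennreal (2 * \<kappa> * lm powr (2 / k))"
      using a \<kappa>(2) by (simp add: ennreal_power ennreal_mult[symmetric] mult_ac)
    then have a2: "a\<^sup>2 \<le> 2 * \<kappa> * lm powr (2 / k)" using \<kappa>(2) by (simp add: ennreal_le_iff)
    have "a powr k = (a powr 2) powr (k / 2)" by (simp add: powr_powr)
    also have "\<dots> = (a\<^sup>2) powr (k / 2)" using a by simp
    also have "\<dots> \<le> (2 * \<kappa> * lm powr (2 / k)) powr (k / 2)" using k by (intro powr_mono2 a2) auto
    also have "\<dots> = (2 * \<kappa>) powr (k / 2) * lm"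
      using k lm \<kappa>(2) by (simp add: powr_mult powr_powr)
    finally have "ennreal (a powr k) \<le> ennreal ((2 * \<kappa>) powr (k / 2) * (1 + h))"
      unfolding lm_def by (rule ennreal_leI)
    also have "\<dots> = ennreal ((2 * \<kappa>) powr (k / 2)) * (1 + H)"
      using h by (simp add: ennreal_mult)
    finally show ?thesis unfolding H_def .
  qed
qed

context bounded_open
begin

text \<open>Young's inequality for the convolution of the gradient with the truncated Riesz kernel.
  It is stated with an arbitrary bound \<delta> > 0 of the gradient norm, so that the normalization
  by \<delta> is legitimate even when the gradient vanishes.\<close>

lemma sobolev_test_fun:
  assumes n: "DIM('a) \<ge> 3" and k: "2 < k" "k < 2 * real DIM('a) / (real DIM('a) - 2)"
  shows "\<exists>C\<ge>0. \<forall>\<phi>\<in>test_fun \<Omega>. \<forall>\<delta>>0. (\<integral>\<^sup>+y. ennreal ((norm (tgrad \<phi> y))\<^sup>2) \<partial>lborel) \<le> ennreal (\<delta>\<^sup>2) \<longrightarrow>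
     (\<integral>\<^sup>+x. ennreal (\<bar>\<phi> x\<bar> powr k) * indicator \<Omega> x \<partial>lborel) \<le> ennreal (C * \<delta> powr k)"
proof -
  let ?n = "real DIM('a)"
  define r where "r = 2 * k / (k + 2)"
  \<comment> \<open>The kernel to the power \<open>r\<close> behaves like |w|^(-s). The inequality s
    < n needed for its integrability is equivalent to k < 2n/(n-2), so this is where subcriticality
    enters.\<close>
  define s where "s = (?n - 1) * r"
  have r: "r > 0" using k by (simp add: r_def)
  have s: "0 < s" "s < ?n"
  proof -
    show "0 < s" using n r by (simp add: s_def)
    have "k * (?n - 2) < 2 * ?n" using k(2) n by (simp add: field_simps)
    then have "(?n - 1) * (2 * k) < ?n * (k + 2)" by (simp add: algebra_simps)
    then show "s < ?n" using k by (simp add: s_def r_def divide_less_eq)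
  qed
  obtain D0 where D0: "\<And>x. x \<in> \<Omega> \<Longrightarrow> norm x \<le> D0" using bounded_\<Omega> unfolding bounded_iff by blast
  \<comment> \<open>Two points of \<Omega> differ by less than \<open>D\<close>, so the kernel may
    be cut off there: for \<open>x\<close> in \<Omega> and larger \<open>w\<close> the gradient at
    \<open>x + w\<close> vanishes.\<close>
  define D where "D = 2 * \<bar>D0\<bar> + 1"
  have D: "D > 0" by (simp add: D_def)
  have Ddist: "w \<in> ball 0 D" if "x \<in> \<Omega>" "x + w \<in> \<Omega>" for x w :: 'a
    using norm_triangle_ineq4[of "x + w" x] D0[OF that(1)] D0[OF that(2)] by (simp add: D_def)
  define \<beta> where "\<beta> = measure lborel (ball (0::'a) 1)"
  have emB: "emeasure lborel (ball (0::'a) 1) = ennreal \<beta>"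
    unfolding \<beta>_def by (rule emeasure_eq_ennreal_measure) (use emeasure_bounded_finite[of "ball (0::'a) 1"] in simp)
  have \<beta>: "\<beta> > 0" unfolding \<beta>_def by (rule content_ball_pos) simp
  define kern where "kern w = (norm w * (1 / norm w) ^ DIM('a) / ?n) / \<beta> * indicator (ball (0::'a) D) w" for w :: 'a
  have [measurable]: "kern \<in> borel_measurable borel"
  proof -
    have [measurable]: "(indicator (ball (0::'a) D) :: _ \<Rightarrow> real) \<in> borel_measurable borel"
      by (rule borel_measurable_indicator) simp
    show ?thesis unfolding kern_def by measurable
  qed
  have kern_nn: "kern w \<ge> 0" for w using \<beta> by (simp add: kern_def)
  define c1 where "c1 = (1 / (?n * \<beta>)) powr r"
  have kern_r: "ennreal (kern w powr r) = ennreal c1 * (ennreal (norm w powr (- s)) * indicator (ball 0 D) w)" for w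
  proof (cases "w = 0 \<or> w \<notin> ball 0 D")
    case True then show ?thesis using r by (auto simp: kern_def)
  next
    case False
    then have w: "norm w > 0" "w \<in> ball 0 D" by auto
    have "norm w * (1 / norm w) ^ DIM('a) = norm w powr (1 - ?n)"
      using w(1) by (simp add: powr_diff powr_realpow power_divide)
    then have "kern w = norm w powr (1 - ?n) * (1 / (?n * \<beta>))" using w(2) by (simp add: kern_def)
    then have "kern w powr r = (norm w powr (1 - ?n)) powr r * c1"
      unfolding c1_def by (simp only: powr_mult)
    also have "(norm w powr (1 - ?n)) powr r = norm w powr (- s)"
      unfolding powr_powr s_def by (simp add: algebra_simps)
    finally have "kern w powr r = norm w powr (- s) * c1" .
    then show ?thesis using w(2) by (simp add: ennreal_mult mult.commute c1_def)
  qed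
  define I where "I = (\<integral>\<^sup>+w. ennreal (kern w powr r) \<partial>lborel)"
  have "I = ennreal c1 * (\<integral>\<^sup>+w. ennreal (norm w powr (- s)) * indicator (ball (0::'a) D) w \<partial>lborel)"
    unfolding I_def kern_r
  proof (rule nn_integral_cmult)
    have [measurable]: "(indicator (ball (0::'a) D) :: _ \<Rightarrow> ennreal) \<in> borel_measurable lborel"
      by (rule borel_measurable_indicator) simp
    show "(\<lambda>w. ennreal (norm w powr (- s)) * indicator (ball (0::'a) D) w) \<in> borel_measurable lborel" by measurable
  qed
  also have "\<dots> < \<infinity>"
    using singular_kernel_integrable[OF s D] by (simp add: ennreal_mult_less_top)
  finally have Ifin: "I < \<infinity>" .
  \<comment> \<open>The summand 1 provides the strict positivity required by the pointwise
    bound.\<close>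
  define \<kappa> where "\<kappa> = enn2real I + 1"
  have \<kappa>: "\<kappa> > 0" "I \<le> ennreal \<kappa>"
  proof -
    show "\<kappa> > 0" by (simp add: \<kappa>_def add_nonneg_pos)
    have "I = ennreal (enn2real I)" using Ifin by simp
    also have "\<dots> \<le> ennreal \<kappa>" by (intro ennreal_leI) (simp add: \<kappa>_def)
    finally show "I \<le> ennreal \<kappa>" .
  qed
  define V where "V = measure lborel \<Omega>"
  have emV: "emeasure lborel \<Omega> = ennreal V"
    unfolding V_def by (rule emeasure_eq_ennreal_measure) (use emeasure_bounded_finite[OF bounded_\<Omega>] in simp)
  \<comment> \<open>Integrating the pointwise bound over \<Omega> gives the volume \<open>V\<close>
    for the constant term and, by Fubini and the normalization of \<open>F\<close>, at most \<kappa>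
    for the convolution term.\<close>
  define C where "C = (2 * \<kappa>) powr (k / 2) * (V + \<kappa>)"
  have V: "V \<ge> 0" by (simp add: V_def)
  have "(\<integral>\<^sup>+x. ennreal (\<bar>\<phi> x\<bar> powr k) * indicator \<Omega> x \<partial>lborel) \<le> ennreal (C * \<delta> powr k)"
    if \<phi>: "\<phi> \<in> test_fun \<Omega>" and \<delta>: "\<delta> > 0"
      and N: "(\<integral>\<^sup>+y. ennreal ((norm (tgrad \<phi> y))\<^sup>2) \<partial>lborel) \<le> ennreal (\<delta>\<^sup>2)" for \<phi> \<delta>
  proof -
    note sm = test_funD(1)[OF \<phi>]
    have [measurable]: "tgrad \<phi> \<in> borel_measurable borel" "\<phi> \<in> borel_measurable borel"
      by (intro borel_measurable_continuous_onI tgrad_continuous smooth_continuous sm)+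
    have [measurable]: "\<Omega> \<in> sets borel" using open_\<Omega> by simp
    define F where "F y = norm (tgrad \<phi> y) / \<delta>" for y
    have [measurable]: "F \<in> borel_measurable borel" unfolding F_def by measurable
    have F_nn: "F y \<ge> 0" for y using \<delta> by (simp add: F_def)
    have F1: "(\<integral>\<^sup>+y. ennreal ((F y)\<^sup>2) \<partial>lborel) \<le> 1"
    proof -
      have "(\<integral>\<^sup>+y. ennreal ((F y)\<^sup>2) \<partial>lborel) = (\<integral>\<^sup>+y. ennreal (1 / \<delta>\<^sup>2) * ennreal ((norm (tgrad \<phi> y))\<^sup>2) \<partial>lborel)"
        by (intro nn_integral_cong) (simp add: F_def ennreal_mult[symmetric] power_divide)
      also have "\<dots> = ennreal (1 / \<delta>\<^sup>2) * (\<integral>\<^sup>+y. ennreal ((norm (tgrad \<phi> y))\<^sup>2) \<partial>lborel)"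
        by (rule nn_integral_cmult) measurable
      also have "\<dots> \<le> ennreal (1 / \<delta>\<^sup>2) * ennreal (\<delta>\<^sup>2)" by (intro mult_left_mono N) simp
      also have "\<dots> = 1" using \<delta> by (simp add: ennreal_mult[symmetric])
      finally show ?thesis .
    qed
    have pw: "ennreal ((\<bar>\<phi> x\<bar> / \<delta>) powr k) \<le> ennreal ((2 * \<kappa>) powr (k / 2)) * (1 + (\<integral>\<^sup>+w. ennreal ((F (x + w))\<^sup>2 * kern w powr r) \<partial>lborel))"
      if x: "x \<in> \<Omega>" for x
    proof (rule convolution_pointwise_bound[OF _ _ F_nn kern_nn k(1) r_def _ \<kappa>(1) F1])
      show "(\<integral>\<^sup>+w. ennreal (kern w powr r) \<partial>lborel) \<le> ennreal \<kappa>" using \<kappa>(2) by (simp add: I_def)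
      have out: "\<phi> y = 0" if "y \<notin> cball 0 D0" for y
      proof -
        have "y \<notin> \<Omega>" using that D0[of y] by auto
        then show ?thesis by (rule test_funD(6)[OF \<phi>])
      qed
      have "ennreal (\<bar>\<phi> x\<bar> / \<delta>) = ennreal (1 / (\<delta> * \<beta>)) * (ennreal \<bar>\<phi> x\<bar> * ennreal \<beta>)"
        using \<delta> \<beta> by (simp add: ennreal_mult[symmetric])
      also have "\<dots> \<le> ennreal (1 / (\<delta> * \<beta>)) * (\<integral>\<^sup>+w. ennreal (norm (tgrad \<phi> (x + w)) * (norm w * (1 / norm w) ^ DIM('a) / ?n)) \<partial>lborel)"
        by (intro mult_left_mono test_fun_riesz[OF sm out, unfolded emB]) simp_all
      also have "\<dots> = (\<integral>\<^sup>+w. ennreal (1 / (\<delta> * \<beta>)) * ennreal (norm (tgrad \<phi> (x + w)) * (norm w * (1 / norm w) ^ DIM('a) / ?n)) \<partial>lborel)"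
        by (rule nn_integral_cmult[symmetric]) measurable
      also have "\<dots> = (\<integral>\<^sup>+w. ennreal (F (x + w) * kern w) \<partial>lborel)"
      proof (rule nn_integral_cong)
        fix w :: 'a
        show "ennreal (1 / (\<delta> * \<beta>)) * ennreal (norm (tgrad \<phi> (x + w)) * (norm w * (1 / norm w) ^ DIM('a) / ?n)) = ennreal (F (x + w) * kern w)"
        proof (cases "w \<in> ball 0 D")
          case True
          then show ?thesis using \<delta> \<beta> by (simp add: F_def kern_def ennreal_mult[symmetric] mult_ac)
        next
          case False
          then have "x + w \<notin> \<Omega>" using Ddist[OF x] by blast
          then have "tgrad \<phi> (x + w) = 0" by (rule test_funD(7)[OF \<phi>])
          then show ?thesis by (simp add: F_def)
        qed
      qed
      finally show "ennreal (\<bar>\<phi> x\<bar> / \<delta>) \<le> (\<integral>\<^sup>+w. ennreal (F (x + w) * kern w) \<partial>lborel)" .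
    qed (use \<delta> in auto)
    have H: "(\<integral>\<^sup>+x. (\<integral>\<^sup>+w. ennreal ((F (x + w))\<^sup>2 * kern w powr r) \<partial>lborel) \<partial>lborel) \<le> ennreal \<kappa>"
    proof -
      have "(\<integral>\<^sup>+x. (\<integral>\<^sup>+w. ennreal ((F (x + w))\<^sup>2 * kern w powr r) \<partial>lborel) \<partial>lborel)
        = (\<integral>\<^sup>+w. (\<integral>\<^sup>+x. ennreal ((F (x + w))\<^sup>2 * kern w powr r) \<partial>lborel) \<partial>lborel)"
        by (rule pair_sigma_finite.Fubini'[OF sigma_pair_lborel]) measurable
      also have "\<dots> \<le> (\<integral>\<^sup>+w. ennreal (kern w powr r) \<partial>lborel)"
      proof (rule nn_integral_mono)
        fix w :: 'a
        have "(\<integral>\<^sup>+x. ennreal ((F (x + w))\<^sup>2 * kern w powr r) \<partial>lborel) = (\<integral>\<^sup>+x. ennreal ((F (w + x))\<^sup>2) * ennreal (kern w powr r) \<partial>lborel)"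
          by (intro nn_integral_cong) (simp add: ennreal_mult add.commute)
        also have "\<dots> = (\<integral>\<^sup>+x. ennreal ((F (w + x))\<^sup>2) \<partial>lborel) * ennreal (kern w powr r)"
          by (rule nn_integral_multc) measurable
        also have "\<dots> \<le> 1 * ennreal (kern w powr r)"
          using F1 nn_integral_lborel_translate[of "\<lambda>y. ennreal ((F y)\<^sup>2)" w] by (intro mult_right_mono) auto
        finally show "(\<integral>\<^sup>+x. ennreal ((F (x + w))\<^sup>2 * kern w powr r) \<partial>lborel) \<le> ennreal (kern w powr r)" by simp
      qed
      also have "\<dots> \<le> ennreal \<kappa>" using \<kappa>(2) by (simp add: I_def)
      finally show ?thesis .
    qed
    have Hm: "(\<lambda>x. \<integral>\<^sup>+w. ennreal ((F (x + w))\<^sup>2 * kern w powr r) \<partial>lborel) \<in> borel_measurable lborel"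
      by measurable
    have "(\<integral>\<^sup>+x. ennreal (\<bar>\<phi> x\<bar> powr k) * indicator \<Omega> x \<partial>lborel)
      \<le> (\<integral>\<^sup>+x. ennreal (\<delta> powr k * (2 * \<kappa>) powr (k / 2)) * (indicator \<Omega> x + (\<integral>\<^sup>+w. ennreal ((F (x + w))\<^sup>2 * kern w powr r) \<partial>lborel)) \<partial>lborel)"
    proof (rule nn_integral_mono)
      fix x
      show "ennreal (\<bar>\<phi> x\<bar> powr k) * indicator \<Omega> x
        \<le> ennreal (\<delta> powr k * (2 * \<kappa>) powr (k / 2)) * (indicator \<Omega> x + (\<integral>\<^sup>+w. ennreal ((F (x + w))\<^sup>2 * kern w powr r) \<partial>lborel))"
      proof (cases "x \<in> \<Omega>")
        case True
        have "\<bar>\<phi> x\<bar> powr k = \<delta> powr k * (\<bar>\<phi> x\<bar> / \<delta>) powr k" using \<delta> by (simp add: powr_divide)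
        then have "ennreal (\<bar>\<phi> x\<bar> powr k) = ennreal (\<delta> powr k) * ennreal ((\<bar>\<phi> x\<bar> / \<delta>) powr k)" by (simp add: ennreal_mult)
        also have "\<dots> \<le> ennreal (\<delta> powr k) * (ennreal ((2 * \<kappa>) powr (k / 2)) * (1 + (\<integral>\<^sup>+w. ennreal ((F (x + w))\<^sup>2 * kern w powr r) \<partial>lborel)))"
          by (intro mult_left_mono pw True) simp
        finally show ?thesis using True by (simp add: ennreal_mult mult.assoc)
      qed simp
    qed
    also have "\<dots> = ennreal (\<delta> powr k * (2 * \<kappa>) powr (k / 2)) * (emeasure lborel \<Omega> + (\<integral>\<^sup>+x. (\<integral>\<^sup>+w. ennreal ((F (x + w))\<^sup>2 * kern w powr r) \<partial>lborel) \<partial>lborel))"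
      using Hm by (subst nn_integral_cmult) (simp_all add: nn_integral_add)
    also have "\<dots> \<le> ennreal (\<delta> powr k * (2 * \<kappa>) powr (k / 2)) * (ennreal V + ennreal \<kappa>)"
      unfolding emV by (intro mult_left_mono add_left_mono H) simp
    also have "\<dots> = ennreal (C * \<delta> powr k)"
      using V \<kappa>(1) by (simp add: C_def ennreal_mult[symmetric] ennreal_plus[symmetric] mult_ac del: ennreal_plus)
    finally show ?thesis .
  qed
  moreover have "C \<ge> 0" using V \<kappa>(1) by (simp add: C_def)
  ultimately show ?thesis by blast
qed

end

section \<open>From test functions to H10\<close>

context bounded_open
begin

lemma test_fun_grad_nn_integral:
  assumes \<phi>: "\<phi> \<in> test_fun \<Omega>"
  shows "(\<integral>\<^sup>+y. ennreal ((norm (tgrad \<phi> y))\<^sup>2) \<partial>lborel) = ennreal ((Lnorm 2 \<Omega> (wgrad \<Omega> \<phi>))\<^sup>2)"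
proof -
  note sm = test_funD(1)[OF \<phi>]
  have c: "continuous_on UNIV (\<lambda>y. (norm (tgrad \<phi> y))\<^sup>2)"
    by (intro continuous_intros tgrad_continuous sm)
  define K where "K = closure {x. \<phi> x \<noteq> 0}"
  have "(\<lambda>x. indicator K x *\<^sub>R (norm (tgrad \<phi> x))\<^sup>2) = (\<lambda>y. (norm (tgrad \<phi> y))\<^sup>2)"
    using test_funD(5)[OF \<phi>] unfolding K_def[symmetric] by (auto simp: indicator_def fun_eq_iff)
  moreover have "integrable lborel (\<lambda>x. indicator K x *\<^sub>R (norm (tgrad \<phi> x))\<^sup>2)"
    unfolding K_def by (rule borel_integrable_compact[OF test_funD(2)[OF \<phi>] continuous_on_subset[OF c subset_UNIV]])
  ultimately have i: "integrable lborel (\<lambda>y. (norm (tgrad \<phi> y))\<^sup>2)" by (simp only:)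
  have "(\<integral>\<^sup>+y. ennreal ((norm (tgrad \<phi> y))\<^sup>2) \<partial>lborel) = ennreal (LINT y|lborel. (norm (tgrad \<phi> y))\<^sup>2)"
    by (rule nn_integral_eq_integral[OF i]) simp
  also have "(LINT y|lborel. (norm (tgrad \<phi> y))\<^sup>2) = (LINT y|M. (norm (tgrad \<phi> y))\<^sup>2)"
    by (rule lebesgue_on_integral_eq_lborel[symmetric, OF borel_measurable_continuous_onI[OF c] open_\<Omega>])
      (simp add: test_funD(7)[OF \<phi>])
  also have "\<dots> = (Lnorm 2 \<Omega> (tgrad \<phi>))\<^sup>2"
    by (simp add: Lnorm_2_sq L2inner_def power2_norm_eq_inner)
  also have "Lnorm 2 \<Omega> (tgrad \<phi>) = Lnorm 2 \<Omega> (wgrad \<Omega> \<phi>)"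
  proof (rule Lnorm_cong_AE)
    show "AE x in M. tgrad \<phi> x = wgrad \<Omega> \<phi> x" using test_fun_H1(2)[OF \<phi>] by eventually_elim simp
  qed (intro Lspace_2_measurable test_fun_L2[OF open_\<Omega> bounded_\<Omega> \<phi>] wgrad test_fun_H1(1) \<phi>)+
  finally show ?thesis .
qed

text \<open>The strict gap between \<delta> and the gradient norm of \<open>f\<close> is the error
  budget that keeps all approximants below \<delta>. Pointwise convergence, needed for Fatou's
  lemma, holds along a subsequence of an L2 convergent sequence.\<close>

lemma H10_approx:
  assumes f: "f \<in> H10 \<Omega>" and \<delta>: "\<delta> > Lnorm 2 \<Omega> (wgrad \<Omega> f)"
  shows "\<exists>\<phi>. (\<forall>n::nat. \<phi> n \<in> test_fun \<Omega> \<and> Lnorm 2 \<Omega> (wgrad \<Omega> (\<phi> n)) \<le> \<delta>) \<and> (AE x in M. (\<lambda>n. \<phi> n x) \<longlonglongrightarrow> f x)"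
proof -
  define e where "e n = (\<delta> - Lnorm 2 \<Omega> (wgrad \<Omega> f)) * (1 / real (Suc n))" for n
  have e: "e n > 0" "e n \<le> \<delta> - Lnorm 2 \<Omega> (wgrad \<Omega> f)" for n
    using \<delta> mult_left_le[of "1 / real (Suc n)" "\<delta> - Lnorm 2 \<Omega> (wgrad \<Omega> f)"] unfolding e_def by simp_all
  have e0: "e \<longlonglongrightarrow> 0" unfolding e_def by (intro tendsto_mult_right_zero LIMSEQ_Suc[OF lim_1_over_n])
  have "\<forall>n. \<exists>\<phi>. \<phi> \<in> test_fun \<Omega> \<and> H1norm \<Omega> (\<lambda>x. f x - \<phi> x) < e n"
    using f e(1) unfolding H10_def by blast
  then obtain \<phi> where \<phi>: "\<And>n. \<phi> n \<in> test_fun \<Omega>" "\<And>n. H1norm \<Omega> (\<lambda>x. f x - \<phi> n x) < e n" by metis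
  note f1 = H10_H1[OF f]
  note \<phi>1 = test_fun_H1(1)[OF \<phi>(1)]
  have bd: "Lnorm 2 \<Omega> (wgrad \<Omega> (\<phi> n)) \<le> \<delta>" for n
  proof -
    note d1 = H1_diff[OF f1 \<phi>1[of n]]
    have "Lnorm 2 \<Omega> (wgrad \<Omega> (\<phi> n)) = Lnorm 2 \<Omega> (wgrad \<Omega> (\<lambda>x. f x - (f x - \<phi> n x)))" by simp
    also have "\<dots> = Lnorm 2 \<Omega> (\<lambda>x. wgrad \<Omega> f x - wgrad \<Omega> (\<lambda>x. f x - \<phi> n x) x)" by (rule Lnorm_wgrad_diff[OF f1 d1])
    also have "\<dots> \<le> Lnorm 2 \<Omega> (wgrad \<Omega> f) + Lnorm 2 \<Omega> (wgrad \<Omega> (\<lambda>x. f x - \<phi> n x))"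
      by (intro Lnorm_2_triangle wgrad f1 d1)
    also have "\<dots> \<le> Lnorm 2 \<Omega> (wgrad \<Omega> f) + e n"
      using H1norm_bounds(2)[of "\<lambda>x. f x - \<phi> n x"] \<phi>(2)[of n] by simp
    finally show ?thesis using e(2)[of n] by simp
  qed
  have L2: "(\<lambda>x. f x - \<phi> n x) \<in> Lspace 2 \<Omega>" for n by (intro H1_L2 H1_diff f1 \<phi>1)
  have "(\<lambda>n. Lnorm 2 \<Omega> (\<lambda>x. f x - \<phi> n x)) \<longlonglongrightarrow> 0"
  proof (rule Lim_null_comparison[OF always_eventually e0], rule allI)
    show "norm (Lnorm 2 \<Omega> (\<lambda>x. f x - \<phi> n x)) \<le> e n" for n
      using H1norm_bounds(1)[of "\<lambda>x. f x - \<phi> n x"] \<phi>(2)[of n] Lnorm_nonneg[of 2 \<Omega> "\<lambda>x. f x - \<phi> n x"] by simp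
  qed
  then have "(\<lambda>n. (Lnorm 2 \<Omega> (\<lambda>x. f x - \<phi> n x))\<^sup>2) \<longlonglongrightarrow> 0" 
    using tendsto_power[of "\<lambda>n. Lnorm 2 \<Omega> (\<lambda>x. f x - \<phi> n x)" 0 sequentially 2] by simp
  then have "(\<lambda>n. LINT x|M. norm ((f x - \<phi> n x)\<^sup>2)) \<longlonglongrightarrow> 0"
    unfolding Lnorm_2_sq L2inner_def by (simp add: power2_eq_square)
  moreover have "integrable M (\<lambda>x. (f x - \<phi> n x)\<^sup>2)" for n
    using L2[of n] unfolding Lspace_2_iff by simp
  ultimately obtain s :: "nat \<Rightarrow> nat" where s: "AE x in M. (\<lambda>n. (f x - \<phi> (s n) x)\<^sup>2) \<longlonglongrightarrow> 0"
    using tendsto_L1_AE_subseq[of M "\<lambda>n x. (f x - \<phi> n x)\<^sup>2"] by blast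
  have "AE x in M. (\<lambda>n. \<phi> (s n) x) \<longlonglongrightarrow> f x"
    using s
  proof eventually_elim
    case (elim x)
    then have "(\<lambda>n. sqrt ((f x - \<phi> (s n) x)\<^sup>2)) \<longlonglongrightarrow> sqrt 0" by (rule tendsto_real_sqrt)
    then have "(\<lambda>n. \<bar>f x - \<phi> (s n) x\<bar>) \<longlonglongrightarrow> 0" by simp
    then have "(\<lambda>n. f x - \<phi> (s n) x) \<longlonglongrightarrow> 0" by (rule tendsto_rabs_zero_cancel)
    then have "(\<lambda>n. f x - (f x - \<phi> (s n) x)) \<longlonglongrightarrow> f x - 0" by (intro tendsto_diff tendsto_const)
    then show ?case by simp
  qed
  then show ?thesis using \<phi>(1) bd by (intro exI[of _ "\<lambda>n. \<phi> (s n)"]) auto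
qed

text \<open>Fatou's lemma transfers the bound from test functions with any \<delta> above the
  gradient norm; letting \<delta> decrease to that norm gives the homogeneous inequality, including
  the case of a zero gradient.\<close>

theorem sobolev_subcritical:
  assumes n: "DIM('a) \<ge> 3" and k: "2 < k" "k < 2 * real DIM('a) / (real DIM('a) - 2)"
  shows "\<exists>C\<ge>0. \<forall>f\<in>H10 \<Omega>. integrable M (\<lambda>x. \<bar>f x\<bar> powr k) \<and>
     (LINT x|M. \<bar>f x\<bar> powr k) \<le> C * Lnorm 2 \<Omega> (wgrad \<Omega> f) powr k"
proof -
  obtain C where C: "C \<ge> 0" "\<And>\<phi> \<delta>. \<phi> \<in> test_fun \<Omega> \<Longrightarrow> \<delta> > 0 \<Longrightarrow> (\<integral>\<^sup>+y. ennreal ((norm (tgrad \<phi> y))\<^sup>2) \<partial>lborel) \<le> ennreal (\<delta>\<^sup>2)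
     \<Longrightarrow> (\<integral>\<^sup>+x. ennreal (\<bar>\<phi> x\<bar> powr k) * indicator \<Omega> x \<partial>lborel) \<le> ennreal (C * \<delta> powr k)"
    using sobolev_test_fun[OF n k] by blast
  have main: "(\<integral>\<^sup>+x. ennreal (\<bar>f x\<bar> powr k) \<partial>M) \<le> ennreal (C * \<delta> powr k)"
    if f: "f \<in> H10 \<Omega>" and \<delta>: "\<delta> > Lnorm 2 \<Omega> (wgrad \<Omega> f)" for f \<delta>
  proof -
    have \<delta>0: "\<delta> > 0" using \<delta> Lnorm_nonneg[of 2 \<Omega> "wgrad \<Omega> f"] by linarith
    obtain \<phi> where \<phi>: "\<And>n::nat. \<phi> n \<in> test_fun \<Omega>" "\<And>n. Lnorm 2 \<Omega> (wgrad \<Omega> (\<phi> n)) \<le> \<delta>"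
      and lim: "AE x in M. (\<lambda>n. \<phi> n x) \<longlonglongrightarrow> f x" using H10_approx[OF f \<delta>] by blast
    have bd: "(\<integral>\<^sup>+x. ennreal (\<bar>\<phi> n x\<bar> powr k) \<partial>M) \<le> ennreal (C * \<delta> powr k)" for n
    proof -
      have [measurable]: "\<phi> n \<in> borel_measurable borel" "\<Omega> \<in> sets borel"
        using borel_measurable_continuous_onI[OF smooth_continuous[OF test_funD(1)[OF \<phi>(1)]]] open_\<Omega> by auto
      have "(\<integral>\<^sup>+x. ennreal (\<bar>\<phi> n x\<bar> powr k) \<partial>M) = (\<integral>\<^sup>+x. ennreal (\<bar>\<phi> n x\<bar> powr k) * indicator \<Omega> x \<partial>lebesgue)"
        by (rule nn_integral_restrict_space) (use open_\<Omega> in simp)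
      also have "\<dots> = (\<integral>\<^sup>+x. ennreal (\<bar>\<phi> n x\<bar> powr k) * indicator \<Omega> x \<partial>lborel)"
        by (rule nn_integral_completion)
      also have "\<dots> \<le> ennreal (C * \<delta> powr k)"
        by (intro C(2) \<phi> \<delta>0, unfold test_fun_grad_nn_integral[OF \<phi>(1)])
          (intro ennreal_leI power_mono \<phi> Lnorm_nonneg)
      finally show ?thesis .
    qed
    have m: "\<phi> n \<in> borel_measurable M" for n
      by (intro continuous_measurable_lebesgue_on smooth_continuous test_funD(1)[OF \<phi>(1)])
    have "(\<integral>\<^sup>+x. ennreal (\<bar>f x\<bar> powr k) \<partial>M) \<le> (\<integral>\<^sup>+x. liminf (\<lambda>n. ennreal (\<bar>\<phi> n x\<bar> powr k)) \<partial>M)"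
    proof (rule nn_integral_mono_AE)
      show "AE x in M. ennreal (\<bar>f x\<bar> powr k) \<le> liminf (\<lambda>n. ennreal (\<bar>\<phi> n x\<bar> powr k))"
        using lim
      proof eventually_elim
        case (elim x)
        have "(\<lambda>n. \<bar>\<phi> n x\<bar> powr k) \<longlonglongrightarrow> \<bar>f x\<bar> powr k"
          by (rule tendsto_powr'[OF tendsto_rabs[OF elim] tendsto_const]) (use k in auto)
        then have "(\<lambda>n. ennreal (\<bar>\<phi> n x\<bar> powr k)) \<longlonglongrightarrow> ennreal (\<bar>f x\<bar> powr k)" by (rule tendsto_ennrealI)
        from lim_imp_Liminf[OF trivial_limit_sequentially this] show ?case by (rule eq_refl[OF sym])
      qed
    qed
    also have "\<dots> \<le> liminf (\<lambda>n. \<integral>\<^sup>+x. ennreal (\<bar>\<phi> n x\<bar> powr k) \<partial>M)"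
      by (rule nn_integral_liminf) (use m in measurable)
    also have "\<dots> \<le> ennreal (C * \<delta> powr k)"
      by (rule order_trans[OF Liminf_le_Limsup Limsup_bounded]) (simp_all add: bd)
    finally show ?thesis .
  qed
  have "integrable M (\<lambda>x. \<bar>f x\<bar> powr k) \<and> (LINT x|M. \<bar>f x\<bar> powr k) \<le> C * Lnorm 2 \<Omega> (wgrad \<Omega> f) powr k"
    if f: "f \<in> H10 \<Omega>" for f
  proof
    let ?N = "Lnorm 2 \<Omega> (wgrad \<Omega> f)"
    have [measurable]: "f \<in> borel_measurable M" by (intro Lspace_2_measurable H10_L2 f)
    have "(\<integral>\<^sup>+x. ennreal (\<bar>f x\<bar> powr k) \<partial>M) < \<infinity>"
      by (rule le_less_trans[OF main[OF f, of "?N + 1"]]) auto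
    then show i: "integrable M (\<lambda>x. \<bar>f x\<bar> powr k)" by (intro integrableI_nonneg) auto
    have bd: "(LINT x|M. \<bar>f x\<bar> powr k) \<le> C * \<delta> powr k" if \<delta>: "\<delta> > ?N" for \<delta>
    proof -
      have "ennreal (LINT x|M. \<bar>f x\<bar> powr k) = (\<integral>\<^sup>+x. ennreal (\<bar>f x\<bar> powr k) \<partial>M)"
        by (rule nn_integral_eq_integral[symmetric, OF i]) simp
      also have "\<dots> \<le> ennreal (C * \<delta> powr k)" by (rule main[OF f \<delta>])
      finally show ?thesis using C(1) by (simp add: ennreal_le_iff)
    qed
    have "((\<lambda>\<delta>. C * \<delta> powr k) \<longlongrightarrow> C * ?N powr k) (at_right ?N)"
      by (intro tendsto_mult tendsto_const tendsto_powr' tendsto_ident_at)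
        (use k Lnorm_nonneg[of 2 \<Omega> "wgrad \<Omega> f"] in \<open>auto simp: eventually_at_filter\<close>)
    then show "(LINT x|M. \<bar>f x\<bar> powr k) \<le> C * ?N powr k"
      by (rule tendsto_lowerbound) (use bd in \<open>auto simp: eventually_at_filter\<close>)
  qed
  then show ?thesis using C(1) by blast
qed

text \<open>On a bounded domain it follows from the Sobolev inequality: y^2 \<le> 1 + y^k with y =
  |f|/\<delta>, integrated over a set of finite measure. Again \<delta> decreases to the gradient
  norm.\<close>

theorem poincare:
  assumes n: "DIM('a) \<ge> 3"
  shows "\<exists>C>0. \<forall>f\<in>H10 \<Omega>. (Lnorm 2 \<Omega> f)\<^sup>2 \<le> C * (Lnorm 2 \<Omega> (wgrad \<Omega> f))\<^sup>2"
proof -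
  \<comment> \<open>The midpoint between 2 and the critical exponent; any exponent strictly between
    them would serve.\<close>
  define k where "k = (2 + 2 * real DIM('a) / (real DIM('a) - 2)) / 2"
  have "2 * real DIM('a) / (real DIM('a) - 2) > 2" using n by (simp add: field_simps)
  then have k: "2 < k" "k < 2 * real DIM('a) / (real DIM('a) - 2)" by (simp_all add: k_def)
  obtain C where C: "C \<ge> 0" "\<And>f. f \<in> H10 \<Omega> \<Longrightarrow> integrable M (\<lambda>x. \<bar>f x\<bar> powr k) \<and>
     (LINT x|M. \<bar>f x\<bar> powr k) \<le> C * Lnorm 2 \<Omega> (wgrad \<Omega> f) powr k"
    using sobolev_subcritical[OF n k] by blast
  define V where "V = measure M (space M)"
  have "(Lnorm 2 \<Omega> f)\<^sup>2 \<le> (V + C + 1) * (Lnorm 2 \<Omega> (wgrad \<Omega> f))\<^sup>2" if f: "f \<in> H10 \<Omega>" for f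
  proof -
    let ?N = "Lnorm 2 \<Omega> (wgrad \<Omega> f)"
    have N: "?N \<ge> 0" by (rule Lnorm_nonneg)
    have bd: "(Lnorm 2 \<Omega> f)\<^sup>2 \<le> (V + C + 1) * \<delta>\<^sup>2" if \<delta>: "\<delta> > ?N" for \<delta>
    proof -
      have \<delta>0: "\<delta> > 0" using \<delta> N by linarith
      have i: "integrable M (\<lambda>x. \<bar>f x\<bar> powr k)" using C(2)[OF f] by blast
      have "(LINT x|M. f x * f x) \<le> (LINT x|M. \<delta>\<^sup>2 * (1 + \<bar>f x\<bar> powr k / \<delta> powr k))"
      proof (rule integral_mono)
        show "integrable M (\<lambda>x. f x * f x)" using L2_integrable_inner[OF H10_L2[OF f] H10_L2[OF f]] by simp
        show "integrable M (\<lambda>x. \<delta>\<^sup>2 * (1 + \<bar>f x\<bar> powr k / \<delta> powr k))" using i by simp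
        show "f x * f x \<le> \<delta>\<^sup>2 * (1 + \<bar>f x\<bar> powr k / \<delta> powr k)" for x
        proof -
          have "(\<bar>f x\<bar> / \<delta>)\<^sup>2 \<le> 1 + (\<bar>f x\<bar> / \<delta>) powr k"
          proof (cases "\<bar>f x\<bar> / \<delta> \<le> 1")
            case True
            have "(\<bar>f x\<bar> / \<delta>)\<^sup>2 \<le> 1\<^sup>2" using True \<delta>0 by (intro power_mono) auto
            then show ?thesis by (simp add: add_increasing2)
          next
            case False
            then have "(\<bar>f x\<bar> / \<delta>) powr 2 \<le> (\<bar>f x\<bar> / \<delta>) powr k" using k by (intro powr_mono) auto
            then show ?thesis using \<delta>0 by simp
          qed
          then have "\<delta>\<^sup>2 * (\<bar>f x\<bar> / \<delta>)\<^sup>2 \<le> \<delta>\<^sup>2 * (1 + \<bar>f x\<bar> powr k / \<delta> powr k)"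
            using \<delta>0 by (simp add: powr_divide)
          then show ?thesis using \<delta>0 by (simp add: power_divide power2_eq_square)
        qed
      qed
      also have "\<dots> = \<delta>\<^sup>2 * (V + (LINT x|M. \<bar>f x\<bar> powr k) / \<delta> powr k)"
        using i by (simp add: V_def)
      also have "\<dots> \<le> \<delta>\<^sup>2 * (V + C)"
      proof -
        have "(LINT x|M. \<bar>f x\<bar> powr k) \<le> C * ?N powr k" using C(2)[OF f] by blast
        also have "\<dots> \<le> C * \<delta> powr k" using \<delta> N k C(1) by (intro mult_left_mono powr_mono2) auto
        finally show ?thesis using \<delta>0 by (intro mult_left_mono add_left_mono) (auto simp: divide_le_eq)
      qed
      also have "\<dots> \<le> (V + C + 1) * \<delta>\<^sup>2" by (simp add: algebra_simps)
      finally show ?thesis by (simp add: Lnorm_2_sq L2inner_def)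
    qed
    have "((\<lambda>\<delta>. (V + C + 1) * \<delta>\<^sup>2) \<longlongrightarrow> (V + C + 1) * ?N\<^sup>2) (at_right ?N)"
      by (intro tendsto_intros)
    then show ?thesis
      by (rule tendsto_lowerbound) (use bd in \<open>auto simp: eventually_at_filter\<close>)
  qed
  moreover have "V + C + 1 > 0" using C(1) by (simp add: V_def add_nonneg_pos)
  ultimately show ?thesis by blast
qed

end

section \<open>The logarithmic source\<close>

definition src :: "real \<Rightarrow> real \<Rightarrow> real" where
  "src p s = \<bar>s\<bar> powr (p - 2) * s * ln \<bar>s\<bar>"

definition dsrc :: "real \<Rightarrow> real \<Rightarrow> real" where
  "dsrc p s = \<bar>s\<bar> powr (p - 2) * ((p - 1) * ln \<bar>s\<bar> + 1)"

text \<open>The antiderivative of \<open>src p\<close> that vanishes at 0. Its integral is the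
  difference of the two source terms of the energy. At \<open>s = 0\<close> the convention
  \<open>0 powr _ = 0\<close> gives \<open>src\<close>, \<open>dsrc\<close> and \<open>pot\<close>
  their limit value 0 when p > 2.\<close>

definition pot :: "real \<Rightarrow> real \<Rightarrow> real" where
  "pot p s = \<bar>s\<bar> powr p * ln \<bar>s\<bar> / p - \<bar>s\<bar> powr p / p\<^sup>2"

text \<open>The inequality ln y \<le> y - 1 at y = x^(-a/2) spends half of the power on the
  logarithm.\<close>

lemma powr_ln_small:
  fixes x a :: real
  assumes "0 < x" "x \<le> 1" "a > 0"
  shows "\<bar>x powr a * ln x\<bar> \<le> (2 / a) * x powr (a / 2)"
proof -
  have "ln (x powr (- (a / 2))) \<le> x powr (- (a / 2))"
    using ln_le_minus_one[of "x powr (- (a / 2))"] assms by simp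
  then have "- ln x \<le> (2 / a) * x powr (- (a / 2))" using assms by (simp add: ln_powr field_simps)
  then have "x powr a * (- ln x) \<le> x powr a * ((2 / a) * x powr (- (a / 2)))" by (rule mult_left_mono) simp
  also have "\<dots> = (2 / a) * (x powr a * x powr (- (a / 2)))" by simp
  also have "x powr a * x powr (- (a / 2)) = x powr (a / 2)" unfolding powr_add[symmetric] by simp
  finally show ?thesis using assms by (simp add: abs_mult)
qed

text \<open>Below 1 the logarithm costs half of the exponent p1 - 2, above 1 the gap m - p2. The
  bound is uniform for \<open>p\<close> between \<open>p1\<close> and \<open>p2\<close>, as a
  variable exponent requires.\<close>

lemma powr_ln_bound:
  fixes x p p1 p2 m :: real
  assumes x: "x > 0" and p: "2 < p1" "p1 \<le> p" "p \<le> p2" "p2 < m"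
  shows "\<bar>x powr (p - 2) * ln x\<bar> \<le> 2 / (p1 - 2) + x powr (m - 2) / (m - p2)"
proof (cases "x \<le> 1")
  case True
  have "\<bar>x powr (p - 2) * ln x\<bar> = x powr (p - 2) * \<bar>ln x\<bar>" by (simp add: abs_mult)
  also have "\<dots> \<le> x powr (p1 - 2) * \<bar>ln x\<bar>"
    using x True p by (intro mult_right_mono powr_mono') auto
  also have "\<dots> = \<bar>x powr (p1 - 2) * ln x\<bar>" by (simp add: abs_mult)
  also have "\<dots> \<le> (2 / (p1 - 2)) * x powr ((p1 - 2) / 2)" using x True p by (intro powr_ln_small) auto
  also have "\<dots> \<le> (2 / (p1 - 2)) * 1" using x True p by (intro mult_left_mono powr_le1) auto
  finally have "\<bar>x powr (p - 2) * ln x\<bar> \<le> 2 / (p1 - 2)" by simp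
  moreover have "x powr (m - 2) / (m - p2) \<ge> 0" using p by simp
  ultimately show ?thesis by linarith
next
  case False
  have "ln (x powr (m - p2)) \<le> x powr (m - p2)"
    using ln_le_minus_one[of "x powr (m - p2)"] x by simp
  then have l: "ln x \<le> x powr (m - p2) / (m - p2)" using x p by (simp add: ln_powr field_simps)
  have "x powr (p - 2) * ln x \<le> x powr (p2 - 2) * (x powr (m - p2) / (m - p2))"
    using False p l by (intro mult_mono powr_mono) auto
  also have "\<dots> = x powr (m - 2) / (m - p2)" by (simp add: powr_add[symmetric])
  finally have "\<bar>x powr (p - 2) * ln x\<bar> \<le> x powr (m - 2) / (m - p2)" using False by simp
  moreover have "2 / (p1 - 2) \<ge> 0" using p by simp
  ultimately show ?thesis by linarith
qed

lemma even_odd_deriv_neg: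
  assumes d: "(f has_real_derivative D) (at (- s))" and c: "c = 1 \<or> c = (-1::real)"
    and sym: "\<And>x. f x = c * f (- x)"
  shows "(f has_real_derivative (- c * D)) (at s)"
proof -
  have "((\<lambda>x. c * f (- x)) has_real_derivative (c * (D * - 1))) (at s)"
    by (intro DERIV_cmult DERIV_chain2[where f = f and g = "\<lambda>x. - x", OF d]) (auto intro!: derivative_eq_intros)
  moreover have "(\<lambda>x. c * f (- x)) = f" by (intro ext) (rule sym[symmetric])
  ultimately show ?thesis by (simp only: mult_minus_right mult_1_right mult_minus_left)
qed

text \<open>Away from 0 this is the product rule and oddness; at 0 the difference quotient is
  |x|^(p-2) ln |x|, which tends to 0 because p > 2.\<close>

lemma src_deriv:
  assumes p: "p > 2"
  shows "(src p has_real_derivative dsrc p s) (at s)"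
proof -
  have pos: "(src p has_real_derivative dsrc p s) (at s)" if s: "s > 0" for s
  proof -
    have d: "((\<lambda>s. s powr (p - 2) * s * ln s) has_real_derivative
        (((p - 2) * s powr (p - 2 - 1)) * s + s powr (p - 2)) * ln s + s powr (p - 2) * s * (1 / s)) (at s)"
      using s by (auto intro!: derivative_eq_intros has_real_derivative_powr simp: field_simps)
    have e: "s powr (p - 2 - 1) * s = s powr (p - 2)"
      using s powr_add[of s "p - 2 - 1" 1] by simp
    have "(((p - 2) * s powr (p - 2 - 1)) * s + s powr (p - 2)) * ln s + s powr (p - 2) * s * (1 / s) = dsrc p s"
      using s unfolding mult.assoc e by (simp add: dsrc_def algebra_simps)
    with d have "((\<lambda>s. s powr (p - 2) * s * ln s) has_real_derivative dsrc p s) (at s)" by simp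
    then show ?thesis
    proof (rule DERIV_cong_ev[THEN iffD1, rotated -1])
      show "\<forall>\<^sub>F x in nhds s. x powr (p - 2) * x * ln x = src p x"
        using eventually_nhds_in_open[of "{0<..}" s] s by (auto simp: src_def elim!: eventually_mono)
    qed simp_all
  qed
  consider "s > 0" | "s < 0" | "s = 0" by linarith
  then show ?thesis
  proof cases
    case 2
    have "(src p has_real_derivative (- (- 1) * dsrc p (- s))) (at s)"
      by (rule even_odd_deriv_neg[OF pos]) (use 2 in \<open>auto simp: src_def\<close>)
    then show ?thesis by (simp add: dsrc_def)
  next
    case 3
    have "((\<lambda>x. src p x / x) \<longlongrightarrow> 0) (at 0)"
    proof (rule Lim_null_comparison)
      have "eventually (\<lambda>x::real. x \<in> {-1<..<1}) (at 0)"
        by (rule eventually_at_in_open') auto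
      moreover have "eventually (\<lambda>x::real. x \<noteq> 0) (at 0)" by (simp add: eventually_at_filter)
      ultimately show "\<forall>\<^sub>F x in at 0. norm (src p x / x) \<le> (2 / (p - 2)) * \<bar>x\<bar> powr ((p - 2) / 2)"
      proof eventually_elim
        case (elim x)
        then have "src p x / x = \<bar>x\<bar> powr (p - 2) * ln \<bar>x\<bar>" by (simp add: src_def)
        moreover have "\<bar>x\<bar> \<le> 1" using elim by auto
        ultimately show ?case using powr_ln_small[of "\<bar>x\<bar>" "p - 2"] elim(2) p by simp
      qed
      have "((\<lambda>x::real. (2 / (p - 2)) * \<bar>x\<bar> powr ((p - 2) / 2)) \<longlongrightarrow> (2 / (p - 2)) * \<bar>0\<bar> powr ((p - 2) / 2)) (at 0)"
        using p by (intro tendsto_mult tendsto_const tendsto_powr' tendsto_rabs tendsto_ident_at) auto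
      then show "((\<lambda>x::real. (2 / (p - 2)) * \<bar>x\<bar> powr ((p - 2) / 2)) \<longlongrightarrow> 0) (at 0)" by simp
    qed
    then show ?thesis using 3 by (simp add: has_field_derivative_iff src_def dsrc_def)
  qed (rule pos)
qed

lemma pot_deriv:
  assumes p: "p > 2"
  shows "(pot p has_real_derivative src p s) (at s)"
proof -
  have pos: "(pot p has_real_derivative src p s) (at s)" if s: "s > 0" for s
  proof -
    have d: "((\<lambda>s. s powr p * ln s / p - s powr p / p\<^sup>2) has_real_derivative
        ((p * s powr (p - 1)) * ln s + 1 / s * s powr p) / p - (p * s powr (p - 1)) / p\<^sup>2) (at s)"
      by (intro DERIV_diff DERIV_cdivide DERIV_mult has_real_derivative_powr DERIV_ln_divide s)
    have e: "1 / s * s powr p = s powr (p - 1)" using s by (simp add: powr_diff)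
    have e2: "s powr (p - 1) = s powr (p - 2) * s"
      using s powr_add[of s "p - 2" 1] by simp
    have "((p * s powr (p - 1)) * ln s + 1 / s * s powr p) / p - (p * s powr (p - 1)) / p\<^sup>2 = s powr (p - 1) * ln s"
      unfolding e using p by (simp add: field_simps power2_eq_square)
    also have "\<dots> = src p s" using s by (simp add: src_def e2)
    finally have "((\<lambda>s. s powr p * ln s / p - s powr p / p\<^sup>2) has_real_derivative src p s) (at s)" using d by simp
    then show ?thesis
    proof (rule DERIV_cong_ev[THEN iffD1, rotated -1])
      show "\<forall>\<^sub>F x in nhds s. x powr p * ln x / p - x powr p / p\<^sup>2 = pot p x"
        using eventually_nhds_in_open[of "{0<..}" s] s by (auto simp: pot_def elim!: eventually_mono)
    qed simp_all
  qed
  consider "s > 0" | "s < 0" | "s = 0" by linarith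
  then show ?thesis
  proof cases
    case 2
    have "(pot p has_real_derivative (- 1 * src p (- s))) (at s)"
      by (rule even_odd_deriv_neg[OF pos]) (use 2 in \<open>auto simp: pot_def\<close>)
    then show ?thesis by (simp add: src_def)
  next
    case 3
    have "((\<lambda>x. pot p x / x) \<longlongrightarrow> 0) (at 0)"
    proof (rule Lim_null_comparison)
      have "eventually (\<lambda>x::real. x \<in> {-1<..<1}) (at 0)"
        by (rule eventually_at_in_open') auto
      moreover have "eventually (\<lambda>x::real. x \<noteq> 0) (at 0)" by (simp add: eventually_at_filter)
      ultimately show "\<forall>\<^sub>F x in at 0. norm (pot p x / x) \<le> (2 / (p - 1)) * \<bar>x\<bar> powr ((p - 1) / 2) + \<bar>x\<bar> powr (p - 1)"
      proof eventually_elim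
        case (elim x)
        have e: "\<bar>x\<bar> powr p = \<bar>x\<bar> powr (p - 1) * \<bar>x\<bar>" using elim powr_add[of "\<bar>x\<bar>" "p - 1" 1] by simp
        have "\<bar>pot p x\<bar> \<le> \<bar>\<bar>x\<bar> powr (p - 1) * ln \<bar>x\<bar>\<bar> * \<bar>x\<bar> / p + \<bar>x\<bar> powr (p - 1) * \<bar>x\<bar> / p\<^sup>2"
          unfolding pot_def e using p by (intro order_trans[OF abs_triangle_ineq4]) (simp add: abs_mult mult_ac)
        also have "\<dots> \<le> \<bar>\<bar>x\<bar> powr (p - 1) * ln \<bar>x\<bar>\<bar> * \<bar>x\<bar> / 1 + \<bar>x\<bar> powr (p - 1) * \<bar>x\<bar> / 1"
          using p by (intro add_mono divide_left_mono) (auto simp: one_le_power)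
        finally have "\<bar>pot p x\<bar> / \<bar>x\<bar> \<le> \<bar>\<bar>x\<bar> powr (p - 1) * ln \<bar>x\<bar>\<bar> + \<bar>x\<bar> powr (p - 1)"
          using elim by (simp add: divide_le_eq algebra_simps)
        moreover have "\<bar>\<bar>x\<bar> powr (p - 1) * ln \<bar>x\<bar>\<bar> \<le> (2 / (p - 1)) * \<bar>x\<bar> powr ((p - 1) / 2)"
          by (rule powr_ln_small) (use elim p in auto)
        ultimately show ?case unfolding real_norm_def abs_divide by linarith
      qed
      have "((\<lambda>x::real. (2 / (p - 1)) * \<bar>x\<bar> powr ((p - 1) / 2) + \<bar>x\<bar> powr (p - 1)) \<longlongrightarrow> (2 / (p - 1)) * \<bar>0\<bar> powr ((p - 1) / 2) + \<bar>0\<bar> powr (p - 1)) (at 0)"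
        using p by (intro tendsto_add tendsto_mult tendsto_const tendsto_powr' tendsto_rabs tendsto_ident_at) auto
      then show "((\<lambda>x::real. (2 / (p - 1)) * \<bar>x\<bar> powr ((p - 1) / 2) + \<bar>x\<bar> powr (p - 1)) \<longlongrightarrow> 0) (at 0)" by simp
    qed
    then show ?thesis using 3 by (simp add: has_field_derivative_iff src_def pot_def)
  qed (rule pos)
qed

text \<open>A mean value theorem indifferent to the order of the end points. The bound on the size
  of \<theta> serves growth estimates, the bound on its distance from \<open>r\<close> serves the
  Taylor remainder.\<close>

lemma mvt_between:
  fixes f :: "real \<Rightarrow> real"
  assumes d: "\<And>x. (f has_real_derivative f' x) (at x)"
  shows "\<exists>\<theta>. \<bar>\<theta> - r\<bar> \<le> \<bar>s - r\<bar> \<and> \<bar>\<theta>\<bar> \<le> max \<bar>s\<bar> \<bar>r\<bar> \<and> f s - f r = f' \<theta> * (s - r)"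
proof -
  consider "s = r" | "r < s" | "s < r" by linarith
  then show ?thesis
  proof cases
    case 1 then show ?thesis by (intro exI[of _ r]) auto
  next
    case 2
    from MVT2[OF 2 d] obtain z where "r < z" "z < s" "f s - f r = (s - r) * f' z" by blast
    then show ?thesis by (intro exI[of _ z]) auto
  next
    case 3
    from MVT2[OF 3 d] obtain z where z: "s < z" "z < r" "f r - f s = (r - s) * f' z" by blast
    then have "f s - f r = f' z * (s - r)" by (simp add: algebra_simps)
    with z show ?thesis by (intro exI[of _ z]) auto
  qed
qed

section \<open>Growth of the source, uniformly in the exponent\<close>

locale growth =
  fixes p1 p2 m :: real
  assumes p1: "2 < p1" and p2m: "p2 < m" and m2: "2 < m"
begin

definition "C0 = m * (2 / (p1 - 2)) + m / (m - p2) + 1"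

lemma C0_pos: "C0 > 0"
proof -
  have "m * (2 / (p1 - 2)) \<ge> 0" "m / (m - p2) \<ge> 0" using p1 p2m m2 by simp_all
  then show ?thesis unfolding C0_def by linarith
qed

lemma dsrc_bound:
  assumes p: "p1 \<le> p" "p \<le> p2"
  shows "\<bar>dsrc p s\<bar> \<le> C0 * (1 + \<bar>s\<bar> powr (m - 2))"
proof (cases "s = 0")
  case True then show ?thesis using C0_pos by (simp add: dsrc_def)
next
  case False
  define x where "x = \<bar>s\<bar>"
  have x: "x > 0" using False by (simp add: x_def)
  define y where "y = x powr (m - 2)"
  have y: "y \<ge> 0" by (simp add: y_def)
  have 1: "\<bar>x powr (p - 2) * ln x\<bar> \<le> 2 / (p1 - 2) + y / (m - p2)"
    unfolding y_def by (rule powr_ln_bound[OF x p1 p p2m])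
  have 2: "x powr (p - 2) \<le> 1 + y"
  proof (cases "x \<le> 1")
    case True
    then have "x powr (p - 2) \<le> 1" using x p p1 by (intro powr_le1) auto
    then show ?thesis using y by simp
  next
    case False
    then have "x powr (p - 2) \<le> y" unfolding y_def using p p2m by (intro powr_mono) auto
    then show ?thesis by simp
  qed
  have "dsrc p s = (p - 1) * (x powr (p - 2) * ln x) + x powr (p - 2)"
    by (simp add: dsrc_def x_def algebra_simps)
  then have "\<bar>dsrc p s\<bar> \<le> (p - 1) * \<bar>x powr (p - 2) * ln x\<bar> + x powr (p - 2)"
    using abs_triangle_ineq[of "(p - 1) * (x powr (p - 2) * ln x)" "x powr (p - 2)"] p p1 by (simp add: abs_mult)
  also have "\<dots> \<le> m * (2 / (p1 - 2) + y / (m - p2)) + (1 + y)"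
    using p p2m p1 1 2 by (intro add_mono mult_mono) auto
  also have "\<dots> \<le> C0 * (1 + y)"
  proof -
    have "(a + b + 1) * (1 + y) = (a + b * y + (1 + y)) + (a * y + b)" for a b :: real
      by (simp add: algebra_simps)
    then have "C0 * (1 + y) = (m * (2 / (p1 - 2)) + m / (m - p2) * y + (1 + y)) + (m * (2 / (p1 - 2)) * y + m / (m - p2))"
      unfolding C0_def .
    moreover have "m * (2 / (p1 - 2)) * y + m / (m - p2) \<ge> 0" using p1 p2m m2 y by simp
    moreover have "m * (2 / (p1 - 2) + y / (m - p2)) + (1 + y) = m * (2 / (p1 - 2)) + m / (m - p2) * y + (1 + y)"
      by (simp add: distrib_left)
    ultimately show ?thesis by linarith
  qed
  finally show ?thesis by (simp add: y_def x_def)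
qed

lemma powr_between: "\<bar>t\<bar> \<le> max \<bar>s\<bar> \<bar>r\<bar> \<Longrightarrow> \<bar>t\<bar> powr (m - 2) \<le> \<bar>s\<bar> powr (m - 2) + \<bar>r\<bar> powr (m - 2)"
proof -
  assume t: "\<bar>t\<bar> \<le> max \<bar>s\<bar> \<bar>r\<bar>"
  have "\<bar>t\<bar> powr (m - 2) \<le> \<bar>s\<bar> powr (m - 2) \<or> \<bar>t\<bar> powr (m - 2) \<le> \<bar>r\<bar> powr (m - 2)"
    using t m2 by (cases "\<bar>s\<bar> \<le> \<bar>r\<bar>") (auto intro!: powr_mono2)
  then show ?thesis using powr_ge_zero[of "\<bar>s\<bar>" "m - 2"] powr_ge_zero[of "\<bar>r\<bar>" "m - 2"] by linarith
qed

lemma src_lipschitz: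
  assumes p: "p1 \<le> p" "p \<le> p2"
  shows "\<bar>src p s - src p r\<bar> \<le> C0 * ((1 + \<bar>s\<bar> powr (m - 2) + \<bar>r\<bar> powr (m - 2)) * \<bar>s - r\<bar>)"
proof -
  obtain t where t: "\<bar>t\<bar> \<le> max \<bar>s\<bar> \<bar>r\<bar>" "src p s - src p r = dsrc p t * (s - r)"
    using mvt_between[of "src p" "dsrc p" r s] src_deriv[of p] p p1 by auto
  have "\<bar>dsrc p t\<bar> \<le> C0 * (1 + \<bar>t\<bar> powr (m - 2))" by (rule dsrc_bound[OF p])
  also have "\<dots> \<le> C0 * (1 + \<bar>s\<bar> powr (m - 2) + \<bar>r\<bar> powr (m - 2))"
    using powr_between[OF t(1)] C0_pos by (intro mult_left_mono) auto
  finally have "\<bar>dsrc p t\<bar> * \<bar>s - r\<bar> \<le> C0 * (1 + \<bar>s\<bar> powr (m - 2) + \<bar>r\<bar> powr (m - 2)) * \<bar>s - r\<bar>"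
    by (rule mult_right_mono) simp
  then show ?thesis unfolding t(2) abs_mult by (simp add: mult.assoc)
qed

text \<open>The mean value theorem for \<open>pot\<close> leaves a difference of \<open>src\<close>
  at two points, to which the Lipschitz bound applies. Replacing the intermediate point in the
  weight by the end points costs the factor 2.\<close>

lemma pot_taylor:
  assumes p: "p1 \<le> p" "p \<le> p2"
  shows "\<bar>pot p s - pot p r - src p r * (s - r)\<bar> \<le> 2 * C0 * ((1 + \<bar>s\<bar> powr (m - 2) + \<bar>r\<bar> powr (m - 2)) * (s - r)\<^sup>2)"
proof -
  let ?W = "1 + \<bar>s\<bar> powr (m - 2) + \<bar>r\<bar> powr (m - 2)"
  obtain t where t: "\<bar>t - r\<bar> \<le> \<bar>s - r\<bar>" "\<bar>t\<bar> \<le> max \<bar>s\<bar> \<bar>r\<bar>" "pot p s - pot p r = src p t * (s - r)"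
    using mvt_between[of "pot p" "src p" r s] pot_deriv[of p] p p1 by auto
  have "\<bar>src p t - src p r\<bar> \<le> C0 * ((1 + \<bar>t\<bar> powr (m - 2) + \<bar>r\<bar> powr (m - 2)) * \<bar>t - r\<bar>)"
    by (rule src_lipschitz[OF p])
  also have "\<dots> \<le> C0 * ((2 * ?W) * \<bar>s - r\<bar>)"
  proof (intro mult_left_mono mult_mono t(1))
    show "1 + \<bar>t\<bar> powr (m - 2) + \<bar>r\<bar> powr (m - 2) \<le> 2 * ?W"
    proof -
      have "1 + z + y \<le> 2 * (1 + x + y)" if "z \<le> x + y" "0 \<le> x" "0 \<le> y" for x y z :: real
        using that by (simp add: algebra_simps)
      then show ?thesis using powr_between[OF t(2)] powr_ge_zero by blast
    qed
  qed (use C0_pos in auto)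
  finally have "\<bar>src p t - src p r\<bar> * \<bar>s - r\<bar> \<le> C0 * ((2 * ?W) * \<bar>s - r\<bar>) * \<bar>s - r\<bar>"
    by (rule mult_right_mono) simp
  moreover have "pot p s - pot p r - src p r * (s - r) = (src p t - src p r) * (s - r)"
    unfolding t(3) by (simp add: algebra_simps)
  moreover have "C0 * ((2 * ?W) * \<bar>s - r\<bar>) * \<bar>s - r\<bar> = 2 * C0 * (?W * (\<bar>s - r\<bar> * \<bar>s - r\<bar>))"
    by (simp only: mult_ac)
  ultimately show ?thesis by (simp only: abs_mult power2_eq_square abs_mult_self_eq)
qed

end

lemma Lnorm_2_sq_real:
  fixes f :: "'a::euclidean_space \<Rightarrow> real"
  shows "(Lnorm 2 \<Omega> f)\<^sup>2 = (LINT x|lebesgue_on \<Omega>. (f x)\<^sup>2)"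
  unfolding Lnorm_2_sq L2inner_def by (simp add: power2_eq_square)

text \<open>A case distinction on \<open>c\<^sup>2 \<le> e * A\<^sup>2\<close> replaces Hoelder's
  inequality: in either case one of the two factors can be traded for a power of the other. The free
  parameter \<open>e\<close> later restores homogeneity in \<open>c\<close>.\<close>

lemma powr_interpolate:
  fixes A c m e :: real
  assumes A: "A \<ge> 0" and c: "c \<ge> 0" and m: "m > 2" and e: "e > 0"
  shows "(A powr (m - 2))\<^sup>2 * c\<^sup>2 \<le> e * A powr (2 * (m - 1)) + e powr (- (m - 2)) * c powr (2 * (m - 1))"
proof -
  have sq: "(A powr (m - 2))\<^sup>2 = (A\<^sup>2) powr (m - 2)"
    using A by (simp add: power2_eq_square powr_mult)
  have dbl: "x powr (2 * (m - 1)) = (x\<^sup>2) powr (m - 2) * x\<^sup>2" if "x \<ge> 0" for x :: real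
  proof (cases "x = 0")
    case False
    then have x: "x > 0" using that by simp
    have "x powr (2 * (m - 1)) = (x powr 2) powr (m - 1)" by (simp add: powr_powr)
    also have "\<dots> = (x\<^sup>2) powr ((m - 2) + 1)" using x by simp
    also have "\<dots> = (x\<^sup>2) powr (m - 2) * (x\<^sup>2) powr 1" by (rule powr_add)
    finally show ?thesis by simp
  qed simp
  show ?thesis
  proof (cases "c\<^sup>2 \<le> e * A\<^sup>2")
    case True
    have "(A\<^sup>2) powr (m - 2) * c\<^sup>2 \<le> (A\<^sup>2) powr (m - 2) * (e * A\<^sup>2)"
      by (rule mult_left_mono[OF True]) simp
    also have "\<dots> = e * A powr (2 * (m - 1))" unfolding dbl[OF A] by simp
    finally show ?thesis unfolding sq by (simp add: add_increasing2)
  next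
    case False
    then have "A\<^sup>2 \<le> c\<^sup>2 / e" using e by (simp add: field_simps)
    then have "(A\<^sup>2) powr (m - 2) \<le> (c\<^sup>2 / e) powr (m - 2)" using m by (intro powr_mono2) auto
    also have "\<dots> = (c\<^sup>2) powr (m - 2) / e powr (m - 2)" by (rule powr_divide)
    also have "\<dots> = e powr (- (m - 2)) * (c\<^sup>2) powr (m - 2)"
      unfolding powr_minus by (simp only: divide_inverse mult.commute)
    finally have "(A\<^sup>2) powr (m - 2) * c\<^sup>2 \<le> e powr (- (m - 2)) * (c\<^sup>2) powr (m - 2) * c\<^sup>2"
      by (rule mult_right_mono) simp
    also have "\<dots> = e powr (- (m - 2)) * c powr (2 * (m - 1))" unfolding dbl[OF c] by simp
    finally show ?thesis unfolding sq using e by (simp add: add_increasing)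
  qed
qed

text \<open>The exponent \<open>2 * (m - 1)\<close> arises when the source, of growth |u|^(m-1), is
  to be square integrable; requiring it to be subcritical makes the Sobolev inequality
  available.\<close>

locale sobolev_growth = bounded_open \<Omega> + growth p1 p2 m
  for \<Omega> :: "'a::euclidean_space set" and p1 p2 m +
  assumes dim: "DIM('a) \<ge> 3" and mn: "2 * (m - 1) < 2 * real DIM('a) / (real DIM('a) - 2)"
begin

abbreviation "N u \<equiv> Lnorm 2 \<Omega> (wgrad \<Omega> u)"

definition W :: "('a \<Rightarrow> real) \<Rightarrow> ('a \<Rightarrow> real) \<Rightarrow> 'a \<Rightarrow> real" where
  "W a b x = 1 + \<bar>a x\<bar> powr (m - 2) + \<bar>b x\<bar> powr (m - 2)"

lemma W_pos: "W a b x \<ge> 1"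
  unfolding W_def using powr_ge_zero[of "\<bar>a x\<bar>" "m - 2"] powr_ge_zero[of "\<bar>b x\<bar>" "m - 2"] by linarith

lemma W_measurable:
  assumes "a \<in> borel_measurable M" "b \<in> borel_measurable M"
  shows "W a b \<in> borel_measurable M"
  using assms unfolding W_def by measurable

text \<open>Multiplication by the Lipschitz weight of the source is bounded from H10 to L2,
  uniformly as long as \<open>a\<close> and \<open>b\<close> stay in a ball. All estimates of the
  source reduce to this one.\<close>

lemma weight_bound:
  "\<exists>C\<ge>0. \<forall>a\<in>H10 \<Omega>. \<forall>b\<in>H10 \<Omega>. \<forall>c\<in>H10 \<Omega>. N a \<le> \<rho> \<longrightarrow> N b \<le> \<rho> \<longrightarrow>
     (\<lambda>x. W a b x * c x) \<in> Lspace 2 \<Omega> \<and> (Lnorm 2 \<Omega> (\<lambda>x. W a b x * c x))\<^sup>2 \<le> C * (N c)\<^sup>2"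
proof -
  let ?k = "2 * (m - 1)"
  have k2: "2 < ?k" using m2 by simp
  obtain Cs where Cs: "Cs \<ge> 0" "\<And>f. f \<in> H10 \<Omega> \<Longrightarrow> integrable M (\<lambda>x. \<bar>f x\<bar> powr ?k)"
    "\<And>f. f \<in> H10 \<Omega> \<Longrightarrow> (LINT x|M. \<bar>f x\<bar> powr ?k) \<le> Cs * N f powr ?k"
    using sobolev_subcritical[OF dim k2 mn] by blast
  obtain Cp where Cp: "Cp > 0" "\<And>f. f \<in> H10 \<Omega> \<Longrightarrow> (Lnorm 2 \<Omega> f)\<^sup>2 \<le> Cp * (N f)\<^sup>2"
    using poincare[OF dim] by blast
  define K where "K = Cs * \<rho> powr ?k"
  have K: "K \<ge> 0" using Cs(1) by (simp add: K_def)
  have main: "(\<lambda>x. W a b x * c x) \<in> Lspace 2 \<Omega> \<and>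
      (Lnorm 2 \<Omega> (\<lambda>x. W a b x * c x))\<^sup>2 \<le> 3 * (Cp + 2 * (K + Cs)) * (N c)\<^sup>2"
    if a: "a \<in> H10 \<Omega>" and b: "b \<in> H10 \<Omega>" and c: "c \<in> H10 \<Omega>" and Na: "N a \<le> \<rho>" and Nb: "N b \<le> \<rho>" for a b c
  proof -
    have [measurable]: "a \<in> borel_measurable M" "b \<in> borel_measurable M" "c \<in> borel_measurable M"
      by (intro Lspace_2_measurable H10_L2 a b c)+
    have [measurable]: "W a b \<in> borel_measurable M" by (intro W_measurable) measurable
    have c2: "integrable M (\<lambda>x. (c x)\<^sup>2)" using H10_L2[OF c] unfolding Lspace_2_iff by simp
    define R where "R e x = 3 * ((c x)\<^sup>2 + (e * \<bar>a x\<bar> powr ?k + e * \<bar>b x\<bar> powr ?k) + 2 * (e powr (- (m - 2)) * \<bar>c x\<bar> powr ?k))" for e x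
    have R_int: "integrable M (R e)" for e
      unfolding R_def by (intro Bochner_Integration.integrable_add integrable_mult_right Cs a b c c2)
    have pw: "(W a b x * c x)\<^sup>2 \<le> R e x" if e: "e > 0" for e x
    proof -
      let ?A = "\<bar>a x\<bar> powr (m - 2)" and ?B = "\<bar>b x\<bar> powr (m - 2)"
      have sq3: "(1 + x + y)\<^sup>2 \<le> 3 * (1 + x\<^sup>2 + y\<^sup>2)" for x y :: real
      proof -
        have "3 * (1 + x\<^sup>2 + y\<^sup>2) - (1 + x + y)\<^sup>2 = (1 - x)\<^sup>2 + (1 - y)\<^sup>2 + (x - y)\<^sup>2"
          by (simp add: power2_eq_square algebra_simps)
        then show ?thesis by (metis add_nonneg_nonneg diff_ge_0_iff_ge zero_le_power2)
      qed
      have "(W a b x * c x)\<^sup>2 = (1 + ?A + ?B)\<^sup>2 * (c x)\<^sup>2" by (simp add: W_def power_mult_distrib)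
      also have "\<dots> \<le> 3 * (1 + ?A\<^sup>2 + ?B\<^sup>2) * (c x)\<^sup>2" by (rule mult_right_mono[OF sq3]) simp
      also have "\<dots> = 3 * ((c x)\<^sup>2 + ?A\<^sup>2 * \<bar>c x\<bar>\<^sup>2 + ?B\<^sup>2 * \<bar>c x\<bar>\<^sup>2)" by (simp add: algebra_simps)
      also have "\<dots> \<le> 3 * ((c x)\<^sup>2 + (e * \<bar>a x\<bar> powr ?k + e powr (- (m - 2)) * \<bar>c x\<bar> powr ?k)
           + (e * \<bar>b x\<bar> powr ?k + e powr (- (m - 2)) * \<bar>c x\<bar> powr ?k))"
        by (intro mult_left_mono add_mono powr_interpolate e m2 order_refl abs_ge_zero) simp
      also have "\<dots> = R e x" by (simp add: R_def algebra_simps)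
      finally show ?thesis .
    qed
    have Wi: "integrable M (\<lambda>x. (W a b x * c x)\<^sup>2)"
    proof (rule Bochner_Integration.integrable_bound[OF R_int[of 1]])
      show "AE x in M. norm ((W a b x * c x)\<^sup>2) \<le> norm (R 1 x)"
        using pw[of 1] by (intro AE_I2) (simp add: abs_le_iff order_trans[OF _ abs_ge_self])
    qed measurable
    then have L2: "(\<lambda>x. W a b x * c x) \<in> Lspace 2 \<Omega>" unfolding Lspace_2_iff by simp
    \<comment> \<open>Taking the interpolation parameter \<open>e\<close> to be \<delta>, slightly
      above \<open>(N c)\<^sup>2\<close>, makes every term of the integral of
      \<open>R \<delta>\<close> at most a multiple of \<delta>. Letting \<delta> tend to
      \<open>(N c)\<^sup>2\<close> removes the need for a positive parameter.\<close>
    have bd: "(Lnorm 2 \<Omega> (\<lambda>x. W a b x * c x))\<^sup>2 \<le> 3 * (Cp + 2 * (K + Cs)) * \<delta>" if \<delta>: "\<delta> > (N c)\<^sup>2" for \<delta>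
    proof -
      have \<delta>0: "\<delta> > 0" using \<delta> zero_le_power2[of "N c"] by linarith
      have powle: "(LINT x|M. \<bar>f x\<bar> powr ?k) \<le> K" if f: "f \<in> H10 \<Omega>" "N f \<le> \<rho>" for f
      proof -
        have "(LINT x|M. \<bar>f x\<bar> powr ?k) \<le> Cs * N f powr ?k" by (rule Cs(3)[OF f(1)])
        also have "\<dots> \<le> K" unfolding K_def
          using f(2) k2 Cs(1) by (intro mult_left_mono powr_mono2 Lnorm_nonneg) auto
        finally show ?thesis .
      qed
      have cle: "\<delta> powr (- (m - 2)) * (LINT x|M. \<bar>c x\<bar> powr ?k) \<le> Cs * \<delta>"
      proof -
        have "N c powr ?k = (N c powr 2) powr (m - 1)" by (simp add: powr_powr)
        also have "\<dots> = ((N c)\<^sup>2) powr (m - 1)" by (simp add: Lnorm_nonneg)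
        also have "\<dots> \<le> \<delta> powr (m - 1)" using \<delta> m2 by (intro powr_mono2) auto
        finally have "(LINT x|M. \<bar>c x\<bar> powr ?k) \<le> Cs * \<delta> powr (m - 1)"
          using Cs(3)[OF c] mult_left_mono[OF _ Cs(1)] by (meson order_trans)
        then have "\<delta> powr (- (m - 2)) * (LINT x|M. \<bar>c x\<bar> powr ?k) \<le> \<delta> powr (- (m - 2)) * (Cs * \<delta> powr (m - 1))"
          by (rule mult_left_mono) simp
        also have "\<dots> = Cs * (\<delta> powr (- (m - 2)) * \<delta> powr (m - 1))" by simp
        also have "\<delta> powr (- (m - 2)) * \<delta> powr (m - 1) = \<delta>"
          unfolding powr_add[symmetric] using \<delta>0 by simp
        finally show ?thesis .
      qed
      have "(Lnorm 2 \<Omega> (\<lambda>x. W a b x * c x))\<^sup>2 = (LINT x|M. (W a b x * c x)\<^sup>2)"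
        by (simp add: Lnorm_2_sq_real)
      also have "\<dots> \<le> (LINT x|M. R \<delta> x)" by (intro integral_mono Wi R_int pw \<delta>0)
      also have "\<dots> = 3 * ((LINT x|M. (c x)\<^sup>2) + (\<delta> * (LINT x|M. \<bar>a x\<bar> powr ?k) + \<delta> * (LINT x|M. \<bar>b x\<bar> powr ?k))
          + 2 * (\<delta> powr (- (m - 2)) * (LINT x|M. \<bar>c x\<bar> powr ?k)))"
        unfolding R_def using Cs(2)[OF a] Cs(2)[OF b] Cs(2)[OF c] c2 by simp
      also have "\<dots> \<le> 3 * (Cp * \<delta> + (\<delta> * K + \<delta> * K) + 2 * (Cs * \<delta>))"
      proof -
        have "(LINT x|M. (c x)\<^sup>2) = (Lnorm 2 \<Omega> c)\<^sup>2" by (simp add: Lnorm_2_sq_real)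
        also have "\<dots> \<le> Cp * (N c)\<^sup>2" by (rule Cp(2)[OF c])
        also have "\<dots> \<le> Cp * \<delta>" using \<delta> Cp(1) by (intro mult_left_mono) auto
        finally show ?thesis
          using powle[OF a Na] powle[OF b Nb] cle \<delta>0 by (intro mult_left_mono add_mono) auto
      qed
      also have "\<dots> = 3 * (Cp + 2 * (K + Cs)) * \<delta>" by (simp add: algebra_simps)
      finally show ?thesis .
    qed
    have "((\<lambda>\<delta>. 3 * (Cp + 2 * (K + Cs)) * \<delta>) \<longlongrightarrow> 3 * (Cp + 2 * (K + Cs)) * (N c)\<^sup>2) (at_right ((N c)\<^sup>2))"
      by (intro tendsto_intros)
    then have "(Lnorm 2 \<Omega> (\<lambda>x. W a b x * c x))\<^sup>2 \<le> 3 * (Cp + 2 * (K + Cs)) * (N c)\<^sup>2"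
      by (rule tendsto_lowerbound) (use bd in \<open>auto simp: eventually_at_filter\<close>)
    with L2 show ?thesis by blast
  qed
  have "3 * (Cp + 2 * (K + Cs)) \<ge> 0" using Cp(1) K Cs(1) by simp
  with main show ?thesis by blast
qed

end

section \<open>The source as a map from H10 to L2\<close>

locale nemytskii = sobolev_growth \<Omega> p1 p2 m for \<Omega> :: "'a::euclidean_space set" and p1 p2 m +
  fixes p :: "'a \<Rightarrow> real"
  assumes p_meas: "p \<in> borel_measurable M" and p_bounds: "AE x in M. p1 \<le> p x \<and> p x \<le> p2"
begin

definition Fu :: "('a \<Rightarrow> real) \<Rightarrow> 'a \<Rightarrow> real" where "Fu u x = src (p x) (u x)"

definition Pot :: "('a \<Rightarrow> real) \<Rightarrow> real" where "Pot u = (LINT x|M. pot (p x) (u x))"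

lemma Fu_measurable: "u \<in> borel_measurable M \<Longrightarrow> Fu u \<in> borel_measurable M"
proof -
  assume [measurable]: "u \<in> borel_measurable M"
  note p_meas[measurable]
  show ?thesis unfolding Fu_def src_def by measurable
qed

lemma pot_measurable: "u \<in> borel_measurable M \<Longrightarrow> (\<lambda>x. pot (p x) (u x)) \<in> borel_measurable M"
proof -
  assume [measurable]: "u \<in> borel_measurable M"
  note p_meas[measurable]
  show ?thesis unfolding pot_def by measurable
qed

lemma L2_dominated:
  assumes f: "f \<in> borel_measurable M" and h: "h \<in> Lspace 2 \<Omega>" and le: "AE x in M. \<bar>f x\<bar> \<le> C * \<bar>h x\<bar>" and C: "C \<ge> 0"
  shows "f \<in> Lspace 2 \<Omega>" "(Lnorm 2 \<Omega> f)\<^sup>2 \<le> C\<^sup>2 * (Lnorm 2 \<Omega> h)\<^sup>2"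
proof -
  have hi: "integrable M (\<lambda>x. (h x)\<^sup>2)" using h unfolding Lspace_2_iff by simp
  have le2: "AE x in M. (f x)\<^sup>2 \<le> C\<^sup>2 * (h x)\<^sup>2"
    using le
  proof eventually_elim
    case (elim x)
    then have "\<bar>f x\<bar>\<^sup>2 \<le> (C * \<bar>h x\<bar>)\<^sup>2" by (intro power_mono) auto
    then show ?case by (simp add: power_mult_distrib)
  qed
  have fi: "integrable M (\<lambda>x. (f x)\<^sup>2)"
  proof (rule Bochner_Integration.integrable_bound[OF integrable_mult_right[OF hi, of "C\<^sup>2"]])
    show "(\<lambda>x. (f x)\<^sup>2) \<in> borel_measurable M" using f by measurable
    show "AE x in M. norm ((f x)\<^sup>2) \<le> norm (C\<^sup>2 * (h x)\<^sup>2)" using le2 by eventually_elim simp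
  qed
  then show "f \<in> Lspace 2 \<Omega>" using f unfolding Lspace_2_iff by simp
  have "(LINT x|M. (f x)\<^sup>2) \<le> (LINT x|M. C\<^sup>2 * (h x)\<^sup>2)"
    by (intro integral_mono_AE fi integrable_mult_right hi le2)
  then show "(Lnorm 2 \<Omega> f)\<^sup>2 \<le> C\<^sup>2 * (Lnorm 2 \<Omega> h)\<^sup>2"
    by (simp add: Lnorm_2_sq_real)
qed

text \<open>One constant for all estimates on the ball of radius \<rho>. In the last one, the
  quadratic remainder is split by Cauchy-Schwarz as a gradient norm times an L2 norm: after division
  by a time step the L2 factor stays bounded and the gradient factor tends to 0, which is what
  \<open>Pot_deriv\<close> can use.\<close>

lemma Fu_bounds:
  "\<exists>C\<ge>0. \<forall>u\<in>H10 \<Omega>. \<forall>w\<in>H10 \<Omega>. N u \<le> \<rho> \<longrightarrow> N w \<le> \<rho> \<longrightarrow>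
     Fu u \<in> Lspace 2 \<Omega> \<and> Lnorm 2 \<Omega> (Fu u) \<le> C * N u \<and>
     Lnorm 2 \<Omega> (\<lambda>x. Fu u x - Fu w x) \<le> C * N (\<lambda>x. u x - w x) \<and>
     integrable M (\<lambda>x. pot (p x) (u x)) \<and> \<bar>Pot u\<bar> \<le> C * (N u)\<^sup>2 \<and>
     \<bar>Pot u - Pot w - L2inner \<Omega> (Fu w) (\<lambda>x. u x - w x)\<bar> \<le> C * N (\<lambda>x. u x - w x) * Lnorm 2 \<Omega> (\<lambda>x. u x - w x)"
proof -
  obtain Cw where Cw: "Cw \<ge> 0" "\<And>a b c. a \<in> H10 \<Omega> \<Longrightarrow> b \<in> H10 \<Omega> \<Longrightarrow> c \<in> H10 \<Omega> \<Longrightarrow> N a \<le> \<rho> \<Longrightarrow> N b \<le> \<rho> \<Longrightarrow>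
     (\<lambda>x. W a b x * c x) \<in> Lspace 2 \<Omega> \<and> (Lnorm 2 \<Omega> (\<lambda>x. W a b x * c x))\<^sup>2 \<le> Cw * (N c)\<^sup>2"
    using weight_bound[of \<rho>] by blast
  obtain Cp where Cp: "Cp > 0" "\<And>f. f \<in> H10 \<Omega> \<Longrightarrow> (Lnorm 2 \<Omega> f)\<^sup>2 \<le> Cp * (N f)\<^sup>2"
    using poincare[OF dim] by blast
  have C0: "C0 \<ge> 0" using C0_pos by simp
  define C where "C = 2 * C0 * sqrt Cw * (1 + sqrt Cp)"
  have CC: "C0 * sqrt Cw \<le> C" "2 * C0 * sqrt Cw \<le> C" "2 * C0 * sqrt Cw * sqrt Cp \<le> C" "C \<ge> 0"
    using C0 Cw(1) Cp(1) by (simp_all add: C_def distrib_left)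
  have sqrtle: "x \<le> sqrt K * y" if "x\<^sup>2 \<le> K * y\<^sup>2" "y \<ge> 0" "K \<ge> 0" for x y K :: real
  proof -
    have "x \<le> sqrt (K * y\<^sup>2)" by (rule real_le_rsqrt[OF that(1)])
    then show ?thesis using that by (simp add: real_sqrt_mult)
  qed
  have WL: "(\<lambda>x. W a b x * c x) \<in> Lspace 2 \<Omega>" "Lnorm 2 \<Omega> (\<lambda>x. W a b x * c x) \<le> sqrt Cw * N c"
    if "a \<in> H10 \<Omega>" "b \<in> H10 \<Omega>" "c \<in> H10 \<Omega>" "N a \<le> \<rho>" "N b \<le> \<rho>" for a b c
    using Cw(2)[OF that] sqrtle[OF _ Lnorm_nonneg Cw(1)] by blast+
  have main: "Fu u \<in> Lspace 2 \<Omega> \<and> Lnorm 2 \<Omega> (Fu u) \<le> C * N u \<and>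
     Lnorm 2 \<Omega> (\<lambda>x. Fu u x - Fu w x) \<le> C * N (\<lambda>x. u x - w x) \<and>
     integrable M (\<lambda>x. pot (p x) (u x)) \<and> \<bar>Pot u\<bar> \<le> C * (N u)\<^sup>2 \<and>
     \<bar>Pot u - Pot w - L2inner \<Omega> (Fu w) (\<lambda>x. u x - w x)\<bar> \<le> C * N (\<lambda>x. u x - w x) * Lnorm 2 \<Omega> (\<lambda>x. u x - w x)"
    if u: "u \<in> H10 \<Omega>" and w: "w \<in> H10 \<Omega>" and Nu: "N u \<le> \<rho>" and Nw: "N w \<le> \<rho>" for u w
  proof -
    note d = H10_diff[OF u w]
    have m: "u \<in> borel_measurable M" "w \<in> borel_measurable M" by (intro Lspace_2_measurable H10_L2 u w)+
    have F_L2: "Fu u \<in> Lspace 2 \<Omega> \<and> Lnorm 2 \<Omega> (Fu u) \<le> C0 * (sqrt Cw * N u)" if u: "u \<in> H10 \<Omega>" and Nu: "N u \<le> \<rho>" for u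
    proof -
      have m: "u \<in> borel_measurable M" by (intro Lspace_2_measurable H10_L2 u)
      have le: "AE x in M. \<bar>Fu u x\<bar> \<le> C0 * \<bar>W u u x * u x\<bar>"
        using p_bounds
      proof eventually_elim
        case (elim x)
        have "\<bar>src (p x) (u x) - src (p x) 0\<bar> \<le> C0 * ((1 + \<bar>u x\<bar> powr (m - 2) + \<bar>0\<bar> powr (m - 2)) * \<bar>u x - 0\<bar>)"
          using elim by (intro src_lipschitz) auto
        also have "\<dots> \<le> C0 * (W u u x * \<bar>u x\<bar>)"
          unfolding W_def by (intro mult_left_mono mult_mono) (use C0 in auto)
        finally show ?case using W_pos[of u u x] by (simp add: Fu_def src_def[of _ 0] abs_mult)
      qed
      note L = L2_dominated[OF Fu_measurable[OF m] WL(1)[OF u u u Nu Nu] le C0]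
      have "Lnorm 2 \<Omega> (Fu u) \<le> sqrt (C0\<^sup>2) * Lnorm 2 \<Omega> (\<lambda>x. W u u x * u x)"
        by (rule sqrtle[OF L(2) Lnorm_nonneg]) simp
      also have "\<dots> \<le> C0 * (sqrt Cw * N u)"
        using WL(2)[OF u u u Nu Nu] C0 by (simp add: mult_left_mono)
      finally show ?thesis using L(1) by blast
    qed
    note Fu_L2 = F_L2[OF u Nu] and Fw_L2 = F_L2[OF w Nw]
    have diff: "Lnorm 2 \<Omega> (\<lambda>x. Fu u x - Fu w x) \<le> C0 * (sqrt Cw * N (\<lambda>x. u x - w x))"
    proof -
      have le: "AE x in M. \<bar>Fu u x - Fu w x\<bar> \<le> C0 * \<bar>W u w x * (u x - w x)\<bar>"
        using p_bounds
      proof eventually_elim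
        case (elim x)
        have "\<bar>src (p x) (u x) - src (p x) (w x)\<bar> \<le> C0 * ((1 + \<bar>u x\<bar> powr (m - 2) + \<bar>w x\<bar> powr (m - 2)) * \<bar>u x - w x\<bar>)"
          using elim by (intro src_lipschitz) auto
        then show ?case using W_pos[of u w x] by (simp add: Fu_def W_def[symmetric] abs_mult)
      qed
      have "(Lnorm 2 \<Omega> (\<lambda>x. Fu u x - Fu w x))\<^sup>2 \<le> C0\<^sup>2 * (Lnorm 2 \<Omega> (\<lambda>x. W u w x * (u x - w x)))\<^sup>2"
        by (rule L2_dominated(2)[OF _ WL(1)[OF u w d Nu Nw] le C0])
          (intro borel_measurable_diff Fu_measurable m)
      then have "Lnorm 2 \<Omega> (\<lambda>x. Fu u x - Fu w x) \<le> sqrt (C0\<^sup>2) * Lnorm 2 \<Omega> (\<lambda>x. W u w x * (u x - w x))"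
        by (rule sqrtle[OF _ Lnorm_nonneg]) simp
      also have "\<dots> \<le> C0 * (sqrt Cw * N (\<lambda>x. u x - w x))"
        using WL(2)[OF u w d Nu Nw] C0 by (simp add: mult_left_mono)
      finally show ?thesis .
    qed
    have Wint: "integrable M (\<lambda>x. W a b x * (c x)\<^sup>2)"
      and Wle: "(LINT x|M. W a b x * (c x)\<^sup>2) \<le> sqrt Cw * N c * Lnorm 2 \<Omega> c"
      if abc: "a \<in> H10 \<Omega>" "b \<in> H10 \<Omega>" "c \<in> H10 \<Omega>" "N a \<le> \<rho>" "N b \<le> \<rho>" for a b c
    proof -
      show "integrable M (\<lambda>x. W a b x * (c x)\<^sup>2)"
        using L2_integrable_inner[OF WL(1)[OF abc] H10_L2[OF abc(3)]] by (simp add: power2_eq_square mult.assoc)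
      have "(LINT x|M. W a b x * (c x)\<^sup>2) = L2inner \<Omega> (\<lambda>x. W a b x * c x) c"
        by (simp add: L2inner_def power2_eq_square mult.assoc)
      also have "\<dots> \<le> Lnorm 2 \<Omega> (\<lambda>x. W a b x * c x) * Lnorm 2 \<Omega> c"
        using L2_Cauchy_Schwarz[OF WL(1)[OF abc] H10_L2[OF abc(3)]] by linarith
      also have "\<dots> \<le> sqrt Cw * N c * Lnorm 2 \<Omega> c"
        by (intro mult_right_mono WL(2)[OF abc] Lnorm_nonneg)
      finally show "(LINT x|M. W a b x * (c x)\<^sup>2) \<le> sqrt Cw * N c * Lnorm 2 \<Omega> c" .
    qed
    have pot0: "AE x in M. \<bar>pot (p x) (u x)\<bar> \<le> 2 * C0 * (W u u x * (u x)\<^sup>2)" if u: "u \<in> H10 \<Omega>" for u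
      using p_bounds
    proof eventually_elim
      case (elim x)
      have "\<bar>pot (p x) (u x) - pot (p x) 0 - src (p x) 0 * (u x - 0)\<bar> \<le> 2 * C0 * ((1 + \<bar>u x\<bar> powr (m - 2) + \<bar>0\<bar> powr (m - 2)) * (u x - 0)\<^sup>2)"
        using elim by (intro pot_taylor) auto
      also have "\<dots> \<le> 2 * C0 * (W u u x * (u x)\<^sup>2)"
        unfolding W_def by (intro mult_left_mono mult_mono) (use C0 in auto)
      finally show ?case by (simp add: src_def[of _ 0] pot_def[of _ 0])
    qed
    have pot_int: "integrable M (\<lambda>x. pot (p x) (u x))" if u: "u \<in> H10 \<Omega>" "N u \<le> \<rho>" for u
    proof (rule Bochner_Integration.integrable_bound[OF integrable_mult_right[OF Wint[OF u(1,1,1) u(2,2)], of "2 * C0"]])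
      show "(\<lambda>x. pot (p x) (u x)) \<in> borel_measurable M"
        by (intro pot_measurable Lspace_2_measurable H10_L2 u)
      show "AE x in M. norm (pot (p x) (u x)) \<le> norm (2 * C0 * (W u u x * (u x)\<^sup>2))"
        using pot0[OF u(1)] by eventually_elim simp
    qed
    have P1: "\<bar>Pot u\<bar> \<le> 2 * C0 * sqrt Cw * sqrt Cp * (N u)\<^sup>2"
    proof -
      have "\<bar>Pot u\<bar> \<le> (LINT x|M. \<bar>pot (p x) (u x)\<bar>)" unfolding Pot_def by (rule integral_abs_bound)
      also have "\<dots> \<le> (LINT x|M. 2 * C0 * (W u u x * (u x)\<^sup>2))"
        by (intro integral_mono_AE integrable_abs pot_int integrable_mult_right Wint pot0 u Nu)
      also have "\<dots> \<le> 2 * C0 * (sqrt Cw * N u * Lnorm 2 \<Omega> u)"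
        using Wle[OF u u u Nu Nu] C0 by (simp add: mult_left_mono)
      also have "\<dots> \<le> 2 * C0 * (sqrt Cw * N u * (sqrt Cp * N u))"
        using sqrtle[OF Cp(2)[OF u] Lnorm_nonneg] Cp(1) C0 Cw(1)
        by (intro mult_left_mono mult_nonneg_nonneg Lnorm_nonneg) auto
      finally show ?thesis by (simp add: power2_eq_square mult_ac)
    qed
    have P2: "\<bar>Pot u - Pot w - L2inner \<Omega> (Fu w) (\<lambda>x. u x - w x)\<bar> \<le> 2 * C0 * sqrt Cw * N (\<lambda>x. u x - w x) * Lnorm 2 \<Omega> (\<lambda>x. u x - w x)"
    proof -
      have i3: "integrable M (\<lambda>x. Fu w x * (u x - w x))"
        using L2_integrable_inner[OF _ H10_L2[OF d]] Fw_L2 by fastforce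
      have "Pot u - Pot w - L2inner \<Omega> (Fu w) (\<lambda>x. u x - w x) = (LINT x|M. pot (p x) (u x) - pot (p x) (w x) - Fu w x * (u x - w x))"
        unfolding Pot_def L2inner_def using pot_int[OF u Nu] pot_int[OF w Nw] i3 by simp
      then have "\<bar>Pot u - Pot w - L2inner \<Omega> (Fu w) (\<lambda>x. u x - w x)\<bar> \<le> (LINT x|M. \<bar>pot (p x) (u x) - pot (p x) (w x) - Fu w x * (u x - w x)\<bar>)"
        by (simp only: integral_abs_bound)
      also have "\<dots> \<le> (LINT x|M. 2 * C0 * (W u w x * (u x - w x)\<^sup>2))"
      proof (rule integral_mono_AE)
        show "integrable M (\<lambda>x. \<bar>pot (p x) (u x) - pot (p x) (w x) - Fu w x * (u x - w x)\<bar>)"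
          using pot_int[OF u Nu] pot_int[OF w Nw] i3 by (intro integrable_abs Bochner_Integration.integrable_diff)
        show "integrable M (\<lambda>x. 2 * C0 * (W u w x * (u x - w x)\<^sup>2))"
          by (intro integrable_mult_right Wint u w d Nu Nw)
        show "AE x in M. \<bar>pot (p x) (u x) - pot (p x) (w x) - Fu w x * (u x - w x)\<bar> \<le> 2 * C0 * (W u w x * (u x - w x)\<^sup>2)"
          using p_bounds
        proof eventually_elim
          case (elim x)
          show ?case unfolding Fu_def W_def using elim by (intro pot_taylor) auto
        qed
      qed
      also have "\<dots> \<le> 2 * C0 * (sqrt Cw * N (\<lambda>x. u x - w x) * Lnorm 2 \<Omega> (\<lambda>x. u x - w x))"
        using Wle[OF u w d Nu Nw] C0 by (simp add: mult_left_mono)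
      finally show ?thesis by (simp add: mult_ac)
    qed
    show ?thesis
    proof (intro conjI)
      show "Fu u \<in> Lspace 2 \<Omega>" using Fu_L2 by blast
      have "Lnorm 2 \<Omega> (Fu u) \<le> (C0 * sqrt Cw) * N u" using Fu_L2 by (simp add: mult.assoc)
      also have "\<dots> \<le> C * N u" by (intro mult_right_mono CC Lnorm_nonneg)
      finally show "Lnorm 2 \<Omega> (Fu u) \<le> C * N u" .
      have "Lnorm 2 \<Omega> (\<lambda>x. Fu u x - Fu w x) \<le> (C0 * sqrt Cw) * N (\<lambda>x. u x - w x)" using diff by (simp add: mult.assoc)
      also have "\<dots> \<le> C * N (\<lambda>x. u x - w x)" by (intro mult_right_mono CC Lnorm_nonneg)
      finally show "Lnorm 2 \<Omega> (\<lambda>x. Fu u x - Fu w x) \<le> C * N (\<lambda>x. u x - w x)" .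
      show "integrable M (\<lambda>x. pot (p x) (u x))" by (rule pot_int[OF u Nu])
      have "2 * C0 * sqrt Cw * sqrt Cp * (N u)\<^sup>2 \<le> C * (N u)\<^sup>2" by (intro mult_right_mono CC) simp
      then show "\<bar>Pot u\<bar> \<le> C * (N u)\<^sup>2" using P1 by linarith
      have "2 * C0 * sqrt Cw * N (\<lambda>x. u x - w x) * Lnorm 2 \<Omega> (\<lambda>x. u x - w x) \<le> C * N (\<lambda>x. u x - w x) * Lnorm 2 \<Omega> (\<lambda>x. u x - w x)"
        by (intro mult_right_mono CC Lnorm_nonneg)
      then show "\<bar>Pot u - Pot w - L2inner \<Omega> (Fu w) (\<lambda>x. u x - w x)\<bar> \<le> C * N (\<lambda>x. u x - w x) * Lnorm 2 \<Omega> (\<lambda>x. u x - w x)"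
        using P2 by linarith
    qed
  qed
  show ?thesis using main CC(4) by blast
qed

text \<open>The energy contains two separate integrals, so their separate integrability has to be
  secured before they may be merged; |u|^p(x) is dominated by
  \<open>1 + \<bar>u x\<bar> powr (2 * (m - 1))\<close>.\<close>

lemma Pot_split:
  assumes u: "u \<in> H10 \<Omega>"
  shows "Pot u = (LINT x|M. \<bar>u x\<bar> powr p x * ln \<bar>u x\<bar> / p x) - (LINT x|M. \<bar>u x\<bar> powr p x / (p x)\<^sup>2)"
proof -
  have k: "2 < 2 * (m - 1)" using m2 by simp
  obtain Cs where Cs: "integrable M (\<lambda>x. \<bar>u x\<bar> powr (2 * (m - 1)))"
    using sobolev_subcritical[OF dim k mn] u by blast
  have [measurable]: "u \<in> borel_measurable M" "p \<in> borel_measurable M"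
    by (intro Lspace_2_measurable H10_L2 u p_meas)+
  have i1: "integrable M (\<lambda>x. pot (p x) (u x))" using Fu_bounds[of "N u"] u by blast
  have i2: "integrable M (\<lambda>x. \<bar>u x\<bar> powr p x / (p x)\<^sup>2)"
  proof (rule Bochner_Integration.integrable_bound)
    show "integrable M (\<lambda>x. 1 + \<bar>u x\<bar> powr (2 * (m - 1)))" using Cs by simp
    show "(\<lambda>x. \<bar>u x\<bar> powr p x / (p x)\<^sup>2) \<in> borel_measurable M" by measurable
    show "AE x in M. norm (\<bar>u x\<bar> powr p x / (p x)\<^sup>2) \<le> norm (1 + \<bar>u x\<bar> powr (2 * (m - 1)))"
      using p_bounds
    proof eventually_elim
      case (elim x)
      have "\<bar>u x\<bar> powr p x \<le> 1 + \<bar>u x\<bar> powr (2 * (m - 1))"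
      proof (cases "\<bar>u x\<bar> \<le> 1")
        case True
        then have "\<bar>u x\<bar> powr p x \<le> 1" using elim p1 by (intro powr_le1) auto
        then show ?thesis by (simp add: add_increasing2)
      next
        case False
        then have "\<bar>u x\<bar> powr p x \<le> \<bar>u x\<bar> powr (2 * (m - 1))" using elim p2m m2 by (intro powr_mono) auto
        then show ?thesis by simp
      qed
      moreover have "\<bar>u x\<bar> powr p x / (p x)\<^sup>2 \<le> \<bar>u x\<bar> powr p x / 1"
        using elim p1 by (intro divide_left_mono) (auto simp: one_le_power)
      ultimately show ?case by simp
    qed
  qed
  have "(LINT x|M. \<bar>u x\<bar> powr p x * ln \<bar>u x\<bar> / p x) = (LINT x|M. pot (p x) (u x) + \<bar>u x\<bar> powr p x / (p x)\<^sup>2)"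
    by (simp add: pot_def)
  also have "\<dots> = Pot u + (LINT x|M. \<bar>u x\<bar> powr p x / (p x)\<^sup>2)"
    unfolding Pot_def by (rule Bochner_Integration.integral_add[OF i1 i2])
  finally show ?thesis by simp
qed

end

section \<open>Convolutions and symmetric difference quotients\<close>

definition cont2 :: "(real \<Rightarrow> real \<Rightarrow> real) \<Rightarrow> bool" where
  "cont2 F \<longleftrightarrow> continuous_on ({0..} \<times> {0..}) (\<lambda>z. F (fst z) (snd z))"

lemma cont2_compose:
  assumes F: "cont2 F" and "continuous_on S p" "continuous_on S q"
    and "\<And>x. x \<in> S \<Longrightarrow> p x \<ge> 0" "\<And>x. x \<in> S \<Longrightarrow> q x \<ge> 0"
  shows "continuous_on S (\<lambda>x. F (p x) (q x))"
proof -
  have "continuous_on S (\<lambda>x. (\<lambda>z. F (fst z) (snd z)) (p x, q x))"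
    by (rule continuous_on_compose2[OF F[unfolded cont2_def] continuous_on_Pair[OF assms(2,3)]]) (use assms in auto)
  then show ?thesis by simp
qed

lemma cont2_flip: "cont2 F \<Longrightarrow> cont2 (\<lambda>s t. F t s)"
  unfolding cont2_def by (rule cont2_compose[of F]) (auto simp: cont2_def intro!: continuous_intros)

lemma cont2_add: "cont2 F \<Longrightarrow> cont2 G \<Longrightarrow> cont2 (\<lambda>s t. F s t + G s t)"
  unfolding cont2_def by (rule continuous_on_add)

lemma cont2_diff: "cont2 F \<Longrightarrow> cont2 G \<Longrightarrow> cont2 (\<lambda>s t. F s t - G s t)"
  unfolding cont2_def by (rule continuous_on_diff)

lemma cont2_cmult: "cont2 F \<Longrightarrow> cont2 (\<lambda>s t. c * F s t)"
  unfolding cont2_def by (rule continuous_on_mult_left)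

lemma cont2_diag: "cont2 F \<Longrightarrow> continuous_on {0..} (\<lambda>t. F t t)"
  by (rule cont2_compose) auto

lemma cont2_isCont:
  assumes F: "cont2 F" and "s > 0" "t > 0"
  shows "isCont (\<lambda>z. F (fst z) (snd z)) (s, t)"
proof -
  have "open ({0<..} \<times> {0<..} :: (real \<times> real) set)" by (intro open_Times) auto
  moreover have "continuous_on ({0<..} \<times> {0<..}) (\<lambda>z. F (fst z) (snd z))"
    by (rule continuous_on_subset[OF F[unfolded cont2_def]]) auto
  ultimately show ?thesis using assms by (auto simp: continuous_on_eq_continuous_at)
qed

lemma within_atLeast_eq_at: "(t::real) > 0 \<Longrightarrow> at t within {0..} = at t"
  by (rule at_within_interior) (simp add: interior_Ici[of _ "-1"])

text \<open>The increment along the diagonal is split into a step in the first variable, with the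
  second frozen at \<open>t\<close>, and a step in the second, treated by the mean value theorem.
  Hence in the first variable a derivative at the single point \<open>(t, t)\<close> is enough,
  which is all the weak equation provides.\<close>

lemma diag_derivative:
  fixes F :: "real \<Rightarrow> real \<Rightarrow> real"
  assumes d1: "((\<lambda>a. F a t) has_real_derivative D) (at t)"
    and d2: "\<And>a b. \<bar>a - t\<bar> < e \<Longrightarrow> \<bar>b - t\<bar> < e \<Longrightarrow> ((\<lambda>b. F a b) has_real_derivative F2 a b) (at b)" and e: "e > 0"
    and c: "isCont (\<lambda>z. F2 (fst z) (snd z)) (t, t)"
  shows "((\<lambda>s. F s s) has_real_derivative D + F2 t t) (at t)"
proof -
  have mvt: "\<exists>\<theta>. \<bar>\<theta> - t\<bar> \<le> \<bar>s - t\<bar> \<and> (F s s - F s t) / (s - t) = F2 s \<theta>" if s: "s \<noteq> t" "\<bar>s - t\<bar> < e" for s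
  proof (cases "t < s")
    case True
    obtain z where "t < z" "z < s" "F s s - F s t = (s - t) * F2 s z"
      using MVT2[OF True, of "\<lambda>b. F s b" "\<lambda>b. F2 s b"] d2[of s] s by force
    then show ?thesis using True by (intro exI[of _ z]) auto
  next
    case False
    then have st: "s < t" using s by simp
    obtain z where z: "s < z" "z < t" "F s t - F s s = (t - s) * F2 s z"
      using MVT2[OF st, of "\<lambda>b. F s b" "\<lambda>b. F2 s b"] d2[of s] s st by force
    have "F s s - F s t = (s - t) * F2 s z" using z(3) by (simp add: algebra_simps)
    then show ?thesis using z st by (intro exI[of _ z]) auto
  qed
  have "((\<lambda>s. (F s s - F s t) / (s - t)) \<longlongrightarrow> F2 t t) (at t)"
  proof (rule tendstoI)
    fix r :: real assume r: "r > 0"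
    obtain d where d: "d > 0" "\<And>z. dist z (t, t) < d \<Longrightarrow> dist (F2 (fst z) (snd z)) (F2 t t) < r"
      using c r unfolding continuous_at_eps_delta by fastforce
    have "eventually (\<lambda>s. \<bar>s - t\<bar> < min e (d / 2)) (at t)"
      using e d(1) eventually_at_ball[of "min e (d / 2)" t UNIV] by (auto simp: dist_real_def abs_minus_commute elim!: eventually_mono)
    moreover have "eventually (\<lambda>s. s \<noteq> t) (at t)" by (simp add: eventually_at_filter)
    ultimately show "eventually (\<lambda>s. dist ((F s s - F s t) / (s - t)) (F2 t t) < r) (at t)"
    proof eventually_elim
      case (elim s)
      then obtain \<theta> where \<theta>: "\<bar>\<theta> - t\<bar> \<le> \<bar>s - t\<bar>" "(F s s - F s t) / (s - t) = F2 s \<theta>" using mvt[of s] by auto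
      have "dist (s, \<theta>) (t, t) \<le> \<bar>s - t\<bar> + \<bar>\<theta> - t\<bar>"
        unfolding dist_Pair_Pair dist_real_def by (metis sqrt_sum_squares_le_sum_abs abs_idempotent)
      also have "\<dots> < d" using \<theta>(1) elim by simp
      finally show ?case using d(2)[of "(s, \<theta>)"] \<theta>(2) by simp
    qed
  qed
  moreover have "((\<lambda>s. (F s t - F t t) / (s - t)) \<longlongrightarrow> D) (at t)"
    using d1 by (simp add: has_field_derivative_iff)
  ultimately have "((\<lambda>s. (F s t - F t t) / (s - t) + (F s s - F s t) / (s - t)) \<longlongrightarrow> D + F2 t t) (at t)"
    by (intro tendsto_add)
  then show ?thesis by (simp add: has_field_derivative_iff add_divide_distrib[symmetric])
qed

text \<open>Moving to the fixed interval [0,1] turns integrals with variable limits into parameter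
  integrals, whose continuity, also at length 0, is immediate.\<close>

lemma integral_rescale:
  fixes f :: "real \<Rightarrow> real"
  assumes f: "continuous_on {a..a + h} f" and h: "h \<ge> 0"
  shows "integral {a..a + h} f = h * integral {0..1} (\<lambda>r. f (a + h * r))"
proof -
  have "((\<lambda>r. h *\<^sub>R f (a + h * r)) has_integral (integral {a + h * 0..a + h * 1} f)) {0..1}"
  proof (rule has_integral_substitution[where c = a and d = "a + h"])
    show "(\<lambda>r. a + h * r) ` {0..1} \<subseteq> {a..a + h}" using h by (auto simp: mult_left_le)
    show "((\<lambda>r. a + h * r) has_real_derivative h) (at x within {0..1})" for x
      by (auto intro!: derivative_eq_intros)
  qed (use f h in auto)
  then have "integral {0..1} (\<lambda>r. h *\<^sub>R f (a + h * r)) = integral {a + h * 0..a + h * 1} f" by (rule integral_unique)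
  then show ?thesis by simp
qed

lemma integral_param_cont:
  fixes f :: "'b::topological_space \<Rightarrow> real \<Rightarrow> real"
  assumes "continuous_on (S \<times> {a..b}) (\<lambda>z. f (fst z) (snd z))"
  shows "continuous_on S (\<lambda>x. integral {a..b} (f x))"
  using integral_continuous_on_param[of S a b f] assms by (simp add: case_prod_unfold)

section \<open>Convolution on the half-line\<close>

definition conv :: "(real \<Rightarrow> real) \<Rightarrow> (real \<Rightarrow> real) \<Rightarrow> real \<Rightarrow> real" where
  "conv c B t = integral {0..t} (\<lambda>s. c (t - s) * B s)"

lemma conv_integrand_cont:
  fixes c B :: "real \<Rightarrow> real"
  assumes "continuous_on {0..} c" "continuous_on {0..} B"
  shows "continuous_on {0..t} (\<lambda>s. c (t - s) * B s)"
  by (intro continuous_on_mult continuous_on_compose2[OF assms(1)] continuous_on_subset[OF assms(2)] continuous_intros) auto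

lemma conv_cont2:
  assumes c: "continuous_on {0..} c" and B: "cont2 B"
  shows "cont2 (\<lambda>t \<sigma>. conv c (\<lambda>s. B s \<sigma>) t)"
proof -
  have B1: "continuous_on {0..} (\<lambda>s. B s \<sigma>)" if "\<sigma> \<ge> 0" for \<sigma>
    by (rule cont2_compose[OF B]) (use that in \<open>auto intro!: continuous_intros\<close>)
  have e: "conv c (\<lambda>s. B s \<sigma>) t = t * integral {0..1} (\<lambda>r. c (t - t * r) * B (t * r) \<sigma>)" if "t \<ge> 0" "\<sigma> \<ge> 0" for t \<sigma>
    using integral_rescale[of 0 t "\<lambda>s. c (t - s) * B s \<sigma>"] conv_integrand_cont[OF c B1[OF that(2)], of t] that
    by (simp add: conv_def)
  have "continuous_on ({0..} \<times> {0..}) (\<lambda>z. fst z * integral {0..1} (\<lambda>r. c (fst z - fst z * r) * B (fst z * r) (snd z)))"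
  proof (rule continuous_on_mult[OF continuous_on_fst[OF continuous_on_id] integral_param_cont])
    show "continuous_on (({0..} \<times> {0..}) \<times> {0..1})
     (\<lambda>z. c (fst (fst z) - fst (fst z) * snd z) * B (fst (fst z) * snd z) (snd (fst z)))"
      by (intro continuous_on_mult continuous_on_compose2[OF c] cont2_compose[OF B] continuous_intros)
        (auto simp: mult_left_le)
  qed
  then show ?thesis unfolding cont2_def
    by (rule continuous_on_eq) (auto simp: e)
qed

lemma conv_cont:
  assumes "continuous_on {0..} c" "continuous_on {0..} B"
  shows "continuous_on {0..} (conv c B)"
proof -
  have "cont2 (\<lambda>s t. B s)" unfolding cont2_def
    by (rule continuous_on_compose2[OF assms(2) continuous_on_fst[OF continuous_on_id]]) auto
  from cont2_diag[OF conv_cont2[OF assms(1) this]] show ?thesis by simp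
qed

text \<open>The variable \<open>t\<close> occurs as the upper limit and inside the kernel.
  Separating the two occurrences gives a function of two variables with explicit partial
  derivatives, and \<open>diag_derivative\<close> recombines them.\<close>

lemma conv_deriv:
  assumes c: "\<And>t. t \<ge> 0 \<Longrightarrow> (c has_real_derivative c' t) (at t within {0..})" and c': "continuous_on {0..} c'"
    and B: "continuous_on {0..} B" and t: "t > 0"
  shows "(conv c B has_real_derivative (c 0 * B t + conv c' B t)) (at t)"
proof -
  \<comment> \<open>The kernel is continued linearly to negative arguments, keeping it continuously
    differentiable, because with separated variables the argument \<open>b - s\<close> can be
    negative.\<close>
  define ce where "ce x = (if x \<ge> 0 then c x else c 0 + c' 0 * x)" for x
  define ce' where "ce' x = c' (max 0 x)" for x
  have ce'_cont: "continuous_on S ce'" for S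
    unfolding ce'_def by (rule continuous_on_compose2[OF c']) (auto intro!: continuous_intros)
  have ce_deriv: "(ce has_real_derivative ce' x) (at x)" for x
  proof -
    consider "x > 0" | "x < 0" | "x = 0" by linarith
    then show ?thesis
    proof cases
      case 1
      have "(c has_real_derivative ce' x) (at x)" using c[of x] 1 by (simp add: within_atLeast_eq_at ce'_def)
      then show ?thesis
        by (rule DERIV_cong_ev[THEN iffD1, rotated -1])
          (use eventually_nhds_in_open[of "{0<..}" x] 1 in \<open>auto simp: ce_def elim!: eventually_mono\<close>)
    next
      case 2
      have "((\<lambda>x. c 0 + c' 0 * x) has_real_derivative ce' x) (at x)"
        using 2 by (auto intro!: derivative_eq_intros simp: ce'_def)
      then show ?thesis
        by (rule DERIV_cong_ev[THEN iffD1, rotated -1])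
          (use eventually_nhds_in_open[of "{..<0}" x] 2 in \<open>auto simp: ce_def elim!: eventually_mono\<close>)
    next
      case 3
      have "((\<lambda>s. (ce s - ce 0) / (s - 0)) \<longlongrightarrow> c' 0) (at_right 0)"
      proof (rule Lim_transform_eventually)
        show "((\<lambda>s. (c s - c 0) / (s - 0)) \<longlongrightarrow> c' 0) (at_right 0)"
          using c[of 0] unfolding has_field_derivative_iff by (rule filterlim_mono) (auto intro: at_le)
        show "\<forall>\<^sub>F s in at_right 0. (c s - c 0) / (s - 0) = (ce s - ce 0) / (s - 0)"
          using eventually_at_right_less[of "0::real"] by eventually_elim (simp add: ce_def)
      qed
      moreover have "((\<lambda>s. (ce s - ce 0) / (s - 0)) \<longlongrightarrow> c' 0) (at_left 0)"
      proof (rule Lim_transform_eventually[OF tendsto_const])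
        show "\<forall>\<^sub>F s in at_left 0. c' 0 = (ce s - ce 0) / (s - 0)"
          by (auto simp: eventually_at_filter ce_def)
      qed
      ultimately have "((\<lambda>s. (ce s - ce 0) / (s - 0)) \<longlongrightarrow> c' 0) (at 0)" using filterlim_at_split by blast
      then show ?thesis using 3 by (simp add: has_field_derivative_iff ce'_def)
    qed
  qed
  have ce_cont: "continuous_on S ce" for S
    using ce_deriv by (meson DERIV_continuous_on DERIV_subset subset_UNIV)
  define F where "F a b = integral {0..a} (\<lambda>s. ce (b - s) * B s)" for a b
  define F2 where "F2 a b = integral {0..a} (\<lambda>s. ce' (b - s) * B s)" for a b
  have Bc: "continuous_on {0..a} B" for a by (rule continuous_on_subset[OF B]) auto
  have "((\<lambda>s. F s s) has_real_derivative ce (t - t) * B t + F2 t t) (at t)"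
  proof (rule diag_derivative[where e = t and F = F and ?F2.0 = F2])
    have "((\<lambda>a. F a t) has_real_derivative ce (t - t) * B t) (at t within {0..t + 1})"
      unfolding F_def
      by (rule integral_has_real_derivative)
        (use t in \<open>auto intro!: continuous_intros Bc continuous_on_compose2[OF ce_cont[of UNIV]]\<close>)
    then show "((\<lambda>a. F a t) has_real_derivative ce (t - t) * B t) (at t)"
      using t by (subst (asm) at_within_interior) auto
    show "((\<lambda>b. F a b) has_real_derivative F2 a b) (at b)" if "\<bar>a - t\<bar> < t" "\<bar>b - t\<bar> < t" for a b
    proof -
      have "((\<lambda>b. integral (cbox 0 a) (\<lambda>s. ce (b - s) * B s)) has_real_derivative integral (cbox 0 a) (\<lambda>s. ce' (b - s) * B s)) (at b within UNIV)"
      proof (rule leibniz_rule_field_derivative)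
        show "((\<lambda>x. ce (x - s) * B s) has_real_derivative ce' (x - s) * B s) (at x within UNIV)" for x s
        proof -
          have "((\<lambda>x. ce (x - s)) has_real_derivative ce' (x - s) * 1) (at x)"
            by (rule DERIV_chain2[OF ce_deriv]) (auto intro!: derivative_eq_intros)
          then show ?thesis by (intro DERIV_cmult_right) simp
        qed
        show "(\<lambda>s. ce (x - s) * B s) integrable_on cbox 0 a" for x
          unfolding box_real
          by (intro integrable_continuous_interval continuous_intros Bc continuous_on_compose2[OF ce_cont[of UNIV]]) auto
        have "continuous_on (UNIV \<times> {0..a}) (\<lambda>z. ce' (fst z - snd z) * B (snd z))"
          by (intro continuous_intros continuous_on_compose2[OF ce'_cont[of UNIV]] continuous_on_compose2[OF B]) auto
        then show "continuous_on (UNIV \<times> cbox 0 a) (\<lambda>(x, s). ce' (x - s) * B s)" by (simp add: case_prod_unfold)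
      qed auto
      then show ?thesis by (simp add: F_def F2_def[abs_def])
    qed
    have "cont2 F2"
    proof -
      have e: "F2 a b = a * integral {0..1} (\<lambda>r. ce' (b - a * r) * B (a * r))" if "a \<ge> 0" for a b
      proof -
        have "continuous_on {0..0 + a} (\<lambda>s. ce' (b - s) * B s)"
          by (intro continuous_intros Bc continuous_on_compose2[OF ce'_cont[of UNIV]]) (auto intro: continuous_on_subset[OF B])
        from integral_rescale[OF this that] show ?thesis by (simp add: F2_def)
      qed
      have "continuous_on ({0..} \<times> {0..}) (\<lambda>z. fst z * integral {0..1} (\<lambda>r. ce' (snd z - fst z * r) * B (fst z * r)))"
      proof (rule continuous_on_mult[OF continuous_on_fst[OF continuous_on_id] integral_param_cont])
        show "continuous_on (({0..} \<times> {0..}) \<times> {0..1})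
          (\<lambda>z. ce' (snd (fst z) - fst (fst z) * snd z) * B (fst (fst z) * snd z))"
          by (intro continuous_on_mult continuous_on_compose2[OF ce'_cont[of UNIV]] continuous_on_compose2[OF B] continuous_intros) auto
      qed
      then show ?thesis unfolding cont2_def by (rule continuous_on_eq) (auto simp: e)
    qed
    then show "isCont (\<lambda>z. F2 (fst z) (snd z)) (t, t)" by (rule cont2_isCont[OF _ t t])
  qed (use t in auto)
  moreover have "F2 t t = conv c' B t" unfolding F2_def conv_def
    by (rule integral_cong) (simp add: ce'_def)
  moreover have "ce (t - t) = c 0" by (simp add: ce_def)
  ultimately have "((\<lambda>s. F s s) has_real_derivative (c 0 * B t + conv c' B t)) (at t)" by simp
  then show ?thesis
  proof (rule DERIV_cong_ev[THEN iffD1, rotated -1])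
    have "F s s = conv c B s" for s unfolding F_def conv_def
      by (rule integral_cong) (simp add: ce_def)
    then show "\<forall>\<^sub>F s in nhds t. F s s = conv c B s" by simp
  qed simp_all
qed

text \<open>The symmetric difference quotient in the second time, on the diagonal, integrated over
  [t1, t2]. For a product (a(s), b(t)) it is the integral of a tested with the difference quotient
  of b.\<close>

definition sdq :: "(real \<Rightarrow> real \<Rightarrow> real) \<Rightarrow> real \<Rightarrow> real \<Rightarrow> real \<Rightarrow> real" where
  "sdq S t1 t2 h = integral {t1..t2} (\<lambda>\<tau>. S \<tau> (\<tau> + h) - S \<tau> (\<tau> - h)) / (2 * h)"

lemma sdq_cont:
  assumes "cont2 S" "0 \<le> h" "h \<le> t1"
  shows "continuous_on {t1..t2} (\<lambda>\<tau>. S \<tau> (\<tau> + h))" "continuous_on {t1..t2} (\<lambda>\<tau>. S \<tau> (\<tau> - h))"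
  by (rule cont2_compose[OF assms(1)]; use assms in \<open>auto intro!: continuous_intros\<close>)+

text \<open>The shift \<open>\<tau> \<mapsto> \<tau> - h\<close> turns the integral into a telescoping difference of averages.\<close>

lemma sdq_symmetric:
  assumes S: "cont2 S" and sym: "\<And>s t. S s t = S t s" and t: "0 < t1" "t1 \<le> t2"
  shows "((\<lambda>h. sdq S t1 t2 h) \<longlongrightarrow> (S t2 t2 - S t1 t1) / 2) (at_right 0)"
proof -
  \<comment> \<open>The mean of \<open>S \<tau> (\<tau> + h)\<close> over \<open>\<tau>\<close> in
    [t-h, t], rescaled so that it extends continuously to \<open>h = 0\<close> with value
    \<open>S t t\<close>.\<close>
  define J where "J t h = integral {0..1} (\<lambda>r. S (t - h + h * r) (t + h * r))" for t h
  have J_lim: "((\<lambda>h. J t h) \<longlongrightarrow> S t t) (at_right 0)" if "t \<ge> t1" for t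
  proof -
    have "continuous_on {0..t1} (J t)"
      unfolding J_def
      by (rule integral_param_cont, rule cont2_compose[OF S])
        (use that t in \<open>auto intro!: continuous_intros add_nonneg_nonneg\<close>)
    then have "(J t \<longlongrightarrow> J t 0) (at 0 within {0..t1})" using t by (auto simp: continuous_on)
    then have "(J t \<longlongrightarrow> J t 0) (at_right 0)" using t by (simp add: at_within_Icc_at_right)
    moreover have "J t 0 = S t t" by (simp add: J_def)
    ultimately show ?thesis by simp
  qed
  have eq: "sdq S t1 t2 h = (J t2 h - J t1 h) / 2" if h: "0 < h" "h < t1" for h
  proof -
    define mh where "mh \<tau> = S \<tau> (\<tau> + h)" for \<tau>
    have mc: "continuous_on {a..b} mh" if "a \<ge> 0" for a b
      unfolding mh_def by (rule cont2_compose[OF S]) (use that h in \<open>auto intro!: continuous_intros\<close>)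
    have mi: "mh integrable_on {a..b}" if "a \<ge> 0" for a b
      by (rule integrable_continuous_interval[OF mc[OF that]])
    have J: "integral {t - h..t} mh = h * J t h" if "t \<ge> t1" for t
    proof -
      have "integral {t - h..(t - h) + h} mh = h * integral {0..1} (\<lambda>r. mh (t - h + h * r))"
        by (rule integral_rescale) (use h that in \<open>auto intro!: mc\<close>)
      then show ?thesis by (simp add: J_def mh_def)
    qed
    have "integral {t1..t2} (\<lambda>\<tau>. S \<tau> (\<tau> - h)) = integral {t1 - h..t2 - h} mh"
    proof -
      have "integral {t1 + - h..t2 + - h} mh = integral {t1..t2} (mh \<circ> (+) (- h))"
        by (rule integral_shift_Icc_real[symmetric])
      also have "\<dots> = integral {t1..t2} (\<lambda>\<tau>. S \<tau> (\<tau> - h))"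
      proof (rule integral_cong)
        fix \<tau>
        show "(mh \<circ> (+) (- h)) \<tau> = S \<tau> (\<tau> - h)" using sym[of "\<tau> - h" \<tau>] by (simp add: mh_def add.commute)
      qed
      finally show ?thesis by simp
    qed
    moreover have "integral {t1..t2} (\<lambda>\<tau>. S \<tau> (\<tau> + h) - S \<tau> (\<tau> - h)) = integral {t1..t2} (\<lambda>\<tau>. S \<tau> (\<tau> + h)) - integral {t1..t2} (\<lambda>\<tau>. S \<tau> (\<tau> - h))"
      by (intro integral_diff integrable_continuous_interval sdq_cont S) (use h in auto)
    moreover have "integral {t1 - h..t1} mh + integral {t1..t2} mh = integral {t1 - h..t2} mh"
      by (rule Henstock_Kurzweil_Integration.integral_combine) (use h t mi in auto)
    moreover have "integral {t1 - h..t2 - h} mh + integral {t2 - h..t2} mh = integral {t1 - h..t2} mh"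
      by (rule Henstock_Kurzweil_Integration.integral_combine) (use h t mi in auto)
    ultimately have "integral {t1..t2} (\<lambda>\<tau>. S \<tau> (\<tau> + h) - S \<tau> (\<tau> - h)) = integral {t2 - h..t2} mh - integral {t1 - h..t1} mh"
      unfolding mh_def by linarith
    also have "\<dots> = h * (J t2 h - J t1 h)" using J[of t1] J[of t2] t by (simp add: algebra_simps)
    finally show ?thesis using h by (simp add: sdq_def)
  qed
  have "((\<lambda>h. (J t2 h - J t1 h) / 2) \<longlongrightarrow> (S t2 t2 - S t1 t1) / 2) (at_right 0)"
    by (intro tendsto_divide tendsto_diff J_lim tendsto_const) (use t in auto)
  then show ?thesis
  proof (rule Lim_transform_eventually)
    have "eventually (\<lambda>h. h \<in> {0<..<t1}) (at_right 0)" by (rule eventually_at_right_real[OF t(1)])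
    then show "\<forall>\<^sub>F h in at_right 0. (J t2 h - J t1 h) / 2 = sdq S t1 t2 h"
      by eventually_elim (simp add: eq)
  qed
qed

text \<open>The quotient is the mean of \<open>S2 \<tau>\<close> over an interval of length 2h
  around \<tau>; written over [0,1] it is continuous in \<open>h\<close> up to 0, where it becomes
  the value on the diagonal.\<close>

lemma sdq_derivative:
  assumes S2: "cont2 S2" and d: "\<And>s t. s \<ge> 0 \<Longrightarrow> t > 0 \<Longrightarrow> ((\<lambda>t. S s t) has_real_derivative S2 s t) (at t)"
    and t: "0 < t1" "t1 \<le> t2"
  shows "((\<lambda>h. sdq S t1 t2 h) \<longlongrightarrow> integral {t1..t2} (\<lambda>\<tau>. S2 \<tau> \<tau>)) (at_right 0)"
proof -
  define J where "J h = integral {t1..t2} (\<lambda>\<tau>. integral {0..1} (\<lambda>r. S2 \<tau> (\<tau> - h + 2 * h * r)))" for h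
  have "continuous_on {0..t1} J"
    unfolding J_def
  proof (intro integral_param_cont)
    show "continuous_on (({0..t1} \<times> {t1..t2}) \<times> {0..1})
     (\<lambda>z. S2 (snd (fst z)) (snd (fst z) - fst (fst z) + 2 * fst (fst z) * snd z))"
      by (rule cont2_compose[OF S2]) (use t in \<open>auto intro!: continuous_intros add_nonneg_nonneg\<close>)
  qed
  then have "(J \<longlongrightarrow> J 0) (at 0 within {0..t1})" using t by (auto simp: continuous_on)
  then have lim: "(J \<longlongrightarrow> J 0) (at_right 0)" using t by (simp add: at_within_Icc_at_right)
  have J0: "J 0 = integral {t1..t2} (\<lambda>\<tau>. S2 \<tau> \<tau>)" by (simp add: J_def)
  have ev: "eventually (\<lambda>h. J h = sdq S t1 t2 h) (at_right 0)"
  proof -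
    have "eventually (\<lambda>h. h \<in> {0<..<t1}) (at_right 0)" by (rule eventually_at_right_real[OF t(1)])
    then show ?thesis
    proof eventually_elim
      case (elim h)
      have "(S \<tau> (\<tau> + h) - S \<tau> (\<tau> - h)) / (2 * h) = integral {0..1} (\<lambda>r. S2 \<tau> (\<tau> - h + 2 * h * r))" if \<tau>: "\<tau> \<in> {t1..t2}" for \<tau>
      proof -
        have c: "continuous_on {\<tau> - h..(\<tau> - h) + 2 * h} (\<lambda>s. S2 \<tau> s)"
          by (rule cont2_compose[OF S2]) (use \<tau> elim t in \<open>auto intro!: continuous_intros\<close>)
        have "((\<lambda>s. S2 \<tau> s) has_integral (S \<tau> (\<tau> - h + 2 * h) - S \<tau> (\<tau> - h))) {\<tau> - h..(\<tau> - h) + 2 * h}"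
          by (rule fundamental_theorem_of_calculus)
            (use \<tau> elim t in \<open>auto intro!: d[THEN has_field_derivative_at_within] simp: has_real_derivative_iff_has_vector_derivative[symmetric]\<close>)
        note I = integral_unique[OF this]
        have e: "\<tau> - h + 2 * h = \<tau> + h" by simp
        have "S \<tau> (\<tau> + h) - S \<tau> (\<tau> - h) = integral {\<tau> - h..(\<tau> - h) + 2 * h} (\<lambda>s. S2 \<tau> s)"
          using I[unfolded e] unfolding e by simp
        also have "\<dots> = 2 * h * integral {0..1} (\<lambda>r. S2 \<tau> (\<tau> - h + 2 * h * r))"
          by (rule integral_rescale[OF c]) (use elim in auto)
        finally show ?thesis using elim by simp
      qed
      then have "J h = integral {t1..t2} (\<lambda>\<tau>. (S \<tau> (\<tau> + h) - S \<tau> (\<tau> - h)) / (2 * h))"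
        unfolding J_def by (intro integral_cong) simp
      then show "J h = sdq S t1 t2 h" by (simp add: sdq_def)
    qed
  qed
  show ?thesis using Lim_transform_eventually[OF lim ev] unfolding J0 .
qed

section \<open>The energy identity\<close>

lemma conv_diff:
  assumes "continuous_on {0..} c" "continuous_on {0..} B1" "continuous_on {0..} B2"
  shows "conv c (\<lambda>s. B1 s - B2 s) t = conv c B1 t - conv c B2 t"
  unfolding conv_def right_diff_distrib
  by (intro integral_diff integrable_continuous_interval conv_integrand_cont assms)

lemma conv_add:
  assumes "continuous_on {0..} c" "continuous_on {0..} B1" "continuous_on {0..} B2"
  shows "conv c (\<lambda>s. B1 s + B2 s) t = conv c B1 t + conv c B2 t"
  unfolding conv_def distrib_left
  by (intro integral_add integrable_continuous_interval conv_integrand_cont assms)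

lemma conv_cmult: "conv c (\<lambda>s. k * B s) t = k * conv c B t"
  unfolding conv_def by (simp add: mult.left_commute)

lemma conv_const: "conv c (\<lambda>s. k) t = k * integral {0..t} c"
proof -
  have "integral {0..t} ((\<lambda>x. c (- x)) \<circ> (+) (- t)) = integral {0 + - t..t + - t} (\<lambda>x. c (- x))"
    by (rule integral_shift_Icc_real)
  also have "\<dots> = integral {0..t} c" using Henstock_Kurzweil_Integration.integral_reflect_real[of t 0 c] by simp
  finally have "integral {0..t} (\<lambda>s. c (t - s)) = integral {0..t} c" by (simp add: o_def)
  then show ?thesis by (simp add: conv_def)
qed

lemma conv_mono:
  assumes "continuous_on {0..} c1" "continuous_on {0..} B1" "continuous_on {0..} c2" "continuous_on {0..} B2"
    and "\<And>r s. 0 \<le> r \<Longrightarrow> 0 \<le> s \<Longrightarrow> r + s = t \<Longrightarrow> c1 r * B1 s \<le> c2 r * B2 s"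
  shows "conv c1 B1 t \<le> conv c2 B2 t"
  unfolding conv_def
  by (intro integral_le integrable_continuous_interval conv_integrand_cont assms) auto

lemma conv_nonneg:
  assumes "\<And>r. 0 \<le> r \<Longrightarrow> 0 \<le> c r" "\<And>s. 0 \<le> s \<Longrightarrow> 0 \<le> B s"
  shows "0 \<le> conv c B t"
proof (cases "(\<lambda>s. c (t - s) * B s) integrable_on {0..t}")
  case True
  then show ?thesis unfolding conv_def
    by (rule Henstock_Kurzweil_Integration.integral_nonneg) (use assms in auto)
next
  case False
  then show ?thesis by (simp add: conv_def not_integrable_integral)
qed

lemma sdq_add:
  assumes "cont2 S" "cont2 T" "0 < h" "h < t1"
  shows "sdq (\<lambda>s t. S s t + T s t) t1 t2 h = sdq S t1 t2 h + sdq T t1 t2 h"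
proof -
  have "integral {t1..t2} (\<lambda>\<tau>. (S \<tau> (\<tau> + h) - S \<tau> (\<tau> - h)) + (T \<tau> (\<tau> + h) - T \<tau> (\<tau> - h)))
    = integral {t1..t2} (\<lambda>\<tau>. S \<tau> (\<tau> + h) - S \<tau> (\<tau> - h)) + integral {t1..t2} (\<lambda>\<tau>. T \<tau> (\<tau> + h) - T \<tau> (\<tau> - h))"
    by (intro integral_add integrable_continuous_interval continuous_on_diff sdq_cont assms) (use assms in auto)
  then show ?thesis by (simp add: sdq_def add_divide_distrib[symmetric] algebra_simps)
qed

lemma nonincreasing_from_deriv:
  fixes f :: "real \<Rightarrow> real"
  assumes "a \<le> b" "continuous_on {a..b} f"
    and d: "\<And>x. a < x \<Longrightarrow> x < b \<Longrightarrow> \<exists>y\<le>0. (f has_real_derivative y) (at x)"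
  shows "f b \<le> f a"
proof (cases "a = b")
  case False
  then have ab: "a < b" using assms by simp
  have "f differentiable (at x)" if "a < x" "x < b" for x
    using d[OF that] real_differentiable_def by blast
  from MVT[OF ab assms(2) this] obtain l z where lz: "a < z" "z < b" "(f has_real_derivative l) (at z)" "f b - f a = (b - a) * l"
    by blast
  obtain y where "y \<le> 0" "(f has_real_derivative y) (at z)" using d[OF lz(1,2)] by blast
  then have "l \<le> 0" using DERIV_unique[OF lz(3)] by simp
  then have "(b - a) * l \<le> 0" using ab by (simp add: mult_nonneg_nonpos)
  then show ?thesis using lz(4) by simp
qed simp

text \<open>The scalar trace of the problem: \<open>A\<close>, \<open>V\<close>, \<open>X\<close>,
  \<open>Fs\<close>, \<open>Y\<close> stand for the products of (\<nabla>u, \<nabla>u), (u_t, u_t),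
  (u_t, u), (source, u), (source, u_t) at two times, and \<open>Ph\<close> for the integrated
  potential. \<open>X_d1\<close> is the equation at time \<open>t\<close> tested with u(\<sigma>);
  everything else is regularity and symmetry.\<close>

locale visco_scalar =
  fixes g g' :: "real \<Rightarrow> real" and A V X Fs Y :: "real \<Rightarrow> real \<Rightarrow> real" and Ph :: "real \<Rightarrow> real" and \<alpha> :: real
  assumes g_deriv: "\<And>t. t \<ge> 0 \<Longrightarrow> (g has_real_derivative g' t) (at t within {0..})"
    and g'_cont: "continuous_on {0..} g'"
    and A_cont: "cont2 A" and V_cont: "cont2 V" and X_cont: "cont2 X" and Fs_cont: "cont2 Fs" and Y_cont: "cont2 Y"
    and Ph_cont: "continuous_on {0..} Ph"
    and A_sym: "\<And>s t. A s t = A t s" and V_sym: "\<And>s t. V s t = V t s"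
    and X_d2: "\<And>s t. s \<ge> 0 \<Longrightarrow> t > 0 \<Longrightarrow> ((\<lambda>t. X s t) has_real_derivative V s t) (at t)"
    and X_d1: "\<And>t \<sigma>. t > 0 \<Longrightarrow> \<sigma> \<ge> 0 \<Longrightarrow> ((\<lambda>s. X s \<sigma>) has_real_derivative
       (- A t \<sigma> + conv g (\<lambda>s. A s \<sigma>) t - X t \<sigma> + \<alpha> * Fs t \<sigma>)) (at t)"
    and Fs_d2: "\<And>s t. s \<ge> 0 \<Longrightarrow> t > 0 \<Longrightarrow> ((\<lambda>t. Fs s t) has_real_derivative Y s t) (at t)"
    and Ph_d: "\<And>t. t > 0 \<Longrightarrow> (Ph has_real_derivative Y t t) (at t)"
begin

text \<open>Here \<open>kk\<close> is the memory force tested with u(\<sigma>), \<open>kk1\<close>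
  its derivative in time, \<open>hh t s\<close> the squared norm of \<nabla>u(t) - \<nabla>u(s), and
  \<open>mem\<close>, \<open>memd\<close> are the memory functionals with kernels g and g'.\<close>

definition "kk t \<sigma> = conv g (\<lambda>s. A s \<sigma>) t"
definition "kk1 t \<sigma> = g 0 * A t \<sigma> + conv g' (\<lambda>s. A s \<sigma>) t"
definition "hh t s = A t t + A s s - 2 * A s t"
definition "mem t = conv g (hh t) t"
definition "memd t = conv g' (hh t) t"
definition "En t = 1/2 * V t t + 1/2 * (1 - integral {0..t} g) * A t t + 1/2 * mem t - \<alpha> * Ph t"

lemma g_cont: "continuous_on {0..} g"
  by (rule DERIV_continuous_on[OF g_deriv]) simp

lemma A_slice: "\<sigma> \<ge> 0 \<Longrightarrow> continuous_on {0..} (\<lambda>s. A s \<sigma>)"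
  by (rule cont2_compose[OF A_cont]) (auto intro!: continuous_intros)

lemma A_diag: "continuous_on {0..} (\<lambda>s. A s s)"
  by (rule cont2_diag[OF A_cont])

lemma hh_cont: "t \<ge> 0 \<Longrightarrow> continuous_on {0..} (hh t)"
  unfolding hh_def by (intro continuous_intros A_slice A_diag)

lemma kk_cont: "cont2 kk"
  using conv_cont2[OF g_cont A_cont] unfolding kk_def .

lemma kk1_cont: "cont2 kk1"
  unfolding kk1_def by (intro cont2_add cont2_cmult A_cont conv_cont2 g'_cont)

lemma kk_deriv: "t > 0 \<Longrightarrow> \<sigma> \<ge> 0 \<Longrightarrow> ((\<lambda>t. kk t \<sigma>) has_real_derivative kk1 t \<sigma>) (at t)"
  unfolding kk_def kk1_def by (rule conv_deriv[OF g_deriv g'_cont A_slice])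

lemma conv_hh:
  assumes c: "continuous_on {0..} c" and t: "t \<ge> 0"
  shows "conv c (hh t) t = A t t * integral {0..t} c + conv c (\<lambda>s. A s s) t - 2 * conv c (\<lambda>s. A s t) t"
  unfolding hh_def
  by (subst conv_diff[OF c], intro continuous_intros A_diag, intro continuous_intros A_slice t,
      subst conv_add[OF c], intro continuous_intros, rule A_diag)
    (simp add: conv_cmult conv_const)

text \<open>Expanding \<open>hh\<close> cancels the term with the integral of g. The first bracket
  is treated by the energy identity, the second has an explicit derivative.\<close>

lemma En_alt:
  assumes t: "t \<ge> 0"
  shows "En t = (V t t / 2 + A t t / 2 - kk t t) + (conv g (\<lambda>s. A s s) t / 2 - \<alpha> * Ph t)"
  unfolding En_def mem_def conv_hh[OF g_cont t] kk_def by (simp add: algebra_simps)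

lemma En_cont: "continuous_on {0..} En"
proof -
  have "continuous_on {0..} (\<lambda>t. (V t t / 2 + A t t / 2 - kk t t) + (conv g (\<lambda>s. A s s) t / 2 - \<alpha> * Ph t))"
    by (intro continuous_on_add continuous_on_diff continuous_on_mult continuous_on_divide continuous_on_const
        cont2_diag[OF V_cont] A_diag cont2_diag[OF kk_cont] conv_cont[OF g_cont A_diag] Ph_cont) auto
  then show ?thesis by (rule continuous_on_eq) (simp add: En_alt)
qed

text \<open>The derivative of (u_t(t), u(t+c)): the equation supplies the part from u_t, and the
  moving test function supplies \<open>V\<close>. For c = h and c = -h this is the equation tested
  with a difference quotient.\<close>

lemma X_shift_deriv:
  assumes "t > 0" "t + c > 0"
  shows "((\<lambda>t. X t (t + c)) has_real_derivative
     (- A t (t + c) + kk t (t + c) - X t (t + c) + \<alpha> * Fs t (t + c)) + V t (t + c)) (at t)"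
proof (rule diag_derivative[where F = "\<lambda>a b. X a (b + c)" and ?F2.0 = "\<lambda>a b. V a (b + c)" and e = "min t (t + c)"])
  show "((\<lambda>a. X a (t + c)) has_real_derivative (- A t (t + c) + kk t (t + c) - X t (t + c) + \<alpha> * Fs t (t + c))) (at t)"
    unfolding kk_def by (rule X_d1) (use assms in auto)
  show "((\<lambda>b. X a (b + c)) has_real_derivative V a (b + c)) (at b)" if "\<bar>a - t\<bar> < min t (t + c)" "\<bar>b - t\<bar> < min t (t + c)" for a b
  proof -
    have "a \<ge> 0" "b + c > 0" using that by (auto simp: abs_less_iff)
    from X_d2[OF this] show ?thesis by (simp add: DERIV_shift)
  qed
  have "isCont (\<lambda>z. (fst z, snd z + c)) (t, t)" by (intro continuous_intros)
  moreover have "isCont (\<lambda>z. V (fst z) (snd z)) (fst (t, t), snd (t, t) + c)"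
    using cont2_isCont[OF V_cont, of t "t + c"] assms by simp
  ultimately show "isCont (\<lambda>z. V (fst z) (snd z + c)) (t, t)"
    using isCont_o2[of "(t, t)" "\<lambda>z. (fst z, snd z + c)" "\<lambda>z. V (fst z) (snd z)"] by simp
qed (use assms in auto)

text \<open>The symmetric quotient is the average of the quotients with steps h and -h, both tending
  to the derivative of \<open>X t\<close> at \<open>t\<close>. These are the boundary terms of the
  energy identity.\<close>

lemma X_central_difference:
  assumes t: "t > 0"
  shows "((\<lambda>h. (X t (t + h) - X t (t - h)) / (2 * h)) \<longlongrightarrow> V t t) (at_right 0)"
proof -
  have d: "((\<lambda>h. (X t (t + h) - X t t) / h) \<longlongrightarrow> V t t) (at 0)"
    using X_d2[of t t] t by (simp add: DERIV_def)
  have 1: "((\<lambda>h. (X t (t + h) - X t t) / h) \<longlongrightarrow> V t t) (at_right 0)"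
    by (rule filterlim_mono[OF d order_refl]) (simp add: at_le)
  have "filterlim (\<lambda>h::real. - h) (at 0) (at_right 0)"
    unfolding filterlim_at by (auto intro!: tendsto_eq_intros simp: eventually_at_filter)
  from filterlim_compose[OF d this] have 2: "((\<lambda>h. (X t (t - h) - X t t) / (- h)) \<longlongrightarrow> V t t) (at_right 0)" by simp
  have "((\<lambda>h. ((X t (t + h) - X t t) / h + (X t (t - h) - X t t) / (- h)) / 2) \<longlongrightarrow> (V t t + V t t) / 2) (at_right 0)"
    by (intro tendsto_intros 1 2) simp
  then have "((\<lambda>h. ((X t (t + h) - X t t) / h + (X t (t - h) - X t t) / (- h)) / 2) \<longlongrightarrow> V t t) (at_right 0)" by simp
  then show ?thesis
  proof (rule Lim_transform_eventually)
    show "\<forall>\<^sub>F h in at_right 0. ((X t (t + h) - X t t) / h + (X t (t - h) - X t t) / (- h)) / 2 = (X t (t + h) - X t (t - h)) / (2 * h)"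
      using eventually_at_right_less[of "0::real"] by eventually_elim (simp add: field_simps)
  qed
qed

text \<open>
  The equation cannot be tested with \<open>u\<^sub>t\<close>, which is only square integrable. Testing with the symmetric
  difference quotient of \<open>u\<close> gives the energy identity in the limit; the part of the memory term that
  is not symmetric in its two times is integrated by parts, so only \<open>g'\<close> falls on it.
\<close>

lemma energy_identity:
  assumes t: "0 < t1" "t1 \<le> t2"
  shows "(V t2 t2 / 2 + A t2 t2 / 2 - kk t2 t2) - (V t1 t1 / 2 + A t1 t1 / 2 - kk t1 t1)
     = integral {t1..t2} (\<lambda>\<tau>. - kk1 \<tau> \<tau> - V \<tau> \<tau> + \<alpha> * Y \<tau> \<tau>)"
proof -
  \<comment> \<open>The integrand is \<open>S1 + S2\<close>. Adding \<open>kk t s\<close> makes the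
    memory part of \<open>S1\<close> symmetric; it is subtracted again in \<open>S2\<close>, where
    the second variable is the outer time of the convolution and thus differentiable with derivative
    \<open>kk1 t s\<close>.\<close>
  define S1 where "S1 s t = (V s t - A s t) + (kk s t + kk t s)" for s t
  define S2 where "S2 s t = (- 1 * kk t s - X s t) + \<alpha> * Fs s t" for s t
  define S3 where "S3 s t = (- 1 * kk1 t s - V s t) + \<alpha> * Y s t" for s t
  have S1c: "cont2 S1" unfolding S1_def by (intro cont2_add cont2_diff V_cont A_cont kk_cont cont2_flip[OF kk_cont])
  have S2c: "cont2 S2" unfolding S2_def by (intro cont2_add cont2_diff cont2_cmult X_cont Fs_cont cont2_flip[OF kk_cont])
  have S3c: "cont2 S3" unfolding S3_def by (intro cont2_add cont2_diff cont2_cmult V_cont Y_cont cont2_flip[OF kk1_cont])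
  have l1: "((\<lambda>h. sdq S1 t1 t2 h) \<longlongrightarrow> (S1 t2 t2 - S1 t1 t1) / 2) (at_right 0)"
    by (rule sdq_symmetric[OF S1c _ t]) (simp add: S1_def A_sym V_sym)
  have l2: "((\<lambda>h. sdq S2 t1 t2 h) \<longlongrightarrow> integral {t1..t2} (\<lambda>\<tau>. S3 \<tau> \<tau>)) (at_right 0)"
  proof (rule sdq_derivative[OF S3c _ t])
    fix s t :: real assume st: "s \<ge> 0" "t > 0"
    show "((\<lambda>t. S2 s t) has_real_derivative S3 s t) (at t)"
      unfolding S2_def S3_def by (intro DERIV_add DERIV_diff DERIV_cmult kk_deriv X_d2 Fs_d2 st)
  qed
  have "eventually (\<lambda>h. h \<in> {0<..<t1}) (at_right 0)" by (rule eventually_at_right_real[OF t(1)])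
  then have ev: "\<forall>\<^sub>F h in at_right 0. sdq S1 t1 t2 h + sdq S2 t1 t2 h
     = (X t2 (t2 + h) - X t2 (t2 - h)) / (2 * h) - (X t1 (t1 + h) - X t1 (t1 - h)) / (2 * h)"
  proof eventually_elim
    case (elim h)
    let ?S = "\<lambda>s t. S1 s t + S2 s t"
    have S: "?S s t = (- A s t + kk s t - X s t + \<alpha> * Fs s t) + V s t" for s t
      by (simp add: S1_def S2_def)
    have "((\<lambda>\<tau>. ?S \<tau> (\<tau> + h) - ?S \<tau> (\<tau> - h)) has_integral
       (X t2 (t2 + h) - X t2 (t2 - h)) - (X t1 (t1 + h) - X t1 (t1 - h))) {t1..t2}"
    proof (rule fundamental_theorem_of_calculus[OF t(2)])
      fix \<tau> assume \<tau>: "\<tau> \<in> {t1..t2}"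
      have "((\<lambda>\<tau>. X \<tau> (\<tau> + h) - X \<tau> (\<tau> + - h)) has_real_derivative ?S \<tau> (\<tau> + h) - ?S \<tau> (\<tau> + - h)) (at \<tau>)"
        unfolding S by (intro DERIV_diff X_shift_deriv) (use \<tau> elim t in auto)
      then show "((\<lambda>\<tau>. X \<tau> (\<tau> + h) - X \<tau> (\<tau> - h)) has_vector_derivative ?S \<tau> (\<tau> + h) - ?S \<tau> (\<tau> - h)) (at \<tau> within {t1..t2})"
        by (simp add: has_real_derivative_iff_has_vector_derivative has_vector_derivative_at_within)
    qed
    from integral_unique[OF this] have "sdq ?S t1 t2 h
      = (X t2 (t2 + h) - X t2 (t2 - h)) / (2 * h) - (X t1 (t1 + h) - X t1 (t1 - h)) / (2 * h)"
      by (simp add: sdq_def diff_divide_distrib)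
    moreover have "sdq ?S t1 t2 h = sdq S1 t1 t2 h + sdq S2 t1 t2 h"
      by (rule sdq_add[OF S1c S2c]) (use elim in auto)
    ultimately show ?case by simp
  qed
  have "((\<lambda>h. (X t2 (t2 + h) - X t2 (t2 - h)) / (2 * h) - (X t1 (t1 + h) - X t1 (t1 - h)) / (2 * h)) \<longlongrightarrow>
     (S1 t2 t2 - S1 t1 t1) / 2 + integral {t1..t2} (\<lambda>\<tau>. S3 \<tau> \<tau>)) (at_right 0)"
    by (rule Lim_transform_eventually[OF tendsto_add[OF l1 l2] ev])
  moreover have "((\<lambda>h. (X t2 (t2 + h) - X t2 (t2 - h)) / (2 * h) - (X t1 (t1 + h) - X t1 (t1 - h)) / (2 * h)) \<longlongrightarrow>
     V t2 t2 - V t1 t1) (at_right 0)"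
    by (intro tendsto_diff X_central_difference) (use t in auto)
  \<comment> \<open>On the diagonal \<open>S1\<close> equals V - A + 2 kk, so half of the boundary
    term \<open>V\<close> cancels and the other half is the kinetic energy.\<close>
  ultimately have "(S1 t2 t2 - S1 t1 t1) / 2 + integral {t1..t2} (\<lambda>\<tau>. S3 \<tau> \<tau>) = V t2 t2 - V t1 t1"
    by (intro tendsto_unique[where F = "at_right (0::real)"]) auto
  moreover have "integral {t1..t2} (\<lambda>\<tau>. S3 \<tau> \<tau>) = integral {t1..t2} (\<lambda>\<tau>. - kk1 \<tau> \<tau> - V \<tau> \<tau> + \<alpha> * Y \<tau> \<tau>)"
    by (rule integral_cong) (simp add: S3_def)
  ultimately show ?thesis by (simp add: S1_def field_simps)
qed

lemma integral_g': "t \<ge> 0 \<Longrightarrow> integral {0..t} g' = g t - g 0"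
proof (rule integral_unique, rule fundamental_theorem_of_calculus)
  fix x assume "x \<in> {0..t}"
  then have "(g has_real_derivative g' x) (at x within {0..})" by (intro g_deriv) auto
  then have "(g has_real_derivative g' x) (at x within {0..t})" by (rule DERIV_subset) auto
  then show "(g has_vector_derivative g' x) (at x within {0..t})"
    by (simp add: has_real_derivative_iff_has_vector_derivative)
qed

text \<open>The terms with \<open>kk1\<close> and with the potential cancel against the derivative
  of the remaining part of \<open>En_alt\<close>; what is left of the convolution terms recombines,
  through the integral of g', into \<open>memd\<close> and \<open>- g t * A t t / 2\<close>.\<close>

theorem En_deriv:
  assumes t: "t > 0"
  shows "(En has_real_derivative (- V t t + 1/2 * memd t - 1/2 * g t * A t t)) (at t)"
proof -
  let ?D = "\<lambda>\<tau>. - kk1 \<tau> \<tau> - V \<tau> \<tau> + \<alpha> * Y \<tau> \<tau>"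
  let ?e = "\<lambda>t. V t t / 2 + A t t / 2 - kk t t"
  have Dc: "continuous_on {0..} ?D" 
    by (intro continuous_on_add continuous_on_diff continuous_on_mult continuous_on_minus continuous_on_const
        cont2_diag[OF kk1_cont] cont2_diag[OF V_cont] cont2_diag[OF Y_cont])
  \<comment> \<open>The energy identity holds between positive times, so t/2 serves as base
    point.\<close>
  have "((\<lambda>s. integral {t/2..s} ?D) has_real_derivative ?D t) (at t within {t/2..t + 1})"
    by (rule integral_has_real_derivative) (use t in \<open>auto intro!: continuous_on_subset[OF Dc]\<close>)
  then have "((\<lambda>s. integral {t/2..s} ?D) has_real_derivative ?D t) (at t)"
    using t by (subst (asm) at_within_interior) auto
  then have "((\<lambda>s. integral {t/2..s} ?D + ?e (t/2)) has_real_derivative ?D t + 0) (at t)"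
    by (intro DERIV_add DERIV_const)
  then have e: "(?e has_real_derivative ?D t) (at t)"
    unfolding add_0_right
  proof (rule DERIV_cong_ev[THEN iffD1, rotated -1])
    have "\<forall>\<^sub>F s in nhds t. s \<in> {t/2<..}" using t by (intro eventually_nhds_in_open) auto
    then show "\<forall>\<^sub>F s in nhds t. integral {t/2..s} ?D + ?e (t/2) = ?e s"
    proof eventually_elim
      case (elim s)
      then show ?case using energy_identity[of "t/2" s] t by simp
    qed
  qed simp_all
  have "((\<lambda>t. ?e t + (conv g (\<lambda>s. A s s) t / 2 - \<alpha> * Ph t)) has_real_derivative
     ?D t + ((g 0 * A t t + conv g' (\<lambda>s. A s s) t) / 2 - \<alpha> * Y t t)) (at t)"
    by (intro DERIV_add e DERIV_diff DERIV_cdivide DERIV_cmult conv_deriv[OF g_deriv g'_cont A_diag t] Ph_d t)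
  moreover have "?D t + ((g 0 * A t t + conv g' (\<lambda>s. A s s) t) / 2 - \<alpha> * Y t t) = - V t t + 1/2 * memd t - 1/2 * g t * A t t"
    unfolding memd_def conv_hh[OF g'_cont less_imp_le[OF t]] integral_g'[OF less_imp_le[OF t]] kk1_def by (simp add: field_simps)
  ultimately have "((\<lambda>t. ?e t + (conv g (\<lambda>s. A s s) t / 2 - \<alpha> * Ph t)) has_real_derivative - V t t + 1/2 * memd t - 1/2 * g t * A t t) (at t)"
    by simp
  then show ?thesis
  proof (rule DERIV_cong_ev[THEN iffD1, rotated -1])
    have "\<forall>\<^sub>F s in nhds t. s \<in> {0<..}" using t by (intro eventually_nhds_in_open) auto
    then show "\<forall>\<^sub>F s in nhds t. ?e s + (conv g (\<lambda>r. A r r) s / 2 - \<alpha> * Ph s) = En s"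
      by eventually_elim (simp add: En_alt)
  qed simp_all
qed

end

section \<open>Decay of the energy\<close>

lemma conv_has_integral:
  assumes "continuous_on {0..} c" "continuous_on {0..} B"
  shows "((\<lambda>s. c (t - s) * B s) has_integral conv c B t) {0..t}"
  unfolding conv_def by (intro integrable_integral integrable_continuous_interval conv_integrand_cont assms)

lemma integral_deriv:
  fixes f :: "real \<Rightarrow> real"
  assumes f: "continuous_on {0..} f" and t: "t > 0"
  shows "((\<lambda>t. integral {0..t} f) has_real_derivative f t) (at t)"
proof -
  have "((\<lambda>t. integral {0..t} f) has_real_derivative f t) (at t within {0..t + 1})"
    by (rule integral_has_real_derivative) (use t in \<open>auto intro!: continuous_on_subset[OF f]\<close>)
  then show ?thesis using t by (subst (asm) at_within_interior) auto
qed

lemma integral_deriv_within: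
  fixes f :: "real \<Rightarrow> real"
  assumes f: "continuous_on {0..} f" and t: "t \<ge> 0"
  shows "((\<lambda>t. integral {0..t} f) has_real_derivative f t) (at t within {0..})"
proof -
  have "((\<lambda>t. integral {0..t} f) has_real_derivative f t) (at t within {0..t + 1})"
    by (rule integral_has_real_derivative) (use t in \<open>auto intro!: continuous_on_subset[OF f]\<close>)
  moreover have "at t within {0..t + 1} = at t within {0..}"
    by (rule at_within_nhd[of t "{..<t + 1}"]) auto
  ultimately show ?thesis by simp
qed

lemma integral_cont: "continuous_on {0..} f \<Longrightarrow> continuous_on {0..} (\<lambda>t::real. integral {0..t} f :: real)"
  by (rule DERIV_continuous_on[OF integral_deriv_within]) auto

text \<open>Abstract form of the smallness regime: \<open>U\<close> is the squared L2 norm of u,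
  \<open>l\<close> the reserve left by the relaxation function, and \<open>C\<close> bounds the
  source only while \<open>A t t\<close> is at most \<open>R\<close>. \<open>R\<close> exceeds what
  the initial data allow, so the source bound can be propagated.\<close>

locale visco_decay = visco_scalar +
  fixes U :: "real \<Rightarrow> real" and l C Cp R :: real
  assumes l: "0 < l" "l \<le> 1"
    and g_pos: "\<And>t. t \<ge> 0 \<Longrightarrow> g t > 0" and g'_neg: "\<And>t. t \<ge> 0 \<Longrightarrow> g' t < 0"
    and g_int: "\<And>t. t \<ge> 0 \<Longrightarrow> integral {0..t} g \<le> 1 - l"
    and hh_nonneg: "\<And>s t. s \<ge> 0 \<Longrightarrow> t \<ge> 0 \<Longrightarrow> 2 * A s t \<le> A t t + A s s"
    and hh_upper: "\<And>s t. s \<ge> 0 \<Longrightarrow> t \<ge> 0 \<Longrightarrow> - (2 * A s t) \<le> A t t + A s s"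
    and A_CS: "\<And>s t. s \<ge> 0 \<Longrightarrow> t \<ge> 0 \<Longrightarrow> (A s t - A t t)\<^sup>2 \<le> (A t t + A s s - 2 * A s t) * A t t"
    and V_nonneg: "\<And>t. t \<ge> 0 \<Longrightarrow> 0 \<le> V t t" and A_nonneg: "\<And>t. t \<ge> 0 \<Longrightarrow> 0 \<le> A t t"
    and XU: "\<And>t. t \<ge> 0 \<Longrightarrow> 2 * \<bar>X t t\<bar> \<le> V t t + U t"
    and U_nonneg: "\<And>t. t \<ge> 0 \<Longrightarrow> 0 \<le> U t" and U_le: "\<And>t. t \<ge> 0 \<Longrightarrow> U t \<le> Cp * A t t"
    and U_cont: "continuous_on {0..} U" and U_d: "\<And>t. t > 0 \<Longrightarrow> (U has_real_derivative 2 * X t t) (at t)"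
    and Cp: "Cp \<ge> 0"
    and small: "\<And>t. t \<ge> 0 \<Longrightarrow> A t t \<le> R \<Longrightarrow> \<bar>Fs t t\<bar> \<le> C * A t t \<and> \<bar>Ph t\<bar> \<le> C * A t t"
    and \<alpha>: "0 < \<alpha>" "\<alpha> * C \<le> l / 8"
    and R: "4 / l * (V 0 0 + A 0 0) < R"
begin

section \<open>Coercivity of the energy and the continuation argument\<close>

abbreviation "Q t \<equiv> conv g (\<lambda>s. A s s) t"

lemma hh_pos: "s \<ge> 0 \<Longrightarrow> t \<ge> 0 \<Longrightarrow> 0 \<le> hh t s"
  using hh_nonneg[of s t] by (simp add: hh_def)

lemma mem_nonneg: "t \<ge> 0 \<Longrightarrow> 0 \<le> mem t"
  unfolding mem_def by (rule conv_nonneg) (auto intro: hh_pos less_imp_le g_pos)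

lemma memd_nonpos: "t \<ge> 0 \<Longrightarrow> memd t \<le> 0"
proof -
  assume t: "t \<ge> 0"
  have "conv g' (hh t) t \<le> conv (\<lambda>r. 0) (\<lambda>s. 0) t"
    by (intro conv_mono g'_cont hh_cont t continuous_on_const)
      (use t in \<open>auto intro!: mult_nonpos_nonneg less_imp_le[OF g'_neg] hh_pos\<close>)
  then show ?thesis by (simp add: memd_def conv_def)
qed

lemma En_deriv_le:
  assumes t: "t > 0"
  shows "\<exists>y. (En has_real_derivative y) (at t) \<and> y \<le> - V t t + 1/2 * memd t \<and> y \<le> 0"
proof -
  have "0 \<le> g t * A t t" using t g_pos[of t] A_nonneg[of t] by simp
  then show ?thesis
    using En_deriv[OF t] memd_nonpos[of t] V_nonneg[of t] t by (intro exI[of _ "- V t t + 1/2 * memd t - 1/2 * g t * A t t"]) auto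
qed

lemma En_antimono:
  assumes "0 \<le> s" "s \<le> t" shows "En t \<le> En s"
proof (rule nonincreasing_from_deriv[where f = En, OF assms(2)])
  show "continuous_on {s..t} En" using assms by (intro continuous_on_subset[OF En_cont]) auto
  show "\<exists>y\<le>0. (En has_real_derivative y) (at x)" if "s < x" "x < t" for x
    using En_deriv_le[of x] that assms by auto
qed

lemma alpha_C: "A t t \<le> R \<Longrightarrow> t \<ge> 0 \<Longrightarrow> \<bar>\<alpha> * Fs t t\<bar> \<le> l / 8 * A t t \<and> \<bar>\<alpha> * Ph t\<bar> \<le> l / 8 * A t t"
proof -
  assume a: "A t t \<le> R" and t: "t \<ge> 0"
  have "\<alpha> * x \<le> l / 8 * A t t" if "x \<le> C * A t t" for x
  proof -
    have "\<alpha> * x \<le> \<alpha> * (C * A t t)" using that \<alpha>(1) by (intro mult_left_mono) auto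
    also have "\<dots> = (\<alpha> * C) * A t t" by simp
    also have "\<dots> \<le> l / 8 * A t t" by (intro mult_right_mono \<alpha>(2) A_nonneg t)
    finally show ?thesis .
  qed
  then show ?thesis using small[OF t a] \<alpha>(1) by (simp add: abs_mult)
qed

text \<open>Of the coefficient l/2 of \<open>A t t\<close> the potential consumes at most
  l/8.\<close>

lemma En_lower':
  assumes t: "t \<ge> 0" and a: "A t t \<le> R"
  shows "V t t / 2 + 3 * l / 8 * A t t + mem t / 2 \<le> En t"
proof -
  have "l * A t t \<le> (1 - integral {0..t} g) * A t t"
    using g_int[OF t] A_nonneg[OF t] by (intro mult_right_mono) auto
  moreover have "\<alpha> * Ph t \<le> l / 8 * A t t" by (rule order_trans[OF abs_ge_self conjunct2[OF alpha_C[OF a t]]])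
  moreover have "3 * l / 8 * A t t = 3 / 8 * (l * A t t)" "l / 8 * A t t = 1 / 8 * (l * A t t)"
    "1 / 2 * (1 - integral {0..t} g) * A t t = 1 / 2 * ((1 - integral {0..t} g) * A t t)" by simp_all
  ultimately show ?thesis unfolding En_def by linarith
qed

lemma start: "A 0 0 < R" "En 0 \<le> V 0 0 + A 0 0"
proof -
  have "1 * (V 0 0 + A 0 0) \<le> 4 / l * (V 0 0 + A 0 0)"
    using l V_nonneg[of 0] A_nonneg[of 0] by (intro mult_right_mono) (auto simp: field_simps)
  then show a: "A 0 0 < R" using R V_nonneg[of 0] by simp
  have "\<bar>\<alpha> * Ph 0\<bar> \<le> l / 8 * A 0 0" using alpha_C[of 0] a by simp
  also have "\<dots> \<le> 1 / 2 * A 0 0" using l A_nonneg[of 0] by (intro mult_right_mono) auto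
  finally show "En 0 \<le> V 0 0 + A 0 0"
    using V_nonneg[of 0] unfolding En_def mem_def conv_def by (simp add: abs_le_iff)
qed

text \<open>Monotonicity of the energy was obtained without the bound \<open>R\<close>, so there is
  no circularity. If \<open>A t t\<close> reached \<open>R\<close>, at that very time coercivity
  would still hold and bound it by the initial data, strictly below \<open>R\<close>.\<close>

lemma A_less_R:
  assumes t: "t \<ge> 0" shows "A t t < R"
proof (rule ccontr)
  assume "\<not> A t t < R"
  then obtain s where s: "0 \<le> s" "s \<le> t" "A s s = R"
    using IVT'[of "\<lambda>t. A t t" 0 R t] start(1) t continuous_on_subset[OF A_diag] by force
  have "l / 4 * A s s \<le> V s s / 2 + 3 * l / 8 * A s s + mem s / 2"
  proof -
    have "l / 4 * A s s \<le> 3 * l / 8 * A s s" using l A_nonneg[of s] s by (intro mult_right_mono) auto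
    then show ?thesis using V_nonneg[of s] mem_nonneg[of s] s by linarith
  qed
  also have "\<dots> \<le> En s" using En_lower'[of s] s by simp
  also have "\<dots> \<le> En 0" by (rule En_antimono) (use s in auto)
  also have "\<dots> \<le> V 0 0 + A 0 0" by (rule start)
  finally have "A s s \<le> 4 / l * (V 0 0 + A 0 0)" using l by (simp add: field_simps)
  with R s(3) show False by simp
qed

lemma En_lower: "t \<ge> 0 \<Longrightarrow> l / 4 * (V t t + A t t + mem t) \<le> En t"
proof -
  assume t: "t \<ge> 0"
  have "l / 4 * V t t \<le> 1 / 2 * V t t" "l / 4 * mem t \<le> 1 / 2 * mem t" "l / 4 * A t t \<le> 3 * l / 8 * A t t"
    using l V_nonneg[OF t] mem_nonneg[OF t] A_nonneg[OF t] by (intro mult_right_mono; simp)+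
  then show ?thesis using En_lower'[OF t] A_less_R[OF t] by (simp add: distrib_left)
qed

lemma En_upper: "t \<ge> 0 \<Longrightarrow> En t \<le> V t t + A t t + mem t"
proof -
  assume t: "t \<ge> 0"
  have 1: "(1 - integral {0..t} g) * A t t \<le> 1 * A t t"
  proof (intro mult_right_mono A_nonneg t)
    have "0 \<le> integral {0..t} g"
      by (rule Henstock_Kurzweil_Integration.integral_nonneg)
        (auto intro!: integrable_continuous_interval continuous_on_subset[OF g_cont] less_imp_le[OF g_pos])
    then show "1 - integral {0..t} g \<le> 1" by simp
  qed
  have "\<bar>\<alpha> * Ph t\<bar> \<le> l / 8 * A t t" using alpha_C[of t] A_less_R[OF t] t by simp
  also have "\<dots> \<le> 1 / 2 * A t t" using l A_nonneg[OF t] by (intro mult_right_mono) auto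
  finally show ?thesis using 1 V_nonneg[OF t] mem_nonneg[OF t] unfolding En_def by (simp add: abs_le_iff)
qed

lemma En_nonneg:
  assumes t: "t \<ge> 0" shows "0 \<le> En t"
proof -
  have "0 \<le> l / 4 * (V t t + A t t + mem t)"
    by (intro mult_nonneg_nonneg add_nonneg_nonneg V_nonneg A_nonneg mem_nonneg t) (use l in simp)
  then show ?thesis using En_lower[OF t] by linarith
qed

lemma g_antimono:
  assumes "0 \<le> s" "s \<le> t" shows "g t \<le> g s"
proof (rule nonincreasing_from_deriv[where f = g, OF assms(2)])
  show "continuous_on {s..t} g" using assms by (intro continuous_on_subset[OF g_cont]) auto
  show "\<exists>y\<le>0. (g has_real_derivative y) (at x)" if "s < x" "x < t" for x
    using g_deriv[of x] g'_neg[of x] that assms by (intro exI[of _ "g' x"]) (simp add: within_atLeast_eq_at)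
qed

text \<open>
  Absorbing \<open>g\<^sup>2\<close> by \<open>a g - g'\<close> costs a constant of order \<open>\<epsilon> / a\<close> with \<open>\<epsilon>\<close> as small as we please: \<open>-g'\<close> is
  bounded below on bounded intervals and the tail of \<open>g\<close> is small. Hence the coefficient of the memory
  term in \<open>weighted_cross_term\<close> can be made small.
\<close>

definition "qq a r = (g r)\<^sup>2 / (a * g r - g' r)"

lemma theta_pos: "a > 0 \<Longrightarrow> r \<ge> 0 \<Longrightarrow> a * g r - g' r > 0"
  using g_pos[of r] g'_neg[of r] by (simp add: add_pos_pos diff_conv_add_uminus del: add_uminus_conv_diff)

lemma qq_cont:
  assumes a: "a > 0" shows "continuous_on {0..} (qq a)"
proof -
  have "a * g r - g' r \<noteq> 0" if "r \<in> {0..}" for r using theta_pos[OF a, of r] that by simp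
  moreover have "continuous_on {0..} (\<lambda>r. a * g r - g' r)" "continuous_on {0..} (\<lambda>r. (g r)\<^sup>2)"
    by (intro continuous_on_power continuous_on_diff continuous_on_mult continuous_on_const g_cont g'_cont)+
  ultimately show ?thesis unfolding qq_def by (intro continuous_on_divide) blast+
qed

lemma small_kernel:
  assumes e: "\<epsilon> > 0"
  shows "\<exists>a>0. \<forall>t\<ge>0. integral {0..t} (qq a) \<le> \<epsilon> / a"
proof -
  have gi: "g integrable_on {a..b}" if "a \<ge> 0" for a b
    by (intro integrable_continuous_interval continuous_on_subset[OF g_cont]) (use that in auto)
  \<comment> \<open>The total integral of g, taken as a supremum; beyond a suitable \<open>T\<close>
    less than half of \<epsilon> remains.\<close>
  define S where "S = (SUP t\<in>{0..}. integral {0..t} g)"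
  have bdd: "bdd_above ((\<lambda>t. integral {0..t} g) ` {0..})" using g_int by (intro bdd_aboveI2[of _ _ "1 - l"]) auto
  have "S - \<epsilon> / 2 < S" using e by simp
  then obtain T where T: "T \<ge> 0" "S - \<epsilon> / 2 < integral {0..T} g"
    unfolding S_def using less_cSUP_iff[OF _ bdd, of "S - \<epsilon> / 2"] by (auto simp: S_def)
  have tail: "integral {T..t} g \<le> \<epsilon> / 2" if "t \<ge> T" for t
  proof -
    have "integral {0..T} g + integral {T..t} g = integral {0..t} g"
      by (rule Henstock_Kurzweil_Integration.integral_combine) (use T that gi in auto)
    moreover have "integral {0..t} g \<le> S" unfolding S_def by (rule cSUP_upper[OF _ bdd]) (use T that in auto)
    ultimately show ?thesis using T(2) by linarith
  qed
  obtain r0 where r0: "r0 \<in> {0..T}" "\<And>r. r \<in> {0..T} \<Longrightarrow> - g' r0 \<le> - g' r"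
  proof -
    have "continuous_on {0..T} (\<lambda>r. - g' r)" by (intro continuous_on_minus continuous_on_subset[OF g'_cont]) auto
    from continuous_attains_inf[OF compact_Icc _ this] T(1) that show ?thesis by fastforce
  qed
  define c where "c = - g' r0"
  have c: "c > 0" "\<And>r. r \<in> {0..T} \<Longrightarrow> c \<le> - g' r" using r0 g'_neg[of r0] by (auto simp: c_def)
  define D where "D = T * ((g 0)\<^sup>2 / c)"
  have D: "D \<ge> 0" using T(1) c(1) by (simp add: D_def)
  \<comment> \<open>With this choice \<open>\<epsilon> / (2 * a)\<close> equals
    \<open>D + 1\<close>: the part on [0, T], bounded by \<open>D\<close> independently of
    \<open>a\<close>, takes one half of the budget, and the tail takes the other.\<close>
  define a where "a = \<epsilon> / (2 * (D + 1))"
  have a: "a > 0" using e D by (simp add: a_def)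
  have aD: "D \<le> \<epsilon> / (2 * a)" using e D by (simp add: a_def)
  have qi: "qq a integrable_on {x..y}" if "x \<ge> 0" for x y
    by (intro integrable_continuous_interval continuous_on_subset[OF qq_cont[OF a]]) (use that in auto)
  have q_nn: "0 \<le> qq a r" if "r \<ge> 0" for r using theta_pos[OF a that] by (simp add: qq_def)
  have q1: "qq a r \<le> (g 0)\<^sup>2 / c" if "r \<in> {0..T}" for r
  proof -
    have "(g r)\<^sup>2 \<le> (g 0)\<^sup>2" using g_antimono[of 0 r] g_pos[of r] that by (intro power_mono) auto
    moreover have "c \<le> a * g r - g' r" using c(2)[OF that] mult_pos_pos[OF a g_pos[of r]] that by auto
    ultimately show ?thesis unfolding qq_def using c(1) by (intro frac_le) auto
  qed
  have q2: "qq a r \<le> g r * (1 / a)" if "r \<ge> 0" for r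
  proof -
    have p: "a * g r > 0" using a g_pos[OF that] by simp
    have "qq a r \<le> (g r)\<^sup>2 / (a * g r)"
      unfolding qq_def using p g'_neg[OF that] mult_pos_pos[OF theta_pos[OF a that] p] by (intro divide_left_mono) auto
    also have "\<dots> = g r * (1 / a)" using g_pos[OF that] a by (simp add: power2_eq_square)
    finally show ?thesis .
  qed
  have le1: "integral {0..T} (qq a) \<le> \<epsilon> / (2 * a)"
  proof -
    have "integral {0..T} (qq a) \<le> integral {0..T} (\<lambda>r. (g 0)\<^sup>2 / c)"
      by (rule integral_le[OF qi]) (use q1 in auto)
    also have "\<dots> = D" using T(1) by (simp add: D_def)
    finally show ?thesis using aD by linarith
  qed
  have "integral {0..t} (qq a) \<le> \<epsilon> / a" if t: "t \<ge> 0" for t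
  proof (cases "t \<le> T")
    case True
    have "integral {0..t} (qq a) \<le> integral {0..T} (qq a)"
      by (rule integral_subset_le) (use True t qi q_nn in auto)
    also have "\<dots> \<le> \<epsilon> / (2 * a)" by (rule le1)
    also have "\<dots> \<le> \<epsilon> / a" using e a by (simp add: field_simps)
    finally show ?thesis .
  next
    case False
    have "integral {0..t} (qq a) = integral {0..T} (qq a) + integral {T..t} (qq a)"
      by (rule Henstock_Kurzweil_Integration.integral_combine[symmetric]) (use T False qi in auto)
    also have "integral {T..t} (qq a) \<le> integral {T..t} (\<lambda>r. g r * (1 / a))"
      using T(1) by (intro integral_le qi integrable_on_mult_left gi q2) auto
    also have "integral {T..t} (\<lambda>r. g r * (1 / a)) = integral {T..t} g * (1 / a)" by simp
    also have "\<dots> \<le> \<epsilon> / 2 * (1 / a)" using tail[of t] False a by (intro mult_right_mono) auto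
    finally have "integral {0..t} (qq a) \<le> \<epsilon> / (2 * a) + \<epsilon> / (2 * a)" using le1 by simp
    then show ?thesis by simp
  qed
  then show ?thesis using a by blast
qed

text \<open>Under the memory integral \<nabla>u(s) is replaced by \<nabla>u(t) plus a difference.
  The first contributes at most 1 - l; the second is split by Young's inequality with weight a g -
  g', so that part of the cost falls on \<open>memd\<close>, which the energy dissipates.\<close>

lemma weighted_cross_term:
  assumes t: "t \<ge> 0" and a: "a > 0" and \<eta>: "\<eta> > 0"
  shows "kk t t \<le> (1 - l) * A t t + \<eta> * A t t * integral {0..t} (qq a) + 1 / (4 * \<eta>) * (a * mem t - memd t)"
proof -
  have wc: "continuous_on {0..} (\<lambda>s. A s t - A t t)" by (intro continuous_on_diff continuous_on_const A_slice t)
  have "kk t t = conv g (\<lambda>s. (A s t - A t t) + A t t) t" by (simp add: kk_def)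
  also have "\<dots> = conv g (\<lambda>s. A s t - A t t) t + A t t * integral {0..t} g"
    by (subst conv_add[OF g_cont wc continuous_on_const]) (simp add: conv_const)
  also have "A t t * integral {0..t} g \<le> A t t * (1 - l)" by (intro mult_left_mono g_int A_nonneg t)
  also have "conv g (\<lambda>s. A s t - A t t) t \<le> \<eta> * A t t * conv (qq a) (\<lambda>s. 1) t + 1 / (4 * \<eta>) * (a * mem t - memd t)"
  proof (rule has_integral_le)
    show "((\<lambda>s. g (t - s) * (A s t - A t t)) has_integral conv g (\<lambda>s. A s t - A t t) t) {0..t}"
      by (rule conv_has_integral[OF g_cont wc])
    show "((\<lambda>s. \<eta> * A t t * (qq a (t - s) * 1) + 1 / (4 * \<eta>) * (a * (g (t - s) * hh t s) - g' (t - s) * hh t s))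
       has_integral \<eta> * A t t * conv (qq a) (\<lambda>s. 1) t + 1 / (4 * \<eta>) * (a * mem t - memd t)) {0..t}"
      unfolding mem_def memd_def
      by (intro has_integral_add has_integral_mult_right has_integral_diff conv_has_integral qq_cont[OF a] g_cont g'_cont hh_cont[OF t] continuous_on_const)
    fix s assume s: "s \<in> {0..t}"
    \<comment> \<open>\<open>x\<close> and \<open>y\<close> are chosen so that
      \<open>4 * x * y\<close> is the Cauchy-Schwarz bound of the squared left-hand side; the
      inequality 4xy \<le> (x+y)^2 then finishes.\<close>
    define x where "x = \<eta> * A t t * qq a (t - s)"
    define \<theta> where "\<theta> = a * g (t - s) - g' (t - s)"
    define y where "y = \<theta> * hh t s / (4 * \<eta>)"
    have \<theta>: "\<theta> > 0" unfolding \<theta>_def using theta_pos[OF a, of "t - s"] s by simp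
    have x: "x \<ge> 0" unfolding x_def qq_def using \<eta> A_nonneg[OF t] \<theta> by (simp add: \<theta>_def)
    have y: "y \<ge> 0" unfolding y_def using \<eta> \<theta> hh_pos[of s t] s t by simp
    have "(g (t - s) * (A s t - A t t))\<^sup>2 \<le> (g (t - s))\<^sup>2 * (hh t s * A t t)"
      unfolding power_mult_distrib hh_def using A_CS[of s t] s t by (intro mult_left_mono) auto
    also have "\<dots> = 4 * x * y"
      unfolding x_def y_def qq_def \<theta>_def[symmetric] using \<theta> \<eta> by (simp add: field_simps)
    also have "\<dots> \<le> (x + y)\<^sup>2" using sum_squares_bound[of x y] by (simp add: power2_sum)
    finally have "g (t - s) * (A s t - A t t) \<le> x + y" by (rule power2_le_imp_le) (rule add_nonneg_nonneg[OF x y])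
    then have that: "g (t - s) * (A s t - A t t) \<le> x + y" .
    show "g (t - s) * (A s t - A t t) \<le> \<eta> * A t t * (qq a (t - s) * 1) + 1 / (4 * \<eta>) * (a * (g (t - s) * hh t s) - g' (t - s) * hh t s)"
    proof -
      have "\<theta> * hh t s = a * (g (t - s) * hh t s) - g' (t - s) * hh t s" by (simp add: \<theta>_def left_diff_distrib)
      then show ?thesis using that by (simp add: x_def y_def)
    qed
  qed
  finally show ?thesis by (simp add: conv_const mult.commute)
qed

definition "psi t = X t t + U t / 2"

lemma psi_cont: "continuous_on {0..} psi"
  unfolding psi_def by (intro continuous_on_add continuous_on_divide cont2_diag[OF X_cont] U_cont continuous_on_const) auto

text \<open>The summand \<open>U t / 2\<close> is there to cancel the damping term
  \<open>- X t t\<close> produced by the equation.\<close>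

lemma psi_deriv:
  assumes t: "t > 0"
  shows "(psi has_real_derivative (V t t - A t t + kk t t + \<alpha> * Fs t t)) (at t)"
proof -
  have "((\<lambda>t. X t (t + 0) + U t / 2) has_real_derivative
     ((- A t (t + 0) + kk t (t + 0) - X t (t + 0) + \<alpha> * Fs t (t + 0)) + V t (t + 0)) + 2 * X t t / 2) (at t)"
    by (intro DERIV_add X_shift_deriv DERIV_cdivide U_d) (use t in auto)
  then have "((\<lambda>t. X t t + U t / 2) has_real_derivative (V t t - A t t + kk t t + \<alpha> * Fs t t)) (at t)"
    by (simp add: algebra_simps)
  then show ?thesis by (simp add: psi_def[abs_def])
qed

lemma psi_abs: "t \<ge> 0 \<Longrightarrow> \<bar>psi t\<bar> \<le> (1 + Cp) * (4 / l) * En t"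
proof -
  assume t: "t \<ge> 0"
  have "\<bar>psi t\<bar> \<le> V t t / 2 + U t"
    using XU[OF t] U_nonneg[OF t] unfolding psi_def by linarith
  also have "\<dots> \<le> V t t / 2 + Cp * A t t" using U_le[OF t] by simp
  also have "\<dots> \<le> (1 + Cp) * (V t t + A t t + mem t)"
    using Cp V_nonneg[OF t] A_nonneg[OF t] mem_nonneg[OF t] by (simp add: algebra_simps add_nonneg_nonneg add_increasing add_increasing2)
  also have "\<dots> \<le> (1 + Cp) * (4 / l * En t)"
    using En_lower[OF t] l Cp by (intro mult_left_mono) (auto simp: field_simps)
  finally show ?thesis by (simp only: mult.assoc)
qed

text \<open>The multiplier \<open>psi\<close> produces the missing negative gradient term at the
  price of kinetic energy and of \<open>- memd\<close>; a large multiple of the energy pays for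
  both. The coefficient l/16 of the memory is what integrability of the energy will rely on.\<close>

lemma lyapunov:
  "\<exists>L L' CL. CL > 0 \<and> continuous_on {0..} L \<and> (\<forall>t\<ge>0. En t \<le> L t \<and> L t \<le> CL * En t) \<and>
     (\<forall>t>0. (L has_real_derivative L' t) (at t) \<and> L' t \<le> - V t t - 3 * l / 4 * A t t + l / 16 * mem t)"
proof -
  \<comment> \<open>These constants are solved backwards: with \<eta> below,
    \<open>\<eta> * (\<epsilon> / a)\<close> becomes l/8 and \<open>a / (4 * \<eta>)\<close> becomes
    l/16. Together with l/8 for the source, 3l/4 of the gradient term survives.\<close>
  define \<epsilon> where "\<epsilon> = l\<^sup>2 / 32"
  have e: "\<epsilon> > 0" using l by (simp add: \<epsilon>_def)
  obtain a where a: "a > 0" "\<And>t. t \<ge> 0 \<Longrightarrow> integral {0..t} (qq a) \<le> \<epsilon> / a" using small_kernel[OF e] by blast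
  define \<eta> where "\<eta> = a * l / (8 * \<epsilon>)"
  have \<eta>: "\<eta> > 0" using a l e by (simp add: \<eta>_def)
  define m where "m = 1 / (4 * \<eta>)"
  have m: "m > 0" using \<eta> by (simp add: m_def)
  have ma: "m * a = l / 16" using a l by (simp add: m_def \<eta>_def \<epsilon>_def field_simps power2_eq_square)
  have \<eta>q: "\<eta> * (\<epsilon> / a) = l / 8" using a e by (simp add: \<eta>_def)
  \<comment> \<open>The three summands absorb \<open>- m * memd\<close>, give the sign of the
    kinetic term, and dominate \<open>psi\<close>, respectively.\<close>
  define K where "K = 2 * m + 2 + (1 + Cp) * (4 / l)"
  have cc: "(1 + Cp) * (4 / l) \<ge> 0" using Cp l by simp
  have K: "K \<ge> 2" "K / 2 \<ge> m" using m cc by (auto simp: K_def)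
  define L where "L t = K * En t + psi t" for t
  define L' where "L' t = K * (- V t t + 1/2 * memd t - 1/2 * g t * A t t) + (V t t - A t t + kk t t + \<alpha> * Fs t t)" for t
  have "continuous_on {0..} L" unfolding L_def by (intro continuous_on_add continuous_on_mult continuous_on_const En_cont psi_cont)
  moreover have "En t \<le> L t \<and> L t \<le> (2 * K) * En t" if t: "t \<ge> 0" for t
  proof -
    have "(1 + Cp) * (4 / l) * En t + 2 * En t \<le> K * En t"
      using m En_nonneg[OF t] unfolding K_def by (simp add: distrib_right)
    then show ?thesis using psi_abs[OF t] En_nonneg[OF t] unfolding L_def by (simp add: abs_le_iff)
  qed
  moreover have "(L has_real_derivative L' t) (at t)" if "t > 0" for t
    unfolding L_def L'_def by (intro DERIV_add DERIV_cmult En_deriv psi_deriv that)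
  moreover have "L' t \<le> - V t t - 3 * l / 4 * A t t + l / 16 * mem t" if "t > 0" for t
  proof -
    have t: "t \<ge> 0" using that by simp
    have "kk t t \<le> (1 - l) * A t t + \<eta> * A t t * integral {0..t} (qq a) + m * (a * mem t - memd t)"
      unfolding m_def by (rule weighted_cross_term[OF t a(1) \<eta>])
    also have "\<eta> * A t t * integral {0..t} (qq a) \<le> \<eta> * A t t * (\<epsilon> / a)"
      using a(2)[OF t] \<eta> A_nonneg[OF t] by (intro mult_left_mono) auto
    also have "\<eta> * A t t * (\<epsilon> / a) = l / 8 * A t t" unfolding \<eta>q[symmetric] by simp
    also have "m * (a * mem t - memd t) = l / 16 * mem t - m * memd t" unfolding ma[symmetric] by (simp add: right_diff_distrib)
    finally have kk: "kk t t \<le> (1 - l) * A t t + l / 8 * A t t + (l / 16 * mem t - m * memd t)" by simp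
    have F: "\<alpha> * Fs t t \<le> l / 8 * A t t" by (rule order_trans[OF abs_ge_self conjunct1[OF alpha_C[OF less_imp_le[OF A_less_R[OF t]] t]]])
    have gA: "0 \<le> K * (g t * A t t)" using K(1) g_pos[OF t] A_nonneg[OF t] by simp
    have md: "K / 2 * memd t \<le> m * memd t" using K(2) memd_nonpos[OF t] by (rule mult_right_mono_neg)
    have KV: "2 * V t t \<le> K * V t t" using K(1) V_nonneg[OF t] by (rule mult_right_mono)
    have "L' t = - (K * V t t) + K / 2 * memd t - 1 / 2 * (K * (g t * A t t)) + V t t - A t t + kk t t + \<alpha> * Fs t t"
      by (simp add: L'_def algebra_simps)
    moreover have "(1 - l) * A t t = A t t - l * A t t" by (simp add: left_diff_distrib)
    ultimately show ?thesis using kk F gA md KV by simp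
  qed
  moreover have "2 * K > 0" using K by simp
  ultimately show ?thesis by blast
qed

section \<open>Integrability of the energy in time\<close>

lemma mem_upper:
  assumes t: "t \<ge> 0" shows "mem t \<le> 2 * A t t + 2 * Q t"
proof -
  have "mem t \<le> conv g (\<lambda>s. 2 * (A t t + A s s)) t"
    unfolding mem_def
  proof (intro conv_mono g_cont hh_cont t continuous_on_mult continuous_on_add continuous_on_const A_diag)
    fix r s :: real assume "0 \<le> r" "0 \<le> s" "r + s = t"
    then show "g r * hh t s \<le> g r * (2 * (A t t + A s s))"
      using hh_upper[of s t] t g_pos[of r] unfolding hh_def by (intro mult_left_mono) auto
  qed
  also have "\<dots> = 2 * (A t t * integral {0..t} g + Q t)"
    by (subst conv_cmult, subst conv_add[OF g_cont continuous_on_const A_diag]) (simp add: conv_const)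
  also have "A t t * integral {0..t} g \<le> A t t * 1"
    using g_int[OF t] l A_nonneg[OF t] by (intro mult_left_mono) auto
  finally show ?thesis by simp
qed

text \<open>The memory is at most \<open>2 * A t t + 2 * Q t\<close>, and the delayed part
  \<open>Q\<close> has the primitive \<open>J\<close>, a convolution with the primitive of g. As
  that primitive is at most 1, \<open>J\<close> is at most the integral of \<open>A\<close>, and the
  total cost (l/16)(2 + 2) = l/4 stays below the 3l/4 gained in \<open>lyapunov\<close>.\<close>

lemma energy_integrable:
  "\<exists>CE>0. \<forall>t\<ge>0. integral {0..t} En \<le> CE \<and> integral {0..t} (\<lambda>s. A s s) \<le> CE"
proof -
  obtain L L' CL where L: "continuous_on {0..} L" "\<And>t. t \<ge> 0 \<Longrightarrow> En t \<le> L t"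
    "\<And>t. t > 0 \<Longrightarrow> (L has_real_derivative L' t) (at t)"
    "\<And>t. t > 0 \<Longrightarrow> L' t \<le> - V t t - 3 * l / 4 * A t t + l / 16 * mem t"
    using lyapunov by blast
  define G where "G t = integral {0..t} g" for t
  define J where "J = conv G (\<lambda>s. A s s)"
  define IA where "IA t = integral {0..t} (\<lambda>s. A s s)" for t
  define IV where "IV t = integral {0..t} (\<lambda>s. V s s)" for t
  define IE where "IE t = integral {0..t} En" for t
  have Vc: "continuous_on {0..} (\<lambda>s. V s s)" by (rule cont2_diag[OF V_cont])
  have Gd: "(G has_real_derivative g t) (at t within {0..})" if "t \<ge> 0" for t
    unfolding G_def by (rule integral_deriv_within[OF g_cont that])
  have G1: "G t \<le> 1" if "t \<ge> 0" for t using g_int[OF that] l by (simp add: G_def)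
  have Gc: "continuous_on {0..} G" by (rule DERIV_continuous_on[OF Gd]) simp
  have Jd: "(J has_real_derivative Q t) (at t)" if "t > 0" for t
    using conv_deriv[OF Gd g_cont A_diag that] by (simp add: J_def G_def)
  have Jc: "continuous_on {0..} J" unfolding J_def by (rule conv_cont[OF Gc A_diag])
  have IAd: "(IA has_real_derivative A t t) (at t)" if "t > 0" for t unfolding IA_def by (rule integral_deriv[OF A_diag that])
  have IVd: "(IV has_real_derivative V t t) (at t)" if "t > 0" for t unfolding IV_def by (rule integral_deriv[OF Vc that])
  have IEd: "(IE has_real_derivative En t) (at t)" if "t > 0" for t unfolding IE_def by (rule integral_deriv[OF En_cont that])
  have Ic: "continuous_on {0..} IA" "continuous_on {0..} IV" "continuous_on {0..} IE"
    unfolding IA_def IV_def IE_def by (intro integral_cont A_diag Vc En_cont)+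
  have zero: "J 0 = 0" "IA 0 = 0" "IV 0 = 0" "IE 0 = 0" by (simp_all add: J_def conv_def IA_def IV_def IE_def)
  have bd: "IV t + l / 2 * IA t \<le> L 0 \<and> IE t \<le> IV t + 5 * IA t \<and> 0 \<le> IV t \<and> 0 \<le> IA t" if t: "t \<ge> 0" for t
  proof -
    have J1: "J t \<le> 1 * IA t"
    proof -
      have "J t \<le> conv (\<lambda>r. 1) (\<lambda>s. A s s) t"
        unfolding J_def
        by (intro conv_mono Gc A_diag continuous_on_const mult_right_mono A_nonneg G1)
      then show ?thesis by (simp add: conv_def IA_def)
    qed
    \<comment> \<open>Subtracting \<open>l / 8 * J\<close> removes the delayed term exactly, leaving
      -V - (5l/8) A for the derivative.\<close>
    have "L t - l / 8 * J t + (IV t + 5 * l / 8 * IA t) \<le> L 0 - l / 8 * J 0 + (IV 0 + 5 * l / 8 * IA 0)"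
    proof (rule nonincreasing_from_deriv[where f = "\<lambda>t. L t - l / 8 * J t + (IV t + 5 * l / 8 * IA t)", OF t])
      show "continuous_on {0..t} (\<lambda>t. L t - l / 8 * J t + (IV t + 5 * l / 8 * IA t))"
        by (intro continuous_on_add continuous_on_diff continuous_on_mult continuous_on_const
            continuous_on_subset[OF L(1)] continuous_on_subset[OF Jc] continuous_on_subset[OF Ic(1)] continuous_on_subset[OF Ic(2)]) auto
      fix x assume x: "0 < x" "x < t"
      have "((\<lambda>t. L t - l / 8 * J t + (IV t + 5 * l / 8 * IA t)) has_real_derivative
          L' x - l / 8 * Q x + (V x x + 5 * l / 8 * A x x)) (at x)"
        by (intro DERIV_add DERIV_diff DERIV_cmult L Jd IVd IAd x)
      moreover have "L' x - l / 8 * Q x + (V x x + 5 * l / 8 * A x x) \<le> 0"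
      proof -
        have "l / 16 * mem x \<le> l / 16 * (2 * A x x + 2 * Q x)" using mem_upper[of x] l x by (intro mult_left_mono) auto
        then show ?thesis using L(4)[OF x(1)] by (simp add: algebra_simps)
      qed
      ultimately show "\<exists>y\<le>0. ((\<lambda>t. L t - l / 8 * J t + (IV t + 5 * l / 8 * IA t)) has_real_derivative y) (at x)" by blast
    qed
    moreover have "l / 8 * J t \<le> l / 8 * IA t" using J1 l by (intro mult_left_mono) auto
    moreover have "0 \<le> L t" using L(2)[OF t] En_nonneg[OF t] by linarith
    ultimately have 1: "IV t + l / 2 * IA t \<le> L 0" unfolding zero by simp
    \<comment> \<open>The coefficients come from \<open>En_upper\<close> with the memory replaced by
      \<open>2 * A + 2 * Q\<close>.\<close>
    have "IE t - IV t - 3 * IA t - 2 * J t \<le> IE 0 - IV 0 - 3 * IA 0 - 2 * J 0"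
    proof (rule nonincreasing_from_deriv[where f = "\<lambda>t. IE t - IV t - 3 * IA t - 2 * J t", OF t])
      show "continuous_on {0..t} (\<lambda>t. IE t - IV t - 3 * IA t - 2 * J t)"
        by (intro continuous_on_diff continuous_on_mult continuous_on_const
            continuous_on_subset[OF Jc] continuous_on_subset[OF Ic(1)] continuous_on_subset[OF Ic(2)] continuous_on_subset[OF Ic(3)]) auto
      fix x assume x: "0 < x" "x < t"
      have "((\<lambda>t. IE t - IV t - 3 * IA t - 2 * J t) has_real_derivative En x - V x x - 3 * A x x - 2 * Q x) (at x)"
        by (intro DERIV_diff DERIV_cmult IEd Jd IVd IAd x)
      moreover have "En x - V x x - 3 * A x x - 2 * Q x \<le> 0" using En_upper[of x] mem_upper[of x] x by simp
      ultimately show "\<exists>y\<le>0. ((\<lambda>t. IE t - IV t - 3 * IA t - 2 * J t) has_real_derivative y) (at x)" by blast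
    qed
    then have 2: "IE t \<le> IV t + 5 * IA t" using J1 unfolding zero by simp
    have "0 \<le> IV t" "0 \<le> IA t" unfolding IV_def IA_def
      by (rule Henstock_Kurzweil_Integration.integral_nonneg,
          auto intro!: integrable_continuous_interval continuous_on_subset[OF A_diag] continuous_on_subset[OF Vc] A_nonneg V_nonneg)+
    with 1 2 show ?thesis by blast
  qed
  have L0: "L 0 \<ge> 0" using L(2)[of 0] En_nonneg[of 0] by simp
  \<comment> \<open>From the bounds IV \<le> L 0 and 5 IA \<le> 10 L 0 / l; the 1 makes the constant
    positive when the data vanish.\<close>
  define CE where "CE = L 0 + 10 * L 0 / l + 1"
  have "IE t \<le> CE \<and> IA t \<le> CE" if t: "t \<ge> 0" for t
  proof -
    have "IA t \<le> 2 * L 0 / l" using bd[OF t] l by (simp add: field_simps)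
    moreover have "5 * (2 * L 0 / l) = 10 * L 0 / l" by simp
    moreover have "IV t \<le> L 0"
    proof -
      have "0 \<le> l / 2 * IA t" using bd[OF t] l by (intro mult_nonneg_nonneg) auto
      then show ?thesis using bd[OF t] by linarith
    qed
    moreover have "0 \<le> L 0 / l" using L0 l by simp
    ultimately show ?thesis using bd[OF t] L0 unfolding CE_def by simp
  qed
  moreover have "CE > 0" using L0 l by (simp add: CE_def add_nonneg_pos)
  ultimately show ?thesis unfolding IE_def IA_def by blast
qed

text \<open>The dangerous term is \<open>t * A t t\<close>, which a mere bound on \<open>A\<close>
  would let grow. Since the energy decreases, t times its value is at most its integral over [0, t],
  which is bounded.\<close>

lemma hh_integral_bounded: "\<exists>H>0. \<forall>t\<ge>0. integral {0..t} (hh t) \<le> H"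
proof -
  obtain CE where CE: "CE > 0" "\<And>t. t \<ge> 0 \<Longrightarrow> integral {0..t} En \<le> CE" "\<And>t. t \<ge> 0 \<Longrightarrow> integral {0..t} (\<lambda>s. A s s) \<le> CE"
    using energy_integrable by blast
  define H where "H = 2 * (4 / l * CE + CE)"
  have "integral {0..t} (hh t) \<le> H" if t: "t \<ge> 0" for t
  proof -
    have i: "En integrable_on {0..t}" "(\<lambda>s. A s s) integrable_on {0..t}" "hh t integrable_on {0..t}"
      by (intro integrable_continuous_interval continuous_on_subset[OF En_cont] continuous_on_subset[OF A_diag] continuous_on_subset[OF hh_cont[OF t]]; auto)+
    have "integral {0..t} (hh t) \<le> integral {0..t} (\<lambda>s. 2 * (A t t + A s s))"
    proof (rule integral_le)
      show "(\<lambda>s. 2 * (A t t + A s s)) integrable_on {0..t}"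
        by (intro integrable_on_mult_right integrable_add i integrable_const_ivl)
      show "hh t s \<le> 2 * (A t t + A s s)" if "s \<in> {0..t}" for s
        using hh_upper[of s t] that t unfolding hh_def by simp
    qed (rule i)
    also have "\<dots> = 2 * (t * A t t + integral {0..t} (\<lambda>s. A s s))"
    proof (rule integral_unique)
      show "((\<lambda>s. 2 * (A t t + A s s)) has_integral 2 * (t * A t t + integral {0..t} (\<lambda>s. A s s))) {0..t}"
        using has_integral_mult_right[OF has_integral_add[OF has_integral_const_real[of "A t t" 0 t] integrable_integral[OF i(2)]], of 2] t by simp
    qed
    also have "t * A t t \<le> 4 / l * CE"
    proof -
      have "l / 4 * A t t \<le> l / 4 * (V t t + A t t + mem t)"
        using V_nonneg[OF t] mem_nonneg[OF t] l by (intro mult_left_mono) auto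
      also have "\<dots> \<le> En t" by (rule En_lower[OF t])
      finally have "t * (l / 4 * A t t) \<le> t * En t" using t by (rule mult_left_mono)
      also have "\<dots> = integral {0..t} (\<lambda>s. En t)" using t by simp
      also have "\<dots> \<le> integral {0..t} En" by (rule integral_le) (use i En_antimono in auto)
      also have "\<dots> \<le> CE" by (rule CE(2)[OF t])
      finally show ?thesis using l by (simp add: field_simps)
    qed
    also have "integral {0..t} (\<lambda>s. A s s) \<le> CE" by (rule CE(3)[OF t])
    finally show ?thesis by (simp add: H_def)
  qed
  moreover have "H > 0" using CE(1) l by (simp add: H_def add_pos_pos)
  ultimately show ?thesis by blast
qed

end

section \<open>Decay rates from the differential inequality for g\<close>

locale visco_rate = visco_decay +
  fixes \<xi> \<xi>' :: "real \<Rightarrow> real" and q :: real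
  assumes \<xi>_deriv: "\<And>t. t \<ge> 0 \<Longrightarrow> (\<xi> has_real_derivative \<xi>' t) (at t within {0..})"
    and \<xi>_pos: "\<And>t. t \<ge> 0 \<Longrightarrow> \<xi> t > 0" and \<xi>'_nonpos: "\<And>t. t > 0 \<Longrightarrow> \<xi>' t \<le> 0"
    and \<xi>_antimono: "\<And>s t. 0 \<le> s \<Longrightarrow> s \<le> t \<Longrightarrow> \<xi> t \<le> \<xi> s"
    and rate: "\<And>r. r \<ge> 0 \<Longrightarrow> g' r \<le> - \<xi> r * g r powr q" and q: "q \<ge> 1"
begin

lemma \<xi>_cont: "continuous_on {0..} \<xi>"
  by (rule DERIV_continuous_on[OF \<xi>_deriv]) simp

text \<open>
  Young's inequality is applied inside the memory integral, where it reduces to comparing \<open>g\<close> with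
  \<open>\<epsilon> En\<close> pointwise; the integral of \<open>hh\<close> is bounded because the energy is integrable.
\<close>

lemma memory_absorb:
  "\<exists>D\<ge>0. \<forall>t\<ge>0. En t > 0 \<longrightarrow> \<xi> t * (En t powr (q - 1) * mem t) \<le> l / 4 * (\<xi> t * En t powr q) + D * (- memd t)"
proof -
  obtain H where H: "H > 0" "\<And>t. t \<ge> 0 \<Longrightarrow> integral {0..t} (hh t) \<le> H" using hh_integral_bounded by blast
  \<comment> \<open>Chosen so that \<open>\<epsilon> * H\<close> is l/4, half of the coefficient l/2
    available in \<open>modified_energy\<close>.\<close>
  define \<epsilon> where "\<epsilon> = l / (4 * H)"
  have e: "\<epsilon> > 0" using l H by (simp add: \<epsilon>_def)
  define D where "D = \<epsilon> powr (- (q - 1))"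
  have gq_cont: "continuous_on {0..} (\<lambda>r. g r powr q)"
    by (intro continuous_on_powr g_cont continuous_on_const) (use g_pos in fastforce)
  have "\<xi> t * (En t powr (q - 1) * mem t) \<le> l / 4 * (\<xi> t * En t powr q) + D * (- memd t)"
    if t: "t \<ge> 0" and E: "En t > 0" for t
  proof -
    let ?E = "En t"
    have young: "?E powr (q - 1) * g r \<le> \<epsilon> * ?E powr q + D * g r powr q" if r: "r \<ge> 0" for r
    proof (cases "g r \<le> \<epsilon> * ?E")
      case True
      have "?E powr (q - 1) * g r \<le> ?E powr (q - 1) * (\<epsilon> * ?E)" using True by (rule mult_left_mono) simp
      also have "\<dots> = \<epsilon> * (?E powr (q - 1) * ?E powr 1)" using E by simp
      also have "\<dots> = \<epsilon> * ?E powr q" unfolding powr_add[symmetric] by simp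
      finally show ?thesis by (simp add: D_def add_increasing2)
    next
      case False
      then have "?E \<le> g r / \<epsilon>" using e by (simp add: field_simps)
      then have "?E powr (q - 1) \<le> (g r / \<epsilon>) powr (q - 1)" using E q by (intro powr_mono2) auto
      also have "\<dots> = g r powr (q - 1) / \<epsilon> powr (q - 1)" by (rule powr_divide)
      also have "\<dots> = D * g r powr (q - 1)"
        unfolding D_def powr_minus by (simp only: divide_inverse mult.commute)
      finally have "?E powr (q - 1) * g r \<le> D * g r powr (q - 1) * g r"
        using g_pos[OF r] by (intro mult_right_mono) auto
      also have "\<dots> = D * (g r powr (q - 1) * g r powr 1)" using g_pos[OF r] by simp
      also have "\<dots> = D * g r powr q" unfolding powr_add[symmetric] by simp
      finally show ?thesis using e by (simp add: add_increasing)
    qed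
    have i: "hh t integrable_on {0..t}"
      by (intro integrable_continuous_interval continuous_on_subset[OF hh_cont[OF t]]) auto
    have m1: "?E powr (q - 1) * mem t \<le> \<epsilon> * ?E powr q * integral {0..t} (hh t) + D * conv (\<lambda>r. g r powr q) (hh t) t"
    proof (rule has_integral_le)
      show "((\<lambda>s. ?E powr (q - 1) * (g (t - s) * hh t s)) has_integral ?E powr (q - 1) * mem t) {0..t}"
        unfolding mem_def by (intro has_integral_mult_right conv_has_integral g_cont hh_cont t)
      show "((\<lambda>s. \<epsilon> * ?E powr q * hh t s + D * (g (t - s) powr q * hh t s)) has_integral
          \<epsilon> * ?E powr q * integral {0..t} (hh t) + D * conv (\<lambda>r. g r powr q) (hh t) t) {0..t}"
        by (intro has_integral_add has_integral_mult_right integrable_integral i conv_has_integral[OF gq_cont hh_cont[OF t]])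
      fix s assume s: "s \<in> {0..t}"
      have "(?E powr (q - 1) * g (t - s)) * hh t s \<le> (\<epsilon> * ?E powr q + D * g (t - s) powr q) * hh t s"
        using young[of "t - s"] hh_pos[of s t] s t by (intro mult_right_mono) auto
      then show "?E powr (q - 1) * (g (t - s) * hh t s) \<le> \<epsilon> * ?E powr q * hh t s + D * (g (t - s) powr q * hh t s)"
        by (simp add: algebra_simps)
    qed
    have m2: "\<epsilon> * ?E powr q * integral {0..t} (hh t) \<le> l / 4 * ?E powr q"
    proof -
      have "\<epsilon> * ?E powr q * integral {0..t} (hh t) \<le> \<epsilon> * ?E powr q * H"
        using e by (intro mult_left_mono H(2)[OF t]) auto
      also have "\<dots> = l / 4 * ?E powr q" using H(1) by (simp add: \<epsilon>_def)
      finally show ?thesis .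
    qed
    have m3: "\<xi> t * conv (\<lambda>r. g r powr q) (hh t) t \<le> - memd t"
    proof -
      have "\<xi> t * conv (\<lambda>r. g r powr q) (hh t) t = conv (\<lambda>r. g r powr q) (\<lambda>s. \<xi> t * hh t s) t"
        by (rule conv_cmult[symmetric])
      also have "\<dots> \<le> conv (\<lambda>r. - g' r) (hh t) t"
      proof (intro conv_mono gq_cont hh_cont t continuous_on_mult continuous_on_const continuous_on_minus g'_cont)
        fix r s :: real assume rs: "0 \<le> r" "0 \<le> s" "r + s = t"
        have "\<xi> t * g r powr q \<le> \<xi> r * g r powr q" using \<xi>_antimono[of r t] rs by (intro mult_right_mono) auto
        also have "\<dots> \<le> - g' r" using rate[OF rs(1)] by simp
        finally have "\<xi> t * g r powr q * hh t s \<le> - g' r * hh t s" by (rule mult_right_mono) (rule hh_pos[OF rs(2) t])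
        then show "g r powr q * (\<xi> t * hh t s) \<le> - g' r * hh t s" by (simp add: mult_ac)
      qed
      also have "\<dots> = - memd t" by (simp add: memd_def conv_def)
      finally show ?thesis .
    qed
    have "\<xi> t * (?E powr (q - 1) * mem t) \<le> \<xi> t * (l / 4 * ?E powr q + D * conv (\<lambda>r. g r powr q) (hh t) t)"
      using m1 m2 \<xi>_pos[OF t] by (intro mult_left_mono) auto
    also have "\<dots> = l / 4 * (\<xi> t * ?E powr q) + D * (\<xi> t * conv (\<lambda>r. g r powr q) (hh t) t)"
      by (simp add: algebra_simps)
    also have "\<dots> \<le> l / 4 * (\<xi> t * ?E powr q) + D * (- memd t)"
      using m3 by (intro add_left_mono mult_left_mono) (auto simp: D_def)
    finally show ?thesis .
  qed
  moreover have "D \<ge> 0" by (simp add: D_def)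
  ultimately show ?thesis by blast
qed

text \<open>Everything is conditional on \<open>En t > 0\<close> because the derivative of
  \<open>En t powr (q - 1)\<close> needs a positive base; as the energy decreases, positivity at one
  time gives it at all earlier times. Differentiating the decreasing factors \<xi> and
  \<open>En powr (q - 1)\<close> only helps, since \<open>L\<close> is nonnegative.\<close>

lemma modified_energy:
  assumes E0: "En 0 > 0"
  shows "\<exists>F F' c CF. 0 < c \<and> 0 < CF \<and>
     (\<forall>T\<ge>0. En T > 0 \<longrightarrow> continuous_on {0..T} F) \<and>
     (\<forall>t\<ge>0. En t > 0 \<longrightarrow> c * En t \<le> F t \<and> F t \<le> CF * En t) \<and>
     (\<forall>t>0. En t > 0 \<longrightarrow> (F has_real_derivative F' t) (at t) \<and> F' t \<le> - (l / 4) * (\<xi> t * En t powr q))"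
proof -
  obtain D where D: "D \<ge> 0" "\<And>t. t \<ge> 0 \<Longrightarrow> En t > 0 \<Longrightarrow>
      \<xi> t * (En t powr (q - 1) * mem t) \<le> l / 4 * (\<xi> t * En t powr q) + D * (- memd t)"
    using memory_absorb by blast
  obtain L L' CL where CL: "CL > 0" and L: "continuous_on {0..} L" "\<And>t. t \<ge> 0 \<Longrightarrow> En t \<le> L t" "\<And>t. t \<ge> 0 \<Longrightarrow> L t \<le> CL * En t"
    "\<And>t. t > 0 \<Longrightarrow> (L has_real_derivative L' t) (at t)"
    "\<And>t. t > 0 \<Longrightarrow> L' t \<le> - V t t - 3 * l / 4 * A t t + l / 16 * mem t"
    using lyapunov by blast
  \<comment> \<open>At least \<open>2 * D\<close>, so the dissipation \<open>memd / 2\<close>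
    contained in the derivative of the energy compensates the term \<open>D * (- memd)\<close> from
    \<open>memory_absorb\<close>; the 1 keeps \<open>c\<close> positive.\<close>
  define c where "c = 2 * D + 1"
  have c: "c > 0" "2 * D \<le> c" using D(1) by (auto simp: c_def)
  define e' where "e' t = - V t t + 1/2 * memd t - 1/2 * g t * A t t" for t
  have e': "e' t \<le> 1/2 * memd t" if "t \<ge> 0" for t
  proof -
    have "0 \<le> g t * A t t" using g_pos[OF that] A_nonneg[OF that] by simp
    then show ?thesis using V_nonneg[OF that] unfolding e'_def by simp
  qed
  have e'0: "e' t \<le> 0" if "t \<ge> 0" for t using e'[OF that] memd_nonpos[OF that] by simp
  define F where "F t = \<xi> t * En t powr (q - 1) * L t + c * En t" for t
  define F' where "F' t = (\<xi>' t * En t powr (q - 1) + ((q - 1) * En t powr (q - 1 - 1) * e' t) * \<xi> t) * L t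
     + L' t * (\<xi> t * En t powr (q - 1)) + c * e' t" for t
  define CF where "CF = \<xi> 0 * En 0 powr (q - 1) * CL + c"
  have CF: "CF > 0" using \<xi>_pos[of 0] CL c(1) by (simp add: CF_def add_nonneg_pos)
  have Fc: "continuous_on {0..T} F" if T: "T \<ge> 0" "En T > 0" for T
  proof -
    have "En t \<noteq> 0" if "t \<in> {0..T}" for t using En_antimono[of t T] T that by auto
    then have "continuous_on {0..T} (\<lambda>t. En t powr (q - 1))"
      by (intro continuous_on_powr continuous_on_subset[OF En_cont] continuous_on_const) auto
    then show ?thesis unfolding F_def
      by (intro continuous_on_add continuous_on_mult continuous_on_const continuous_on_subset[OF En_cont]
          continuous_on_subset[OF \<xi>_cont] continuous_on_subset[OF L(1)]) auto
  qed
  have Fb: "c * En t \<le> F t \<and> F t \<le> CF * En t" if t: "t \<ge> 0" "En t > 0" for t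
  proof
    have "0 \<le> L t" using L(2)[OF t(1)] t(2) by simp
    then have "0 \<le> \<xi> t * En t powr (q - 1) * L t" using \<xi>_pos[OF t(1)] by simp
    then show "c * En t \<le> F t" by (simp add: F_def)
    have "\<xi> t * En t powr (q - 1) * L t \<le> \<xi> 0 * En 0 powr (q - 1) * (CL * En t)"
    proof (intro mult_mono)
      show "\<xi> t \<le> \<xi> 0" using \<xi>_antimono[of 0 t] t by simp
      show "En t powr (q - 1) \<le> En 0 powr (q - 1)" using En_antimono[of 0 t] t q by (intro powr_mono2) auto
      show "L t \<le> CL * En t" by (rule L(3)[OF t(1)])
    qed (use \<xi>_pos[of 0] \<open>0 \<le> L t\<close> in auto)
    then show "F t \<le> CF * En t" by (simp add: F_def CF_def algebra_simps)
  qed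
  have Fd: "(F has_real_derivative F' t) (at t) \<and> F' t \<le> - (l / 4) * (\<xi> t * En t powr q)" if t: "t > 0" "En t > 0" for t
  proof
    have t0: "t \<ge> 0" using t by simp
    have Ed: "(En has_real_derivative e' t) (at t)" unfolding e'_def by (rule En_deriv[OF t(1)])
    have xd: "(\<xi> has_real_derivative \<xi>' t) (at t)" using \<xi>_deriv[of t] t by (simp add: within_atLeast_eq_at)
    have pd: "((\<lambda>t. En t powr (q - 1)) has_real_derivative (q - 1) * En t powr (q - 1 - 1) * e' t) (at t)"
      by (rule DERIV_chain2[where f = "\<lambda>z. z powr (q - 1)" and g = En, OF has_real_derivative_powr[OF t(2)] Ed])
    show "(F has_real_derivative F' t) (at t)"
      unfolding F_def F'_def by (intro DERIV_add DERIV_mult DERIV_cmult xd pd L(4) t Ed)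
    define x where "x = \<xi> t * En t powr (q - 1)"
    have x: "x \<ge> 0" using \<xi>_pos[OF t0] by (simp add: x_def)
    have Lt: "L t \<ge> 0" using L(2)[OF t0] t(2) by simp
    have a1: "(\<xi>' t * En t powr (q - 1) + ((q - 1) * En t powr (q - 1 - 1) * e' t) * \<xi> t) * L t \<le> 0"
    proof (rule mult_nonpos_nonneg[OF add_nonpos_nonpos Lt])
      show "\<xi>' t * En t powr (q - 1) \<le> 0" using \<xi>'_nonpos[OF t(1)] by (simp add: mult_nonpos_nonneg)
      show "(q - 1) * En t powr (q - 1 - 1) * e' t * \<xi> t \<le> 0"
        using q e'0[OF t0] \<xi>_pos[OF t0] by (intro mult_nonpos_nonneg mult_nonneg_nonpos) auto
    qed
    \<comment> \<open>The negative terms are traded for a multiple of the whole energy; the memory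
      this costs is again covered by \<open>memory_absorb\<close>.\<close>
    have L'le: "L' t \<le> - (l / 2) * En t + mem t"
    proof -
      have "l / 2 * En t \<le> l / 2 * (V t t + A t t + mem t)" using En_upper[OF t0] l by (intro mult_left_mono) auto
      moreover have "l / 2 * V t t \<le> 1 * V t t" "l / 2 * A t t \<le> 3 * l / 4 * A t t" "(l / 16 + l / 2) * mem t \<le> 1 * mem t"
        using l V_nonneg[OF t0] A_nonneg[OF t0] mem_nonneg[OF t0] by (intro mult_right_mono; simp)+
      ultimately show ?thesis using L(5)[OF t(1)] by (simp add: distrib_left distrib_right)
    qed
    have "L' t * x \<le> (- (l / 2) * En t + mem t) * x" by (rule mult_right_mono[OF L'le x])
    also have "\<dots> = - (l / 2) * (x * En t) + \<xi> t * (En t powr (q - 1) * mem t)" by (simp add: x_def algebra_simps)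
    also have "x * En t = \<xi> t * En t powr q"
    proof -
      have "En t powr (q - 1) * En t powr 1 = En t powr q" unfolding powr_add[symmetric] by simp
      then show ?thesis using t(2) by (simp add: x_def mult.assoc)
    qed
    also have "- (l / 2) * (\<xi> t * En t powr q) + \<xi> t * (En t powr (q - 1) * mem t)
       \<le> - (l / 2) * (\<xi> t * En t powr q) + (l / 4 * (\<xi> t * En t powr q) + D * (- memd t))"
      by (rule add_left_mono[OF D(2)[OF t0 t(2)]])
    finally have a2: "L' t * x \<le> - (l / 4) * (\<xi> t * En t powr q) - D * memd t" by (simp add: field_simps)
    have a3: "c * e' t \<le> D * memd t"
    proof -
      have "c * e' t \<le> 2 * D * e' t" using c(2) e'0[OF t0] by (rule mult_right_mono_neg)
      also have "\<dots> \<le> 2 * D * (1/2 * memd t)" using D(1) e'[OF t0] by (intro mult_left_mono) auto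
      finally show ?thesis by simp
    qed
    show "F' t \<le> - (l / 4) * (\<xi> t * En t powr q)"
      using a1 a2 a3 unfolding F'_def x_def by linarith
  qed
  show ?thesis using c(1) CF Fc Fb Fd by blast
qed

lemma \<xi>_integral_deriv: "t > 0 \<Longrightarrow> ((\<lambda>t. integral {0..t} \<xi>) has_real_derivative \<xi> t) (at t)"
  by (rule integral_deriv[OF \<xi>_cont])

lemma \<xi>_integral_nonneg: "0 \<le> integral {0..t} \<xi>"
  by (rule Henstock_Kurzweil_Integration.integral_nonneg)
    (auto intro!: integrable_continuous_interval continuous_on_subset[OF \<xi>_cont] less_imp_le[OF \<xi>_pos])

text \<open>For \<open>q = 1\<close> the modified energy satisfies a linear inequality, so F exp(b
  I), with I the integral of \<xi>, is nonincreasing; the equivalence constants of \<open>F\<close>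
  and the energy end up in \<open>B\<close>.\<close>

lemma exponential_decay:
  assumes q1: "q = 1" and E0: "En 0 > 0"
  shows "\<exists>b>0. \<exists>B\<ge>0. \<forall>t\<ge>0. En t > 0 \<longrightarrow> En t \<le> En 0 * exp (B - b * integral {0..t} \<xi>)"
proof -
  obtain F F' c CF where c: "0 < c" "0 < CF" and Fc: "\<And>T. T \<ge> 0 \<Longrightarrow> En T > 0 \<Longrightarrow> continuous_on {0..T} F"
    and Fb: "\<And>t. t \<ge> 0 \<Longrightarrow> En t > 0 \<Longrightarrow> c * En t \<le> F t \<and> F t \<le> CF * En t"
    and Fd: "\<And>t. t > 0 \<Longrightarrow> En t > 0 \<Longrightarrow> (F has_real_derivative F' t) (at t) \<and> F' t \<le> - (l / 4) * (\<xi> t * En t powr q)"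
    using modified_energy[OF E0] by blast
  define b where "b = l / (4 * CF)"
  have b: "b > 0" using l c by (simp add: b_def)
  define B where "B = max 0 (ln (CF / c))"
  have "En t \<le> En 0 * exp (B - b * integral {0..t} \<xi>)" if t: "t \<ge> 0" and E: "En t > 0" for t
  proof -
    let ?I = "\<lambda>t. integral {0..t} \<xi>"
    have pos: "En x > 0" if "0 \<le> x" "x \<le> t" for x using En_antimono[OF that] E by simp
    have "F t * exp (b * ?I t) \<le> F 0 * exp (b * ?I 0)"
    proof (rule nonincreasing_from_deriv[where f = "\<lambda>t. F t * exp (b * ?I t)", OF t])
      show "continuous_on {0..t} (\<lambda>t. F t * exp (b * ?I t))"
        by (intro continuous_on_mult Fc t E continuous_on_exp continuous_on_const continuous_on_subset[OF integral_cont[OF \<xi>_cont]]) auto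
      fix x assume x: "0 < x" "x < t"
      have Ex: "En x > 0" using pos[of x] x by simp
      have d: "((\<lambda>t. F t * exp (b * ?I t)) has_real_derivative F' x * exp (b * ?I x) + exp (b * ?I x) * (b * \<xi> x) * F x) (at x)"
        by (intro DERIV_mult DERIV_chain2[OF DERIV_exp] DERIV_cmult \<xi>_integral_deriv conjunct1[OF Fd] x Ex)
      have "b * \<xi> x * F x \<le> b * \<xi> x * (CF * En x)"
        using Fb[of x] Ex x b \<xi>_pos[of x] by (intro mult_left_mono) auto
      also have "\<dots> = l / 4 * (\<xi> x * En x powr q)" using c Ex by (simp add: b_def q1)
      finally have "F' x + b * \<xi> x * F x \<le> 0" using Fd[OF x(1) Ex] by simp
      then have "exp (b * ?I x) * (F' x + b * \<xi> x * F x) \<le> 0" by (simp add: mult_nonneg_nonpos)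
      then have "F' x * exp (b * ?I x) + exp (b * ?I x) * (b * \<xi> x) * F x \<le> 0" by (simp add: algebra_simps)
      with d show "\<exists>y\<le>0. ((\<lambda>t. F t * exp (b * ?I t)) has_real_derivative y) (at x)" by blast
    qed
    then have "F t * exp (b * ?I t) \<le> F 0" by simp
    also have "\<dots> \<le> CF * En 0" using Fb[of 0] E0 by simp
    finally have 1: "F t * exp (b * ?I t) \<le> CF * En 0" .
    have "c * En t * exp (b * ?I t) \<le> F t * exp (b * ?I t)" using Fb[OF t E] by (intro mult_right_mono) auto
    with 1 have "c * En t * exp (b * ?I t) \<le> CF * En 0" by linarith
    then have "En t * exp (b * ?I t) \<le> CF / c * En 0" using c by (simp add: field_simps)
    also have "\<dots> \<le> exp B * En 0"
    proof (intro mult_right_mono less_imp_le[OF E0])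
      have "CF / c = exp (ln (CF / c))" using c by simp
      also have "\<dots> \<le> exp B" by (simp add: B_def)
      finally show "CF / c \<le> exp B" .
    qed
    finally show ?thesis by (simp add: exp_diff field_simps)
  qed
  moreover have "B \<ge> 0" by (simp add: B_def)
  ultimately show ?thesis using b by blast
qed

text \<open>For \<open>q > 1\<close> the quantity F^(1-q) grows at least like b times the integral
  of \<xi>. Its initial value is dropped; \<open>decay\<close> recovers the behaviour near time 0
  from monotonicity of the energy.\<close>

lemma polynomial_decay:
  assumes q1: "q > 1" and E0: "En 0 > 0"
  shows "\<exists>b>0. \<forall>t\<ge>0. En t > 0 \<longrightarrow> b * integral {0..t} \<xi> * En t powr (q - 1) \<le> 1"
proof -
  obtain F F' c CF where c: "0 < c" "0 < CF" and Fc: "\<And>T. T \<ge> 0 \<Longrightarrow> En T > 0 \<Longrightarrow> continuous_on {0..T} F"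
    and Fb: "\<And>t. t \<ge> 0 \<Longrightarrow> En t > 0 \<Longrightarrow> c * En t \<le> F t \<and> F t \<le> CF * En t"
    and Fd: "\<And>t. t > 0 \<Longrightarrow> En t > 0 \<Longrightarrow> (F has_real_derivative F' t) (at t) \<and> F' t \<le> - (l / 4) * (\<xi> t * En t powr q)"
    using modified_energy[OF E0] by blast
  define b where "b = (q - 1) * (l / 4) * CF powr (- q)"
  have b: "b > 0" using l c q1 by (simp add: b_def)
  have "(b * c powr (q - 1)) * integral {0..t} \<xi> * En t powr (q - 1) \<le> 1" if t: "t \<ge> 0" and E: "En t > 0" for t
  proof -
    let ?I = "\<lambda>t. integral {0..t} \<xi>"
    have pos: "En x > 0" if "0 \<le> x" "x \<le> t" for x using En_antimono[OF that] E by simp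
    have Fpos: "F x > 0" if "0 \<le> x" "x \<le> t" for x
      using Fb[OF that(1) pos[OF that]] mult_pos_pos[OF c(1) pos[OF that]] by linarith
    have "b * ?I t - F t powr (1 - q) \<le> b * ?I 0 - F 0 powr (1 - q)"
    proof (rule nonincreasing_from_deriv[where f = "\<lambda>t. b * ?I t - F t powr (1 - q)", OF t])
      have "F x \<noteq> 0" if "x \<in> {0..t}" for x using Fpos[of x] that by auto
      then show "continuous_on {0..t} (\<lambda>t. b * ?I t - F t powr (1 - q))"
        by (intro continuous_on_diff continuous_on_mult continuous_on_powr Fc t E continuous_on_const
            continuous_on_subset[OF integral_cont[OF \<xi>_cont]]) auto
      fix x assume x: "0 < x" "x < t"
      have Ex: "En x > 0" and Fx: "F x > 0" using pos[of x] Fpos[of x] x by auto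
      have d: "((\<lambda>t. b * ?I t - F t powr (1 - q)) has_real_derivative b * \<xi> x - (1 - q) * F x powr (1 - q - 1) * F' x) (at x)"
        by (intro DERIV_diff DERIV_cmult \<xi>_integral_deriv x DERIV_chain2[where f = "\<lambda>z. z powr (1 - q)" and g = F, OF has_real_derivative_powr[OF Fx] conjunct1[OF Fd[OF x(1) Ex]]])
      have "b * \<xi> x - (1 - q) * F x powr (1 - q - 1) * F' x \<le> 0"
      proof -
        have e: "1 - q - 1 = - q" by simp
        have "F x powr q \<le> (CF * En x) powr q" using Fb[of x] Ex Fx x q1 by (intro powr_mono2) auto
        also have "\<dots> = CF powr q * En x powr q" by (rule powr_mult)
        finally have "CF powr (- q) * F x powr q \<le> CF powr (- q) * (CF powr q * En x powr q)" by (rule mult_left_mono) simp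
        also have "\<dots> = En x powr q"
        proof -
          have "CF powr (- q) * CF powr q = 1" unfolding powr_add[symmetric] using c by simp
          then show ?thesis by (simp only: mult.assoc[symmetric] mult_1)
        qed
        finally have k: "CF powr (- q) * F x powr q \<le> En x powr q" .
        have "(l / 4 * \<xi> x) * (CF powr (- q) * F x powr q) \<le> (l / 4 * \<xi> x) * En x powr q"
          using k l \<xi>_pos[of x] x by (intro mult_left_mono) auto
        also have "\<dots> \<le> - F' x" using Fd[OF x(1) Ex] by simp
        finally have "((q - 1) * F x powr (- q)) * ((l / 4 * \<xi> x) * (CF powr (- q) * F x powr q)) \<le> ((q - 1) * F x powr (- q)) * (- F' x)"
          using q1 by (intro mult_left_mono) auto
        moreover have "((q - 1) * F x powr (- q)) * ((l / 4 * \<xi> x) * (CF powr (- q) * F x powr q)) = b * \<xi> x"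
        proof -
          have "F x powr (- q) * F x powr q = 1" unfolding powr_add[symmetric] using Fx by simp
          then have "(q - 1) * (l / 4) * CF powr (- q) * \<xi> x * (F x powr (- q) * F x powr q) = b * \<xi> x" by (simp add: b_def)
          then show ?thesis by (simp only: mult_ac)
        qed
        ultimately show ?thesis unfolding e by (simp add: algebra_simps)
      qed
      with d show "\<exists>y\<le>0. ((\<lambda>t. b * ?I t - F t powr (1 - q)) has_real_derivative y) (at x)" by blast
    qed
    moreover have "0 \<le> F 0 powr (1 - q)" by (rule powr_ge_zero)
    moreover have "b * ?I 0 = 0" by simp
    ultimately have 1: "b * ?I t \<le> F t powr (1 - q)" by linarith
    have "c powr (q - 1) * En t powr (q - 1) = (c * En t) powr (q - 1)" by (rule powr_mult[symmetric])
    also have "\<dots> \<le> F t powr (q - 1)" using Fb[OF t E] c E q1 by (intro powr_mono2) auto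
    finally have "(b * ?I t) * (c powr (q - 1) * En t powr (q - 1)) \<le> F t powr (1 - q) * F t powr (q - 1)"
      using 1 b \<xi>_integral_nonneg[of t] by (intro mult_mono) auto
    also have "\<dots> = 1" unfolding powr_add[symmetric] using Fpos[OF t] by simp
    finally show ?thesis by (simp add: mult_ac)
  qed
  moreover have "b * c powr (q - 1) > 0" using b c by simp
  ultimately show ?thesis by blast
qed

text \<open>The asymptotic bounds of the two preceding results are combined with En t \<le> En 0 to
  obtain the prescribed numerical constants.\<close>

theorem decay:
  "\<exists>K>0. \<exists>K'>0. \<forall>t\<ge>0. En t \<le>
     (if q = 1 then En 0 * exp (1 - K * integral {0..t} \<xi>)
      else En 0 * (q / (1 + K' * (q - 1) * integral {0..t} \<xi>)) powr (1 / (q - 1)))"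
proof (cases "En 0 > 0")
  case False
  then have E0: "En 0 = 0" using En_nonneg[of 0] by simp
  have "En t \<le> 0" if "t \<ge> 0" for t using En_antimono[of 0 t] that E0 by simp
  then show ?thesis using E0 by (auto intro!: exI[of _ 1])
next
  case E0: True
  let ?I = "\<lambda>t. integral {0..t} \<xi>"
  show ?thesis
  proof (cases "q = 1")
    case True
    obtain b B where b: "b > 0" "B \<ge> 0" "\<And>t. t \<ge> 0 \<Longrightarrow> En t > 0 \<Longrightarrow> En t \<le> En 0 * exp (B - b * ?I t)"
      using exponential_decay[OF True E0] by blast
    \<comment> \<open>If \<open>B - b I\<close> is nonnegative, then K I \<le> 1 and monotonicity
      suffices. Otherwise the negative exponent \<open>B - b I\<close> only increases when divided
      by \<open>1 + B\<close>, and B/(1+B) \<le> 1.\<close>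
    define K where "K = b / (1 + B)"
    have "En t \<le> En 0 * exp (1 - K * ?I t)" if t: "t \<ge> 0" for t
    proof (cases "En t > 0")
      case E: True
      show ?thesis
      proof (cases "B - b * ?I t \<ge> 0")
        case True
        have "b * ?I t \<le> 1 + B" using True by simp
        then have "K * ?I t \<le> 1" using b by (simp add: K_def field_simps)
        then have "En 0 * 1 \<le> En 0 * exp (1 - K * ?I t)" using E0 by (intro mult_left_mono) auto
        then show ?thesis using En_antimono[of 0 t] t by simp
      next
        case False
        have "B - b * ?I t \<le> 1 - K * ?I t"
        proof -
          have "B - b * ?I t = (B - b * ?I t) * 1" by simp
          also have "\<dots> \<le> (B - b * ?I t) * (1 / (1 + B))"
            using False b(2) by (intro mult_left_mono_neg) (auto simp: field_simps)
          also have "\<dots> = B / (1 + B) - K * ?I t"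
            by (simp add: K_def diff_divide_distrib)
          also have "\<dots> \<le> 1 - K * ?I t" using b(2) by (simp add: field_simps)
          finally show ?thesis .
        qed
        then have "En 0 * exp (B - b * ?I t) \<le> En 0 * exp (1 - K * ?I t)" using E0 by (intro mult_left_mono) auto
        then show ?thesis using b(3)[OF t E] by linarith
      qed
    next
      case False
      then have "En t \<le> 0" by simp
      also have "0 \<le> En 0 * exp (1 - K * ?I t)" using E0 by simp
      finally show ?thesis .
    qed
    moreover have "K > 0" using b by (simp add: K_def)
    ultimately show ?thesis using True by auto
  next
    case False
    then have q1: "q > 1" using q by simp
    obtain b where b: "b > 0" "\<And>t. t \<ge> 0 \<Longrightarrow> En t > 0 \<Longrightarrow> b * ?I t * En t powr (q - 1) \<le> 1"
      using polynomial_decay[OF q1 E0] by blast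
    define e where "e = En 0 powr (q - 1)"
    have e: "e > 0" using E0 by (simp add: e_def)
    \<comment> \<open>Adding y \<le> e to \<open>e * (q - 1)\<close> times the bound b I y \<le> 1
      gives y (1 + K' (q-1) I) \<le> e q; this is the origin of the numerator
      \<open>q\<close>.\<close>
    define K' where "K' = e * b"
    have K': "K' > 0" using e b by (simp add: K'_def)
    have "En t \<le> En 0 * (q / (1 + K' * (q - 1) * ?I t)) powr (1 / (q - 1))" if t: "t \<ge> 0" for t
    proof (cases "En t > 0")
      case E: True
      define y where "y = En t powr (q - 1)"
      define d where "d = 1 + K' * (q - 1) * ?I t"
      have d: "d > 0" unfolding d_def using K' q1 \<xi>_integral_nonneg[of t] by (intro add_pos_nonneg mult_nonneg_nonneg) auto
      have "y \<le> e" unfolding y_def e_def using En_antimono[of 0 t] t E q1 by (intro powr_mono2) auto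
      moreover have "(e * (q - 1)) * (b * ?I t * y) \<le> (e * (q - 1)) * 1"
        using b(2)[OF t E] e q1 unfolding y_def by (intro mult_left_mono) auto
      ultimately have "y + (e * (q - 1)) * (b * ?I t * y) \<le> e + e * (q - 1)" by simp
      then have "y * d \<le> e * q" by (simp add: d_def K'_def algebra_simps)
      then have "y \<le> e * (q / d)" using d by (simp add: field_simps)
      then have "y powr (1 / (q - 1)) \<le> (e * (q / d)) powr (1 / (q - 1))"
        using q1 by (intro powr_mono2) (auto simp: y_def)
      also have "\<dots> = e powr (1 / (q - 1)) * (q / d) powr (1 / (q - 1))" by (rule powr_mult)
      also have "e powr (1 / (q - 1)) = En 0" unfolding e_def powr_powr using q1 E0 by simp
      also have "y powr (1 / (q - 1)) = En t" unfolding y_def powr_powr using q1 E by simp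
      finally show ?thesis by (simp add: d_def)
    next
      case False
      then have "En t \<le> 0" by simp
      also have "0 \<le> En 0 * (q / (1 + K' * (q - 1) * ?I t)) powr (1 / (q - 1))" using E0 by simp
      finally show ?thesis .
    qed
    then show ?thesis using K' False by auto
  qed
qed

end

section \<open>Weak solutions\<close>

lemma Lnorm_2_scale: "Lnorm 2 \<Omega> (\<lambda>x. c *\<^sub>R f x) = \<bar>c\<bar> * Lnorm 2 \<Omega> f"
proof -
  have "L2inner \<Omega> (\<lambda>x. c *\<^sub>R f x) (\<lambda>x. c *\<^sub>R f x) = c\<^sup>2 * L2inner \<Omega> f f"
    by (simp add: L2inner_def power2_eq_square mult.assoc)
  then show ?thesis by (simp add: Lnorm_2_eq_sqrt real_sqrt_mult)
qed

lemma cont2_L2inner: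
  assumes "L2cont \<Omega> a" "L2cont \<Omega> b"
  shows "cont2 (\<lambda>s t. L2inner \<Omega> (a s) (b t))"
  using L2cont_inner[OF assms] by (simp add: cont2_def case_prod_unfold)

locale weak_sol = nemytskii \<Omega> p1 p2 m p for \<Omega> :: "'a::euclidean_space set" and p1 p2 m p +
  fixes g :: "real \<Rightarrow> real" and \<alpha> :: real and u0 u1 :: "'a \<Rightarrow> real" and u v :: "real \<Rightarrow> 'a \<Rightarrow> real"
  assumes sol: "weak_solution \<Omega> g p \<alpha> u0 u1 u v"
begin

definition "Du t = wgrad \<Omega> (u t)"
definition "Gf t = Fu (u t)"

lemma u_H10: "t \<ge> 0 \<Longrightarrow> u t \<in> H10 \<Omega>"
  using sol unfolding weak_solution_def by blast

lemma u_L2: "t \<ge> 0 \<Longrightarrow> u t \<in> Lspace 2 \<Omega>"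
  by (rule H10_L2[OF u_H10])

lemma v_L2: "t \<ge> 0 \<Longrightarrow> v t \<in> Lspace 2 \<Omega>"
  using sol unfolding weak_solution_def by blast

lemma Du_L2: "t \<ge> 0 \<Longrightarrow> Du t \<in> Lspace 2 \<Omega>"
  unfolding Du_def by (rule wgrad(1)[OF H10_H1[OF u_H10]])

lemma u_cont_H1: "t \<ge> 0 \<Longrightarrow> ((\<lambda>s. H1norm \<Omega> (\<lambda>x. u s x - u t x)) \<longlongrightarrow> 0) (at t within {0..})"
  using sol unfolding weak_solution_def by blast

lemma u_diff: "t \<ge> 0 \<Longrightarrow> ((\<lambda>s. Lnorm 2 \<Omega> (\<lambda>x. (u s x - u t x) / (s - t) - v t x)) \<longlongrightarrow> 0) (at t within {0..})"
  using sol unfolding weak_solution_def by blast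

lemma eventually_nonneg: "\<forall>\<^sub>F s in at (t::real) within {0..}. s \<ge> 0"
  by (auto simp: eventually_at_filter)

lemma N_diff_lim: "t \<ge> 0 \<Longrightarrow> ((\<lambda>s. N (\<lambda>x. u s x - u t x)) \<longlongrightarrow> 0) (at t within {0..})"
  by (rule tendsto_sandwich[OF always_eventually always_eventually tendsto_const u_cont_H1])
    (auto simp: Lnorm_nonneg H1norm_bounds)

lemma u_diff_lim: "t \<ge> 0 \<Longrightarrow> ((\<lambda>s. Lnorm 2 \<Omega> (\<lambda>x. u s x - u t x)) \<longlongrightarrow> 0) (at t within {0..})"
  by (rule tendsto_sandwich[OF always_eventually always_eventually tendsto_const u_cont_H1])
    (auto simp: Lnorm_nonneg H1norm_bounds)

lemma u_L2cont: "L2cont \<Omega> u"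
  unfolding L2cont_def using u_L2 u_diff_lim by blast

lemma v_L2cont: "L2cont \<Omega> v"
  using sol unfolding weak_solution_def L2cont_def by blast

lemma Du_diff: "s \<ge> 0 \<Longrightarrow> t \<ge> 0 \<Longrightarrow> Lnorm 2 \<Omega> (\<lambda>x. Du s x - Du t x) = N (\<lambda>x. u s x - u t x)"
  unfolding Du_def by (rule Lnorm_wgrad_diff[symmetric]) (intro H10_H1 u_H10; assumption)+

lemma Du_L2cont: "L2cont \<Omega> Du"
  unfolding L2cont_def
proof (intro conjI allI impI Du_L2)
  fix t :: real assume t: "t \<ge> 0"
  have "\<forall>\<^sub>F s in at t within {0..}. N (\<lambda>x. u s x - u t x) = Lnorm 2 \<Omega> (\<lambda>x. Du s x - Du t x)"
    using eventually_nonneg by eventually_elim (simp add: Du_diff t)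
  then show "((\<lambda>s. Lnorm 2 \<Omega> (\<lambda>x. Du s x - Du t x)) \<longlongrightarrow> 0) (at t within {0..})"
    by (rule Lim_transform_eventually[OF N_diff_lim[OF t]])
qed

text \<open>The constants of \<open>Fu_bounds\<close> depend on a radius; near a given time the
  radius \<open>N (u t) + 1\<close> serves for all s.\<close>

lemma N_near:
  assumes t: "t \<ge> 0"
  shows "\<forall>\<^sub>F s in at t within {0..}. s \<ge> 0 \<and> N (u s) \<le> N (u t) + 1"
proof -
  have "\<forall>\<^sub>F s in at t within {0..}. N (\<lambda>x. u s x - u t x) < 1"
    using order_tendstoD(2)[OF N_diff_lim[OF t]] by simp
  with eventually_nonneg show ?thesis
  proof eventually_elim
    case (elim s)
    have "Lnorm 2 \<Omega> (\<lambda>x. (Du s x - Du t x) - (- 1) *\<^sub>R Du t x) \<le> Lnorm 2 \<Omega> (\<lambda>x. Du s x - Du t x) + Lnorm 2 \<Omega> (\<lambda>x. (- 1) *\<^sub>R Du t x)"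
      by (intro Lnorm_2_triangle L2_diff L2_scale Du_L2 t elim)
    then have "Lnorm 2 \<Omega> (Du s) \<le> N (\<lambda>x. u s x - u t x) + Lnorm 2 \<Omega> (Du t)"
      unfolding Lnorm_2_scale Du_diff[OF elim(1) t] by simp
    then show ?case using elim by (simp add: Du_def)
  qed
qed

lemma Gf_L2: "t \<ge> 0 \<Longrightarrow> Gf t \<in> Lspace 2 \<Omega>"
  unfolding Gf_def using Fu_bounds[of "N (u t)"] u_H10[of t] by blast

lemma Gf_L2cont: "L2cont \<Omega> Gf"
  unfolding L2cont_def
proof (intro conjI allI impI Gf_L2)
  fix t :: real assume t: "t \<ge> 0"
  obtain C where C: "C \<ge> 0" "\<And>a b. a \<in> H10 \<Omega> \<Longrightarrow> b \<in> H10 \<Omega> \<Longrightarrow> N a \<le> N (u t) + 1 \<Longrightarrow> N b \<le> N (u t) + 1 \<Longrightarrow>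
     Lnorm 2 \<Omega> (\<lambda>x. Fu a x - Fu b x) \<le> C * N (\<lambda>x. a x - b x)"
    using Fu_bounds[of "N (u t) + 1"] by blast
  have "\<forall>\<^sub>F s in at t within {0..}. norm (Lnorm 2 \<Omega> (\<lambda>x. Gf s x - Gf t x)) \<le> C * N (\<lambda>x. u s x - u t x)"
    using N_near[OF t]
  proof eventually_elim
    case (elim s)
    then show ?case using C(2)[OF u_H10 u_H10, of s t] t by (simp add: Gf_def Lnorm_nonneg)
  qed
  then show "((\<lambda>s. Lnorm 2 \<Omega> (\<lambda>x. Gf s x - Gf t x)) \<longlongrightarrow> 0) (at t within {0..})"
    by (rule Lim_null_comparison) (rule tendsto_mult_right_zero[OF N_diff_lim[OF t]])
qed

lemma inner_u_deriv:
  assumes t: "t \<ge> 0" and w: "w \<in> Lspace 2 \<Omega>"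
  shows "((\<lambda>s. L2inner \<Omega> w (u s)) has_real_derivative L2inner \<Omega> w (v t)) (at t within {0..})"
  by (rule L2_weak_derivative[where u = u and v = v, OF u_L2 v_L2[OF t] t u_diff[OF t] w])

text \<open>The curve u has a time derivative only in L2, so differentiability of \<open>Pot\<close>
  on H10 would not suffice. In the remainder divided by the time step, the L2 difference quotient
  stays bounded because it converges to \<open>v t\<close>, while the gradient factor tends to
  0.\<close>

lemma Pot_deriv:
  assumes t: "t \<ge> 0"
  shows "((\<lambda>s. Pot (u s)) has_real_derivative L2inner \<Omega> (Gf t) (v t)) (at t within {0..})"
proof -
  obtain C where C: "C \<ge> 0" "\<And>a b. a \<in> H10 \<Omega> \<Longrightarrow> b \<in> H10 \<Omega> \<Longrightarrow> N a \<le> N (u t) + 1 \<Longrightarrow> N b \<le> N (u t) + 1 \<Longrightarrow>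
     \<bar>Pot a - Pot b - L2inner \<Omega> (Fu b) (\<lambda>x. a x - b x)\<bar> \<le> C * N (\<lambda>x. a x - b x) * Lnorm 2 \<Omega> (\<lambda>x. a x - b x)"
    using Fu_bounds[of "N (u t) + 1"] by blast
  let ?q = "\<lambda>s. Lnorm 2 \<Omega> (\<lambda>x. (u s x - u t x) / (s - t) - v t x)"
  have ev: "\<forall>\<^sub>F s in at t within {0..}. norm ((Pot (u s) - Pot (u t)) / (s - t) - (L2inner \<Omega> (Gf t) (u s) - L2inner \<Omega> (Gf t) (u t)) / (s - t))
     \<le> C * N (\<lambda>x. u s x - u t x) * (?q s + Lnorm 2 \<Omega> (v t))"
  proof -
    have "\<forall>\<^sub>F s in at t within {0..}. s \<noteq> t" by (simp add: eventually_at_filter)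
    with N_near[OF t] show ?thesis
    proof eventually_elim
      case (elim s)
      then have s: "s \<ge> 0" "N (u s) \<le> N (u t) + 1" "s \<noteq> t" by auto
      have b: "\<bar>Pot (u s) - Pot (u t) - L2inner \<Omega> (Gf t) (\<lambda>x. u s x - u t x)\<bar> \<le> C * N (\<lambda>x. u s x - u t x) * Lnorm 2 \<Omega> (\<lambda>x. u s x - u t x)"
        unfolding Gf_def by (rule C(2)) (use s t u_H10 in auto)
      have d: "L2inner \<Omega> (Gf t) (\<lambda>x. u s x - u t x) = L2inner \<Omega> (Gf t) (u s) - L2inner \<Omega> (Gf t) (u t)"
        by (rule L2inner_diff_right) (intro u_L2 Gf_L2 s t)+
      have q: "(\<lambda>x. (u s x - u t x) / (s - t)) = (\<lambda>x. inverse (s - t) *\<^sub>R (u s x - u t x))"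
        by (simp add: divide_inverse mult.commute)
      have qL: "(\<lambda>x. (u s x - u t x) / (s - t)) \<in> Lspace 2 \<Omega>"
        unfolding q by (intro L2_scale L2_diff u_L2 s t)
      have "Lnorm 2 \<Omega> (\<lambda>x. u s x - u t x) / \<bar>s - t\<bar> = Lnorm 2 \<Omega> (\<lambda>x. (u s x - u t x) / (s - t))"
        unfolding q Lnorm_2_scale by (simp add: divide_inverse mult.commute)
      also have "\<dots> = Lnorm 2 \<Omega> (\<lambda>x. ((u s x - u t x) / (s - t) - v t x) - (- 1) *\<^sub>R v t x)" by simp
      also have "\<dots> \<le> ?q s + Lnorm 2 \<Omega> (\<lambda>x. (- 1) *\<^sub>R v t x)"
        by (rule Lnorm_2_triangle[OF L2_diff[OF qL v_L2[OF t]] L2_scale[OF v_L2[OF t]]])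
      also have "\<dots> = ?q s + Lnorm 2 \<Omega> (v t)" unfolding Lnorm_2_scale by simp
      finally have k: "Lnorm 2 \<Omega> (\<lambda>x. u s x - u t x) / \<bar>s - t\<bar> \<le> ?q s + Lnorm 2 \<Omega> (v t)" .
      have "norm ((Pot (u s) - Pot (u t)) / (s - t) - (L2inner \<Omega> (Gf t) (u s) - L2inner \<Omega> (Gf t) (u t)) / (s - t))
         = \<bar>Pot (u s) - Pot (u t) - L2inner \<Omega> (Gf t) (\<lambda>x. u s x - u t x)\<bar> / \<bar>s - t\<bar>"
        unfolding d by (simp add: diff_divide_distrib[symmetric] abs_divide)
      also have "\<dots> \<le> (C * N (\<lambda>x. u s x - u t x) * Lnorm 2 \<Omega> (\<lambda>x. u s x - u t x)) / \<bar>s - t\<bar>"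
        by (rule divide_right_mono[OF b]) simp
      also have "\<dots> = C * N (\<lambda>x. u s x - u t x) * (Lnorm 2 \<Omega> (\<lambda>x. u s x - u t x) / \<bar>s - t\<bar>)" by simp
      also have "\<dots> \<le> C * N (\<lambda>x. u s x - u t x) * (?q s + Lnorm 2 \<Omega> (v t))"
        by (intro mult_left_mono k mult_nonneg_nonneg C Lnorm_nonneg)
      finally show ?case .
    qed
  qed
  have "((\<lambda>s. C * N (\<lambda>x. u s x - u t x) * (?q s + Lnorm 2 \<Omega> (v t))) \<longlongrightarrow> C * 0 * (0 + Lnorm 2 \<Omega> (v t))) (at t within {0..})"
    by (intro tendsto_mult tendsto_add tendsto_const N_diff_lim u_diff t)
  then have lm: "((\<lambda>s. C * N (\<lambda>x. u s x - u t x) * (?q s + Lnorm 2 \<Omega> (v t))) \<longlongrightarrow> 0) (at t within {0..})"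
    by (simp only: mult_zero_right mult_zero_left)
  have "((\<lambda>s. (Pot (u s) - Pot (u t)) / (s - t) - (L2inner \<Omega> (Gf t) (u s) - L2inner \<Omega> (Gf t) (u t)) / (s - t)) \<longlongrightarrow> 0) (at t within {0..})"
    by (rule Lim_null_comparison[OF ev lm])
  moreover have "((\<lambda>s. (L2inner \<Omega> (Gf t) (u s) - L2inner \<Omega> (Gf t) (u t)) / (s - t)) \<longlongrightarrow> L2inner \<Omega> (Gf t) (v t)) (at t within {0..})"
    using inner_u_deriv[OF t Gf_L2[OF t]] by (simp add: has_field_derivative_iff)
  ultimately have "((\<lambda>s. ((Pot (u s) - Pot (u t)) / (s - t) - (L2inner \<Omega> (Gf t) (u s) - L2inner \<Omega> (Gf t) (u t)) / (s - t))
      + (L2inner \<Omega> (Gf t) (u s) - L2inner \<Omega> (Gf t) (u t)) / (s - t)) \<longlongrightarrow> 0 + L2inner \<Omega> (Gf t) (v t)) (at t within {0..})"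
    by (rule tendsto_add)
  then show ?thesis by (simp add: has_field_derivative_iff)
qed

text \<open>The test function is the solution itself frozen at another time, which belongs to H10,
  unlike u_t.\<close>

lemma equation:
  assumes t: "t > 0" and \<sigma>: "\<sigma> \<ge> 0"
  shows "((\<lambda>s. L2inner \<Omega> (v s) (u \<sigma>)) has_real_derivative
     (- L2inner \<Omega> (Du t) (Du \<sigma>) + conv g (\<lambda>s. L2inner \<Omega> (Du s) (Du \<sigma>)) t
       - L2inner \<Omega> (v t) (u \<sigma>) + \<alpha> * L2inner \<Omega> (Gf t) (u \<sigma>))) (at t)"
proof -
  obtain D where D: "((\<lambda>\<tau>. L2inner \<Omega> (v \<tau>) (u \<sigma>)) has_real_derivative D) (at t)"
    "D + L2inner \<Omega> (wgrad \<Omega> (u t)) (wgrad \<Omega> (u \<sigma>))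
          - integral {0..t} (\<lambda>s. g (t - s) * L2inner \<Omega> (wgrad \<Omega> (u s)) (wgrad \<Omega> (u \<sigma>)))
          + L2inner \<Omega> (v t) (u \<sigma>)
        = \<alpha> * (LINT x|lebesgue_on \<Omega>. \<bar>u t x\<bar> powr (p x - 2) * u t x * ln \<bar>u t x\<bar> * u \<sigma> x)"
    using sol t u_H10[OF \<sigma>] unfolding weak_solution_def by blast
  have "D = - L2inner \<Omega> (Du t) (Du \<sigma>) + conv g (\<lambda>s. L2inner \<Omega> (Du s) (Du \<sigma>)) t
       - L2inner \<Omega> (v t) (u \<sigma>) + \<alpha> * L2inner \<Omega> (Gf t) (u \<sigma>)"
    using D(2) by (simp add: Du_def conv_def Gf_def Fu_def src_def L2inner_def)
  with D(1) show ?thesis by simp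
qed

definition "sA s t = L2inner \<Omega> (Du s) (Du t)"
definition "sV s t = L2inner \<Omega> (v s) (v t)"
definition "sX s t = L2inner \<Omega> (v s) (u t)"
definition "sF s t = L2inner \<Omega> (Gf s) (u t)"
definition "sY s t = L2inner \<Omega> (Gf s) (v t)"
definition "sU t = L2inner \<Omega> (u t) (u t)"

lemma scalar:
  assumes "\<And>t. t \<ge> 0 \<Longrightarrow> (g has_real_derivative g' t) (at t within {0..})" "continuous_on {0..} g'"
  shows "visco_scalar g g' sA sV sX sF sY (\<lambda>t. Pot (u t)) \<alpha>"
proof
  show "cont2 sA" "cont2 sV" "cont2 sX" "cont2 sF" "cont2 sY"
    unfolding sA_def sV_def sX_def sF_def sY_def
    by (intro cont2_L2inner Du_L2cont v_L2cont u_L2cont Gf_L2cont)+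
  show "continuous_on {0..} (\<lambda>t. Pot (u t))" by (rule DERIV_continuous_on[OF Pot_deriv]) simp
  show "sA s t = sA t s" "sV s t = sV t s" for s t by (simp_all add: sA_def sV_def L2inner_commute)
  show "(sX s has_real_derivative sV s t) (at t)" if "s \<ge> 0" "t > 0" for s t
    using inner_u_deriv[of t "v s"] v_L2[OF that(1)] that(2) by (simp add: sX_def[abs_def] sV_def within_atLeast_eq_at)
  show "(sF s has_real_derivative sY s t) (at t)" if "s \<ge> 0" "t > 0" for s t
    using inner_u_deriv[of t "Gf s"] Gf_L2[OF that(1)] that(2) by (simp add: sF_def[abs_def] sY_def within_atLeast_eq_at)
  show "((\<lambda>t. Pot (u t)) has_real_derivative sY t t) (at t)" if "t > 0" for t
    using Pot_deriv[of t] that by (simp add: sY_def within_atLeast_eq_at)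
  show "((\<lambda>s. sX s \<sigma>) has_real_derivative - sA t \<sigma> + conv g (\<lambda>s. sA s \<sigma>) t - sX t \<sigma> + \<alpha> * sF t \<sigma>) (at t)"
    if "t > 0" "\<sigma> \<ge> 0" for t \<sigma>
    unfolding sX_def sA_def sF_def by (rule equation[OF that])
qed (use assms in auto)

text \<open>The derivative of u is available only against fixed functions, so the square is treated
  as a function of two times and differentiated along the diagonal.\<close>

lemma sU_deriv: "t > 0 \<Longrightarrow> (sU has_real_derivative 2 * sX t t) (at t)"
proof -
  assume t: "t > 0"
  have c: "cont2 (\<lambda>a b. L2inner \<Omega> (u a) (v b))" by (intro cont2_L2inner u_L2cont v_L2cont)
  have d: "((\<lambda>b. L2inner \<Omega> (u a) (u b)) has_real_derivative L2inner \<Omega> (u a) (v b)) (at b)" if "a > 0" "b > 0" for a b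
    using inner_u_deriv[of b "u a"] u_L2[of a] that by (simp add: within_atLeast_eq_at)
  have "((\<lambda>s. L2inner \<Omega> (u s) (u s)) has_real_derivative L2inner \<Omega> (u t) (v t) + L2inner \<Omega> (u t) (v t)) (at t)"
  proof (rule diag_derivative[where F = "\<lambda>a b. L2inner \<Omega> (u a) (u b)" and ?F2.0 = "\<lambda>a b. L2inner \<Omega> (u a) (v b)" and e = t])
    show "((\<lambda>a. L2inner \<Omega> (u a) (u t)) has_real_derivative L2inner \<Omega> (u t) (v t)) (at t)"
      using d[OF t t] by (simp only: L2inner_commute[of \<Omega> _ "u t"])
    show "((\<lambda>b. L2inner \<Omega> (u a) (u b)) has_real_derivative L2inner \<Omega> (u a) (v b)) (at b)"
      if "\<bar>a - t\<bar> < t" "\<bar>b - t\<bar> < t" for a b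
      by (rule d) (use that in \<open>auto simp: abs_less_iff\<close>)
  qed (use t cont2_isCont[OF c t t] in auto)
  then show ?thesis by (simp add: sU_def[abs_def] sX_def L2inner_commute[of \<Omega> "u t"])
qed

lemma sA_norm: "sA t t = (N (u t))\<^sup>2"
  by (simp add: sA_def Lnorm_2_sq Du_def)

text \<open>Expanding the squared gradient difference turns the memory into \<open>mem\<close>, and
  \<open>Pot_split\<close> merges the two source integrals.\<close>

lemma energy_eq:
  assumes sc: "visco_scalar g g' sA sV sX sF sY (\<lambda>t. Pot (u t)) \<alpha>" and t: "t \<ge> 0"
  shows "energy \<Omega> g p \<alpha> u v t = visco_scalar.En g sA sV (\<lambda>t. Pot (u t)) \<alpha> t"
proof -
  interpret S: visco_scalar g g' sA sV sX sF sY "\<lambda>t. Pot (u t)" \<alpha> by (rule sc)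
  have "memory \<Omega> g u t = S.mem t"
    unfolding memory_def S.mem_def conv_def
  proof (rule integral_cong)
    fix s assume s: "s \<in> {0..t}"
    have "(Lnorm 2 \<Omega> (\<lambda>x. wgrad \<Omega> (u t) x - wgrad \<Omega> (u s) x))\<^sup>2 = S.hh t s"
      unfolding Lnorm_2_sq Du_def[symmetric] S.hh_def sA_def
      using L2inner_diff_self[OF Du_L2[OF t] Du_L2[of s]] s L2inner_commute[of \<Omega> "Du s" "Du t"] by simp
    then show "g (t - s) * (Lnorm 2 \<Omega> (\<lambda>x. wgrad \<Omega> (u t) x - wgrad \<Omega> (u s) x))\<^sup>2 = g (t - s) * S.hh t s" by simp
  qed
  then show ?thesis
    unfolding energy_def S.En_def Pot_split[OF u_H10[OF t]] Lnorm_2_sq sA_def sV_def Du_def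
    by (simp add: algebra_simps)
qed

end

section \<open>Essential bounds of the exponent and the inequality for g at time 0\<close>

lemma AE_False_open:
  fixes \<Omega> :: "'a::euclidean_space set"
  assumes "open \<Omega>" "\<Omega> \<noteq> {}" "AE x in lebesgue_on \<Omega>. False"
  shows False
proof -
  have "AE x in lebesgue. x \<in> \<Omega> \<longrightarrow> False"
    using assms(3) by (subst (asm) AE_restrict_space_iff) (use assms(1) in auto)
  then have "negligible \<Omega>" using assms(1) by (simp add: negligible_iff_null_sets AE_iff_null_sets)
  then show False using open_not_negligible[OF assms(1,2)] by blast
qed

text \<open>\<open>ess_upper\<close> and \<open>ess_lower\<close> pass through
  \<open>real_of_ereal\<close>, which sends infinite values to 0; they are genuine bounds only once
  the essential supremum is known to be finite. The value -\<infinity> is excluded because a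
  nonempty open set is not negligible.\<close>

lemma esssup_finite:
  fixes f :: "'a::euclidean_space \<Rightarrow> real"
  assumes \<Omega>: "open \<Omega>" "\<Omega> \<noteq> {}" and f: "f \<in> borel_measurable (lebesgue_on \<Omega>)" "\<And>x. x \<in> \<Omega> \<Longrightarrow> f x \<le> b"
  shows "\<exists>s. esssup (lebesgue_on \<Omega>) (\<lambda>x. ereal (f x)) = ereal s \<and> (AE x in lebesgue_on \<Omega>. f x \<le> s)"
proof -
  let ?s = "esssup (lebesgue_on \<Omega>) (\<lambda>x. ereal (f x))"
  have ae: "AE x in lebesgue_on \<Omega>. ereal (f x) \<le> ?s" by (rule esssup_AE)
  have "?s \<le> ereal b"
    by (rule esssup_I) (use f in \<open>auto intro!: AE_I2\<close>)
  moreover have "?s \<noteq> - \<infinity>"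
  proof
    assume s: "?s = - \<infinity>"
    have "AE x in lebesgue_on \<Omega>. False" using ae unfolding s by eventually_elim simp
    then show False by (rule AE_False_open[OF \<Omega>])
  qed
  ultimately obtain s where s: "?s = ereal s" by (cases ?s) auto
  show ?thesis using ae unfolding s by (intro exI[of _ s]) simp
qed

lemma exponent_bounds:
  fixes \<Omega> :: "'a::euclidean_space set"
  assumes \<Omega>: "open \<Omega>" "\<Omega> \<noteq> {}" and p: "p \<in> borel_measurable (lebesgue_on \<Omega>)" "bounded (p ` \<Omega>)"
  shows "AE x in lebesgue_on \<Omega>. ess_lower \<Omega> p \<le> p x \<and> p x \<le> ess_upper \<Omega> p"
proof -
  obtain b where b: "\<And>x. x \<in> \<Omega> \<Longrightarrow> \<bar>p x\<bar> \<le> b" using p(2) unfolding bounded_iff by fastforce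
  obtain s where s: "esssup (lebesgue_on \<Omega>) (\<lambda>x. ereal (p x)) = ereal s" "AE x in lebesgue_on \<Omega>. p x \<le> s"
    using esssup_finite[OF \<Omega> p(1), of b] b by (auto simp: abs_le_iff)
  have mp: "(\<lambda>x. - p x) \<in> borel_measurable (lebesgue_on \<Omega>)" using p(1) by measurable
  obtain r where r: "esssup (lebesgue_on \<Omega>) (\<lambda>x. ereal (- p x)) = ereal r" "AE x in lebesgue_on \<Omega>. - p x \<le> r"
    using esssup_finite[OF \<Omega> mp, of b] b by (auto simp: abs_le_iff)
  have up: "ess_upper \<Omega> p = s" by (simp add: ess_upper_def s(1))
  have lo: "ess_lower \<Omega> p = - r" using r(1) by (simp add: ess_lower_def)
  show ?thesis using s(2) r(2) unfolding up lo by eventually_elim simp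
qed

lemma halfline_deriv_nonpos:
  assumes d: "(f has_real_derivative y) (at t)" and anti: "antimono_on {0..} f" and t: "t > 0"
  shows "y \<le> (0::real)"
proof (rule ccontr)
  assume "\<not> y \<le> 0"
  then obtain e where "e > 0" "\<And>h. h > 0 \<Longrightarrow> h < e \<Longrightarrow> f t < f (t + h)"
    using DERIV_pos_inc_right[OF d] by auto
  then have "f t < f (t + e / 2)" by simp
  moreover have "f (t + e / 2) \<le> f t" using monotone_onD[OF anti, of t "t + e / 2"] t \<open>e > 0\<close> by simp
  ultimately show False by simp
qed

text \<open>The value at 0 follows by continuity from positive times. It is needed because
  \<open>small_kernel\<close> minimizes -g' over a closed interval starting at 0, where -g' must be
  positive.\<close>

lemma rate_at_0:
  assumes gd: "\<And>t. t \<ge> 0 \<Longrightarrow> (g has_real_derivative g' t) (at t within {0..})" and g': "continuous_on {0..} g'"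
    and gp: "\<And>t. t \<ge> 0 \<Longrightarrow> g t > (0::real)" and xc: "continuous_on {0..} \<xi>"
    and rate: "\<And>t. t > 0 \<Longrightarrow> deriv g t \<le> - \<xi> t * g t powr q" and r: "r \<ge> 0"
  shows "g' r \<le> - \<xi> r * g r powr q"
proof (cases "r = 0")
  case False
  then have "(g has_real_derivative g' r) (at r)" using gd[of r] r by (simp add: within_atLeast_eq_at)
  then show ?thesis using rate[of r] False r by (simp add: DERIV_imp_deriv)
next
  case True
  have gc: "continuous_on {0..} g" by (rule DERIV_continuous_on[OF gd]) simp
  have "continuous_on {0..} (\<lambda>t. - \<xi> t * g t powr q - g' t)"
    by (intro continuous_on_diff continuous_on_mult continuous_on_minus continuous_on_powr xc gc g' continuous_on_const)
      (use gp in fastforce)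
  then have "((\<lambda>t. - \<xi> t * g t powr q - g' t) \<longlongrightarrow> - \<xi> 0 * g 0 powr q - g' 0) (at 0 within {0..})"
    by (simp add: continuous_on)
  then have "((\<lambda>t. - \<xi> t * g t powr q - g' t) \<longlongrightarrow> - \<xi> 0 * g 0 powr q - g' 0) (at_right 0)"
    by (rule filterlim_mono) (auto intro: at_le)
  moreover have "\<forall>\<^sub>F t in at_right 0. 0 \<le> - \<xi> t * g t powr q - g' t"
    using eventually_at_right_less[of "0::real"]
  proof eventually_elim
    case (elim t)
    then have "(g has_real_derivative g' t) (at t)" using gd[of t] by (simp add: within_atLeast_eq_at)
    then show ?case using rate[OF elim] by (simp add: DERIV_imp_deriv)
  qed
  ultimately have "0 \<le> - \<xi> 0 * g 0 powr q - g' 0" by (rule tendsto_lowerbound) simp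
  then show ?thesis using True by simp
qed

context weak_sol
begin

text \<open>Inner products of the weak solution satisfy the scalar assumptions. Pairing the source
  with u costs a Poincare factor and the potential costs none; \<open>C * (1 + sqrt Cp)\<close>
  covers both.\<close>

lemma decay_estimate:
  fixes l Cp C R g0 :: real
  assumes u0: "u0 \<in> H10 \<Omega>" and u1: "u1 \<in> Lspace 2 \<Omega>"
    and A1: "cond_A1 g" and A3: "cond_A3 g \<xi> q" and \<alpha>: "0 < \<alpha>" "\<alpha> * (C * (1 + sqrt Cp)) \<le> ell g / 8"
    and Cp: "Cp > 0" "\<And>f. f \<in> H10 \<Omega> \<Longrightarrow> (Lnorm 2 \<Omega> f)\<^sup>2 \<le> Cp * (N f)\<^sup>2"
    and C: "C \<ge> 0" "\<And>f. f \<in> H10 \<Omega> \<Longrightarrow> N f \<le> sqrt R \<Longrightarrow> Fu f \<in> Lspace 2 \<Omega> \<and> Lnorm 2 \<Omega> (Fu f) \<le> C * N f \<and> \<bar>Pot f\<bar> \<le> C * (N f)\<^sup>2"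
    and R: "4 / ell g * ((Lnorm 2 \<Omega> u1)\<^sup>2 + (N u0)\<^sup>2) < R"
  shows "\<exists>K>0. \<exists>K'>0. \<forall>t\<ge>0.
           energy \<Omega> g p \<alpha> u v t \<le>
             (if q = 1
              then energy \<Omega> g p \<alpha> u v 0 * exp (1 - K * integral {0..t} \<xi>)
              else energy \<Omega> g p \<alpha> u v 0 *
                     (q / (1 + K' * (q - 1) * integral {0..t} \<xi>)) powr (1 / (q - 1)))"
proof -
  obtain g' where g': "\<And>t. t \<ge> 0 \<Longrightarrow> (g has_real_derivative g' t) (at t within {0..})" "continuous_on {0..} g'"
    and gp: "\<And>t. t \<ge> 0 \<Longrightarrow> g t > 0"
    using A1 unfolding cond_A1_def C1_pos_halfline_def by blast
  have gi: "g integrable_on {0..}" and l0: "ell g > 0" using A1 unfolding cond_A1_def by auto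
  obtain \<xi>' where \<xi>': "\<And>t. t \<ge> 0 \<Longrightarrow> (\<xi> has_real_derivative \<xi>' t) (at t within {0..})"
    and \<xi>p: "\<And>t. t \<ge> 0 \<Longrightarrow> \<xi> t > 0"
    using A3 unfolding cond_A3_def C1_pos_halfline_def by blast
  have \<xi>a: "antimono_on {0..} \<xi>" and q: "1 \<le> q" and rate: "\<And>t. t > 0 \<Longrightarrow> deriv g t \<le> - \<xi> t * g t powr q"
    using A3 unfolding cond_A3_def by auto
  have \<xi>c: "continuous_on {0..} \<xi>" by (rule DERIV_continuous_on[OF \<xi>']) simp
  have rate0: "g' r \<le> - \<xi> r * g r powr q" if "r \<ge> 0" for r
    by (rule rate_at_0[OF g' gp \<xi>c rate that])
  have sc: "visco_scalar g g' sA sV sX sF sY (\<lambda>t. Pot (u t)) \<alpha>" by (rule scalar[OF g'])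
  interpret S: visco_scalar g g' sA sV sX sF sY "\<lambda>t. Pot (u t)" \<alpha> by (rule sc)
  have diff_sq: "L2inner \<Omega> (\<lambda>x. Du s x - Du t x) (\<lambda>x. Du s x - Du t x) = sA t t + sA s s - 2 * sA s t" if "s \<ge> 0" "t \<ge> 0" for s t
    using L2inner_diff_self[OF Du_L2[OF that(1)] Du_L2[OF that(2)]] by (simp add: sA_def)
  have Pos: "Lnorm 2 \<Omega> f * Lnorm 2 \<Omega> h \<le> (L2inner \<Omega> f f + L2inner \<Omega> h h) / 2" for f h :: "'a \<Rightarrow> 'b::euclidean_space"
    using sum_squares_bound[of "Lnorm 2 \<Omega> f" "Lnorm 2 \<Omega> h"] by (simp add: Lnorm_2_sq)
  have zero_cont: "g integrable_on {0..t}" for t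
    by (intro integrable_continuous_interval continuous_on_subset[OF S.g_cont]) auto
  have l1: "ell g \<le> 1"
  proof -
    have "0 \<le> integral {0..} g" by (rule Henstock_Kurzweil_Integration.integral_nonneg[OF gi]) (auto intro: less_imp_le gp)
    then show ?thesis by (simp add: ell_def)
  qed
  interpret S: visco_rate g g' sA sV sX sF sY "\<lambda>t. Pot (u t)" \<alpha> sU "ell g" "C * (1 + sqrt Cp)" Cp R \<xi> \<xi>' q
  proof
    show "0 < ell g" "ell g \<le> 1" by (rule l0, rule l1)
    show "0 < g t" if "t \<ge> 0" for t by (rule gp[OF that])
    show "g' t < 0" if "t \<ge> 0" for t
    proof -
      have "0 < \<xi> t * g t powr q" using \<xi>p[OF that] gp[OF that] by simp
      then show ?thesis using rate0[OF that] by simp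
    qed
    show "integral {0..t} g \<le> 1 - ell g" if "t \<ge> 0" for t
    proof -
      have "integral {0..t} g \<le> integral {0..} g"
        by (rule integral_subset_le[OF _ zero_cont gi]) (auto intro: less_imp_le gp)
      then show ?thesis by (simp add: ell_def)
    qed
    fix s t :: real assume s: "s \<ge> 0" and t: "t \<ge> 0"
    show "2 * sA s t \<le> sA t t + sA s s"
      using diff_sq[OF s t] L2inner_nonneg[of \<Omega> "\<lambda>x. Du s x - Du t x"] by simp
    show "- (2 * sA s t) \<le> sA t t + sA s s"
      using L2_Cauchy_Schwarz[OF Du_L2[OF s] Du_L2[OF t]] Pos[of "Du s" "Du t"] by (simp add: sA_def abs_le_iff)
    have "sA s t - sA t t = L2inner \<Omega> (\<lambda>x. Du s x - Du t x) (Du t)"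
      using L2inner_diff_left[OF Du_L2[OF s] Du_L2[OF t] Du_L2[OF t]] by (simp add: sA_def)
    then have "\<bar>sA s t - sA t t\<bar> \<le> Lnorm 2 \<Omega> (\<lambda>x. Du s x - Du t x) * Lnorm 2 \<Omega> (Du t)"
      using L2_Cauchy_Schwarz[OF L2_diff[OF Du_L2[OF s] Du_L2[OF t]] Du_L2[OF t]] by simp
    then have "\<bar>sA s t - sA t t\<bar>\<^sup>2 \<le> (Lnorm 2 \<Omega> (\<lambda>x. Du s x - Du t x) * Lnorm 2 \<Omega> (Du t))\<^sup>2"
      by (rule power_mono) simp
    then show "(sA s t - sA t t)\<^sup>2 \<le> (sA t t + sA s s - 2 * sA s t) * sA t t"
      unfolding power_mult_distrib Lnorm_2_sq diff_sq[OF s t] by (simp add: sA_def)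
  next
    fix t :: real assume t: "t \<ge> 0"
    show "0 \<le> sV t t" "0 \<le> sA t t" "0 \<le> sU t" by (simp_all add: sV_def sA_def sU_def L2inner_nonneg)
    show "2 * \<bar>sX t t\<bar> \<le> sV t t + sU t"
      using L2_Cauchy_Schwarz[OF v_L2[OF t] u_L2[OF t]] Pos[of "v t" "u t"] by (simp add: sX_def sV_def sU_def)
    show "sU t \<le> Cp * sA t t"
      using Cp(2)[OF u_H10[OF t]] by (simp add: sU_def sA_norm Lnorm_2_sq)
    assume "sA t t \<le> R"
    then have Nle: "N (u t) \<le> sqrt R" unfolding sA_norm by (rule real_le_rsqrt)
    note c = C(2)[OF u_H10[OF t] Nle]
    show "\<bar>sF t t\<bar> \<le> C * (1 + sqrt Cp) * sA t t \<and> \<bar>Pot (u t)\<bar> \<le> C * (1 + sqrt Cp) * sA t t"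
    proof
      have ul: "Lnorm 2 \<Omega> (u t) \<le> sqrt Cp * N (u t)"
      proof -
        have "Lnorm 2 \<Omega> (u t) \<le> sqrt (Cp * (N (u t))\<^sup>2)" by (rule real_le_rsqrt[OF Cp(2)[OF u_H10[OF t]]])
        then show ?thesis by (simp add: real_sqrt_mult Lnorm_nonneg)
      qed
      have "\<bar>sF t t\<bar> \<le> Lnorm 2 \<Omega> (Gf t) * Lnorm 2 \<Omega> (u t)"
        unfolding sF_def by (rule L2_Cauchy_Schwarz[OF Gf_L2[OF t] u_L2[OF t]])
      also have "\<dots> \<le> (C * N (u t)) * (sqrt Cp * N (u t))"
        using c ul by (intro mult_mono) (auto simp: Gf_def Lnorm_nonneg C(1))
      also have "\<dots> = C * sqrt Cp * sA t t" by (simp add: sA_norm power2_eq_square)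
      also have "\<dots> \<le> C * (1 + sqrt Cp) * sA t t"
        using C(1) by (intro mult_right_mono mult_left_mono) (auto simp: sA_norm)
      finally show "\<bar>sF t t\<bar> \<le> C * (1 + sqrt Cp) * sA t t" .
      have "\<bar>Pot (u t)\<bar> \<le> C * 1 * sA t t" using c by (simp add: sA_norm)
      also have "\<dots> \<le> C * (1 + sqrt Cp) * sA t t"
        using C(1) Cp(1) by (intro mult_right_mono mult_left_mono) (auto simp: sA_norm)
      finally show "\<bar>Pot (u t)\<bar> \<le> C * (1 + sqrt Cp) * sA t t" .
    qed
  next
    show "continuous_on {0..} sU"
      unfolding sU_def by (rule cont2_diag[OF cont2_L2inner[OF u_L2cont u_L2cont]])
    show "(sU has_real_derivative 2 * sX t t) (at t)" if "t > 0" for t by (rule sU_deriv[OF that])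
    show "0 \<le> Cp" using Cp(1) by simp
    show "0 < \<alpha>" "\<alpha> * (C * (1 + sqrt Cp)) \<le> ell g / 8" by (rule \<alpha>)+
    \<comment> \<open>The radius is defined by the prescribed data, so norms of the solution at time
      0 have to be identified with theirs.\<close>
    have ae: "AE x in M. u 0 x = u0 x" "AE x in M. v 0 x = u1 x" using sol unfolding weak_solution_def by blast+
    have "wgrad \<Omega> (u 0) = wgrad \<Omega> u0" by (rule wgrad_cong_AE[OF ae(1) u_L2[OF order_refl] H10_L2[OF u0]])
    moreover have "Lnorm 2 \<Omega> (v 0) = Lnorm 2 \<Omega> u1"
      by (rule Lnorm_cong_AE[OF ae(2) Lspace_2_measurable[OF v_L2[OF order_refl]] Lspace_2_measurable[OF u1]])
    ultimately show "4 / ell g * (sV 0 0 + sA 0 0) < R"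
      using R by (simp add: sA_norm sV_def Lnorm_2_sq[symmetric])
    show "(\<xi> has_real_derivative \<xi>' t) (at t within {0..})" "\<xi> t > 0" if "t \<ge> 0" for t
      by (rule \<xi>'[OF that], rule \<xi>p[OF that])
    show "\<xi>' t \<le> 0" if "t > 0" for t
      by (rule halfline_deriv_nonpos[OF _ \<xi>a that]) (use \<xi>'[of t] that in \<open>simp add: within_atLeast_eq_at\<close>)
    show "\<xi> t \<le> \<xi> s" if "0 \<le> s" "s \<le> t" for s t
      using monotone_onD[OF \<xi>a, of s t] that by simp
    show "g' r \<le> - \<xi> r * g r powr q" if "r \<ge> 0" for r by (rule rate0[OF that])
    show "1 \<le> q" by (rule q)
  qed
  have E: "energy \<Omega> g p \<alpha> u v t = S.En t" if "t \<ge> 0" for t by (rule energy_eq[OF sc that])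
  obtain K K' where K: "K > 0" "K' > 0" "\<And>t. t \<ge> 0 \<Longrightarrow> S.En t \<le>
     (if q = 1 then S.En 0 * exp (1 - K * integral {0..t} \<xi>)
      else S.En 0 * (q / (1 + K' * (q - 1) * integral {0..t} \<xi>)) powr (1 / (q - 1)))"
    using S.decay by blast
  show ?thesis
  proof (rule exI[of _ K], rule conjI[OF K(1)], rule exI[of _ K'], rule conjI[OF K(2)], intro allI impI)
    fix t :: real assume t: "t \<ge> 0"
    show "energy \<Omega> g p \<alpha> u v t \<le>
             (if q = 1
              then energy \<Omega> g p \<alpha> u v 0 * exp (1 - K * integral {0..t} \<xi>)
              else energy \<Omega> g p \<alpha> u v 0 *
                     (q / (1 + K' * (q - 1) * integral {0..t} \<xi>)) powr (1 / (q - 1)))"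
      unfolding E[OF t] E[OF order_refl] by (rule K(3)[OF t])
  qed
qed

end

theorem theorem3p5:
  fixes \<Omega> :: "'a::euclidean_space set"
    and p u0 u1 :: "'a \<Rightarrow> real"
    and g :: "real \<Rightarrow> real"
    and \<mu> :: real
  assumes "DIM('a) \<ge> 3"
    and "smooth_bounded_domain \<Omega>"
    and "cond_A1 g"
    and "exponent_condition \<Omega> p"
    and "\<mu> > 0"
    and "ess_upper \<Omega> p + \<mu> < 2 * real DIM('a) / (real DIM('a) - 2)"
    and "u0 \<in> H10 \<Omega>"
    and "u1 \<in> Lspace 2 \<Omega>"
  shows "\<exists>\<alpha>0>0. \<forall>\<xi> q. cond_A3 g \<xi> q \<longrightarrow>
    (\<forall>\<alpha>. 0 < \<alpha> \<and> \<alpha> < \<alpha>0 \<longrightarrow>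
      (\<forall>u v. weak_solution \<Omega> g p \<alpha> u0 u1 u v \<and>
             energy \<Omega> g p \<alpha> u v 0 < E1 \<Omega> g p \<mu> \<alpha> \<and>
             lam \<Omega> g u 0 < lambda1 \<Omega> g p \<mu> \<alpha> \<longrightarrow>
        (\<exists>K>0. \<exists>K'>0. \<forall>t\<ge>0.
           energy \<Omega> g p \<alpha> u v t \<le>
             (if q = 1
              then energy \<Omega> g p \<alpha> u v 0 * exp (1 - K * integral {0..t} \<xi>)
              else energy \<Omega> g p \<alpha> u v 0 *
                     (q / (1 + K' * (q - 1) * integral {0..t} \<xi>)) powr (1 / (q - 1))))))"
proof -
  let ?n = "real DIM('a)"
  have \<Omega>: "open \<Omega>" "bounded \<Omega>" "\<Omega> \<noteq> {}" using assms(2) unfolding smooth_bounded_domain_def by auto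
  have pm: "p \<in> borel_measurable (lebesgue_on \<Omega>)" "bounded (p ` \<Omega>)" and p1: "ess_lower \<Omega> p > 2"
    and p2: "ess_upper \<Omega> p < 2 * (?n - 1) / (?n - 2)"
    using assms(4) unfolding exponent_condition_def by auto
  have l: "ell g > 0" using assms(3) unfolding cond_A1_def by auto
  \<comment> \<open>The midpoint between \<open>max 2 p_2\<close> and 2(n-1)/(n-2). Staying below
    the latter is equivalent to \<open>2 * (m - 1)\<close> being subcritical.\<close>
  define m where "m = (max 2 (ess_upper \<Omega> p) + 2 * (?n - 1) / (?n - 2)) / 2"
  have n2: "?n - 2 > 0" using assms(1) by simp
  have c2: "2 < 2 * (?n - 1) / (?n - 2)" using n2 by (simp add: field_simps)
  have "2 < (max 2 a + c) / 2 \<and> a < (max 2 a + c) / 2 \<and> (max 2 a + c) / 2 < c" if "2 < c" "a < c" for a c :: real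
    using that by (auto simp: max_def)
  from this[OF c2 p2] have m: "2 < m" "ess_upper \<Omega> p < m" "m < 2 * (?n - 1) / (?n - 2)"
    unfolding m_def by auto
  have mn: "2 * (m - 1) < 2 * ?n / (?n - 2)"
  proof -
    have "2 * (?n - 1) / (?n - 2) = ?n / (?n - 2) + 1" using n2 by (simp add: field_simps)
    then show ?thesis using m(3) by simp
  qed
  interpret nemytskii \<Omega> "ess_lower \<Omega> p" "ess_upper \<Omega> p" m p
    by unfold_locales (use \<Omega> p1 m mn assms(1) pm exponent_bounds[OF \<Omega>(1,3) pm] in auto)
  \<comment> \<open>The bound that the energy argument gives for the squared gradient norm, enlarged
    by 1 to make the inequality strict. It depends on g and the initial data alone, so the source
    constant \<open>C\<close> and with it \<alpha>0 can be fixed next.\<close>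
  define R where "R = 4 / ell g * ((Lnorm 2 \<Omega> u1)\<^sup>2 + (N u0)\<^sup>2) + 1"
  obtain C where C: "C \<ge> 0" "\<And>f h. f \<in> H10 \<Omega> \<Longrightarrow> h \<in> H10 \<Omega> \<Longrightarrow> N f \<le> sqrt R \<Longrightarrow> N h \<le> sqrt R \<Longrightarrow>
     Fu f \<in> Lspace 2 \<Omega> \<and> Lnorm 2 \<Omega> (Fu f) \<le> C * N f \<and> \<bar>Pot f\<bar> \<le> C * (N f)\<^sup>2"
    using Fu_bounds[of "sqrt R"] by blast
  obtain Cp where Cp: "Cp > 0" "\<And>f. f \<in> H10 \<Omega> \<Longrightarrow> (Lnorm 2 \<Omega> f)\<^sup>2 \<le> Cp * (N f)\<^sup>2"
    using poincare[OF assms(1)] by blast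
  define Cf where "Cf = C * (1 + sqrt Cp)"
  have Cf: "Cf \<ge> 0" using C(1) Cp(1) by (simp add: Cf_def)
  \<comment> \<open>The source may consume l/8 of the gradient term; the summand 1 keeps the
    denominator positive when \<open>Cf\<close> is 0.\<close>
  define \<alpha>0 where "\<alpha>0 = ell g / (8 * (Cf + 1))"
  have \<alpha>0: "\<alpha>0 > 0" using l Cf by (simp add: \<alpha>0_def)
  show ?thesis
  proof (rule exI[of _ \<alpha>0], rule conjI[OF \<alpha>0], intro allI impI, elim conjE)
    fix \<xi> q \<alpha> u v
    assume A3: "cond_A3 g \<xi> q" and \<alpha>: "0 < \<alpha>" "\<alpha> < \<alpha>0" and sol: "weak_solution \<Omega> g p \<alpha> u0 u1 u v"
    interpret W: weak_sol \<Omega> "ess_lower \<Omega> p" "ess_upper \<Omega> p" m p g \<alpha> u0 u1 u v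
      by unfold_locales (rule sol)
    have "\<alpha> * Cf \<le> \<alpha>0 * (Cf + 1)" using \<alpha> Cf by (intro mult_mono) auto
    also have "\<dots> = ell g / 8" using Cf by (simp add: \<alpha>0_def field_simps)
    finally have aC: "\<alpha> * (C * (1 + sqrt Cp)) \<le> ell g / 8" by (simp add: Cf_def)
    show "\<exists>K>0. \<exists>K'>0. \<forall>t\<ge>0.
           energy \<Omega> g p \<alpha> u v t \<le>
             (if q = 1
              then energy \<Omega> g p \<alpha> u v 0 * exp (1 - K * integral {0..t} \<xi>)
              else energy \<Omega> g p \<alpha> u v 0 *
                     (q / (1 + K' * (q - 1) * integral {0..t} \<xi>)) powr (1 / (q - 1)))"
    proof (rule W.decay_estimate[OF assms(7,8,3) A3 \<alpha>(1) aC Cp C(1)])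
      show "Fu f \<in> Lspace 2 \<Omega> \<and> Lnorm 2 \<Omega> (Fu f) \<le> C * N f \<and> \<bar>Pot f\<bar> \<le> C * (N f)\<^sup>2"
        if "f \<in> H10 \<Omega>" "N f \<le> sqrt R" for f
        using C(2)[OF that(1) that(1) that(2) that(2)] .
    qed (auto simp: R_def)
  qed
qed

end
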